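(* Let $\alpha\in(\tfrac13,\tfrac12)$, $k\in\mathbb N$, $k\ge1$, $T>0$, $\mathbf X\in\mathscr C^\alpha([0,T];\mathbb R^{d_X})$ and $$\mathcal F=(f,f',\partial f,\partial f',\dots,\partial^kf,\partial^kf',\partial^{k+1}f)\in\mathscr D^{2\alpha}_X\mathrm{Lip}^{k+2}_x\big(\mathbb R^{d_Y};\mathcal L(\mathbb R^{d_X};\mathbb R^{d_Y})\big).$$ Assume that one of the following holds: (1) for every $t\in[0,T]$, $f_t\in\mathcal C_b(\mathbb R^{d_Y};\mathcal L(\mathbb R^{d_X};\mathbb R^{d_Y}))$ and $f_t'\in\mathcal C_b(\mathbb R^{d_Y};\mathcal L((\mathbb R^{d_X})^{\otimes2};\mathbb R^{d_Y}))$ (bounded continuous); (2) for every $t\in[0,T]$, $f_t\in\mathcal L(\mathbb R^{d_Y};\mathcal L(\mathbb R^{d_X};\mathbb R^{d_Y}))$ and $f_t'\in\mathcal L(\mathbb R^{d_Y};\mathcal L((\mathbb R^{d_X})^{\otimes2};\mathbb R^{d_Y}))$ (linear vector fields). Then for every $s\in[0,T]$ and $\xi\in\mathbb R^{d_Y}$ there is a unique $(Y^{s,\xi},(Y^{s,\xi})')\in\mathscr D^{2\alpha}_X([s,T];\mathbb R^{d_Y})$ with $(Y^{s,\xi})'=f(Y^{s,\xi})$ and $$Y_t^{s,\xi}=\xi+\int_s^t\Big(f_r(Y_r^{s,\xi}),\ \partial f_r(Y_r^{s,\xi})f_r(Y_r^{s,\xi})+f_r'(Y_r^{s,\xi})\Big)d\mathbf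 X_r,\qquad t\in[s,T].$$ Furthermore, for every $s\in[0,T]$, the map $\mathbb R^{d_Y}\times[s,T]\ni(\xi,t)\mapsto\phi(s,t;\xi):=Y^{s,\xi}_t\in\mathbb R^{d_Y}$ is a flow of $C^k$-diffeomorphisms (that is, $\phi(s,t;\cdot)$ is a $C^k$-diffeomorphism of $\mathbb R^{d_Y}$ for each $t\in[s,T]$).
   Context: $\delta X_{s,t}=X_t-X_s$. $\mathbf X=(X,\mathbb X)\in\mathscr C^\alpha([0,T];V)$: $X$ $\alpha$-Hölder, $|\mathbb X_{s,t}|\lesssim|t-s|^{2\alpha}$, $\mathbb X_{s,t}-\mathbb X_{s,u}-\mathbb X_{u,t}=\delta X_{s,u}\otimes\delta X_{u,t}$. $\mathscr D^{2\alpha}_X([s,T];W)$: pairs $(Y,Y')$ with $Y'$ $\mathcal L(V;W)$-valued and $\alpha$-Hölder and $|\delta Y_{u,v}-Y'_u\delta X_{u,v}|\lesssim|v-u|^{2\alpha}$. For $\mathcal L(V;W)$-valued $(Y,Y')\in\mathscr D^{2\alpha}_X$, $\int(Y,Y')d\mathbf X=\lim\sum Y_u\delta X_{u,v}+Y'_u\mathbb X_{u,v}$. $\mathcal L(E_1;\mathcal L(E_2;U))\cong\mathcal L(E_1\otimes E_2;U)$; $f'_t(x)\in\mathcal L(V;\mathcal L(V;W))\cong\mathcal L(V^{\otimes2};W)$ and $(\partial f f)(v_1\otimes v_2)=\big(\partial f(f v_1)\big)v_2$. Controlled $\mathrm{Lip}^m$ fields, $m\ge2$. Let $W,U$ be finite-dimensional.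 $\mathscr D^{2\alpha}_X\mathrm{Lip}^m_x(W;U)$ is the set of $(2m-1)$-tuples $(f,f',\partial f,\partial f',\dots,\partial^{m-2}f,\partial^{m-2}f',\partial^{m-1}f)$ of functions on $[0,T]\times W$, with $\partial^jf$ valued in (symmetric elements of) $\mathcal L(W^{\otimes j};U)$ and $\partial^jf'$ valued in $\mathcal L(W^{\otimes j}\otimes V;U)$, such that: (i) $\sup_t[f_t,\dots,\partial^{m-1}f_t]_{\mathrm{Lip}^m}<\infty$ and $\sup_t[f'_t,\dots,\partial^{m-2}f'_t]_{\mathrm{Lip}^{m-1}}<\infty$, where $[g,\partial g,\dots,\partial^{n-1}g]_{\mathrm{Lip}^n}$ is the smallest constant $C$ such that $|\partial^jg|\le C$ on $W$ for $1\le j\le n-1$ and $\big|\partial^jg(x_1)-\sum_{l=0}^{n-1-j}\frac1{l!}\partial^{j+l}g(x_0)(\cdot\otimes(x_1-x_0)^{\otimes l})\big|\le C|x_1-x_0|^{n-j}$ for $0\le j\le n-1$, $x_0,x_1\in W$ (so $\partial^j$ is the $j$-th spatial derivative); (ii) for each $j=0,\dots,m-2$ there is $C$ such that for all $t_0\le t_1$, $x_0,x_1\in W$, with $\rho=|t_1-t_0|^\alpha\vee|x_1-x_0|$: $|\partial^jf_{t_1}(x_1)-\partial^jf_{t_0}(x_0)-(\partial^jf'_{t_0}(x_0))^\top\delta X_{t_0,t_1}-\partial^{j+1}f_{t_0}(x_0)(x_1-x_0)|\le C\rho^2$, and $|\partial^jf'_{t_1}(x_1)-\partial^jf'_{t_0}(x_0)|+|\partial^{j+1}f_{t_1}(x_1)-\partial^{j+1}f_{t_0}(x_0)|\le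 C\rho$. Here $(\partial^jf')^\top\delta X$ denotes $w\mapsto\partial^jf'(w\otimes\delta X)$, $w\in W^{\otimes j}$. *)

theory Defs
  imports "HOL-Analysis.Analysis"
begin

definition holder_on :: "real \<Rightarrow> real set \<Rightarrow> (real \<Rightarrow> 'a::real_normed_vector) \<Rightarrow> bool" where
  "holder_on \<alpha> A g \<longleftrightarrow>
     (\<exists>C. \<forall>u\<in>A. \<forall>v\<in>A. norm (g v - g u) \<le> C * \<bar>v - u\<bar> powr \<alpha>)"


section \<open>Rough paths and controlled paths\<close>

text \<open>
  For \<open>V = \<real>\<^sup>n\<close> the tensor square \<open>V \<otimes> V\<close> is the space of \<open>n \<times> n\<close> matrices, the entry
  \<open>M $ i $ j\<close> being the coefficient of \<open>e\<^sub>i \<otimes> e\<^sub>j\<close>. A linear map from \<open>E\<^sub>1 \<otimes> E\<^sub>2\<close> to \<open>U\<close> is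
  represented by its curried form of type \<open>E\<^sub>1 \<Rightarrow>\<^sub>L E\<^sub>2 \<Rightarrow>\<^sub>L U\<close>.
\<close>

definition tensor :: "real ^ 'n \<Rightarrow> real ^ 'n \<Rightarrow> real ^ 'n ^ 'n" where
  "tensor a b = (\<chi> i j. a $ i * b $ j)"

definition apply_tensor ::
  "((real ^ 'n) \<Rightarrow>\<^sub>L (real ^ 'n) \<Rightarrow>\<^sub>L 'u::real_normed_vector) \<Rightarrow> real ^ 'n ^ 'n \<Rightarrow> 'u" where
  "apply_tensor B M = (\<Sum>i\<in>UNIV. \<Sum>j\<in>UNIV. (M $ i $ j) *\<^sub>R B (axis i 1) (axis j 1))"

definition rough_path ::
  "real \<Rightarrow> real \<Rightarrow> (real \<Rightarrow> real ^ 'n) \<Rightarrow> (real \<Rightarrow> real \<Rightarrow> real ^ 'n ^ 'n) \<Rightarrow> bool" where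
  "rough_path \<alpha> T X XX \<longleftrightarrow>
     holder_on \<alpha> {0..T} X \<and>
     (\<exists>C. \<forall>s t. 0 \<le> s \<and> s \<le> t \<and> t \<le> T \<longrightarrow>
        norm (XX s t) \<le> C * \<bar>t - s\<bar> powr (2 * \<alpha>)) \<and>
     (\<forall>s u t. 0 \<le> s \<and> s \<le> u \<and> u \<le> t \<and> t \<le> T \<longrightarrow>
        XX s t - XX s u - XX u t = tensor (X u - X s) (X t - X u))"

definition controlled_path ::
  "real \<Rightarrow> real \<Rightarrow> real \<Rightarrow> (real \<Rightarrow> 'v::real_normed_vector) \<Rightarrow>
   (real \<Rightarrow> 'w::real_normed_vector) \<Rightarrow> (real \<Rightarrow> 'v \<Rightarrow>\<^sub>L 'w) \<Rightarrow> bool" where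
  "controlled_path \<alpha> s t X Y Y' \<longleftrightarrow>
     holder_on \<alpha> {s..t} Y' \<and>
     (\<exists>C. \<forall>u v. s \<le> u \<and> u \<le> v \<and> v \<le> t \<longrightarrow>
        norm (Y v - Y u - Y' u (X v - X u)) \<le> C * \<bar>v - u\<bar> powr (2 * \<alpha>))"

text \<open>
  The points \<open>\<pi> 0 < \<dots> < \<pi> N\<close> range over all partitions of \<open>[s, t]\<close>, and the limit of the
  compensated Riemann sums is taken as the mesh tends to 0.
\<close>

definition has_rough_integral ::
  "real \<Rightarrow> (real \<Rightarrow> real ^ 'n) \<Rightarrow> (real \<Rightarrow> real \<Rightarrow> real ^ 'n ^ 'n) \<Rightarrow>
   (real \<Rightarrow> (real ^ 'n) \<Rightarrow>\<^sub>L 'w::real_normed_vector) \<Rightarrow>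
   (real \<Rightarrow> (real ^ 'n) \<Rightarrow>\<^sub>L (real ^ 'n) \<Rightarrow>\<^sub>L 'w) \<Rightarrow> real \<Rightarrow> real \<Rightarrow> 'w \<Rightarrow> bool" where
  "has_rough_integral \<alpha> X XX Y Y' s t I \<longleftrightarrow>
     controlled_path \<alpha> s t X Y Y' \<and>
     (\<forall>\<epsilon>>0. \<exists>\<delta>>0. \<forall>N (\<pi> :: nat \<Rightarrow> real).
        \<pi> 0 = s \<and> \<pi> N = t \<and> (\<forall>i<N. \<pi> i < \<pi> (Suc i) \<and> \<pi> (Suc i) - \<pi> i < \<delta>) \<longrightarrow>
        norm ((\<Sum>i<N. Y (\<pi> i) (X (\<pi> (Suc i)) - X (\<pi> i))
                 + apply_tensor (Y' (\<pi> i)) (XX (\<pi> i) (\<pi> (Suc i)))) - I) < \<epsilon>)"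


section \<open>Controlled Lipschitz vector fields\<close>

text \<open>
  An element of \<open>\<L>(W\<^bsup>\<otimes>j\<^esup>; U)\<close> is represented by a function on lists over \<open>W\<close> that is multilinear
  on lists of length \<open>j\<close>; its values on lists of other lengths are irrelevant. Only such functions
  are ever passed to \<open>mnorm\<close>, and since \<open>W\<close> is finite-dimensional the supremum is then finite.
\<close>

definition multilin ::
  "nat \<Rightarrow> ('w::real_normed_vector list \<Rightarrow> 'u::real_normed_vector) \<Rightarrow> bool" where
  "multilin j A \<longleftrightarrow>
     (\<forall>us vs. length us + length vs + 1 = j \<longrightarrow> linear (\<lambda>w. A (us @ w # vs)))"

definition symmetric_mlin :: "nat \<Rightarrow> ('w list \<Rightarrow> 'u) \<Rightarrow> bool" where
  "symmetric_mlin j A \<longleftrightarrow>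
     (\<forall>us vs. length us = j \<and> mset us = mset vs \<longrightarrow> A us = A vs)"

definition mnorm ::
  "nat \<Rightarrow> ('w::euclidean_space list \<Rightarrow> 'u::real_normed_vector) \<Rightarrow> real" where
  "mnorm j A = (SUP ws\<in>{ws. length ws = j \<and> (\<forall>w\<in>set ws. norm w \<le> 1)}. norm (A ws))"

text \<open>
  \<open>Lip_bound n G C\<close> says that \<open>C\<close> is admissible in the definition of the seminorm
  \<open>[G\<^sub>0, \<dots>, G\<^sub>n\<^sub>-\<^sub>1]\<close> of Stein's space \<open>Lip\<^sup>n\<close>.
\<close>

definition Lip_bound ::
  "nat \<Rightarrow> (nat \<Rightarrow> 'w::euclidean_space \<Rightarrow> 'w list \<Rightarrow> 'u::real_normed_vector) \<Rightarrow> real \<Rightarrow> bool" where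
  "Lip_bound n G C \<longleftrightarrow>
     (\<forall>j x. 1 \<le> j \<and> j < n \<longrightarrow> mnorm j (G j x) \<le> C) \<and>
     (\<forall>j x0 x1. j < n \<longrightarrow>
        mnorm j (\<lambda>ws. G j x1 ws -
            (\<Sum>l<n - j. (1 / fact l) *\<^sub>R G (j + l) x0 (ws @ replicate l (x1 - x0))))
          \<le> C * norm (x1 - x0) ^ (n - j))"

text \<open>
  \<open>F t j x\<close> stands for \<open>\<partial>\<^sup>j f\<^sub>t(x)\<close> with \<open>j < m\<close>, and \<open>F' t j x\<close> for \<open>\<partial>\<^sup>j f'\<^sub>t(x)\<close> with \<open>j < m - 1\<close>; the
  \<open>V\<close>-argument of \<open>\<partial>\<^sup>j f'\<^sub>t(x)\<close> follows the list of \<open>W\<close>-arguments. Other indices \<open>j\<close> and times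
  outside \<open>[0, T]\<close> are not part of the tuple.
\<close>

definition controlled_Lip ::
  "real \<Rightarrow> real \<Rightarrow> (real \<Rightarrow> 'v::real_normed_vector) \<Rightarrow> nat \<Rightarrow>
   (real \<Rightarrow> nat \<Rightarrow> 'w::euclidean_space \<Rightarrow> 'w list \<Rightarrow> 'u::real_normed_vector) \<Rightarrow>
   (real \<Rightarrow> nat \<Rightarrow> 'w \<Rightarrow> 'w list \<Rightarrow> 'v \<Rightarrow>\<^sub>L 'u) \<Rightarrow> bool" where
  "controlled_Lip \<alpha> T X m F F' \<longleftrightarrow>
     (\<forall>t\<in>{0..T}. \<forall>x. \<forall>j<m. multilin j (F t j x) \<and> symmetric_mlin j (F t j x)) \<and>
     (\<forall>t\<in>{0..T}. \<forall>x. \<forall>j<m - 1. multilin j (F' t j x)) \<and>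
     (\<exists>C. \<forall>t\<in>{0..T}. Lip_bound m (F t) C) \<and>
     (\<exists>C. \<forall>t\<in>{0..T}. Lip_bound (m - 1) (F' t) C) \<and>
     (\<forall>j<m - 1. \<exists>C. \<forall>t0 t1 x0 x1. 0 \<le> t0 \<and> t0 \<le> t1 \<and> t1 \<le> T \<longrightarrow>
        (let \<rho> = max (\<bar>t1 - t0\<bar> powr \<alpha>) (norm (x1 - x0)) in
           mnorm j (\<lambda>ws. F t1 j x1 ws - F t0 j x0 ws - F' t0 j x0 ws (X t1 - X t0)
                          - F t0 (Suc j) x0 (ws @ [x1 - x0])) \<le> C * \<rho>\<^sup>2 \<and>
           mnorm j (\<lambda>ws. F' t1 j x1 ws - F' t0 j x0 ws)
             + mnorm (Suc j) (\<lambda>ws. F t1 (Suc j) x1 ws - F t0 (Suc j) x0 ws) \<le> C * \<rho>))"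


section \<open>Rough differential equations and their flow\<close>

text \<open>
  The curried form of \<open>\<partial>f\<^sub>t(x) f\<^sub>t(x) + f'\<^sub>t(x)\<close>. The argument of \<open>Blinfun\<close> is linear on a
  finite-dimensional space, hence bounded linear, whenever \<open>F t 1 x\<close> is multilinear.
\<close>

definition rde_gubinelli ::
  "(real \<Rightarrow> nat \<Rightarrow> 'w::euclidean_space \<Rightarrow> 'w list \<Rightarrow> 'v::real_normed_vector \<Rightarrow>\<^sub>L 'w) \<Rightarrow>
   (real \<Rightarrow> nat \<Rightarrow> 'w \<Rightarrow> 'w list \<Rightarrow> 'v \<Rightarrow>\<^sub>L 'v \<Rightarrow>\<^sub>L 'w) \<Rightarrow>
   real \<Rightarrow> 'w \<Rightarrow> 'v \<Rightarrow>\<^sub>L 'v \<Rightarrow>\<^sub>L 'w" where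
  "rde_gubinelli F F' t x = (Blinfun (\<lambda>w. F t 1 x [w]) o\<^sub>L F t 0 x []) + F' t 0 x []"

text \<open>
  Paths on \<open>[s, T]\<close> are taken in \<open>extensional {s..T}\<close>, so that uniqueness can be stated with
  \<open>\<exists>!\<close>.
\<close>

definition rde_solution ::
  "real \<Rightarrow> real \<Rightarrow> (real \<Rightarrow> real ^ 'n) \<Rightarrow> (real \<Rightarrow> real \<Rightarrow> real ^ 'n ^ 'n) \<Rightarrow>
   (real \<Rightarrow> nat \<Rightarrow> 'w::euclidean_space \<Rightarrow> 'w list \<Rightarrow> (real ^ 'n) \<Rightarrow>\<^sub>L 'w) \<Rightarrow>
   (real \<Rightarrow> nat \<Rightarrow> 'w \<Rightarrow> 'w list \<Rightarrow> (real ^ 'n) \<Rightarrow>\<^sub>L (real ^ 'n) \<Rightarrow>\<^sub>L 'w) \<Rightarrow>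
   real \<Rightarrow> 'w \<Rightarrow> (real \<Rightarrow> 'w) \<times> (real \<Rightarrow> (real ^ 'n) \<Rightarrow>\<^sub>L 'w) \<Rightarrow> bool" where
  "rde_solution \<alpha> T X XX F F' s \<xi> = (\<lambda>(Y, Y').
     Y \<in> extensional {s..T} \<and> Y' \<in> extensional {s..T} \<and>
     controlled_path \<alpha> s T X Y Y' \<and>
     (\<forall>t\<in>{s..T}. Y' t = F t 0 (Y t) []) \<and>
     (\<forall>t\<in>{s..T}. \<exists>I.
        has_rough_integral \<alpha> X XX
          (\<lambda>r. F r 0 (Y r) []) (\<lambda>r. rde_gubinelli F F' r (Y r)) s t I \<and>
        Y t = \<xi> + I))"

definition rde_flow ::
  "real \<Rightarrow> real \<Rightarrow> (real \<Rightarrow> real ^ 'n) \<Rightarrow> (real \<Rightarrow> real \<Rightarrow> real ^ 'n ^ 'n) \<Rightarrow>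
   (real \<Rightarrow> nat \<Rightarrow> 'w::euclidean_space \<Rightarrow> 'w list \<Rightarrow> (real ^ 'n) \<Rightarrow>\<^sub>L 'w) \<Rightarrow>
   (real \<Rightarrow> nat \<Rightarrow> 'w \<Rightarrow> 'w list \<Rightarrow> (real ^ 'n) \<Rightarrow>\<^sub>L (real ^ 'n) \<Rightarrow>\<^sub>L 'w) \<Rightarrow>
   real \<Rightarrow> real \<Rightarrow> 'w \<Rightarrow> 'w" where
  "rde_flow \<alpha> T X XX F F' s t \<xi> = fst (THE p. rde_solution \<alpha> T X XX F F' s \<xi> p) t"

text \<open>
  A map between finite-dimensional spaces is of class \<open>C\<^sup>n\<^sup>+\<^sup>1\<close> iff it is differentiable and all its
  directional derivatives \<open>x \<mapsto> Df(x)v\<close> are of class \<open>C\<^sup>n\<close>.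
\<close>

primrec C_k :: "nat \<Rightarrow> ('a::euclidean_space \<Rightarrow> 'b::euclidean_space) \<Rightarrow> bool" where
  "C_k 0 g \<longleftrightarrow> continuous_on UNIV g"
| "C_k (Suc n) g \<longleftrightarrow>
     (\<forall>x. g differentiable (at x)) \<and> (\<forall>v. C_k n (\<lambda>x. frechet_derivative g (at x) v))"

definition C_k_diffeomorphism ::
  "nat \<Rightarrow> ('a::euclidean_space \<Rightarrow> 'b::euclidean_space) \<Rightarrow> bool" where
  "C_k_diffeomorphism k g \<longleftrightarrow> bij g \<and> C_k k g \<and> C_k k (inv g)"

end

theory Submission
  imports Defs "HOL-Probability.Discrete_Topology"
begin

text \<open>
  Davie's characterization: \<open>Y\<close> solves the equation iff \<open>Y\<^sub>t\<close> differs from the Milstein step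
  \<open>m\<^sub>s\<^sub>t(Y\<^sub>s) = Y\<^sub>s + f\<^sub>s(Y\<^sub>s) X\<^sub>s\<^sub>t + (\<partial>f\<^sub>s f\<^sub>s + f'\<^sub>s)(Y\<^sub>s) \<XX>\<^sub>s\<^sub>t\<close> by \<open>O(|t - s|\<^bsup>3\<alpha>\<^esup>)\<close>, where \<open>3\<alpha> > 1\<close>. The
  steps form an almost flow, so compositions along finer and finer grids converge to the unique
  such path. For the smoothness of the flow, the tangent step \<open>(x, v) \<mapsto> (m(x), Dm(x)v)\<close> is the
  Milstein step of the tangent field and hence again an almost flow. Working in a Banach space
  \<open>E \<cong> E \<times> E\<close> (the bounded sequences in \<open>\<real>\<^sup>d\<close>) keeps all iterated tangent steps in one type, and
  induction on the number of lifts gives \<open>C\<^sup>k\<close>. All estimates hold for times in any order, so the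
  time-reversed steps generate a \<open>C\<^sup>k\<close> flow as well, which is the inverse.
\<close>

section \<open>Chains of an almost flow\<close>

text \<open>The midpoint argument uses p = 3 * \<alpha> only through 2 * 2 powr (-p) < 1. Two
  obstacles shape the rest. First, tangent fields contain products such as Df(x)v, so their
  estimates hold on balls only, and such estimates alone do not keep chains inside a ball.
  Boundedness of chains is therefore a property of its own, \<open>no_blowup\<close>: it comes from
  global estimates for bounded fields, and from homogeneity for linear fields and for every tangent
  component, whose growth is measured relative to its size. Second, comparing two partitions by
  telescoping asks for Lipschitz bounds on chains that are uniform in the partition, and these come
  from bounded chains one tangent lift higher. A field of class Lip of order k + 2 affords k lifts,
  so the last one has no lift above it. Convergence of lifted chains is hence derived from
  convergence one level below, linearity in the tangent component and Davie's local bound. This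
  gives no rate, but the convergence is uniform on balls, which suffices to differentiate the
  limit.\<close>

definition consec :: "real set \<Rightarrow> real \<Rightarrow> real \<Rightarrow> bool" where
  "consec A a b \<longleftrightarrow> a \<in> A \<and> b \<in> A \<and> a < b \<and> (\<forall>x\<in>A. x \<le> a \<or> b \<le> x)"

definition chain :: "(real \<Rightarrow> real \<Rightarrow> 'e \<Rightarrow> 'e) \<Rightarrow> real set \<Rightarrow> (real \<Rightarrow> 'e) \<Rightarrow> bool" where
  "chain m A y \<longleftrightarrow> (\<forall>a b. consec A a b \<longrightarrow> y b = m a b (y a))"

text \<open>For finite \<open>A\<close> containing \<open>s\<close> the values on
  \<open>A \<inter> {s..}\<close> are determined, by \<open>chain_unique\<close>; elsewhere they are
  arbitrary. Indexing by sets of times rather than by step numbers lets partitions be refined by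
  inclusion.\<close>

definition path :: "(real \<Rightarrow> real \<Rightarrow> 'e \<Rightarrow> 'e) \<Rightarrow> real set \<Rightarrow> real \<Rightarrow> 'e \<Rightarrow> real \<Rightarrow> 'e" where
  "path m A s z = (SOME y. chain m (A \<inter> {s..}) y \<and> y s = z)"

lemma consec_around:
  assumes "finite A" "u \<in> A" "v \<in> A" "u \<le> c" "c < v"
  obtains a b where "consec A a b" "u \<le> a" "a \<le> c" "c < b" "b \<le> v"
proof -
  let ?L = "{x\<in>A. x \<le> c}" and ?U = "{x\<in>A. c < x}"
  have L: "finite ?L" "?L \<noteq> {}" and U: "finite ?U" "?U \<noteq> {}" using assms by auto
  define a b where "a = Max ?L" and "b = Min ?U"
  have a: "a \<in> ?L" and b: "b \<in> ?U"
    unfolding a_def b_def by (rule Max_in[OF L], rule Min_in[OF U])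
  have "\<forall>x\<in>A. x \<le> a \<or> b \<le> x"
  proof
    fix x assume "x \<in> A"
    thus "x \<le> a \<or> b \<le> x" using L(1) U(1) unfolding a_def b_def by (cases "x \<le> c") auto
  qed
  hence "consec A a b" using a b by (auto simp: consec_def)
  moreover have "u \<le> a" "b \<le> v"
    using assms L(1) U(1) unfolding a_def b_def by auto
  ultimately show thesis using a b that by auto
qed

lemma consec_induct [consumes 4, case_names start step]:
  assumes "finite A" "s \<in> A" "v \<in> A" "s \<le> v"
    and "P s" and step: "\<And>a b. consec A a b \<Longrightarrow> s \<le> a \<Longrightarrow> P a \<Longrightarrow> P b"
  shows "P v"
proof (rule ccontr)
  assume n: "\<not> P v"
  let ?B = "{x\<in>A. s \<le> x \<and> \<not> P x}"
  have B: "finite ?B" "?B \<noteq> {}" using assms n by auto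
  define b where "b = Min ?B"
  have b: "b \<in> ?B" unfolding b_def by (rule Min_in[OF B])
  with assms have "s < b" by (cases "s = b") auto
  let ?L = "{x\<in>A. x < b}"
  have L: "finite ?L" "?L \<noteq> {}" using assms \<open>s < b\<close> by auto
  define a where "a = Max ?L"
  have a: "a \<in> ?L" unfolding a_def by (rule Max_in[OF L])
  have "consec A a b" using a b L(1) by (force simp: consec_def a_def not_le)
  moreover have "s \<le> a" using L(1) assms \<open>s < b\<close> by (simp add: a_def)
  moreover have "P a"
  proof (rule ccontr)
    assume "\<not> P a"
    hence "a \<in> ?B" using a \<open>s \<le> a\<close> by auto
    hence "b \<le> a" using B(1) by (simp add: b_def)
    thus False using a by auto
  qed
  ultimately have "P b" by (rule step)
  thus False using b by auto
qed

lemma consec_Int_atLeast: "consec (A \<inter> {s..}) a b \<longleftrightarrow> consec A a b \<and> s \<le> a"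
  by (force simp: consec_def)

lemma chain_mono: "chain m A y \<Longrightarrow> chain m (A \<inter> {s..}) y"
  by (auto simp: chain_def consec_Int_atLeast)

lemma chain_exists:
  assumes "finite A"
  shows "\<exists>y. chain m A y \<and> y (Min A) = z"
  using assms
proof (induction A rule: finite_linorder_max_induct)
  case empty
  show ?case by (intro exI[of _ "\<lambda>_. z"]) (auto simp: chain_def consec_def)
next
  case (insert b A)
  show ?case
  proof (cases "A = {}")
    case True
    thus ?thesis by (intro exI[of _ "\<lambda>_. z"]) (auto simp: chain_def consec_def)
  next
    case False
    obtain y where y: "chain m A y" "y (Min A) = z" using insert by auto
    let ?y = "y(b := m (Max A) b (y (Max A)))"
    have mx: "Max A \<in> A" "Min A \<in> A" using False insert by auto
    have lt: "x < b" if "x \<in> A" for x using insert that by auto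
    have "chain m (insert b A) ?y"
      unfolding chain_def
    proof (intro allI impI)
      fix a c assume c: "consec (insert b A) a c"
      show "?y c = m a c (?y a)"
      proof (cases "c = b")
        case True
        have "a \<in> A" using c True by (auto simp: consec_def)
        moreover have "\<forall>x\<in>A. x \<le> a" using c True lt by (force simp: consec_def)
        ultimately have "a = Max A" using insert(1) by (metis Max_eqI)
        thus ?thesis using True mx lt by auto
      next
        case ne: False
        hence "c \<in> A" using c by (auto simp: consec_def)
        hence "a \<in> A" using c lt[of c] by (auto simp: consec_def)
        have "consec A a c" using c \<open>c \<in> A\<close> \<open>a \<in> A\<close> by (auto simp: consec_def)
        thus ?thesis using y(1) ne \<open>a \<in> A\<close> lt[of a] by (auto simp: chain_def)
      qed
    qed
    moreover have "Min (insert b A) = Min A"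
      using False insert(1) lt[of "Min A"] mx by (subst Min_insert) auto
    moreover have "?y (Min A) = z" using y(2) lt[OF mx(2)] by auto
    ultimately show ?thesis by (intro exI[of _ ?y]) (simp del: fun_upd_apply)
  qed
qed

lemma path_spec:
  assumes "finite A" "s \<in> A"
  shows path_chain: "chain m (A \<inter> {s..}) (path m A s z)" and path_start: "path m A s z s = z"
proof -
  have "Min (A \<inter> {s..}) = s" using assms by (intro Min_eqI) auto
  hence "\<exists>y. chain m (A \<inter> {s..}) y \<and> y s = z"
    using chain_exists[of "A \<inter> {s..}" m z] assms by auto
  hence "chain m (A \<inter> {s..}) (path m A s z) \<and> path m A s z s = z"
    unfolding path_def by (rule someI_ex)
  thus "chain m (A \<inter> {s..}) (path m A s z)" "path m A s z s = z" by auto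
qed

lemma path_step:
  assumes "finite A" "s \<in> A" "consec A a b" "s \<le> a"
  shows "path m A s z b = m a b (path m A s z a)"
  using path_chain[OF assms(1,2), of m z] assms(3,4) by (auto simp: chain_def consec_Int_atLeast)

lemma chain_unique:
  assumes "finite A" "s \<in> A" "v \<in> A" "s \<le> v" "chain m (A \<inter> {s..}) y"
  shows "y v = path m A s (y s) v"
  using assms(1-4)
proof (induction v rule: consec_induct)
  case start
  thus ?case using assms by (simp add: path_start)
next
  case (step a b)
  thus ?case using assms by (simp add: path_step chain_def consec_Int_atLeast)
qed

lemma path_cocycle:
  assumes "finite A" "s \<in> A" "u \<in> A" "v \<in> A" "s \<le> u" "u \<le> v"
  shows "path m A u (path m A s z u) v = path m A s z v"
proof -
  have "chain m (A \<inter> {u..}) (path m A s z)"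
    using path_chain[OF assms(1,2), of m z] assms(5) by (auto simp: chain_def consec_Int_atLeast)
  from chain_unique[OF assms(1,3,4,6) this] show ?thesis by simp
qed

lemma path_consec:
  assumes "finite A" "consec A a b"
  shows "path m A a z b = m a b z"
  using assms by (subst path_step[of A a a b]) (auto simp: path_start consec_def)

text \<open>Serves to project a path of a tangent step to the path of the step below it.\<close>

lemma path_semiconj:
  assumes "finite A" "A \<subseteq> I" "s \<in> A" "v \<in> A" "s \<le> v"
    and "\<And>a b z. a \<in> I \<Longrightarrow> b \<in> I \<Longrightarrow> h (m a b z) = m' a b (h z)"
  shows "h (path m A s z v) = path m' A s (h z) v"
proof -
  have "chain m' (A \<inter> {s..}) (\<lambda>v. h (path m A s z v))"
    using path_chain[OF assms(1,3), of m z] assms(2,6)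
    by (auto simp: chain_def consec_Int_atLeast consec_def subset_iff)
  from chain_unique[OF assms(1,3-5) this] show ?thesis using assms by (simp add: path_start)
qed

section \<open>Davie's bound and short-time estimates\<close>

text \<open>In the midpoint argument each half of the interval contributes
  \<open>L * (1/2) powr p\<close>, one of them transported through two steps at cost
  \<open>(1 + e)\<^sup>2\<close>, and the two composition defects add up to
  \<open>(2 + e) * K\<close>. As \<open>e\<close> tends to 0 the factor of \<open>L\<close> tends to
  \<open>2 * (1/2) powr p < 1\<close>, so for small \<open>e\<close> the affine inequality is solved
  by its fixed point.\<close>

lemma davie_constants:
  fixes p K :: real
  assumes "1 < p" "0 \<le> K"
  obtains e L where "0 < e" "0 \<le> L" "(1 + (1 + e)\<^sup>2) * L * (1/2) powr p + (2 + e) * K \<le> L"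
proof -
  have "((\<lambda>e. (1 + (1 + e)\<^sup>2) * (1/2) powr p) \<longlongrightarrow> (1 + (1 + 0)\<^sup>2) * (1/2) powr p) (at_right (0::real))"
    by (intro tendsto_intros)
  moreover have "(1 + (1 + 0)\<^sup>2) * (1/2) powr p < (1::real)"
  proof -
    have "(1/2::real) powr p < (1/2) powr 1"
      by (rule powr_less_mono') (use assms in auto)
    thus ?thesis by simp
  qed
  ultimately have "eventually (\<lambda>e. (1 + (1 + e)\<^sup>2) * (1/2) powr p < 1) (at_right (0::real))"
    by (rule order_tendstoD(2))
  moreover have "eventually (\<lambda>e::real. 0 < e) (at_right 0)" by (simp add: eventually_at_right_less)
  ultimately obtain e :: real where e: "0 < e" "(1 + (1 + e)\<^sup>2) * (1/2) powr p < 1"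
    by (metis (mono_tags, lifting) eventually_conj eventually_happens trivial_limit_at_right_real)
  let ?q = "(1 + (1 + e)\<^sup>2) * (1/2) powr p"
  define L where "L = (2 + e) * K / (1 - ?q)"
  have "0 \<le> L" using e assms by (simp add: L_def)
  moreover have "L * (1 - ?q) = (2 + e) * K" using e by (simp add: L_def)
  hence "?q * L + (2 + e) * K \<le> L" by (simp add: algebra_simps)
  ultimately show thesis using that[of e L] e by (simp add: mult.commute mult.left_commute mult.assoc)
qed

lemma powr_half_le:
  fixes x y p L :: real
  assumes "0 \<le> x" "x \<le> y / 2" "0 \<le> p" "0 \<le> L"
  shows "L * x powr p \<le> L * (1/2) powr p * y powr p"
proof -
  have "x powr p \<le> (1/2 * y) powr p" using assms by (intro powr_mono2) auto
  also have "\<dots> = (1/2) powr p * y powr p" by (rule powr_mult)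
  finally show ?thesis using assms by (simp add: mult_left_mono mult.assoc)
qed

text \<open>Davie's midpoint argument: the gap of the chain that contains the midpoint of \<open>[u, v]\<close> splits
  the chain into two chains over intervals of at most half the length.\<close>

lemma davie_chain_bound:
  fixes m :: "real \<Rightarrow> real \<Rightarrow> 'e::real_normed_vector \<Rightarrow> 'e"
  assumes A: "finite A" "A \<subseteq> I" and ch: "chain m A y"
    and cst: "0 < e" "0 \<le> L" "0 \<le> K" "1 < p" "(1 + (1 + e)\<^sup>2) * L * (1/2) powr p + (2 + e) * K \<le> L"
    and BD: "B \<subseteq> D"
    and e0: "\<And>s z. s \<in> I \<Longrightarrow> z \<in> D \<Longrightarrow> m s s z = z"
    and e2: "\<And>s t z z'. s \<in> I \<Longrightarrow> t \<in> I \<Longrightarrow> s \<le> t \<Longrightarrow> t - s \<le> d \<Longrightarrow> z \<in> D \<Longrightarrow> z' \<in> D \<Longrightarrow>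
          norm (m s t z - m s t z') \<le> (1 + e) * norm (z - z')"
    and e3: "\<And>s u t z. s \<in> I \<Longrightarrow> u \<in> I \<Longrightarrow> t \<in> I \<Longrightarrow> s \<le> u \<Longrightarrow> u \<le> t \<Longrightarrow> t - s \<le> d \<Longrightarrow> z \<in> B \<Longrightarrow>
          norm (m u t (m s u z) - m s t z) \<le> K * (t - s) powr p"
    and dom: "\<And>s t z. s \<in> I \<Longrightarrow> t \<in> I \<Longrightarrow> s \<le> t \<Longrightarrow> t - s \<le> d \<Longrightarrow> z \<in> B \<Longrightarrow> m s t z \<in> D"
    and inB: "\<And>u. u \<in> A \<Longrightarrow> u < w \<Longrightarrow> y u \<in> B"
    and uv: "u \<in> A" "v \<in> A" "u < v" "v \<le> w" "v - u \<le> d"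
  shows "norm (y v - m u v (y u)) \<le> L * (v - u) powr p"
  using uv
\<comment> \<open>Each of the two subintervals misses an endpoint of \<open>[u, v]\<close>, so it
  contains fewer points of \<open>A\<close>.\<close>
proof (induction "card (A \<inter> {u..v})" arbitrary: u v rule: less_induct)
  case less
  obtain a b where ab: "consec A a b" "u \<le> a" "a \<le> (u + v) / 2" "(u + v) / 2 < b" "b \<le> v"
    using consec_around[OF A(1) less.prems(1,2), of "(u+v)/2"] less.prems by auto
  have in_A: "a \<in> A" "b \<in> A" "a < b" using ab(1) by (auto simp: consec_def)
  have in_I: "u \<in> I" "v \<in> I" "a \<in> I" "b \<in> I" using in_A less.prems A by auto
  have halves: "a - u \<le> (v - u) / 2" "v - b \<le> (v - u) / 2" using ab by argo+
  have le_d: "b - a \<le> d" "v - b \<le> d" "a - u \<le> d" "b - u \<le> d" "0 \<le> d"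
    using less.prems ab in_A by auto
  let ?t = "(v - u) powr p" and ?h = "L * (1/2) powr p * (v - u) powr p"
  \<comment> \<open>Membership in \<open>B\<close> is taken from \<open>inB\<close> only at left
    endpoints, which lie strictly before \<open>w\<close>. Values reached by one step from
    \<open>B\<close> are merely in \<open>D\<close>. This is what permits a first-exit argument with
    \<open>w\<close> as the exit time.\<close>
  have yuB: "y u \<in> B" and yaB: "y a \<in> B" using inB less.prems in_A ab by auto
  hence yaD: "y a \<in> D" using BD by auto
  have yb: "y b = m a b (y a)" using ch ab(1) by (auto simp: chain_def)
  have ybD: "y b \<in> D" using yb dom[of a b "y a"] in_I in_A le_d yaB by auto
  have muD: "m u a (y u) \<in> D" "m u b (y u) \<in> D" using dom in_I ab in_A le_d yuB by auto
  have h1: "norm (y a - m u a (y u)) \<le> ?h"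
  proof -
    have "norm (y a - m u a (y u)) \<le> L * (a - u) powr p"
    proof (cases "u = a")
      case True thus ?thesis using e0[OF in_I(3) yaD] by auto
    next
      case False
      have "v \<notin> A \<inter> {u..a}" "v \<in> A \<inter> {u..v}" "A \<inter> {u..a} \<subseteq> A \<inter> {u..v}" using less.prems in_A ab by auto
      hence "A \<inter> {u..a} \<subset> A \<inter> {u..v}" by blast
      hence "card (A \<inter> {u..a}) < card (A \<inter> {u..v})" using A by (intro psubset_card_mono) auto
      thus ?thesis using False less.prems in_A ab by (intro less.hyps) auto
    qed
    also have "\<dots> \<le> ?h" by (rule powr_half_le) (use halves ab cst in auto)
    finally show ?thesis .
  qed
  have h2: "norm (y v - m b v (y b)) \<le> ?h"
  proof -
    have "norm (y v - m b v (y b)) \<le> L * (v - b) powr p"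
    proof (cases "b = v")
      case True thus ?thesis using e0[OF in_I(4) ybD] by auto
    next
      case False
      have "u \<notin> A \<inter> {b..v}" "u \<in> A \<inter> {u..v}" "A \<inter> {b..v} \<subseteq> A \<inter> {u..v}" using less.prems in_A ab by auto
      hence "A \<inter> {b..v} \<subset> A \<inter> {u..v}" by blast
      hence "card (A \<inter> {b..v}) < card (A \<inter> {u..v})" using A by (intro psubset_card_mono) auto
      thus "norm (y v - m b v (y b)) \<le> L * (v - b) powr p"
        using False less.prems in_A ab le_d by (intro less.hyps) auto
    qed
    also have "\<dots> \<le> ?h" by (rule powr_half_le) (use halves ab cst in auto)
    finally show ?thesis .
  qed
  \<comment> \<open>The composition defect enters twice: for the times \<open>u, a, b\<close> here,
    and for \<open>u, b, v\<close> in \<open>h6\<close>.\<close>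
  have h3: "norm (m a b (m u a (y u)) - m u b (y u)) \<le> K * ?t"
  proof -
    have "norm (m a b (m u a (y u)) - m u b (y u)) \<le> K * (b - u) powr p"
      using e3[of u a b "y u"] in_I ab in_A le_d yuB by auto
    also have "\<dots> \<le> K * ?t" using cst ab in_A by (intro mult_left_mono powr_mono2) auto
    finally show ?thesis .
  qed
  have h4: "norm (y b - m u b (y u)) \<le> (1 + e) * ?h + K * ?t"
  proof -
    have "norm (y b - m a b (m u a (y u))) \<le> (1 + e) * norm (y a - m u a (y u))"
      unfolding yb by (rule e2) (use in_I in_A le_d yaD muD in auto)
    also have "\<dots> \<le> (1 + e) * ?h" using h1 cst by (intro mult_left_mono) auto
    finally show ?thesis using h3 by (rule norm_diff_triangle_le)
  qed
  have h5: "norm (m b v (y b) - m b v (m u b (y u))) \<le> (1 + e) * ((1 + e) * ?h + K * ?t)"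
  proof -
    have "norm (m b v (y b) - m b v (m u b (y u))) \<le> (1 + e) * norm (y b - m u b (y u))"
      by (rule e2) (use in_I ab le_d ybD muD in auto)
    also have "\<dots> \<le> (1 + e) * ((1 + e) * ?h + K * ?t)" using h4 cst by (intro mult_left_mono) auto
    finally show ?thesis .
  qed
  have h6: "norm (m b v (m u b (y u)) - m u v (y u)) \<le> K * ?t"
    using e3[of u b v "y u"] in_I ab in_A less.prems yuB by auto
  have "norm (y v - m u v (y u)) \<le> ?h + (1 + e) * ((1 + e) * ?h + K * ?t) + K * ?t"
    using norm_diff_triangle_le[OF norm_diff_triangle_le[OF h2 h5] h6] by simp
  also have "\<dots> = ((1 + (1 + e)\<^sup>2) * L * (1/2) powr p + (2 + e) * K) * ?t"
    by (simp add: algebra_simps power2_eq_square)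
  also have "\<dots> \<le> L * ?t" using cst by (intro mult_right_mono) auto
  finally show ?case .
qed

text \<open>The times are not ordered, so that the class is invariant under time reversal.\<close>

definition almost_flow :: "real \<Rightarrow> real \<Rightarrow> real \<Rightarrow> (real \<Rightarrow> real \<Rightarrow> 'e::real_normed_vector \<Rightarrow> 'e) \<Rightarrow> 'e set \<Rightarrow> real \<Rightarrow> bool"
  where "almost_flow T \<alpha> p m D K \<longleftrightarrow> 0 \<le> K \<and> (\<forall>s\<in>{0..T}. \<forall>t\<in>{0..T}. \<forall>z\<in>D.
     norm (m s t z - z) \<le> K * \<bar>t - s\<bar> powr \<alpha> \<and>
     (\<forall>z'\<in>D. norm (m s t z - m s t z' - (z - z')) \<le> K * \<bar>t - s\<bar> powr \<alpha> * norm (z - z')) \<and>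
     (\<forall>u\<in>{0..T}. norm (m u t (m s u z) - m s t z) \<le> K * (\<bar>u - s\<bar> + \<bar>t - u\<bar>) powr p))"

lemma almost_flowD:
  assumes "almost_flow T \<alpha> p m D K"
  shows "0 \<le> K"
    and "s \<in> {0..T} \<Longrightarrow> t \<in> {0..T} \<Longrightarrow> z \<in> D \<Longrightarrow> norm (m s t z - z) \<le> K * \<bar>t - s\<bar> powr \<alpha>"
    and "s \<in> {0..T} \<Longrightarrow> t \<in> {0..T} \<Longrightarrow> z \<in> D \<Longrightarrow> z' \<in> D \<Longrightarrow>
       norm (m s t z - m s t z' - (z - z')) \<le> K * \<bar>t - s\<bar> powr \<alpha> * norm (z - z')"
    and "s \<in> {0..T} \<Longrightarrow> t \<in> {0..T} \<Longrightarrow> u \<in> {0..T} \<Longrightarrow> z \<in> D \<Longrightarrow>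
       norm (m u t (m s u z) - m s t z) \<le> K * (\<bar>u - s\<bar> + \<bar>t - u\<bar>) powr p"
  using assms unfolding almost_flow_def by blast+

lemma almost_flow_id: "almost_flow T \<alpha> p m D K \<Longrightarrow> s \<in> {0..T} \<Longrightarrow> z \<in> D \<Longrightarrow> m s s z = z"
  using almost_flowD(2)[of T \<alpha> p m D K s s z] by auto

lemma almost_flow_mono: "almost_flow T \<alpha> p m D K \<Longrightarrow> D' \<subseteq> D \<Longrightarrow> almost_flow T \<alpha> p m D' K"
  unfolding almost_flow_def by blast

lemma almost_flow_lip:
  assumes "almost_flow T \<alpha> p m D K" "s \<in> {0..T}" "t \<in> {0..T}" "z \<in> D" "z' \<in> D" "K * \<bar>t - s\<bar> powr \<alpha> \<le> e"
  shows "norm (m s t z - m s t z') \<le> (1 + e) * norm (z - z')"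
proof -
  have "norm (m s t z - m s t z' - (z - z')) \<le> K * \<bar>t - s\<bar> powr \<alpha> * norm (z - z')"
    using assms almost_flowD(3) by blast
  also have "\<dots> \<le> e * norm (z - z')" using assms by (intro mult_right_mono) auto
  finally have "norm (m s t z - m s t z') \<le> norm (z - z') + e * norm (z - z')"
    using norm_triangle_sub[of "m s t z - m s t z'" "z - z'"] by linarith
  thus ?thesis by (simp add: algebra_simps)
qed

lemma small_powr:
  fixes C \<alpha> r :: real
  assumes "0 < \<alpha>" "0 < r"
  obtains d where "0 < d" "\<And>x. 0 \<le> x \<Longrightarrow> x \<le> d \<Longrightarrow> C * x powr \<alpha> \<le> r"
proof -
  define d where "d = (r / (\<bar>C\<bar> + 1)) powr (1 / \<alpha>)"
  have "C * x powr \<alpha> \<le> r" if "0 \<le> x" "x \<le> d" for x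
  proof -
    have "x powr \<alpha> \<le> d powr \<alpha>" using that assms by (intro powr_mono2) auto
    also have "\<dots> = r / (\<bar>C\<bar> + 1)" using assms by (simp add: d_def powr_powr)
    finally have "x powr \<alpha> * (\<bar>C\<bar> + 1) \<le> r" by (simp add: field_simps)
    moreover have "C * x powr \<alpha> \<le> (\<bar>C\<bar> + 1) * x powr \<alpha>" by (intro mult_right_mono) auto
    ultimately show ?thesis by (simp add: mult.commute)
  qed
  moreover have "0 < d" using assms by (simp add: d_def)
  ultimately show thesis using that by blast
qed

section \<open>A priori bounds on chains\<close>

text \<open>A first-exit argument: up to and including the first time \<open>w\<close> at which the
  chain is further than 1 from its start, Davie's bound applies, and it puts \<open>y w\<close>
  within 1/2 of a single step, which itself moves by at most 1/2. The length \<open>d\<close> is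
  fixed before the step map, the centre and the partition; the growth estimates rest on this
  uniformity.\<close>

lemma short_time:
  fixes \<alpha> p K :: real
  assumes "0 < \<alpha>" "1 < p" "0 \<le> K"
  obtains d where "0 < d" "\<And>m (z0 :: 'e::real_normed_vector) A y s v. almost_flow T \<alpha> p m (cball z0 2) K \<Longrightarrow>
     finite A \<Longrightarrow> A \<subseteq> {0..T} \<Longrightarrow> chain m A y \<Longrightarrow> s \<in> A \<Longrightarrow> y s = z0 \<Longrightarrow>
     v \<in> A \<Longrightarrow> s \<le> v \<Longrightarrow> v \<le> s + d \<Longrightarrow> norm (y v - z0) \<le> 1"
proof -
  obtain e L where cst: "0 < e" "0 \<le> L" "(1 + (1 + e)\<^sup>2) * L * (1/2) powr p + (2 + e) * K \<le> L"
    using davie_constants[OF assms(2,3)] by metis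
  \<comment> \<open>The bound \<open>e\<close> makes a step Lipschitz with constant
    \<open>1 + e\<close>; the bound 1/2 limits its displacement.\<close>
  obtain d1 where d1: "0 < d1" "\<And>x. 0 \<le> x \<Longrightarrow> x \<le> d1 \<Longrightarrow> K * x powr \<alpha> \<le> min e (1/2)"
    using small_powr[of \<alpha> "min e (1/2)" K] assms cst by auto
  obtain d2 where d2: "0 < d2" "\<And>x. 0 \<le> x \<Longrightarrow> x \<le> d2 \<Longrightarrow> L * x powr p \<le> 1/2"
    using small_powr[of p "1/2" L] assms by auto
  define d where "d = min d1 d2"
  have "norm (y v - z0) \<le> 1"
    if E: "almost_flow T \<alpha> p m (cball z0 2) K" and A: "finite A" "A \<subseteq> {0..T}" and ch: "chain m A y"
      and s: "s \<in> A" "y s = z0" and v: "v \<in> A" "s \<le> v" "v \<le> s + d"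
    for m and z0 :: 'e and A y s v
  proof (rule ccontr)
    assume n: "\<not> norm (y v - z0) \<le> 1"
    let ?B = "{x \<in> A. s \<le> x \<and> x \<le> s + d \<and> \<not> norm (y x - z0) \<le> 1}"
    have B: "finite ?B" "?B \<noteq> {}" using n v A by auto
    define w where "w = Min ?B"
    have w: "w \<in> ?B" unfolding w_def by (rule Min_in[OF B])
    hence "s \<noteq> w" using s by auto
    have wI: "s \<in> {0..T}" "w \<in> {0..T}" using w s A by auto
    have D: "norm (m a b z - z) \<le> 1/2" if "a \<in> {0..T}" "b \<in> {0..T}" "a \<le> b" "b - a \<le> d" "z \<in> cball z0 2" for a b z
      using almost_flowD(2)[OF E that(1,2,5)] d1(2)[of "b - a"] that by (auto simp: d_def)
    have "norm (y w - m s w (y s)) \<le> L * (w - s) powr p"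
    proof (rule davie_chain_bound[where A = "A \<inter> {s..}" and I = "{0..T}" and B = "cball z0 1"
          and D = "cball z0 2" and K = K and e = e and d = d and w = w])
      show "chain m (A \<inter> {s..}) y" using ch by (rule chain_mono)
      show "m t t z = z" if "t \<in> {0..T}" "z \<in> cball z0 2" for t z using almost_flow_id[OF E] that by auto
      show "norm (m a b z - m a b z') \<le> (1 + e) * norm (z - z')"
        if "a \<in> {0..T}" "b \<in> {0..T}" "a \<le> b" "b - a \<le> d" "z \<in> cball z0 2" "z' \<in> cball z0 2" for a b z z'
        using almost_flow_lip[OF E that(1,2,5,6), of e] d1(2)[of "b - a"] that by (auto simp: d_def)
      show "norm (m u t (m a u z) - m a t z) \<le> K * (t - a) powr p"
        if "a \<in> {0..T}" "u \<in> {0..T}" "t \<in> {0..T}" "a \<le> u" "u \<le> t" "z \<in> cball z0 1" for a u t z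
        using almost_flowD(4)[OF E that(1,3,2), of z] that by auto
      show "m a b z \<in> cball z0 2"
        if "a \<in> {0..T}" "b \<in> {0..T}" "a \<le> b" "b - a \<le> d" "z \<in> cball z0 1" for a b z
      proof -
        have "norm (m a b z - z) \<le> 1/2" "norm (z0 - z) \<le> 1" using D[of a b z] that by (auto simp: dist_norm)
        hence "norm (z0 - m a b z) \<le> 2" by norm
        thus ?thesis by (simp add: dist_norm)
      qed
      show "y u \<in> cball z0 1" if "u \<in> A \<inter> {s..}" "u < w" for u
      proof (rule ccontr)
        assume "y u \<notin> cball z0 1"
        hence "u \<in> ?B" using that w by (auto simp: dist_norm norm_minus_commute)
        hence "w \<le> u" using B(1) by (simp add: w_def)
        thus False using that by auto
      qed
    qed (use A s w cst assms \<open>s \<noteq> w\<close> in auto)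
    moreover have "L * (w - s) powr p \<le> 1/2" using d2(2)[of "w - s"] w by (auto simp: d_def)
    moreover have "norm (m s w (y s) - y s) \<le> 1/2" using D[of s w "y s"] s w wI by auto
    ultimately have "norm (y w - z0) \<le> 1"
      using norm_triangle_ineq[of "y w - m s w (y s)" "m s w (y s) - y s"] s(2) by simp
    thus False using w by auto
  qed
  moreover have "0 < d" using d1 d2 by (simp add: d_def)
  ultimately show thesis using that by blast
qed

text \<open>Each stretch of length \<open>d\<close> costs two factors \<open>c\<close>: one to reach
  the last point before \<open>u + d\<close>, and one for the gap of the partition across
  \<open>u + d\<close>, which may be long because partitions may be coarse. The exponent therefore
  does not depend on the number of points.\<close>

lemma iterate_growth:
  fixes N :: "real \<Rightarrow> real" and c d :: real and n :: nat
  assumes A: "finite A" and c: "1 \<le> c" and d: "0 < d"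
    and N: "\<And>u. u \<in> A \<Longrightarrow> 0 \<le> N u"
    and h1: "\<And>u v. u \<in> A \<Longrightarrow> v \<in> A \<Longrightarrow> s \<le> u \<Longrightarrow> u \<le> v \<Longrightarrow> v \<le> u + d \<Longrightarrow> N v \<le> c * N u"
    and h2: "\<And>u v. consec A u v \<Longrightarrow> s \<le> u \<Longrightarrow> N v \<le> c * N u"
    and u: "u \<in> A" "s \<le> u" and v: "v \<in> A" "u \<le> v" "v - u \<le> real n * d"
  shows "N v \<le> c ^ (2 * n) * N u"
  using u v
proof (induction n arbitrary: u)
  case 0
  thus ?case using c by auto
next
  case (Suc n)
  show ?case
  proof (cases "v \<le> u + d")
    case True
    have "N v \<le> c * N u" using h1 Suc.prems True by auto
    also have "\<dots> \<le> c ^ (2 * Suc n) * N u"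
      using N[of u] Suc.prems c by (intro mult_right_mono self_le_power) auto
    finally show ?thesis .
  next
    case False
    obtain a b where ab: "consec A a b" "u \<le> a" "a \<le> u + d" "u + d < b" "b \<le> v"
      using consec_around[OF A, of u v "u + d"] Suc.prems False d by auto
    hence in_A: "a \<in> A" "b \<in> A" by (auto simp: consec_def)
    have "v - b \<le> n * d" using ab Suc.prems by (simp add: algebra_simps)
    hence "N v \<le> c ^ (2 * n) * N b" using Suc ab in_A d by auto
    also have "\<dots> \<le> c ^ (2 * n) * (c * (c * N u))"
    proof -
      have "N b \<le> c * N a" using h2 ab Suc.prems by auto
      also have "\<dots> \<le> c * (c * N u)" using h1 ab in_A Suc.prems c by (intro mult_left_mono) auto
      finally show ?thesis using c by (intro mult_left_mono) auto
    qed
    finally show ?thesis by (simp add: algebra_simps)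
  qed
qed

definition local_almost_flow :: "real \<Rightarrow> real \<Rightarrow> real \<Rightarrow> (real \<Rightarrow> real \<Rightarrow> 'e::real_normed_vector \<Rightarrow> 'e) \<Rightarrow> bool" where
  "local_almost_flow T \<alpha> p m \<longleftrightarrow> (\<forall>R. \<exists>K. almost_flow T \<alpha> p m (cball 0 R) K)"

definition no_blowup :: "real \<Rightarrow> (real \<Rightarrow> real \<Rightarrow> 'e::real_normed_vector \<Rightarrow> 'e) \<Rightarrow> bool" where
  "no_blowup T m \<longleftrightarrow> (\<forall>R. \<exists>R'. \<forall>A y s v. finite A \<longrightarrow> A \<subseteq> {0..T} \<longrightarrow> chain m A y \<longrightarrow> s \<in> A \<longrightarrow>
      norm (y s) \<le> R \<longrightarrow> v \<in> A \<longrightarrow> s \<le> v \<longrightarrow> norm (y v) \<le> R')"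

lemma no_blowupD:
  assumes "no_blowup T m"
  obtains R' where "0 \<le> R'" "\<And>A y s v. finite A \<Longrightarrow> A \<subseteq> {0..T} \<Longrightarrow> chain m A y \<Longrightarrow> s \<in> A \<Longrightarrow>
      norm (y s) \<le> R \<Longrightarrow> v \<in> A \<Longrightarrow> s \<le> v \<Longrightarrow> norm (y v) \<le> R'"
proof -
  obtain R' where R': "\<forall>A y s v. finite A \<longrightarrow> A \<subseteq> {0..T} \<longrightarrow> chain m A y \<longrightarrow> s \<in> A \<longrightarrow>
      norm (y s) \<le> R \<longrightarrow> v \<in> A \<longrightarrow> s \<le> v \<longrightarrow> norm (y v) \<le> R'"
    using assms unfolding no_blowup_def by blast
  show thesis
  proof (rule that[of "max 0 R'"])
    fix A y s v
    assume "finite A" "A \<subseteq> {0..T}" "chain m A y" "s \<in> A" "norm (y s) \<le> R" "v \<in> A" "s \<le> v"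
    with R' have "norm (y v) \<le> R'" by blast
    thus "norm (y v) \<le> max 0 R'" by simp
  qed simp
qed

lemma no_blowup_path:
  fixes m :: "real \<Rightarrow> real \<Rightarrow> 'e::real_normed_vector \<Rightarrow> 'e"
  assumes "no_blowup T m"
  obtains R' where "0 \<le> R'" "\<And>A (z :: 'e) s v. finite A \<Longrightarrow> A \<subseteq> {0..T} \<Longrightarrow> s \<in> A \<Longrightarrow> norm z \<le> R \<Longrightarrow> v \<in> A \<Longrightarrow> s \<le> v \<Longrightarrow>
      norm (path m A s z v) \<le> R'"
proof -
  obtain R' where R': "0 \<le> R'" "\<And>A y s v. finite A \<Longrightarrow> A \<subseteq> {0..T} \<Longrightarrow> chain m A y \<Longrightarrow> s \<in> A \<Longrightarrow>
      norm (y s) \<le> R \<Longrightarrow> v \<in> A \<Longrightarrow> s \<le> v \<Longrightarrow> norm (y v) \<le> R'"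
    using no_blowupD[OF assms, of R] by metis
  show thesis
  proof (rule that[OF R'(1)])
    fix A and z :: 'e and s v
    assume A: "finite A" "A \<subseteq> {0..T}" "s \<in> A" "norm z \<le> R" "v \<in> A" "s \<le> v"
    show "norm (path m A s z v) \<le> R'"
      by (rule R'(2)[of "A \<inter> {s..}" _ s]) (use A path_spec[OF A(1,3), of m z] in auto)
  qed
qed

lemma abs_powr_le:
  fixes s t T a :: real
  assumes "s \<in> {0..T}" "t \<in> {0..T}" "0 \<le> a"
  shows "\<bar>t - s\<bar> powr a \<le> T powr a"
  using assms by (intro powr_mono2) auto

lemma cball_two_subset:
  fixes w :: "'e::real_normed_vector"
  assumes "w \<in> cball 0 (R + 1)"
  shows "cball w 2 \<subseteq> cball 0 (R + 3)"
proof
  fix z assume "z \<in> cball w 2"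
  thus "z \<in> cball 0 (R + 3)"
    using assms norm_triangle_sub[of z w] by (simp add: dist_norm norm_minus_commute)
qed

text \<open>A global constant makes the time \<open>d\<close> of \<open>short_time\<close> the same
  at every starting point, so the norm grows by at most 1 over each stretch of length
  \<open>d\<close> and by at most \<open>K * T powr \<alpha>\<close> over a single gap. Adding 1 to
  the norm turns this additive growth into the multiplicative form of
  \<open>iterate_growth\<close>.\<close>

lemma no_blowup_uniform:
  assumes "0 < \<alpha>" "1 < p" "almost_flow T \<alpha> p (m :: real \<Rightarrow> real \<Rightarrow> 'e::real_normed_vector \<Rightarrow> 'e) UNIV K"
  shows "no_blowup T m"
proof -
  note K = almost_flowD(1)[OF assms(3)]
  obtain d where d: "0 < d" "\<And>m (z0 :: 'e) A y s v. almost_flow T \<alpha> p m (cball z0 2) K \<Longrightarrow>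
     finite A \<Longrightarrow> A \<subseteq> {0..T} \<Longrightarrow> chain m A y \<Longrightarrow> s \<in> A \<Longrightarrow> y s = z0 \<Longrightarrow>
     v \<in> A \<Longrightarrow> s \<le> v \<Longrightarrow> v \<le> s + d \<Longrightarrow> norm (y v - z0) \<le> 1"
    using short_time[OF assms(1,2) K] by blast
  define n where "n = nat \<lceil>T / d\<rceil>"
  define c where "c = 2 + K * T powr \<alpha>"
  have c: "2 \<le> c" using K by (simp add: c_def)
  have n: "T \<le> n * d" unfolding n_def using d(1) by (metis mult.commute pos_divide_le_eq real_nat_ceiling_ge)
  show ?thesis
    unfolding no_blowup_def
  proof (intro allI exI impI)
    fix R A y s v
    assume A: "finite A" "A \<subseteq> {0..T}" "chain m A y" "s \<in> A" "norm (y s) \<le> R" "v \<in> A" "s \<le> v"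
    have "1 + norm (y v) \<le> c ^ (2 * n) * (1 + norm (y s))"
    proof (rule iterate_growth[OF A(1) _ d(1), where N = "\<lambda>v. 1 + norm (y v)" and s = s])
      fix a b assume ab: "a \<in> A" "b \<in> A" "a \<le> b" "b \<le> a + d"
      have "norm (y b - y a) \<le> 1"
        by (rule d(2)[of m _ A y a]) (use ab A almost_flow_mono[OF assms(3)] in auto)
      hence "norm (y b) \<le> 1 + norm (y a)" using norm_triangle_sub[of "y b" "y a"] by linarith
      hence "1 + norm (y b) \<le> 2 * (1 + norm (y a))" using norm_ge_zero[of "y a"] by argo
      also have "\<dots> \<le> c * (1 + norm (y a))" using c by (intro mult_right_mono) auto
      finally show "1 + norm (y b) \<le> c * (1 + norm (y a))" .
    next
      fix a b assume ab: "consec A a b"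
      hence I: "a \<in> {0..T}" "b \<in> {0..T}" using A by (auto simp: consec_def)
      have "norm (y b - y a) \<le> K * \<bar>b - a\<bar> powr \<alpha>"
        using almost_flowD(2)[OF assms(3) I, of "y a"] A ab by (auto simp: chain_def)
      also have "\<dots> \<le> K * T powr \<alpha>" using I K assms by (intro mult_left_mono abs_powr_le) auto
      finally have "norm (y b) \<le> norm (y a) + K * T powr \<alpha>" using norm_triangle_sub[of "y b" "y a"] by linarith
      also have "1 + \<dots> \<le> c * (1 + norm (y a))" using K by (simp add: c_def algebra_simps)
      finally show "1 + norm (y b) \<le> c * (1 + norm (y a))" by simp
    next
      have "s \<in> {0..T}" "v \<in> {0..T}" using A by blast+
      thus "v - s \<le> n * d" using n by simp
    qed (use A c in auto)
    also have "\<dots> \<le> c ^ (2 * n) * (1 + R)" using A c by (intro mult_left_mono) auto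
    finally show "norm (y v) \<le> c ^ (2 * n) * (1 + R)" by simp
  qed
qed

text \<open>The step is homogeneous in the component \<open>r z\<close>, and chains are bounded in the component
  \<open>l z\<close>. Rescaling the first component to norm at most 1 makes the length of the interval in
  \<open>short_time\<close> independent of its size.\<close>

lemma no_blowup_homogeneous:
  fixes m :: "real \<Rightarrow> real \<Rightarrow> 'e::real_normed_vector \<Rightarrow> 'e" and l r :: "'e \<Rightarrow> 'e"
  assumes "0 < \<alpha>" "1 < p" "local_almost_flow T \<alpha> p m"
    and r: "\<And>z. norm (r z) \<le> norm z" "\<And>z z'. r (z - z') = r z - r z'"
    and lr: "\<And>z. norm z \<le> norm (l z) + norm (r z)"
    and sc: "\<And>c z s t. 0 < c \<Longrightarrow> c \<le> 1 \<Longrightarrow> s \<in> {0..T} \<Longrightarrow> t \<in> {0..T} \<Longrightarrow> m s t (sc c z) = sc c (m s t z)"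
      "\<And>c z. 0 < c \<Longrightarrow> norm (sc c z) \<le> norm (l z) + c * norm (r z)" "\<And>c z. r (sc c z) = c *\<^sub>R r z"
    and lb: "\<And>R. \<exists>R'. \<forall>A y s v. finite A \<longrightarrow> A \<subseteq> {0..T} \<longrightarrow> chain m A y \<longrightarrow> s \<in> A \<longrightarrow>
      norm (y s) \<le> R \<longrightarrow> v \<in> A \<longrightarrow> s \<le> v \<longrightarrow> norm (l (y v)) \<le> R'"
  shows "no_blowup T m"
  unfolding no_blowup_def
proof (intro allI)
  fix R
  obtain R1 where R1: "\<And>A y s v. finite A \<Longrightarrow> A \<subseteq> {0..T} \<Longrightarrow> chain m A y \<Longrightarrow> s \<in> A \<Longrightarrow>
      norm (y s) \<le> R \<Longrightarrow> v \<in> A \<Longrightarrow> s \<le> v \<Longrightarrow> norm (l (y v)) \<le> R1"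
    using lb[of R] by metis
  \<comment> \<open>\<open>R1\<close> bounds the component \<open>l\<close>, 1 bounds the rescaled
    component \<open>r\<close>, and 2 is the radius that \<open>short_time\<close> asks for.\<close>
  obtain K where E: "almost_flow T \<alpha> p m (cball 0 (R1 + 3)) K" using assms(3) unfolding local_almost_flow_def by blast
  note K = almost_flowD(1)[OF E]
  obtain d where d: "0 < d" "\<And>m (z0 :: 'e) A y s v. almost_flow T \<alpha> p m (cball z0 2) K \<Longrightarrow>
     finite A \<Longrightarrow> A \<subseteq> {0..T} \<Longrightarrow> chain m A y \<Longrightarrow> s \<in> A \<Longrightarrow> y s = z0 \<Longrightarrow>
     v \<in> A \<Longrightarrow> s \<le> v \<Longrightarrow> v \<le> s + d \<Longrightarrow> norm (y v - z0) \<le> 1"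
    using short_time[OF assms(1,2) K] by blast
  define n where "n = nat \<lceil>T / d\<rceil>"
  define c where "c = 3 + K * T powr \<alpha>"
  have c: "3 \<le> c" using K by (simp add: c_def)
  have n: "T \<le> n * d" unfolding n_def using d(1) by (metis mult.commute pos_divide_le_eq real_nat_ceiling_ge)
  show "\<exists>R'. \<forall>A y s v. finite A \<longrightarrow> A \<subseteq> {0..T} \<longrightarrow> chain m A y \<longrightarrow> s \<in> A \<longrightarrow>
      norm (y s) \<le> R \<longrightarrow> v \<in> A \<longrightarrow> s \<le> v \<longrightarrow> norm (y v) \<le> R'"
  proof (intro allI exI impI)
    fix A y s v
    assume A: "finite A" "A \<subseteq> {0..T}" "chain m A y" "s \<in> A" "norm (y s) \<le> R" "v \<in> A" "s \<le> v"
    let ?N = "\<lambda>v. 1 + norm (r (y v))"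
    \<comment> \<open>After rescaling by \<open>1 / ?N a\<close> the increment is bounded by a
      constant; undoing the rescaling yields growth by a factor that does not depend on the size of
      \<open>y a\<close>.\<close>
    have grow: "?N b \<le> c * ?N a"
      if ab: "a \<in> A" "s \<le> a" and le: "norm (sc (1 / ?N a) (y b) - sc (1 / ?N a) (y a)) \<le> 1 + K * T powr \<alpha>" for a b
    proof -
      have N: "1 \<le> ?N a" by simp
      have "(1 / ?N a) * norm (r (y b) - r (y a)) = norm (r (sc (1 / ?N a) (y b) - sc (1 / ?N a) (y a)))"
        unfolding r(2) sc(3) scaleR_diff_right[symmetric] by simp
      also have "\<dots> \<le> 1 + K * T powr \<alpha>" using r(1) le by (rule order_trans)
      finally have "norm (r (y b) - r (y a)) \<le> (1 + K * T powr \<alpha>) * ?N a"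
        using N by (simp add: pos_divide_le_eq[where c = "?N a"])
      hence "norm (r (y b)) \<le> norm (r (y a)) + (1 + K * T powr \<alpha>) * ?N a"
        using norm_triangle_sub[of "r (y b)" "r (y a)"] by linarith
      also have "1 + \<dots> \<le> c * ?N a" using N by (simp add: c_def algebra_simps)
      finally show ?thesis by simp
    qed
    have ball: "sc (1 / ?N a) (y a) \<in> cball 0 (R1 + 1)" if "a \<in> A" "s \<le> a" for a
    proof -
      have "norm (sc (1 / ?N a) (y a)) \<le> norm (l (y a)) + 1 / ?N a * norm (r (y a))"
        by (rule sc(2)) (simp add: add_pos_nonneg)
      moreover have "1 / ?N a * norm (r (y a)) \<le> 1" by (simp add: divide_simps add_pos_nonneg)
      moreover have "norm (l (y a)) \<le> R1" using R1[OF A(1-5) that] .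
      ultimately show ?thesis by simp
    qed
    have "?N v \<le> c ^ (2 * n) * ?N s"
    proof (rule iterate_growth[OF A(1) _ d(1), where N = ?N and s = s])
      fix a b assume ab: "a \<in> A" "b \<in> A" "s \<le> a" "a \<le> b" "b \<le> a + d"
      let ?c = "1 / ?N a"
      have c01: "0 < ?c" "?c \<le> 1" by (auto simp: add_pos_nonneg)
      have "chain m A (\<lambda>v. sc ?c (y v))"
        unfolding chain_def
      proof (intro allI impI)
        fix a' b' assume "consec A a' b'"
        moreover from this have "a' \<in> {0..T}" "b' \<in> {0..T}" using A(2) by (auto simp: consec_def)
        ultimately show "sc ?c (y b') = m a' b' (sc ?c (y a'))" using A(3) sc(1)[OF c01] by (simp add: chain_def)
      qed
      moreover have "cball (sc ?c (y a)) 2 \<subseteq> cball 0 (R1 + 3)"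
        using ball[OF ab(1,3)] by (rule cball_two_subset)
      ultimately have "norm (sc ?c (y b) - sc ?c (y a)) \<le> 1"
        by (intro d(2)[of m _ A "\<lambda>v. sc ?c (y v)" a]) (use ab A almost_flow_mono[OF E] in auto)
      thus "?N b \<le> c * ?N a" using K by (intro grow ab) (smt (verit) mult_nonneg_nonneg powr_ge_zero)
    next
      fix a b assume ab: "consec A a b" "s \<le> a"
      let ?c = "1 / ?N a"
      have c01: "0 < ?c" "?c \<le> 1" by (auto simp: add_pos_nonneg)
      have I: "a \<in> {0..T}" "b \<in> {0..T}" "a \<in> A" using A ab by (auto simp: consec_def)
      have "sc ?c (y b) = m a b (sc ?c (y a))"
        using A(3) ab sc(1)[OF c01 I(1,2)] by (auto simp: chain_def)
      moreover have "sc ?c (y a) \<in> cball 0 (R1 + 3)" using ball[OF I(3) ab(2)] by auto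
      ultimately have "norm (sc ?c (y b) - sc ?c (y a)) \<le> K * \<bar>b - a\<bar> powr \<alpha>"
        using almost_flowD(2)[OF E I(1,2)] by auto
      also have "\<dots> \<le> K * T powr \<alpha>" using I K assms by (intro mult_left_mono abs_powr_le) auto
      finally show "?N b \<le> c * ?N a" by (intro grow I ab) auto
    next
      have "s \<in> {0..T}" "v \<in> {0..T}" using A by blast+
      thus "v - s \<le> n * d" using n by simp
    qed (use A c in auto)
    also have "\<dots> \<le> c ^ (2 * n) * (1 + R)" using A c order_trans[OF r(1) A(5)] by (intro mult_left_mono) auto
    finally have "norm (r (y v)) \<le> c ^ (2 * n) * (1 + R)" by simp
    moreover have "norm (l (y v)) \<le> R1" using R1[OF A] .
    ultimately show "norm (y v) \<le> R1 + c ^ (2 * n) * (1 + R)" using lr[of "y v"] by linarith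
  qed
qed

text \<open>Davie's bound without a restriction to short intervals. The a priori bound keeps the
  whole path in one ball, where one constant \<open>K\<close> is valid; beyond length
  \<open>d\<close> both terms are bounded and the factor \<open>1 / d powr p\<close> absorbs
  them.\<close>

lemma davie_path_bound:
  fixes m :: "real \<Rightarrow> real \<Rightarrow> 'e::real_normed_vector \<Rightarrow> 'e"
  assumes a: "0 < \<alpha>" "1 < p" "local_almost_flow T \<alpha> p m" "no_blowup T m"
  obtains L where "0 \<le> L" "\<And>A s (z :: 'e) u v. finite A \<Longrightarrow> A \<subseteq> {0..T} \<Longrightarrow> s \<in> A \<Longrightarrow> norm z \<le> R \<Longrightarrow>
      u \<in> A \<Longrightarrow> v \<in> A \<Longrightarrow> s \<le> u \<Longrightarrow> u \<le> v \<Longrightarrow>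
      norm (path m A s z v - m u v (path m A s z u)) \<le> L * (v - u) powr p"
proof -
  obtain R1 where R1: "0 \<le> R1" "\<And>A (z :: 'e) s v. finite A \<Longrightarrow> A \<subseteq> {0..T} \<Longrightarrow> s \<in> A \<Longrightarrow> norm z \<le> R \<Longrightarrow> v \<in> A \<Longrightarrow> s \<le> v \<Longrightarrow>
      norm (path m A s z v) \<le> R1"
    using no_blowup_path[OF a(4), of R] by metis
  obtain K where E: "almost_flow T \<alpha> p m (cball 0 (R1 + 1)) K" using assms(3) unfolding local_almost_flow_def by blast
  note K = almost_flowD(1)[OF E]
  obtain e L where cst: "0 < e" "0 \<le> L" "(1 + (1 + e)\<^sup>2) * L * (1/2) powr p + (2 + e) * K \<le> L"
    using davie_constants[OF a(2) K] by metis
  obtain d where d: "0 < d" "\<And>x. 0 \<le> x \<Longrightarrow> x \<le> d \<Longrightarrow> K * x powr \<alpha> \<le> min e 1"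
    using small_powr[of \<alpha> "min e 1" K] a cst by auto
  define L' where "L' = max L ((2 * R1 + K * T powr \<alpha>) / d powr p)"
  have "norm (path m A s z v - m u v (path m A s z u)) \<le> L' * (v - u) powr p"
    if A: "finite A" "A \<subseteq> {0..T}" "s \<in> A" "norm z \<le> R" "u \<in> A" "v \<in> A" "s \<le> u" "u \<le> v" for A s z u v
  proof -
    let ?y = "path m A s z"
    have I: "u \<in> {0..T}" "v \<in> {0..T}" using A by auto
    have R: "norm (?y w) \<le> R1" if "w \<in> A" "s \<le> w" for w using R1(2)[OF A(1-4) that] .
    have D: "norm (m a b z - z) \<le> 1" if "a \<in> {0..T}" "b \<in> {0..T}" "a \<le> b" "b - a \<le> d" "norm z \<le> R1" for a b z
      using almost_flowD(2)[OF E that(1,2), of z] d(2)[of "b - a"] that by auto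
    consider "u = v" | "u < v" "v - u \<le> d" | "d < v - u" using A by linarith
    thus ?thesis
    proof cases
      case 1
      thus ?thesis using almost_flow_id[OF E I(1), of "?y u"] R[of u] A R1(1) by auto
    next
      case 2
      have "norm (?y v - m u v (?y u)) \<le> L * (v - u) powr p"
      proof (rule davie_chain_bound[where A = "A \<inter> {s..}" and I = "{0..T}" and B = "cball 0 R1"
          and D = "cball 0 (R1 + 1)" and K = K and e = e and d = d and w = v])
        show "chain m (A \<inter> {s..}) ?y" using A by (intro path_chain)
        show "m t t z = z" if "t \<in> {0..T}" "z \<in> cball 0 (R1 + 1)" for t z using almost_flow_id[OF E] that by auto
        show "norm (m a b z - m a b z') \<le> (1 + e) * norm (z - z')"
          if "a \<in> {0..T}" "b \<in> {0..T}" "a \<le> b" "b - a \<le> d" "z \<in> cball 0 (R1 + 1)" "z' \<in> cball 0 (R1 + 1)" for a b z z'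
          using almost_flow_lip[OF E that(1,2,5,6), of e] d(2)[of "b - a"] that by auto
        show "norm (m u t (m a u z) - m a t z) \<le> K * (t - a) powr p"
          if "a \<in> {0..T}" "u \<in> {0..T}" "t \<in> {0..T}" "a \<le> u" "u \<le> t" "z \<in> cball 0 R1" for a u t z
          using almost_flowD(4)[OF E that(1,3,2), of z] that by auto
        show "m a b z \<in> cball 0 (R1 + 1)"
          if "a \<in> {0..T}" "b \<in> {0..T}" "a \<le> b" "b - a \<le> d" "z \<in> cball 0 R1" for a b z
          using D[of a b z] that norm_triangle_sub[of "m a b z" z] by simp
        show "?y w \<in> cball 0 R1" if "w \<in> A \<inter> {s..}" for w using R that by auto
      qed (use A 2 a cst K in auto)
      also have "\<dots> \<le> L' * (v - u) powr p" by (intro mult_right_mono) (auto simp: L'_def)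
      finally show ?thesis .
    next
      case 3
      have "norm (m u v (?y u) - ?y u) \<le> K * T powr \<alpha>"
        using almost_flowD(2)[OF E I, of "?y u"] R[of u] A abs_powr_le[OF I, of \<alpha>] K a
          mult_left_mono[OF abs_powr_le[OF I, of \<alpha>] K] by auto
      hence "norm (?y v - m u v (?y u)) \<le> 2 * R1 + K * T powr \<alpha>"
        using norm_triangle_ineq4[of "?y v" "?y u"] R[of u] R[of v] A
          norm_triangle_ineq4[of "?y v - ?y u" "m u v (?y u) - ?y u"] by simp
      also have "\<dots> = (2 * R1 + K * T powr \<alpha>) / d powr p * d powr p" using d by simp
      also have "\<dots> \<le> L' * d powr p" by (intro mult_right_mono) (auto simp: L'_def)
      also have "\<dots> \<le> L' * (v - u) powr p"
        using 3 d a cst by (intro mult_left_mono powr_mono2) (auto simp: L'_def)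
      finally show ?thesis .
    qed
  qed
  thus thesis using that[of L'] cst by (auto simp: L'_def)
qed

section \<open>Tangent lifts\<close>

text \<open>The maps \<open>l\<close>, \<open>r\<close> and \<open>pr\<close> identify \<open>'e\<close> with \<open>'e \<times> 'e\<close>; the tangent lift of a map on \<open>'e\<close>
  is then again a map on \<open>'e\<close>.\<close>

locale doubling =
  fixes l r :: "'e::real_normed_vector \<Rightarrow> 'e" and pr :: "'e \<Rightarrow> 'e \<Rightarrow> 'e"
  assumes linear_l: "linear l" and linear_r: "linear r"
    and l_pr [simp]: "l (pr a b) = a" and r_pr [simp]: "r (pr a b) = b" and pr_lr [simp]: "pr (l z) (r z) = z"
    and norm_l: "norm (l z) \<le> norm z" and norm_r: "norm (r z) \<le> norm z"
    and norm_lr: "norm z \<le> norm (l z) + norm (r z)"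
begin

lemma bounded_linear_r: "bounded_linear r"
  using linear_r norm_r by (intro bounded_linear_intro[where K = 1]) (auto simp: linear_add linear_scale)

lemmas l_linear = linear_add[OF linear_l] linear_diff[OF linear_l] linear_scale[OF linear_l] linear_0[OF linear_l]
lemmas r_linear = linear_add[OF linear_r] linear_diff[OF linear_r] linear_scale[OF linear_r] linear_0[OF linear_r]

lemma lr_eqI: "l z = l z' \<Longrightarrow> r z = r z' \<Longrightarrow> z = z'"
  by (metis pr_lr)

lemma pr_add: "pr a b + pr c d = pr (a + c) (b + d)"
  by (rule lr_eqI) (simp_all add: l_linear r_linear)

lemma pr_diff: "pr a b - pr c d = pr (a - c) (b - d)"
  by (rule lr_eqI) (simp_all add: l_linear r_linear)

lemma pr_scale: "c *\<^sub>R pr a b = pr (c *\<^sub>R a) (c *\<^sub>R b)"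
  by (rule lr_eqI) (simp_all add: l_linear r_linear)

lemma norm_pr: "norm (pr a b) \<le> norm a + norm b"
  using norm_lr[of "pr a b"] by simp

lemma pr_0_0: "pr 0 0 = 0"
  by (rule lr_eqI) (simp_all add: l_linear r_linear)

lemma bounded_linear_pr_left: "bounded_linear (\<lambda>a. pr a 0)"
  by (rule bounded_linear_intro[where K = 1]) (auto simp: pr_add pr_scale norm_pr[of _ 0, simplified])

lemma bounded_linear_pr_right: "bounded_linear (\<lambda>a. pr 0 a)"
  by (rule bounded_linear_intro[where K = 1]) (auto simp: pr_add pr_scale norm_pr[of 0, simplified])

definition lift :: "real \<Rightarrow> (real \<Rightarrow> real \<Rightarrow> 'e \<Rightarrow> 'e) \<Rightarrow> (real \<Rightarrow> real \<Rightarrow> 'e \<Rightarrow> 'e) \<Rightarrow> bool" where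
  "lift T m m1 \<longleftrightarrow> (\<forall>s\<in>{0..T}. \<forall>t\<in>{0..T}. \<forall>z. l (m1 s t z) = m s t (l z) \<and>
     (m s t has_derivative (\<lambda>v. r (m1 s t (pr z v)))) (at z))"

lemma liftD:
  assumes "lift T m m1" "s \<in> {0..T}" "t \<in> {0..T}"
  shows "l (m1 s t z) = m s t (l z)" "(m s t has_derivative (\<lambda>v. r (m1 s t (pr z v)))) (at z)"
  using assms unfolding lift_def by auto

lemma lift_path:
  assumes "lift T m m1" "finite A" "A \<subseteq> {0..T}" "s \<in> A" "v \<in> A" "s \<le> v"
  shows "l (path m1 A s z v) = path m A s (l z) v"
  using assms by (intro path_semiconj[where I = "{0..T}"]) (auto simp: liftD)

text \<open>The chain rule: the tangent map of a composition of steps is the composition of their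
  tangent maps.\<close>

lemma path_has_derivative:
  assumes "lift T m m1" "finite A" "A \<subseteq> {0..T}" "s \<in> A" "t \<in> A" "s \<le> t"
  shows "((\<lambda>z. path m A s z t) has_derivative (\<lambda>h. r (path m1 A s (pr z h) t))) (at z)"
  using assms(2,4-6)
proof (induction t rule: consec_induct)
  case start
  show ?case using assms by (simp add: path_start has_derivative_ident)
next
  case (step a b)
  have ab: "a \<in> {0..T}" "b \<in> {0..T}" "a \<in> A" using step(1) assms by (auto simp: consec_def)
  have "((\<lambda>z. m a b (path m A s z a)) has_derivative
      (\<lambda>h. r (m1 a b (pr (path m A s z a) (r (path m1 A s (pr z h) a)))))) (at z)"
    by (rule has_derivative_compose[OF step(3) liftD(2)[OF assms(1) ab(1,2)]])
  moreover have "pr (path m A s z a) (r (path m1 A s (pr z h) a)) = path m1 A s (pr z h) a" for h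
    using lift_path[OF assms(1-4) ab(3) step(2), of "pr z h"] pr_lr[of "path m1 A s (pr z h) a"]
    by (simp only: l_pr)
  ultimately show ?case
    by (simp only: path_step[OF assms(2,4) step(1,2)])
qed

lemma linear_unit_bound:
  fixes f :: "'a::real_normed_vector \<Rightarrow> 'b::real_normed_vector"
  assumes "linear f" "\<And>h. norm h \<le> 1 \<Longrightarrow> norm (f h) \<le> M"
  shows "norm (f h) \<le> M * norm h"
proof (cases "h = 0")
  case True
  thus ?thesis using assms(1) by (simp add: linear_0)
next
  case False
  have "norm (f ((1 / norm h) *\<^sub>R h)) \<le> M" using False by (intro assms(2)) simp
  hence "(1 / norm h) * norm (f h) \<le> M" using assms(1) by (simp add: linear_scale)
  thus ?thesis using False by (simp add: field_simps)
qed

text \<open>Bounded chains of the lifted step bound the derivative on unit vectors, uniformly in the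
  partition, and linearity extends the bound to all \<open>h\<close>.\<close>

lemma path_tangent_bound:
  fixes m m1 :: "real \<Rightarrow> real \<Rightarrow> 'e \<Rightarrow> 'e"
  assumes "lift T m m1" "no_blowup T m1"
  obtains M where "0 \<le> M" "\<And>A s t (z :: 'e) h. finite A \<Longrightarrow> A \<subseteq> {0..T} \<Longrightarrow> s \<in> A \<Longrightarrow> t \<in> A \<Longrightarrow> s \<le> t \<Longrightarrow>
      norm z \<le> R \<Longrightarrow> norm (r (path m1 A s (pr z h) t)) \<le> M * norm h"
proof -
  obtain M where M: "0 \<le> M" "\<And>A (z :: 'e) s v. finite A \<Longrightarrow> A \<subseteq> {0..T} \<Longrightarrow> s \<in> A \<Longrightarrow> norm z \<le> R + 1 \<Longrightarrow> v \<in> A \<Longrightarrow> s \<le> v \<Longrightarrow>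
      norm (path m1 A s z v) \<le> M"
    by (rule no_blowup_path[OF assms(2), of "R + 1"]) (erule that)
  show thesis
  proof (rule that[OF M(1)])
    fix A s t and z h :: 'e
    assume A: "finite A" "A \<subseteq> {0..T}" "s \<in> A" "t \<in> A" "s \<le> t" "norm z \<le> R"
    show "norm (r (path m1 A s (pr z h) t)) \<le> M * norm h"
    proof (rule linear_unit_bound)
      show "linear (\<lambda>h. r (path m1 A s (pr z h) t))"
        using path_has_derivative[OF assms(1) A(1-5), of z] by (rule has_derivative_linear)
      fix h :: 'e assume "norm h \<le> 1"
      hence "norm (pr z h) \<le> R + 1" using norm_pr[of z h] A by linarith
      thus "norm (r (path m1 A s (pr z h) t)) \<le> M" by (intro order_trans[OF norm_r M(2)]) (use A in auto)
    qed
  qed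
qed

text \<open>The mean value inequality on a ball. Multiplying the Lipschitz constants of single steps
  would not do: their product depends on the partition.\<close>

lemma path_lipschitz:
  fixes m m1 :: "real \<Rightarrow> real \<Rightarrow> 'e \<Rightarrow> 'e"
  assumes "lift T m m1" "no_blowup T m1"
  obtains M where "0 \<le> M" "\<And>A s t (z :: 'e) z'. finite A \<Longrightarrow> A \<subseteq> {0..T} \<Longrightarrow> s \<in> A \<Longrightarrow> t \<in> A \<Longrightarrow> s \<le> t \<Longrightarrow>
      norm z \<le> R \<Longrightarrow> norm z' \<le> R \<Longrightarrow> norm (path m A s z t - path m A s z' t) \<le> M * norm (z - z')"
proof -
  obtain M where M: "0 \<le> M" "\<And>A s t (z :: 'e) h. finite A \<Longrightarrow> A \<subseteq> {0..T} \<Longrightarrow> s \<in> A \<Longrightarrow> t \<in> A \<Longrightarrow> s \<le> t \<Longrightarrow>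
      norm z \<le> R \<Longrightarrow> norm (r (path m1 A s (pr z h) t)) \<le> M * norm h"
    by (rule path_tangent_bound[OF assms, of R]) (erule that)
  show thesis
  proof (rule that[OF M(1)])
    fix A s t and z z' :: 'e
    assume A: "finite A" "A \<subseteq> {0..T}" "s \<in> A" "t \<in> A" "s \<le> t" and z: "norm z \<le> R" "norm z' \<le> R"
    show "norm (path m A s z t - path m A s z' t) \<le> M * norm (z - z')"
    proof (rule differentiable_bound[where S = "cball 0 R"])
      fix x :: 'e assume x: "x \<in> cball 0 R"
      show "((\<lambda>z. path m A s z t) has_derivative (\<lambda>h. r (path m1 A s (pr x h) t))) (at x within cball 0 R)"
        using path_has_derivative[OF assms(1) A] by (rule has_derivative_at_withinI)
      show "onorm (\<lambda>h. r (path m1 A s (pr x h) t)) \<le> M"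
        by (rule onorm_bound[OF M(1) M(2)[OF A]]) (use x in simp)
    qed (use z in auto)
  qed
qed

text \<open>A derivative is linear, so the lifted step commutes with scaling of the tangent
  component, while the base component runs along a chain of \<open>m\<close> and is bounded by
  assumption.\<close>

lemma no_blowup_lift:
  assumes "0 < \<alpha>" "1 < p" "lift T m m1" "no_blowup T m" "local_almost_flow T \<alpha> p m1"
  shows "no_blowup T m1"
proof (rule no_blowup_homogeneous[where l = l and r = r and sc = "\<lambda>c z. pr (l z) (c *\<^sub>R r z)", OF assms(1,2,5)])
  show "m1 s t (pr (l z) (c *\<^sub>R r z)) = pr (l (m1 s t z)) (c *\<^sub>R r (m1 s t z))"
    if "s \<in> {0..T}" "t \<in> {0..T}" for c s t z
  proof (rule lr_eqI)
    note d = liftD[OF assms(3) that]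
    have "linear (\<lambda>v. r (m1 s t (pr (l z) v)))" using d(2) by (rule has_derivative_linear)
    from linear_scale[OF this, of c "r z"]
    show "r (m1 s t (pr (l z) (c *\<^sub>R r z))) = r (pr (l (m1 s t z)) (c *\<^sub>R r (m1 s t z)))" by simp
  qed (simp add: liftD[OF assms(3) that])
  show "norm (pr (l z) (c *\<^sub>R r z)) \<le> norm (l z) + c * norm (r z)" if "0 < c" for c z
    using norm_pr[of "l z" "c *\<^sub>R r z"] that by simp
  show "\<exists>R'. \<forall>A y s v. finite A \<longrightarrow> A \<subseteq> {0..T} \<longrightarrow> chain m1 A y \<longrightarrow> s \<in> A \<longrightarrow>
      norm (y s) \<le> R \<longrightarrow> v \<in> A \<longrightarrow> s \<le> v \<longrightarrow> norm (l (y v)) \<le> R'" for R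
  proof -
    obtain R' where R': "0 \<le> R'" "\<And>A y s v. finite A \<Longrightarrow> A \<subseteq> {0..T} \<Longrightarrow> chain m A y \<Longrightarrow> s \<in> A \<Longrightarrow>
      norm (y s) \<le> R \<Longrightarrow> v \<in> A \<Longrightarrow> s \<le> v \<Longrightarrow> norm (y v) \<le> R'"
      by (rule no_blowupD[OF assms(4), of R]) (erule that)
    show ?thesis
    proof (intro exI allI impI)
      fix A y s v
      assume A: "finite A" "A \<subseteq> {0..T}" "chain m1 A y" "s \<in> A" "norm (y s) \<le> R" "v \<in> A" "s \<le> v"
      have "chain m A (\<lambda>v. l (y v))" unfolding chain_def
      proof (intro allI impI)
        fix a b assume ab: "consec A a b"
        hence "a \<in> {0..T}" "b \<in> {0..T}" using A by (auto simp: consec_def)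
        thus "l (y b) = m a b (l (y a))" using A(3) ab liftD(1)[OF assms(3)] by (simp add: chain_def)
      qed
      thus "norm (l (y v)) \<le> R'" using R'(2)[of A "\<lambda>v. l (y v)" s v] A norm_l[of "y s"] by auto
    qed
  qed
qed (auto simp: norm_r norm_lr r_linear)

end

section \<open>Comparison of paths along partitions\<close>

text \<open>Errors proportional to the length of a step sum to a multiple of \<open>t - s\<close>.
  Errors \<open>c0\<close> per step are counted by \<open>card A\<close>, which is harmless when the
  partition is fixed and \<open>c0\<close> is made small afterwards, as in
  \<open>grid_Cauchy_Suc\<close>.\<close>

lemma telescope:
  fixes \<Phi> :: "real \<Rightarrow> 'b::real_normed_vector" and s t c c0 :: real
  assumes A: "finite A" "s \<in> A" "t \<in> A" "s \<le> t" and c0: "0 \<le> c0"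
    and step: "\<And>a b. consec A a b \<Longrightarrow> s \<le> a \<Longrightarrow> b \<le> t \<Longrightarrow> norm (\<Phi> b - \<Phi> a) \<le> c * (b - a) + c0"
  shows "norm (\<Phi> t - \<Phi> s) \<le> c * (t - s) + card A * c0"
proof -
  have "t \<le> t \<longrightarrow> norm (\<Phi> t - \<Phi> s) \<le> c * (t - s) + card (A \<inter> {s<..t}) * c0"
    using A
  proof (induction t rule: consec_induct[where P = "\<lambda>w. w \<le> t \<longrightarrow> norm (\<Phi> w - \<Phi> s) \<le> c * (w - s) + card (A \<inter> {s<..w}) * c0"])
    case (step a b)
    show ?case
    proof
      assume "b \<le> t"
      have "a < b" "b \<in> A" using step(1) by (auto simp: consec_def)
      have "A \<inter> {s<..b} = insert b (A \<inter> {s<..a})"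
        using step(1,2) by (auto simp: consec_def)
      hence "card (A \<inter> {s<..b}) = Suc (card (A \<inter> {s<..a}))"
        using A \<open>a < b\<close> by (simp add: card_insert_if)
      moreover have "norm (\<Phi> a - \<Phi> s) \<le> c * (a - s) + card (A \<inter> {s<..a}) * c0"
        using step \<open>a < b\<close> \<open>b \<le> t\<close> by auto
      moreover have "norm (\<Phi> b - \<Phi> a) \<le> c * (b - a) + c0" using step(1,2) \<open>b \<le> t\<close> assms(6) by blast
      ultimately show "norm (\<Phi> b - \<Phi> s) \<le> c * (b - s) + card (A \<inter> {s<..b}) * c0"
        using norm_triangle_ineq[of "\<Phi> b - \<Phi> a" "\<Phi> a - \<Phi> s"] by (simp add: algebra_simps)
    qed
  qed auto
  moreover have "card (A \<inter> {s<..t}) * c0 \<le> card A * c0"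
    using A c0 by (intro mult_right_mono) (auto intro: card_mono)
  ultimately show ?thesis by simp
qed

definition mesh :: "real set \<Rightarrow> real \<Rightarrow> bool" where
  "mesh A h \<longleftrightarrow> 0 \<le> h \<and> (\<forall>a b. consec A a b \<longrightarrow> b - a \<le> h)"

text \<open>The excess of the exponent over 1 becomes the factor that vanishes with the
  mesh.\<close>

lemma powr_mesh:
  assumes "mesh A h" "consec A a b" "1 < p"
  shows "(b - a) powr p \<le> h powr (p - 1) * (b - a)"
proof -
  have "0 < b - a" using assms(2) by (simp add: consec_def)
  hence "(b - a) powr p = (b - a) powr (p - 1) * (b - a)" by (simp add: powr_mult_base' powr_diff)
  also have "\<dots> \<le> h powr (p - 1) * (b - a)"
    using assms \<open>0 < b - a\<close> by (intro mult_right_mono powr_mono2) (auto simp: mesh_def)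
  finally show ?thesis .
qed

text \<open>Telescopes \<open>path m A w (Y w) t\<close> in \<open>w\<close>, which is
  \<open>Y t\<close> at \<open>w = t\<close> and the path from \<open>Y s\<close> at
  \<open>w = s\<close>. Each increment is a local error of \<open>Y\<close> transported to time
  \<open>t\<close> by a chain with Lipschitz constant \<open>M\<close>.\<close>

lemma path_compare:
  fixes m :: "real \<Rightarrow> real \<Rightarrow> 'e::real_normed_vector \<Rightarrow> 'e"
  assumes A: "finite A" "s \<in> A" "t \<in> A" "s \<le> t" "mesh A h" and p: "1 < p" and M: "0 \<le> M" "0 \<le> L"
    and lip: "\<And>u z z'. u \<in> A \<Longrightarrow> u \<le> t \<Longrightarrow> norm z \<le> R \<Longrightarrow> norm z' \<le> R \<Longrightarrow>
         norm (path m A u z t - path m A u z' t) \<le> M * norm (z - z')"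
    and Dv: "\<And>a b. consec A a b \<Longrightarrow> s \<le> a \<Longrightarrow> b \<le> t \<Longrightarrow> norm (Y b - m a b (Y a)) \<le> L * (b - a) powr p"
    and bd: "\<And>a b. consec A a b \<Longrightarrow> s \<le> a \<Longrightarrow> b \<le> t \<Longrightarrow> norm (Y b) \<le> R \<and> norm (m a b (Y a)) \<le> R"
  shows "norm (Y t - path m A s (Y s) t) \<le> M * L * h powr (p - 1) * (t - s)"
proof -
  have "norm (path m A t (Y t) t - path m A s (Y s) t) \<le> (M * L * h powr (p - 1)) * (t - s) + real (card A) * 0"
  proof (rule telescope[OF A(1-4), of 0 "\<lambda>w. path m A w (Y w) t"])
    fix a b assume ab: "consec A a b" "s \<le> a" "b \<le> t"
    have in_A: "a \<in> A" "b \<in> A" "a \<le> b" using ab by (auto simp: consec_def)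
    have "path m A a (Y a) t = path m A b (path m A a (Y a) b) t"
      using A in_A ab by (subst path_cocycle) auto
    hence "norm (path m A b (Y b) t - path m A a (Y a) t) = norm (path m A b (Y b) t - path m A b (m a b (Y a)) t)"
      using path_consec[OF A(1) ab(1), of m "Y a"] by simp
    also have "\<dots> \<le> M * norm (Y b - m a b (Y a))" using lip in_A bd[OF ab] ab by auto
    also have "\<dots> \<le> M * (L * (h powr (p - 1) * (b - a)))"
    proof -
      have "L * (b - a) powr p \<le> L * (h powr (p - 1) * (b - a))"
        using powr_mesh[OF A(5) ab(1) p] M by (intro mult_left_mono)
      thus ?thesis using Dv[OF ab] M by (intro mult_left_mono) auto
    qed
    finally show "norm (path m A b (Y b) t - path m A a (Y a) t) \<le> M * L * h powr (p - 1) * (b - a) + 0"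
      by (simp add: mult.assoc)
  qed simp
  thus ?thesis using A by (simp add: path_start)
qed

section \<open>Dyadic grids\<close>

definition grid :: "real \<Rightarrow> nat \<Rightarrow> real set" where
  "grid T n = (\<lambda>i. T * real i / 2 ^ n) ` {..2 ^ n :: nat}"

lemma finite_grid [simp]: "finite (grid T n)"
  by (simp add: grid_def)

lemma grid_subset:
  assumes "0 \<le> T"
  shows "grid T n \<subseteq> {0..T}"
proof
  fix x assume "x \<in> grid T n"
  then obtain i :: nat where i: "i \<le> 2 ^ n" "x = T * i / 2 ^ n" by (auto simp: grid_def)
  have "real i \<le> 2 ^ n" using i(1) by (metis of_nat_le_iff of_nat_numeral of_nat_power)
  hence "T * i \<le> T * 2 ^ n" using assms by (intro mult_left_mono) auto
  thus "x \<in> {0..T}" using i(2) assms by (auto simp: pos_divide_le_eq)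
qed

lemma grid_mono:
  assumes "n \<le> n'"
  shows "grid T n \<subseteq> grid T n'"
proof
  fix x assume "x \<in> grid T n"
  then obtain i :: nat where i: "i \<le> 2 ^ n" "x = T * i / 2 ^ n" by (auto simp: grid_def)
  have e: "(2::nat) ^ n' = 2 ^ n * 2 ^ (n' - n)" "(2::real) ^ n' = 2 ^ n * 2 ^ (n' - n)"
    using assms by (simp_all flip: power_add)
  have "i * 2 ^ (n' - n) \<in> {..2 ^ n'}" using i e by simp
  moreover have "x = T * real (i * 2 ^ (n' - n)) / 2 ^ n'" using i(2) e by simp
  ultimately show "x \<in> grid T n'" unfolding grid_def by blast
qed

lemma mesh_grid:
  assumes "0 < T" "grid T n \<subseteq> A" "A \<subseteq> {0..T}"
  shows "mesh A (T / 2 ^ n)"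
  unfolding mesh_def
proof (intro conjI allI impI)
  fix a b assume ab: "consec A a b"
  show "b - a \<le> T / 2 ^ n"
  proof (rule ccontr)
    assume n: "\<not> b - a \<le> T / 2 ^ n"
    have I: "0 \<le> a" "b \<le> T" using ab assms by (auto simp: consec_def)
    \<comment> \<open>The index of the first grid point strictly to the right of \<open>a\<close>;
      in a gap longer than the grid spacing this point would lie inside the gap.\<close>
    define i where "i = nat \<lfloor>a * 2 ^ n / T\<rfloor> + 1"
    have "0 \<le> a * 2 ^ n / T" using I assms by simp
    hence "a * 2 ^ n / T < real i" "real i \<le> a * 2 ^ n / T + 1" unfolding i_def by linarith+
    hence "a < T * i / 2 ^ n" "T * i / 2 ^ n \<le> a + T / 2 ^ n" using assms(1) by (simp_all add: field_simps)
    moreover have "T * i / 2 ^ n \<in> A"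
    proof -
      have "T * i / 2 ^ n < T" using calculation n I by linarith
      hence "real i < 2 ^ n" using assms(1) by (simp add: field_simps)
      hence "i \<le> 2 ^ n" by (metis less_imp_le_nat of_nat_less_iff of_nat_numeral of_nat_power)
      thus ?thesis using assms(2) unfolding grid_def by blast
    qed
    ultimately show False using ab n by (force simp: consec_def)
  qed
qed (use assms in simp)

lemma mesh_grid_tendsto:
  assumes "1 < (p::real)" "0 < T"
  shows "(\<lambda>n. C * (T / 2 ^ n) powr (p - 1)) \<longlonglongrightarrow> 0"
proof -
  have "(\<lambda>n. T / 2 ^ n) \<longlonglongrightarrow> 0" by (rule LIMSEQ_divide_realpow_zero) simp
  hence "(\<lambda>n. (T / 2 ^ n) powr (p - 1)) \<longlonglongrightarrow> 0 powr (p - 1)"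
    by (rule tendsto_powr'[OF _ tendsto_const]) (use assms in auto)
  hence "(\<lambda>n. C * (T / 2 ^ n) powr (p - 1)) \<longlonglongrightarrow> C * 0 powr (p - 1)"
    by (rule tendsto_mult_left)
  thus ?thesis by simp
qed

section \<open>Limits along dyadic grids\<close>

definition davie :: "real \<Rightarrow> (real \<Rightarrow> real \<Rightarrow> 'e::real_normed_vector \<Rightarrow> 'e) \<Rightarrow> real \<Rightarrow> real \<Rightarrow> (real \<Rightarrow> 'e) \<Rightarrow> bool" where
  "davie p m a b Y \<longleftrightarrow> (\<exists>L. \<forall>u v. a \<le> u \<longrightarrow> u \<le> v \<longrightarrow> v \<le> b \<longrightarrow> norm (Y v - m u v (Y u)) \<le> L * (v - u) powr p)"

lemma davieD:
  assumes "davie p m a b Y"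
  obtains L where "0 \<le> L" "\<And>u v. a \<le> u \<Longrightarrow> u \<le> v \<Longrightarrow> v \<le> b \<Longrightarrow> norm (Y v - m u v (Y u)) \<le> L * (v - u) powr p"
proof -
  obtain L where L: "\<forall>u v. a \<le> u \<longrightarrow> u \<le> v \<longrightarrow> v \<le> b \<longrightarrow> norm (Y v - m u v (Y u)) \<le> L * (v - u) powr p"
    using assms unfolding davie_def by blast
  show thesis
  proof (rule that[of "max 0 L"])
    fix u v assume "a \<le> u" "u \<le> v" "v \<le> b"
    hence "norm (Y v - m u v (Y u)) \<le> L * (v - u) powr p" using L by blast
    also have "\<dots> \<le> max 0 L * (v - u) powr p" by (intro mult_right_mono) auto
    finally show "norm (Y v - m u v (Y u)) \<le> max 0 L * (v - u) powr p" .
  qed simp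
qed

lemma local_almost_flow_step_bound:
  assumes "local_almost_flow T \<alpha> p (m :: real \<Rightarrow> real \<Rightarrow> 'e::real_normed_vector \<Rightarrow> 'e)" "0 < \<alpha>"
  obtains R' where "0 \<le> R'" "\<And>s t z. s \<in> {0..T} \<Longrightarrow> t \<in> {0..T} \<Longrightarrow> norm z \<le> R \<Longrightarrow> norm (m s t z) \<le> R'"
proof -
  obtain K where E: "almost_flow T \<alpha> p m (cball 0 R) K" using assms(1) unfolding local_almost_flow_def by blast
  note K = almost_flowD(1)[OF E]
  show thesis
  proof (rule that[of "\<bar>R\<bar> + K * T powr \<alpha>"])
    fix s t and z :: 'e assume I: "s \<in> {0..T}" "t \<in> {0..T}" and z: "norm z \<le> R"
    have "norm (m s t z - z) \<le> K * \<bar>t - s\<bar> powr \<alpha>" using almost_flowD(2)[OF E I] z by simp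
    also have "\<dots> \<le> K * T powr \<alpha>" using K assms(2) I by (intro mult_left_mono abs_powr_le) auto
    finally show "norm (m s t z) \<le> \<bar>R\<bar> + K * T powr \<alpha>" using norm_triangle_sub[of "m s t z" z] z by linarith
  qed (use K in simp)
qed

lemma local_almost_flow_lipschitz:
  assumes "local_almost_flow T \<alpha> p (m :: real \<Rightarrow> real \<Rightarrow> 'e::real_normed_vector \<Rightarrow> 'e)" "0 < \<alpha>"
  obtains K where "0 \<le> K" "\<And>s t z z'. s \<in> {0..T} \<Longrightarrow> t \<in> {0..T} \<Longrightarrow> norm z \<le> R \<Longrightarrow> norm z' \<le> R \<Longrightarrow>
     norm (m s t z - m s t z') \<le> K * norm (z - z')"
proof -
  obtain K where E: "almost_flow T \<alpha> p m (cball 0 R) K" using assms(1) unfolding local_almost_flow_def by blast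
  note K = almost_flowD(1)[OF E]
  show thesis
  proof (rule that[of "1 + K * T powr \<alpha>"])
    fix s t and z z' :: 'e assume I: "s \<in> {0..T}" "t \<in> {0..T}" and z: "norm z \<le> R" "norm z' \<le> R"
    show "norm (m s t z - m s t z') \<le> (1 + K * T powr \<alpha>) * norm (z - z')"
      using K assms(2) I z by (intro almost_flow_lip[OF E] mult_left_mono abs_powr_le) auto
  qed (use K in simp)
qed

lemma local_almost_flow_continuous:
  assumes "local_almost_flow T \<alpha> p (m :: real \<Rightarrow> real \<Rightarrow> 'e::real_normed_vector \<Rightarrow> 'e)" "0 < \<alpha>"
    and "s \<in> {0..T}" "t \<in> {0..T}"
  shows "isCont (m s t) z"
proof -
  obtain K where K: "0 \<le> K" "\<And>s t z' z''. s \<in> {0..T} \<Longrightarrow> t \<in> {0..T} \<Longrightarrow> norm z' \<le> norm z + 1 \<Longrightarrow> norm z'' \<le> norm z + 1 \<Longrightarrow>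
     norm (m s t z' - m s t z'') \<le> K * norm (z' - z'')"
    by (rule local_almost_flow_lipschitz[OF assms(1,2), of "norm z + 1"]) (erule that)
  have "K-lipschitz_on (ball z 1) (m s t)"
  proof (rule lipschitz_onI)
    fix x y assume "x \<in> ball z 1" "y \<in> ball z 1"
    hence "norm (x - z) < 1" "norm (y - z) < 1" by (auto simp: dist_norm norm_minus_commute)
    hence "norm x \<le> norm z + 1" "norm y \<le> norm z + 1"
      using norm_triangle_sub[of x z] norm_triangle_sub[of y z] by linarith+
    thus "dist (m s t x) (m s t y) \<le> K * dist x y" using K(2) assms(3,4) by (simp add: dist_norm)
  qed (rule K(1))
  hence "continuous_on (ball z 1) (m s t)" by (rule lipschitz_on_continuous_on)
  thus ?thesis by (simp add: continuous_on_eq_continuous_at)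
qed

lemma path_continuous:
  assumes "local_almost_flow T \<alpha> p m" "0 < \<alpha>" "finite A" "A \<subseteq> {0..T}" "s \<in> A" "t \<in> A" "s \<le> t"
  shows "isCont (\<lambda>z. path m A s z t) z"
  using assms(3,5-7)
proof (induction t rule: consec_induct)
  case start
  show ?case by (simp add: path_start[OF assms(3,5)])
next
  case (step a b)
  have "a \<in> {0..T}" "b \<in> {0..T}" using step(1) assms(4) by (auto simp: consec_def)
  hence "isCont (m a b) (path m A s z a)" by (rule local_almost_flow_continuous[OF assms(1,2)])
  with step(3) have "isCont (\<lambda>z. m a b (path m A s z a)) z" by (rule isCont_o2)
  thus ?case by (simp only: path_step[OF assms(3,5) step(1,2)])
qed

text \<open>Boundedness of chains is assumed for the bottom step only; it climbs the tower by
  \<open>no_blowup_lift\<close>.\<close>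

locale step_tower = doubling l r pr for l r :: "'e::banach \<Rightarrow> 'e" and pr +
  fixes T \<alpha> p :: real and k :: nat and m :: "nat \<Rightarrow> real \<Rightarrow> real \<Rightarrow> 'e \<Rightarrow> 'e"
  assumes T: "0 < T" and \<alpha>: "0 < \<alpha>" and p: "1 < p" and k: "1 \<le> k"
    and local_almost_flow: "j \<le> k \<Longrightarrow> local_almost_flow T \<alpha> p (m j)"
    and lift: "j < k \<Longrightarrow> lift T (m j) (m (Suc j))"
    and no_blowup_0: "no_blowup T (m 0)"
begin

lemma no_blowup: "j \<le> k \<Longrightarrow> no_blowup T (m j)"
  by (induction j) (use no_blowup_0 no_blowup_lift[OF \<alpha> p lift _ local_almost_flow] in auto)

lemma lift0: "lift T (m 0) (m (Suc 0))" and nb1: "no_blowup T (m (Suc 0))" and local_almost_flow0: "local_almost_flow T \<alpha> p (m 0)"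
  using lift no_blowup local_almost_flow k by auto

lemma davie_bounds:
  assumes "davie p (m 0) s t Y" "0 \<le> s" "t \<le> T"
  obtains R where "\<And>u. s \<le> u \<Longrightarrow> u \<le> t \<Longrightarrow> norm (Y u) \<le> R"
    "\<And>u v. s \<le> u \<Longrightarrow> u \<le> t \<Longrightarrow> v \<in> {0..T} \<Longrightarrow> norm (m 0 u v (Y u)) \<le> R"
proof -
  obtain L where L: "0 \<le> L" "\<And>u v. s \<le> u \<Longrightarrow> u \<le> v \<Longrightarrow> v \<le> t \<Longrightarrow> norm (Y v - m 0 u v (Y u)) \<le> L * (v - u) powr p"
    by (rule davieD[OF assms(1)]) (erule that)
  obtain R1 where R1: "0 \<le> R1" "\<And>a b z. a \<in> {0..T} \<Longrightarrow> b \<in> {0..T} \<Longrightarrow> norm z \<le> norm (Y s) \<Longrightarrow> norm (m 0 a b z) \<le> R1"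
    by (rule local_almost_flow_step_bound[OF local_almost_flow0 \<alpha>, of "norm (Y s)"]) (erule that)
  define R2 where "R2 = R1 + L * T powr p"
  obtain R3 where R3: "0 \<le> R3" "\<And>a b z. a \<in> {0..T} \<Longrightarrow> b \<in> {0..T} \<Longrightarrow> norm z \<le> R2 \<Longrightarrow> norm (m 0 a b z) \<le> R3"
    by (rule local_almost_flow_step_bound[OF local_almost_flow0 \<alpha>, of R2]) (erule that)
  have Y: "norm (Y u) \<le> R2" if "s \<le> u" "u \<le> t" for u
  proof -
    have "norm (Y u - m 0 s u (Y s)) \<le> L * (u - s) powr p" using L(2)[of s u] that by simp
    also have "\<dots> \<le> L * T powr p" using L(1) that assms p by (intro mult_left_mono powr_mono2) auto
    finally show ?thesis using R1(2)[of s u "Y s"] that assms norm_triangle_sub[of "Y u" "m 0 s u (Y s)"]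
      by (simp add: R2_def)
  qed
  show thesis
  proof (rule that[of "max R2 R3"])
    show "norm (Y u) \<le> max R2 R3" if "s \<le> u" "u \<le> t" for u using Y[OF that] by simp
    show "norm (m 0 u v (Y u)) \<le> max R2 R3" if "s \<le> u" "u \<le> t" "v \<in> {0..T}" for u v
      using R3(2)[of u v "Y u"] Y[OF that(1,2)] that assms by simp
  qed
qed

text \<open>The source of uniqueness: the local errors are of order \<open>p > 1\<close> and are
  transported by chains whose Lipschitz constant does not depend on the partition, so a Davie path
  is the limit of the chains that start at its initial value.\<close>

lemma davie_path_distance:
  assumes "davie p (m 0) s t Y" "0 \<le> s" "s \<le> t" "t \<le> T"
  obtains C where "\<And>A h. finite A \<Longrightarrow> A \<subseteq> {0..T} \<Longrightarrow> s \<in> A \<Longrightarrow> t \<in> A \<Longrightarrow> mesh A h \<Longrightarrow>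
    norm (Y t - path (m 0) A s (Y s) t) \<le> C * h powr (p - 1)"
proof -
  obtain L where L: "0 \<le> L" "\<And>u v. s \<le> u \<Longrightarrow> u \<le> v \<Longrightarrow> v \<le> t \<Longrightarrow> norm (Y v - m 0 u v (Y u)) \<le> L * (v - u) powr p"
    by (rule davieD[OF assms(1)]) (erule that)
  obtain R where R: "\<And>u. s \<le> u \<Longrightarrow> u \<le> t \<Longrightarrow> norm (Y u) \<le> R"
    "\<And>u v. s \<le> u \<Longrightarrow> u \<le> t \<Longrightarrow> v \<in> {0..T} \<Longrightarrow> norm (m 0 u v (Y u)) \<le> R"
    by (rule davie_bounds[OF assms(1,2,4)]) (erule that)
  obtain M where M: "0 \<le> M" "\<And>A s t (z :: 'e) z'. finite A \<Longrightarrow> A \<subseteq> {0..T} \<Longrightarrow> s \<in> A \<Longrightarrow> t \<in> A \<Longrightarrow> s \<le> t \<Longrightarrow>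
      norm z \<le> R \<Longrightarrow> norm z' \<le> R \<Longrightarrow> norm (path (m 0) A s z t - path (m 0) A s z' t) \<le> M * norm (z - z')"
    by (rule path_lipschitz[OF lift0 nb1, of R]) (erule that)
  show thesis
  proof (rule that[of "M * L * (t - s)"])
    fix A h assume A: "finite A" "A \<subseteq> {0..T}" "s \<in> A" "t \<in> A" "mesh A h"
    have "norm (Y t - path (m 0) A s (Y s) t) \<le> M * L * h powr (p - 1) * (t - s)"
    proof (rule path_compare[OF A(1,3,4) assms(3) A(5) p M(1) L(1)])
      fix a b assume "consec A a b" "s \<le> a" "b \<le> t"
      hence ab: "s \<le> a" "a \<le> t" "a \<le> b" "s \<le> b" "b \<le> t" "b \<in> {0..T}" using A by (auto simp: consec_def)
      show "norm (Y b - m 0 a b (Y a)) \<le> L * (b - a) powr p" using L(2) ab by blast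
      show "norm (Y b) \<le> R \<and> norm (m 0 a b (Y a)) \<le> R" using R(1)[of b] R(2)[of a b] ab by blast
    qed (use M(2)[OF A(1,2)] A in auto)
    thus "norm (Y t - path (m 0) A s (Y s) t) \<le> M * L * (t - s) * h powr (p - 1)" by (simp add: mult_ac)
  qed
qed

text \<open>Adjoining \<open>s\<close> and \<open>t\<close> to the grid lets chains start and end at
  arbitrary times, while the sets remain nested in \<open>n\<close>.\<close>

definition pts :: "real \<Rightarrow> real \<Rightarrow> nat \<Rightarrow> real set" where
  "pts s t n = insert s (insert t (grid T n))"

lemma pts:
  assumes "s \<in> {0..T}" "t \<in> {0..T}"
  shows "finite (pts s t n)" "pts s t n \<subseteq> {0..T}" "s \<in> pts s t n" "t \<in> pts s t n" "mesh (pts s t n) (T / 2 ^ n)"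
  using assms grid_subset[of T n] T
  by (auto simp: pts_def intro!: mesh_grid)

lemma pts_mono: "n \<le> n' \<Longrightarrow> pts s t n \<subseteq> pts s t n'"
  using grid_mono[of n n' T] by (auto simp: pts_def)

lemma davie_limit:
  assumes "davie p (m 0) s t Y" "0 \<le> s" "s \<le> t" "t \<le> T"
  shows "(\<lambda>n. path (m 0) (pts s t n) s (Y s) t) \<longlonglongrightarrow> Y t"
proof -
  obtain C where C: "\<And>A h. finite A \<Longrightarrow> A \<subseteq> {0..T} \<Longrightarrow> s \<in> A \<Longrightarrow> t \<in> A \<Longrightarrow> mesh A h \<Longrightarrow>
    norm (Y t - path (m 0) A s (Y s) t) \<le> C * h powr (p - 1)"
    by (rule davie_path_distance[OF assms]) (erule that)
  have I: "s \<in> {0..T}" "t \<in> {0..T}" using assms by auto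
  have "(\<lambda>n. path (m 0) (pts s t n) s (Y s) t - Y t) \<longlonglongrightarrow> 0"
  proof (rule Lim_null_comparison[OF _ mesh_grid_tendsto[OF p T, of C]])
    show "\<forall>\<^sub>F n in sequentially. norm (path (m 0) (pts s t n) s (Y s) t - Y t) \<le> C * (T / 2 ^ n) powr (p - 1)"
      using C[OF pts[OF I]] by (simp add: norm_minus_commute)
  qed
  thus ?thesis by (rule LIM_zero_cancel)
qed

text \<open>Davie's bound for the path along \<open>B\<close> holds between any two points of
  \<open>B\<close>, with a constant that does not depend on \<open>B\<close>. In particular it holds
  between consecutive points of \<open>A\<close>, so \<open>path_compare\<close> applies along
  \<open>A\<close>.\<close>

lemma path_refine:
  obtains C where "0 \<le> C" "\<And>A B s t z h. finite A \<Longrightarrow> finite B \<Longrightarrow> A \<subseteq> B \<Longrightarrow> B \<subseteq> {0..T} \<Longrightarrow> s \<in> A \<Longrightarrow> t \<in> A \<Longrightarrow> s \<le> t \<Longrightarrow>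
    mesh A h \<Longrightarrow> norm z \<le> R \<Longrightarrow> norm (path (m 0) B s z t - path (m 0) A s z t) \<le> C * h powr (p - 1)"
proof -
  obtain L where L: "0 \<le> L" "\<And>A s (z :: 'e) u v. finite A \<Longrightarrow> A \<subseteq> {0..T} \<Longrightarrow> s \<in> A \<Longrightarrow> norm z \<le> R \<Longrightarrow>
      u \<in> A \<Longrightarrow> v \<in> A \<Longrightarrow> s \<le> u \<Longrightarrow> u \<le> v \<Longrightarrow>
      norm (path (m 0) A s z v - m 0 u v (path (m 0) A s z u)) \<le> L * (v - u) powr p"
    by (rule davie_path_bound[OF \<alpha> p local_almost_flow0 no_blowup_0, of R]) (erule that)
  obtain R1 where R1: "0 \<le> R1" "\<And>A (z :: 'e) s v. finite A \<Longrightarrow> A \<subseteq> {0..T} \<Longrightarrow> s \<in> A \<Longrightarrow> norm z \<le> R \<Longrightarrow> v \<in> A \<Longrightarrow> s \<le> v \<Longrightarrow>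
      norm (path (m 0) A s z v) \<le> R1"
    by (rule no_blowup_path[OF no_blowup_0, of R]) (erule that)
  obtain R2 where R2: "0 \<le> R2" "\<And>a b z. a \<in> {0..T} \<Longrightarrow> b \<in> {0..T} \<Longrightarrow> norm z \<le> R1 \<Longrightarrow> norm (m 0 a b z) \<le> R2"
    by (rule local_almost_flow_step_bound[OF local_almost_flow0 \<alpha>, of R1]) (erule that)
  define R3 where "R3 = max R1 R2"
  obtain M where M: "0 \<le> M" "\<And>A s t (z :: 'e) z'. finite A \<Longrightarrow> A \<subseteq> {0..T} \<Longrightarrow> s \<in> A \<Longrightarrow> t \<in> A \<Longrightarrow> s \<le> t \<Longrightarrow>
      norm z \<le> R3 \<Longrightarrow> norm z' \<le> R3 \<Longrightarrow> norm (path (m 0) A s z t - path (m 0) A s z' t) \<le> M * norm (z - z')"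
    by (rule path_lipschitz[OF lift0 nb1, of R3]) (erule that)
  show thesis
  proof (rule that[of "M * L * T"])
    fix A B s t h and z :: 'e
    assume A: "finite A" "finite B" "A \<subseteq> B" "B \<subseteq> {0..T}" "s \<in> A" "t \<in> A" "s \<le> t" "mesh A h" "norm z \<le> R"
    hence AB: "A \<subseteq> {0..T}" "s \<in> B" "0 \<le> s" "t \<le> T" by auto
    have "norm (path (m 0) B s z t - path (m 0) A s (path (m 0) B s z s) t) \<le> M * L * h powr (p - 1) * (t - s)"
    proof (rule path_compare[OF A(1,5,6,7,8) p M(1) L(1)])
      fix a b assume "consec A a b" "s \<le> a" "b \<le> t"
      hence ab: "s \<le> a" "a \<le> b" "s \<le> b" "a \<in> B" "b \<in> B" "a \<in> {0..T}" "b \<in> {0..T}" using A by (auto simp: consec_def)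
      show "norm (path (m 0) B s z b - m 0 a b (path (m 0) B s z a)) \<le> L * (b - a) powr p"
        using L(2)[OF A(2,4) AB(2) A(9) ab(4,5,1,2)] .
      show "norm (path (m 0) B s z b) \<le> R3 \<and> norm (m 0 a b (path (m 0) B s z a)) \<le> R3"
        using R1(2)[OF A(2,4) AB(2) A(9) ab(5,3)] R2(2)[OF ab(6,7) R1(2)[OF A(2,4) AB(2) A(9) ab(4,1)]]
        by (simp add: R3_def le_max_iff_disj)
    qed (use M(2)[OF A(1) AB(1)] A in auto)
    also have "\<dots> \<le> M * L * h powr (p - 1) * T" using M L AB by (intro mult_left_mono) auto
    finally show "norm (path (m 0) B s z t - path (m 0) A s z t) \<le> M * L * T * h powr (p - 1)"
      using path_start[OF A(2) AB(2), of "m 0" z] by (simp add: mult_ac)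
  qed (use M L T in auto)
qed

end

context step_tower
begin

lemma mesh_small:
  assumes "0 < e"
  obtains N where "\<And>n. N \<le> n \<Longrightarrow> C * (T / 2 ^ n) powr (p - 1) < e"
proof -
  have "\<forall>\<^sub>F n in sequentially. C * (T / 2 ^ n) powr (p - 1) < e"
    using mesh_grid_tendsto[OF p T, of C] assms by (rule order_tendstoD(2))
  thus thesis using that by (auto simp: eventually_sequentially)
qed

text \<open>Uniformity over balls of initial values is what continuity and differentiation of the
  limit rest on. The time \<open>u\<close> may precede \<open>t\<close> because the step to the next
  lift uses base paths at all points of a coarse partition.\<close>

definition grid_Cauchy :: "(real \<Rightarrow> real \<Rightarrow> 'e \<Rightarrow> 'e) \<Rightarrow> real \<Rightarrow> real \<Rightarrow> real \<Rightarrow> bool" where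
  "grid_Cauchy f s t u \<longleftrightarrow> (\<forall>R. \<forall>e>0. \<exists>N. \<forall>n\<ge>N. \<forall>n'\<ge>N. \<forall>z. norm z \<le> R \<longrightarrow>
     norm (path f (pts s t n) s z u - path f (pts s t n') s z u) < e)"

lemma grid_Cauchy_0:
  assumes I: "s \<in> {0..T}" "t \<in> {0..T}" and u: "u \<in> pts s t c" "s \<le> u"
  shows "grid_Cauchy (m 0) s t u"
  unfolding grid_Cauchy_def
proof (intro allI impI)
  fix R e :: real assume "0 < e"
  obtain C where C: "0 \<le> C" "\<And>A B s t z h. finite A \<Longrightarrow> finite B \<Longrightarrow> A \<subseteq> B \<Longrightarrow> B \<subseteq> {0..T} \<Longrightarrow> s \<in> A \<Longrightarrow> t \<in> A \<Longrightarrow> s \<le> t \<Longrightarrow>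
    mesh A h \<Longrightarrow> norm z \<le> R \<Longrightarrow> norm (path (m 0) B s z t - path (m 0) A s z t) \<le> C * h powr (p - 1)"
    by (rule path_refine[of R]) (erule that)
  obtain N0 where N0: "\<And>n. N0 \<le> n \<Longrightarrow> C * (T / 2 ^ n) powr (p - 1) < e / 2"
    by (rule mesh_small[of "e / 2" C]) (use \<open>0 < e\<close> that in auto)
  define N where "N = max N0 c"
  have "norm (path (m 0) (pts s t n) s z u - path (m 0) (pts s t n') s z u) < e"
    if n: "N \<le> n" "N \<le> n'" "norm z \<le> R" for n n' z
  proof -
    have uN: "u \<in> pts s t N" using pts_mono[of c N s t] u by (auto simp: N_def)
    have "norm (path (m 0) (pts s t j) s z u - path (m 0) (pts s t N) s z u) < e / 2" if "N \<le> j" for j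
      using C(2)[OF pts(1)[OF I] pts(1)[OF I] pts_mono[OF that] pts(2)[OF I] pts(3)[OF I] uN u(2) pts(5)[OF I] n(3)]
        N0[of N] by (simp add: N_def)
    from this[OF n(1)] this[OF n(2)] show ?thesis by (rule norm_triangle_half_l)
  qed
  thus "\<exists>N. \<forall>n\<ge>N. \<forall>n'\<ge>N. \<forall>z. norm z \<le> R \<longrightarrow>
     norm (path (m 0) (pts s t n) s z u - path (m 0) (pts s t n') s z u) < e" by blast
qed

text \<open>The tangent component is compared on a fixed coarse partition: there the Davie bound
  controls the error of each block, the lower component converges, and the propagators of the
  tangent component are linear and uniformly bounded.\<close>

lemma grid_Cauchy_Suc:
  assumes j: "j < k" and I: "s \<in> {0..T}" "t \<in> {0..T}" and u: "u \<in> pts s t c0" "s \<le> u"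
    and grid_Cauchy: "\<And>c u. u \<in> pts s t c \<Longrightarrow> s \<le> u \<Longrightarrow> grid_Cauchy (m j) s t u"
  shows "grid_Cauchy (m (Suc j)) s t u"
  unfolding grid_Cauchy_def
proof (intro allI impI)
  fix R e :: real assume e: "0 < e"
  let ?f = "m j" and ?g = "m (Suc j)"
  note lft = lift[OF j] and ls1 = local_almost_flow[of "Suc j"] and nb1 = no_blowup[of "Suc j"]
  have ls1: "local_almost_flow T \<alpha> p ?g" and nb1: "no_blowup T ?g" using local_almost_flow[of "Suc j"] no_blowup[of "Suc j"] j by auto
  obtain R1 where R1: "0 \<le> R1" "\<And>A (z :: 'e) s v. finite A \<Longrightarrow> A \<subseteq> {0..T} \<Longrightarrow> s \<in> A \<Longrightarrow> norm z \<le> R \<Longrightarrow> v \<in> A \<Longrightarrow> s \<le> v \<Longrightarrow>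
      norm (path ?g A s z v) \<le> R1"
    by (rule no_blowup_path[OF nb1, of R]) (erule that)
  \<comment> \<open>Covers the initial values and the mixed states \<open>?w\<close> below, whose
    two components are each bounded by \<open>R1\<close>.\<close>
  define R2 where "R2 = max R (R1 + R1)"
  obtain L where L: "0 \<le> L" "\<And>A s (z :: 'e) u v. finite A \<Longrightarrow> A \<subseteq> {0..T} \<Longrightarrow> s \<in> A \<Longrightarrow> norm z \<le> R2 \<Longrightarrow>
      u \<in> A \<Longrightarrow> v \<in> A \<Longrightarrow> s \<le> u \<Longrightarrow> u \<le> v \<Longrightarrow>
      norm (path ?g A s z v - ?g u v (path ?g A s z u)) \<le> L * (v - u) powr p"
    by (rule davie_path_bound[OF \<alpha> p ls1 nb1, of R2]) (erule that)
  obtain M where M: "0 \<le> M" "\<And>A s t (z :: 'e) h. finite A \<Longrightarrow> A \<subseteq> {0..T} \<Longrightarrow> s \<in> A \<Longrightarrow> t \<in> A \<Longrightarrow> s \<le> t \<Longrightarrow>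
      norm z \<le> R1 \<Longrightarrow> norm (r (path ?g A s (pr z h) t)) \<le> M * norm h"
    by (rule path_tangent_bound[OF lft nb1, of R1]) (erule that)
  obtain K where K: "0 \<le> K" "\<And>s t z z'. s \<in> {0..T} \<Longrightarrow> t \<in> {0..T} \<Longrightarrow> norm z \<le> R2 \<Longrightarrow> norm z' \<le> R2 \<Longrightarrow>
     norm (?g s t z - ?g s t z') \<le> K * norm (z - z')"
    by (rule local_almost_flow_lipschitz[OF ls1 \<alpha>, of R2]) (erule that)
  \<comment> \<open>The order of choice matters: the coarse level \<open>c\<close> makes the Davie
    errors small, then \<open>\<epsilon>\<close> may depend on the number of points of
    \<open>?A\<close>, and only then is \<open>N1\<close> chosen so that the base paths are
    \<open>\<epsilon>\<close>-close at all these points.\<close>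
  obtain c1 where c1: "\<And>n. c1 \<le> n \<Longrightarrow> (M * (L + L) * T) * (T / 2 ^ n) powr (p - 1) < e / 3"
    by (rule mesh_small[of "e / 3" "M * (L + L) * T"]) (use e that in auto)
  define c where "c = max c0 c1"
  let ?A = "pts s t c"
  have uA: "u \<in> ?A" using u(1) pts_mono[of c0 c s t] by (auto simp: c_def)
  note pA = pts[OF I]
  define \<epsilon> where "\<epsilon> = e / (3 * (1 + card ?A * (M * K)))"
  have \<epsilon>: "0 < \<epsilon>" "card ?A * (M * (K * \<epsilon>)) < e / 3"
  proof -
    have "0 \<le> card ?A * (M * K)" using M K by simp
    thus "0 < \<epsilon>" "card ?A * (M * (K * \<epsilon>)) < e / 3" using e by (auto simp: \<epsilon>_def field_simps)
  qed
  have "\<exists>N. \<forall>n\<ge>N. \<forall>n'\<ge>N. \<forall>z. norm z \<le> R \<longrightarrow>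
     norm (path ?f (pts s t n) s z a - path ?f (pts s t n') s z a) < min \<epsilon> (e / 3)" if "a \<in> ?A" "s \<le> a" for a
    using grid_Cauchy[OF that] \<epsilon>(1) e unfolding grid_Cauchy_def by (metis min_less_iff_conj divide_pos_pos zero_less_numeral)
  then obtain N where N: "\<And>a n n' z. a \<in> ?A \<Longrightarrow> s \<le> a \<Longrightarrow> N a \<le> n \<Longrightarrow> N a \<le> n' \<Longrightarrow> norm z \<le> R \<Longrightarrow>
     norm (path ?f (pts s t n) s z a - path ?f (pts s t n') s z a) < min \<epsilon> (e / 3)" by metis
  define N1 where "N1 = max c (Max (N ` ?A))"
  have N1: "c \<le> N1" "a \<in> ?A \<Longrightarrow> N a \<le> N1" for a
    using pA(1) by (auto simp: N1_def le_max_iff_disj)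
  have "norm (path ?g (pts s t n) s z u - path ?g (pts s t n') s z u) < e"
    if n: "N1 \<le> n" "N1 \<le> n'" and z: "norm z \<le> R" for n n' z
  proof -
    let ?B = "pts s t n" and ?B' = "pts s t n'"
    let ?y = "path ?g ?B s z" and ?y' = "path ?g ?B' s z"
    have sub: "?A \<subseteq> ?B" "?A \<subseteq> ?B'" using pts_mono N1(1) n by (meson order_trans)+
    have l_y: "l (?y a) = path ?f ?B s (l z) a" "l (?y' a) = path ?f ?B' s (l z) a" if "a \<in> ?A" "s \<le> a" for a
      using lift_path[OF lft pA(1-3) _ that(2)] sub that by auto
    have lz: "norm (l z) \<le> R" using norm_l z by (rule order_trans)
    have conv: "norm (l (?y a) - l (?y' a)) < min \<epsilon> (e / 3)" if "a \<in> ?A" "s \<le> a" for a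
      unfolding l_y[OF that] using N1(2)[OF that(1)] n lz by (intro N that) auto
    have bd: "norm (?y a) \<le> R1" "norm (?y' a) \<le> R1" if "a \<in> ?A" "s \<le> a" for a
      using R1(2)[OF pA(1-3) z _ that(2)] sub that(1) by auto
    \<comment> \<open>Interpolates between the two tangent components: the base point of
      \<open>?y'\<close> with the tangent vector of \<open>?y\<close> at time \<open>w\<close>,
      continued along \<open>?B'\<close>. At \<open>w = u\<close> this is the tangent component of
      \<open>?y\<close>, at \<open>w = s\<close> that of \<open>?y'\<close>.\<close>
    let ?\<Phi> = "\<lambda>w. r (path ?g ?B' w (pr (l (?y' w)) (r (?y w))) u)"
    have "norm (?\<Phi> u - ?\<Phi> s) \<le> (M * ((L + L) * (T / 2 ^ c) powr (p - 1))) * (u - s) + card ?A * (M * (K * \<epsilon>))"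
    proof (rule telescope[OF pA(1,3) uA u(2)])
      show "0 \<le> M * (K * \<epsilon>)" using M K \<epsilon> by simp
      fix a b assume ab: "consec ?A a b" "s \<le> a" "b \<le> u"
      have in_A: "a \<in> ?A" "b \<in> ?A" "a \<le> b" "s \<le> b" using ab by (auto simp: consec_def)
      have in_I: "a \<in> {0..T}" "b \<in> {0..T}" using in_A pA(2)[of c] by blast+
      have in_B: "a \<in> ?B" "b \<in> ?B" "a \<in> ?B'" "b \<in> ?B'" "u \<in> ?B'" using in_A sub uA by auto
      let ?w = "pr (l (?y' a)) (r (?y a))"
      define q where "q = path ?g ?B' a ?w b"
      have w: "norm ?w \<le> R2"
        using norm_pr[of "l (?y' a)" "r (?y a)"] norm_l[of "?y' a"] norm_r[of "?y a"] bd[OF in_A(1) ab(2)]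
        by (simp add: R2_def le_max_iff_disj)
      have lq: "l q = l (?y' b)"
      proof -
        have "l q = path ?f ?B' a (l (?y' a)) b"
          unfolding q_def using lift_path[OF lft pA(1,2) in_B(3,4) in_A(3), of ?w] by simp
        thus ?thesis using l_y in_A ab path_cocycle[OF pA(1,3) in_B(3,4) ab(2) in_A(3), of ?f "l z"] by simp
      qed
      have "path ?g ?B' a ?w u = path ?g ?B' b q u"
        unfolding q_def using path_cocycle[OF pA(1) in_B(3) in_B(3,4), of ?g ?w]
        by (metis ab(3) in_A(3) in_B(3-5) order_refl pA(1) path_cocycle)
      also have "q = pr (l (?y' b)) (r q)" using pr_lr[of q] lq by simp
      finally have "?\<Phi> b - ?\<Phi> a = r (path ?g ?B' b (pr (l (?y' b)) (r (?y b))) u) - r (path ?g ?B' b (pr (l (?y' b)) (r q)) u)"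
        by simp
      also have "\<dots> = r (path ?g ?B' b (pr (l (?y' b)) (r (?y b) - r q)) u)"
        by (rule linear_diff[OF has_derivative_linear[OF
              path_has_derivative[OF lft pA(1,2) in_B(4,5) ab(3)]], symmetric])
      also have "norm \<dots> \<le> M * norm (r (?y b) - r q)"
        using order_trans[OF norm_l bd(2)[OF in_A(2,4)]] by (intro M(2) pA in_B ab)
      also have "\<dots> \<le> M * ((L + L) * (b - a) powr p + K * \<epsilon>)"
      \<comment> \<open>Two Davie errors, one for each fine path over the block from
        \<open>a\<close> to \<open>b\<close>, and between them the effect of replacing the base
        point of \<open>?y\<close> by that of \<open>?y'\<close>.\<close>
      proof (intro mult_left_mono M(1))
        have 1: "norm (?y b - ?g a b (?y a)) \<le> L * (b - a) powr p"
          using z by (intro L(2) pA in_B in_A ab) (simp add: R2_def)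
        have 2: "norm (?g a b (?y a) - ?g a b ?w) \<le> K * \<epsilon>"
        proof -
          have "norm (?g a b (?y a) - ?g a b ?w) \<le> K * norm (?y a - ?w)"
            using bd(1)[OF in_A(1) ab(2)] w R1(1) by (intro K(2) in_I) (auto simp: R2_def le_max_iff_disj)
          also have "?y a - ?w = pr (l (?y a) - l (?y' a)) 0"
            using pr_diff[of "l (?y a)" "r (?y a)" "l (?y' a)" "r (?y a)"] by simp
          also have "norm (pr (l (?y a) - l (?y' a)) 0) \<le> \<epsilon>"
            using norm_pr[of "l (?y a) - l (?y' a)" 0] conv[OF in_A(1) ab(2)] by simp
          finally show ?thesis using K(1) by (simp add: mult_left_mono)
        qed
        have 3: "norm (?g a b ?w - q) \<le> L * (b - a) powr p"
          using L(2)[OF pA(1,2) in_B(3) w in_B(3,4) order_refl in_A(3)]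
          by (simp add: q_def path_start[OF pA(1) in_B(3)] norm_minus_commute)
        have "norm (?y b - q) \<le> L * (b - a) powr p + K * \<epsilon> + L * (b - a) powr p"
          by (rule norm_diff_triangle_le[OF norm_diff_triangle_le[OF 1 2] 3])
        thus "norm (r (?y b) - r q) \<le> (L + L) * (b - a) powr p + K * \<epsilon>"
          using norm_r[of "?y b - q"] by (simp add: r_linear algebra_simps)
      qed
      also have "\<dots> \<le> M * ((L + L) * ((T / 2 ^ c) powr (p - 1) * (b - a)) + K * \<epsilon>)"
        using powr_mesh[OF pA(5) ab(1) p] L(1) M(1) by (intro mult_left_mono add_right_mono) auto
      finally show "norm (?\<Phi> b - ?\<Phi> a) \<le> M * ((L + L) * (T / 2 ^ c) powr (p - 1)) * (b - a) + M * (K * \<epsilon>)"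
        by (simp add: algebra_simps)
    qed
    also have "\<dots> \<le> (M * ((L + L) * (T / 2 ^ c) powr (p - 1))) * T + card ?A * (M * (K * \<epsilon>))"
    proof -
      have "u - s \<le> T" using subsetD[OF pA(2) uA] I by simp
      thus ?thesis using M(1) L(1) by (intro add_right_mono mult_left_mono) auto
    qed
    also have "\<dots> < e / 3 + e / 3" using c1[of c] \<epsilon>(2) by (intro add_strict_mono) (auto simp: c_def mult_ac)
    finally have "norm (?\<Phi> u - ?\<Phi> s) < e / 3 + e / 3" .
    moreover have "?\<Phi> u = r (?y u)" by (simp add: path_start[OF pA(1) subsetD[OF sub(2) uA]])
    moreover have "?\<Phi> s = r (?y' u)" by (simp add: path_start[OF pA(1,3)])
    ultimately have "norm (r (?y u - ?y' u)) < e / 3 + e / 3" by (simp add: r_linear)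
    moreover have "norm (l (?y u - ?y' u)) < e / 3" using conv[OF uA u(2)] by (simp add: l_linear)
    ultimately show ?thesis using norm_lr[of "?y u - ?y' u"] by linarith
  qed
  thus "\<exists>N. \<forall>n\<ge>N. \<forall>n'\<ge>N. \<forall>z. norm z \<le> R \<longrightarrow>
     norm (path ?g (pts s t n) s z u - path ?g (pts s t n') s z u) < e" by blast
qed

lemma grid_Cauchy:
  assumes "j \<le> k" "s \<in> {0..T}" "t \<in> {0..T}" "u \<in> pts s t c" "s \<le> u"
  shows "grid_Cauchy (m j) s t u"
  using assms(1,4,5)
proof (induction j arbitrary: c u)
  case 0
  thus ?case using grid_Cauchy_0[OF assms(2,3)] by blast
next
  case (Suc j)
  show ?case
    by (rule grid_Cauchy_Suc[OF _ assms(2,3) Suc.prems(2,3)]) (use Suc in auto)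
qed

end

section \<open>The flow and its inverse\<close>

context step_tower
begin

definition \<Phi> :: "nat \<Rightarrow> real \<Rightarrow> real \<Rightarrow> 'e \<Rightarrow> 'e" where
  "\<Phi> j s t z = lim (\<lambda>n. path (m j) (pts s t n) s z t)"

lemma \<Phi>_limit:
  assumes "j \<le> k" "0 \<le> s" "s \<le> t" "t \<le> T"
  shows "(\<lambda>n. path (m j) (pts s t n) s z t) \<longlonglongrightarrow> \<Phi> j s t z"
proof -
  have I: "s \<in> {0..T}" "t \<in> {0..T}" using assms by auto
  have "Cauchy (\<lambda>n. path (m j) (pts s t n) s z t)"
  proof (rule CauchyI)
    fix e :: real assume "0 < e"
    with grid_Cauchy[OF assms(1) I pts(4)[OF I, of 0] assms(3)]
    show "\<exists>N. \<forall>n\<ge>N. \<forall>n'\<ge>N. norm (path (m j) (pts s t n) s z t - path (m j) (pts s t n') s z t) < e"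
      unfolding grid_Cauchy_def by blast
  qed
  thus ?thesis unfolding \<Phi>_def by (simp add: Cauchy_convergent_iff convergent_LIMSEQ_iff)
qed

lemma \<Phi>_uniform:
  assumes "j \<le> k" "0 \<le> s" "s \<le> t" "t \<le> T" "0 < e"
  obtains N where "\<And>n (z :: 'e). N \<le> n \<Longrightarrow> norm z \<le> R \<Longrightarrow> norm (path (m j) (pts s t n) s z t - \<Phi> j s t z) \<le> e"
proof -
  have I: "s \<in> {0..T}" "t \<in> {0..T}" using assms by auto
  obtain N where N: "\<And>n n' (z :: 'e). N \<le> n \<Longrightarrow> N \<le> n' \<Longrightarrow> norm z \<le> R \<Longrightarrow>
      norm (path (m j) (pts s t n) s z t - path (m j) (pts s t n') s z t) < e"
    using grid_Cauchy[OF assms(1) I pts(4)[OF I, of 0] assms(3)] assms(5) unfolding grid_Cauchy_def by metis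
  show thesis
  proof (rule that[of N])
    fix n and z :: 'e assume n: "N \<le> n" "norm z \<le> R"
    have "(\<lambda>n'. norm (path (m j) (pts s t n) s z t - path (m j) (pts s t n') s z t)) \<longlonglongrightarrow>
        norm (path (m j) (pts s t n) s z t - \<Phi> j s t z)"
      by (intro tendsto_intros \<Phi>_limit assms)
    moreover have "\<forall>n'\<ge>N. norm (path (m j) (pts s t n) s z t - path (m j) (pts s t n') s z t) \<le> e"
      using N n less_imp_le by blast
    ultimately show "norm (path (m j) (pts s t n) s z t - \<Phi> j s t z) \<le> e"
      by (intro LIMSEQ_le_const2) auto
  qed
qed

lemma \<Phi>_continuous:
  assumes "j \<le> k" "0 \<le> s" "s \<le> t" "t \<le> T"
  shows "isCont (\<Phi> j s t) z"
proof -
  have I: "s \<in> {0..T}" "t \<in> {0..T}" using assms by auto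
  have "continuous_on (ball z 1) (\<Phi> j s t)"
  proof (rule uniform_limit_theorem[of _ "\<lambda>n z. path (m j) (pts s t n) s z t" sequentially])
    show "\<forall>\<^sub>F n in sequentially. continuous_on (ball z 1) (\<lambda>z. path (m j) (pts s t n) s z t)"
      using path_continuous[OF local_almost_flow[OF assms(1)] \<alpha> pts(1)[OF I] pts(2)[OF I] pts(3)[OF I] pts(4)[OF I] assms(3)]
      by (intro always_eventually allI continuous_at_imp_continuous_on ballI)
    show "uniform_limit (ball z 1) (\<lambda>n z. path (m j) (pts s t n) s z t) (\<Phi> j s t) sequentially"
      unfolding uniform_limit_iff
    proof (intro allI impI)
      fix e :: real assume "0 < e"
      obtain N where N: "\<And>n x. N \<le> n \<Longrightarrow> norm x \<le> norm z + 1 \<Longrightarrow> norm (path (m j) (pts s t n) s x t - \<Phi> j s t x) \<le> e / 2"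
        by (rule \<Phi>_uniform[OF assms, of "e / 2" "norm z + 1"]) (use \<open>0 < e\<close> in simp, erule that)
      have "dist (path (m j) (pts s t n) s x t) (\<Phi> j s t x) < e" if "N \<le> n" "x \<in> ball z 1" for n x
      proof -
        have "norm (x - z) < 1" using that by (simp add: dist_norm norm_minus_commute)
        hence "norm x \<le> norm z + 1" using norm_triangle_sub[of x z] by linarith
        from N[OF that(1) this] show ?thesis using \<open>0 < e\<close> by (simp add: dist_norm)
      qed
      thus "\<forall>\<^sub>F n in sequentially. \<forall>x\<in>ball z 1. dist (path (m j) (pts s t n) s x t) (\<Phi> j s t x) < e"
        unfolding eventually_sequentially by blast
    qed
  qed simp
  thus ?thesis by (simp add: continuous_on_eq_continuous_at)
qed

text \<open>The derivatives of the paths are tangent components of lifted paths. These converge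
  uniformly on balls, and by linearity the error is a small multiple of \<open>norm h\<close> for
  every direction, so differentiation passes to the limit.\<close>

lemma \<Phi>_has_derivative:
  assumes j: "j < k" and st: "0 \<le> s" "s \<le> t" "t \<le> T"
  shows "(\<Phi> j s t has_derivative (\<lambda>v. r (\<Phi> (Suc j) s t (pr z v)))) (at z)"
proof -
  have I: "s \<in> {0..T}" "t \<in> {0..T}" using assms by auto
  have j1: "j \<le> k" "Suc j \<le> k" using j by auto
  let ?f = "\<lambda>n z. path (m j) (pts s t n) s z t"
  let ?f' = "\<lambda>n z v. r (path (m (Suc j)) (pts s t n) s (pr z v) t)"
  let ?g' = "\<lambda>z v. r (\<Phi> (Suc j) s t (pr z v))"
  have der: "(?f n has_derivative ?f' n x) (at x)" for n x
    by (rule path_has_derivative[OF lift[OF j] pts(1,2,3,4)[OF I] st(2)])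
  have lim: "(\<lambda>n. ?f' n x v) \<longlonglongrightarrow> ?g' x v" for x v
    by (intro bounded_linear.tendsto[OF bounded_linear_r] \<Phi>_limit j1 st)
  have lin: "linear (\<lambda>v. ?f' n x v - ?g' x v)" for n x
  proof (rule linear_compose_sub)
    show lf: "linear (?f' n x)" for n using der by (rule has_derivative_linear)
    show "linear (?g' x)"
    proof (rule linearI)
      fix a b :: 'e and c :: real
      have "(\<lambda>n. ?f' n x (a + b)) \<longlonglongrightarrow> ?g' x a + ?g' x b"
        unfolding linear_add[OF lf] by (intro tendsto_add lim)
      thus "?g' x (a + b) = ?g' x a + ?g' x b" using lim by (rule LIMSEQ_unique[rotated])
      have "(\<lambda>n. ?f' n x (c *\<^sub>R a)) \<longlonglongrightarrow> c *\<^sub>R ?g' x a"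
        unfolding linear_scale[OF lf] by (intro tendsto_scaleR tendsto_const lim)
      thus "?g' x (c *\<^sub>R a) = c *\<^sub>R ?g' x a" using lim by (rule LIMSEQ_unique[rotated])
    qed
  qed
  have nlim: "\<forall>\<^sub>F n in sequentially. \<forall>x\<in>ball z 1. \<forall>h. norm (?f' n x h - ?g' x h) \<le> e * norm h"
    if e: "0 < e" for e
  proof -
    obtain N where N: "\<And>n x. N \<le> n \<Longrightarrow> norm x \<le> norm z + 2 \<Longrightarrow>
        norm (path (m (Suc j)) (pts s t n) s x t - \<Phi> (Suc j) s t x) \<le> e"
      by (rule \<Phi>_uniform[OF j1(2) st e, of "norm z + 2"]) (erule that)
    have "norm (?f' n x h - ?g' x h) \<le> e * norm h" if n: "N \<le> n" and x: "x \<in> ball z 1" for n x h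
    proof (rule linear_unit_bound[OF lin])
      fix h :: 'e assume h: "norm h \<le> 1"
      have "norm (x - z) < 1" using x by (simp add: dist_norm norm_minus_commute)
      hence "norm (pr x h) \<le> norm z + 2" using norm_triangle_sub[of x z] norm_pr[of x h] h by linarith
      from order_trans[OF norm_r N[OF n this]]
      show "norm (?f' n x h - ?g' x h) \<le> e" by (simp add: r_linear)
    qed
    thus ?thesis unfolding eventually_sequentially by blast
  qed
  have z: "z \<in> ball z 1" by simp
  have "\<exists>g. \<forall>x\<in>ball z 1. (\<lambda>n. ?f n x) \<longlonglongrightarrow> g x \<and> (g has_derivative ?g' x) (at x within ball z 1)"
    by (rule has_derivative_sequence[OF convex_ball has_derivative_at_withinI[OF der] nlim z \<Phi>_limit[OF j1(1) st]])
  then obtain g where g: "\<And>x. x \<in> ball z 1 \<Longrightarrow> (\<lambda>n. ?f n x) \<longlonglongrightarrow> g x"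
      "\<And>x. x \<in> ball z 1 \<Longrightarrow> (g has_derivative ?g' x) (at x within ball z 1)" by blast
  have "g x = \<Phi> j s t x" if "x \<in> ball z 1" for x
    using g(1)[OF that] \<Phi>_limit[OF j1(1) st] by (rule LIMSEQ_unique)
  hence "(\<Phi> j s t has_derivative ?g' z) (at z within ball z 1)"
    by (intro has_derivative_transform[OF z _ g(2)[OF z]]) simp
  thus ?thesis using at_within_open[OF z open_ball] by simp
qed

text \<open>A directional derivative of \<open>\<Phi> j\<close> along an affine map is
  \<open>\<Phi> (Suc j)\<close> along another affine map, with offset \<open>pr c (a v)\<close> and
  linear part \<open>pr (a x) 0\<close>. The statement is therefore closed under differentiation, at
  the price of one level of the tower.\<close>

lemma C_k_\<Phi>:
  fixes a :: "'a::euclidean_space \<Rightarrow> 'e" and b :: "'e \<Rightarrow> 'b::euclidean_space"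
  assumes "n + j \<le> k" "bounded_linear a" "bounded_linear b" and st: "0 \<le> s" "s \<le> t" "t \<le> T"
  shows "C_k n (\<lambda>x. b (\<Phi> j s t (c + a x)))"
  using assms(1-3)
proof (induction n arbitrary: j a b c)
  case 0
  have "isCont (\<lambda>x. b (\<Phi> j s t (c + a x))) x" for x
    by (intro bounded_linear.isCont[OF 0(3)] isCont_o2[OF _ \<Phi>_continuous[OF _ st]]
        isCont_add continuous_const bounded_linear.isCont[OF 0(2)] continuous_ident) (use 0 in simp)
  thus ?case by (simp add: continuous_at_imp_continuous_on)
next
  case (Suc n)
  have j: "j < k" using Suc by simp
  let ?D = "\<lambda>x v. b (r (\<Phi> (Suc j) s t (pr (c + a x) (a v))))"
  have der: "((\<lambda>x. b (\<Phi> j s t (c + a x))) has_derivative ?D x) (at x)" for x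
  proof -
    have "((\<lambda>x. c + a x) has_derivative a) (at x)"
      using has_derivative_add[OF has_derivative_const bounded_linear_imp_has_derivative[OF Suc.prems(2)]] by simp
    from has_derivative_compose[OF this \<Phi>_has_derivative[OF j st]]
    show ?thesis by (rule bounded_linear.has_derivative[OF Suc.prems(3)])
  qed
  have "C_k n (\<lambda>x. ?D x v)" for v
  proof -
    have "pr (c + a x) (a v) = pr c (a v) + pr (a x) 0" for x by (simp add: pr_add)
    moreover have "C_k n (\<lambda>x. b (r (\<Phi> (Suc j) s t (pr c (a v) + pr (a x) 0))))"
      using Suc.prems
      by (intro Suc.IH[where b = "\<lambda>z. b (r z)"] bounded_linear_compose[OF bounded_linear_pr_left]
          bounded_linear_compose[OF _ bounded_linear_r]) auto
    ultimately show ?thesis by simp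
  qed
  moreover have "frechet_derivative (\<lambda>x. b (\<Phi> j s t (c + a x))) (at x) = ?D x" for x
    using frechet_derivative_at[OF der] by simp
  ultimately show ?case using der by (auto simp: differentiable_def)
qed

text \<open>Davie's bound with a constant uniform in the partition passes to the limit. The
  intermediate time is put into a common partition \<open>B n\<close> for \<open>u\<close> and
  \<open>v\<close>; by \<open>path_refine\<close> its chains have the same limits as those that
  define \<open>\<Phi>\<close>.\<close>

lemma davie_\<Phi>:
  assumes "0 \<le> s" "s \<le> T"
  shows "davie p (m 0) s T (\<lambda>t. \<Phi> 0 s t z)"
proof -
  obtain C where C: "0 \<le> C" "\<And>A B s t z' h. finite A \<Longrightarrow> finite B \<Longrightarrow> A \<subseteq> B \<Longrightarrow> B \<subseteq> {0..T} \<Longrightarrow> s \<in> A \<Longrightarrow> t \<in> A \<Longrightarrow> s \<le> t \<Longrightarrow>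
    mesh A h \<Longrightarrow> norm z' \<le> norm z \<Longrightarrow> norm (path (m 0) B s z' t - path (m 0) A s z' t) \<le> C * h powr (p - 1)"
    by (rule path_refine[of "norm z"]) (erule that)
  obtain L where L: "0 \<le> L" "\<And>A s (z' :: 'e) u v. finite A \<Longrightarrow> A \<subseteq> {0..T} \<Longrightarrow> s \<in> A \<Longrightarrow> norm z' \<le> norm z \<Longrightarrow>
      u \<in> A \<Longrightarrow> v \<in> A \<Longrightarrow> s \<le> u \<Longrightarrow> u \<le> v \<Longrightarrow>
      norm (path (m 0) A s z' v - m 0 u v (path (m 0) A s z' u)) \<le> L * (v - u) powr p"
    by (rule davie_path_bound[OF \<alpha> p local_almost_flow0 no_blowup_0, of "norm z"]) (erule that)
  show ?thesis
    unfolding davie_def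
  proof (intro exI allI impI)
    fix u v assume uv: "s \<le> u" "u \<le> v" "v \<le> T"
    have I: "s \<in> {0..T}" "u \<in> {0..T}" "v \<in> {0..T}" using uv assms by auto
    define B where "B = (\<lambda>n. insert v (pts s u n))"
    have B: "finite (B n)" "B n \<subseteq> {0..T}" "s \<in> B n" "u \<in> B n" "v \<in> B n" "pts s u n \<subseteq> B n" "pts s v n \<subseteq> B n" for n
      using pts[OF I(1,2)] I by (auto simp: B_def pts_def)
    have conv: "(\<lambda>n. path (m 0) (B n) s z w) \<longlonglongrightarrow> \<Phi> 0 s w z" if w: "w = u \<or> w = v" for w
    proof -
      have wI: "w \<in> {0..T}" "s \<le> w" "w \<le> T" using w I uv by auto
      have sub: "pts s w n \<subseteq> B n" for n using w B(6)[of n] B(7)[of n] by auto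
      have "(\<lambda>n. path (m 0) (B n) s z w - path (m 0) (pts s w n) s z w) \<longlonglongrightarrow> 0"
      proof (rule Lim_null_comparison[OF _ mesh_grid_tendsto[OF p T, of C]])
        have "norm (path (m 0) (B n) s z w - path (m 0) (pts s w n) s z w) \<le> C * (T / 2 ^ n) powr (p - 1)" for n
          by (rule C(2)[OF pts(1)[OF I(1) wI(1)] B(1) sub B(2) pts(3)[OF I(1) wI(1)] pts(4)[OF I(1) wI(1)]
                wI(2) pts(5)[OF I(1) wI(1)] order_refl])
        thus "\<forall>\<^sub>F n in sequentially. norm (path (m 0) (B n) s z w - path (m 0) (pts s w n) s z w) \<le> C * (T / 2 ^ n) powr (p - 1)"
          by simp
      qed
      from tendsto_add[OF this \<Phi>_limit[OF le0 assms(1) wI(2,3), of z]] show ?thesis by simp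
    qed
    have "(\<lambda>n. norm (path (m 0) (B n) s z v - m 0 u v (path (m 0) (B n) s z u)))
        \<longlonglongrightarrow> norm (\<Phi> 0 s v z - m 0 u v (\<Phi> 0 s u z))"
      by (intro tendsto_intros conv isCont_tendsto_compose[OF local_almost_flow_continuous[OF local_almost_flow0 \<alpha> I(2,3)]]) auto
    moreover have "norm (path (m 0) (B n) s z v - m 0 u v (path (m 0) (B n) s z u)) \<le> L * (v - u) powr p" for n
      by (rule L(2)[OF B(1-3) order_refl B(4,5) uv(1,2)])
    ultimately show "norm (\<Phi> 0 s v z - m 0 u v (\<Phi> 0 s u z)) \<le> L * (v - u) powr p"
      by (intro LIMSEQ_le_const2) auto
  qed
qed

lemma \<Phi>_start:
  assumes "0 \<le> s" "s \<le> T" "j \<le> k"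
  shows "\<Phi> j s s z = z"
proof -
  have I: "s \<in> {0..T}" using assms by auto
  have "(\<lambda>n. z) \<longlonglongrightarrow> \<Phi> j s s z"
    using \<Phi>_limit[OF assms(3,1) order_refl assms(2), of z] by (simp add: path_start[OF pts(1,3)[OF I I]])
  thus ?thesis by (rule LIMSEQ_unique[OF _ tendsto_const])
qed

text \<open>The steps preserve the range of \<open>i\<close>, on which \<open>i\<close> after
  \<open>\<pi>\<close> is the identity; this equation survives the limit by continuity.\<close>

lemma \<Phi>_embed:
  assumes i: "bounded_linear i" "bounded_linear \<pi>"
    and m_i: "\<And>a b x. a \<in> {0..T} \<Longrightarrow> b \<in> {0..T} \<Longrightarrow> i (\<pi> (m 0 a b (i x))) = m 0 a b (i x)"
    and \<pi>_i: "\<And>x. \<pi> (i x) = x" and st: "0 \<le> s" "s \<le> t" "t \<le> T"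
  shows "i (\<pi> (\<Phi> 0 s t (i x))) = \<Phi> 0 s t (i x)"
proof -
  have I: "s \<in> {0..T}" "t \<in> {0..T}" using st by auto
  have path: "i (\<pi> (path (m 0) A s (i x) v)) = path (m 0) A s (i x) v"
    if A: "finite A" "A \<subseteq> {0..T}" "s \<in> A" and v: "v \<in> A" "s \<le> v" for A v
    using A(1,3) v
  proof (induction v rule: consec_induct)
    case start
    show ?case by (simp add: path_start[OF A(1,3)] \<pi>_i)
  next
    case (step a b)
    have "a \<in> {0..T}" "b \<in> {0..T}" using step(1) A(2) by (auto simp: consec_def)
    from m_i[OF this, of "\<pi> (path (m 0) A s (i x) a)"] step(3)
    show ?case by (simp add: path_step[OF A(1,3) step(1,2)])
  qed
  have "i (\<pi> (path (m 0) (pts s t n) s (i x) t)) = path (m 0) (pts s t n) s (i x) t" for n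
    by (intro path pts I st(2))
  hence "(\<lambda>n. path (m 0) (pts s t n) s (i x) t) \<longlonglongrightarrow> i (\<pi> (\<Phi> 0 s t (i x)))"
    using bounded_linear.tendsto[OF i(1) bounded_linear.tendsto[OF i(2) \<Phi>_limit[OF le0 st, of "i x"]]] by simp
  thus ?thesis using \<Phi>_limit[OF le0 st] by (rule LIMSEQ_unique)
qed

lemma davie_eq_\<Phi>:
  assumes "davie p (m 0) s t Y" "0 \<le> s" "s \<le> t" "t \<le> T"
  shows "Y t = \<Phi> 0 s t (Y s)"
  using davie_limit[OF assms] \<Phi>_limit[OF le0 assms(2-4)] by (rule LIMSEQ_unique)

text \<open>The defect estimate for the times \<open>a, b, a\<close> says that a step forth and back
  is the identity up to an error of order \<open>p\<close>. Since the backward step is Lipschitz, a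
  path that follows the forward steps to order \<open>p\<close> also follows the backward
  ones.\<close>

lemma davie_reverse:
  assumes Y: "davie p (m 0) s t Y" "0 \<le> s" "s \<le> t" "t \<le> T"
  shows "davie p (\<lambda>a b. m 0 (T - a) (T - b)) (T - t) (T - s) (\<lambda>a. Y (T - a))"
proof -
  obtain L where L: "0 \<le> L" "\<And>u v. s \<le> u \<Longrightarrow> u \<le> v \<Longrightarrow> v \<le> t \<Longrightarrow> norm (Y v - m 0 u v (Y u)) \<le> L * (v - u) powr p"
    by (rule davieD[OF Y(1)]) (erule that)
  obtain R where R: "\<And>u. s \<le> u \<Longrightarrow> u \<le> t \<Longrightarrow> norm (Y u) \<le> R"
    "\<And>u v. s \<le> u \<Longrightarrow> u \<le> t \<Longrightarrow> v \<in> {0..T} \<Longrightarrow> norm (m 0 u v (Y u)) \<le> R"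
    by (rule davie_bounds[OF Y(1,2,4)]) (erule that)
  obtain M where M: "0 \<le> M" "\<And>s t z z'. s \<in> {0..T} \<Longrightarrow> t \<in> {0..T} \<Longrightarrow> norm z \<le> R \<Longrightarrow> norm z' \<le> R \<Longrightarrow>
     norm (m 0 s t z - m 0 s t z') \<le> M * norm (z - z')"
    by (rule local_almost_flow_lipschitz[OF local_almost_flow0 \<alpha>, of R]) (erule that)
  obtain K where K: "almost_flow T \<alpha> p (m 0) (cball 0 R) K" using local_almost_flow0 unfolding local_almost_flow_def by blast
  show ?thesis
    unfolding davie_def
  proof (intro exI allI impI)
    fix u v assume uv: "T - t \<le> u" "u \<le> v" "v \<le> T - s"
    define a b where "a = T - v" and "b = T - u"
    have ab: "s \<le> a" "a \<le> b" "b \<le> t" "a \<in> {0..T}" "b \<in> {0..T}" "a \<le> t" "s \<le> b" "b - a = v - u"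
      using uv Y by (auto simp: a_def b_def)
    have "norm (m 0 b a (Y b) - m 0 b a (m 0 a b (Y a))) \<le> M * norm (Y b - m 0 a b (Y a))"
      using R(1)[of b] R(2)[of a b] ab by (intro M(2)) auto
    also have "\<dots> \<le> M * (L * (v - u) powr p)" using L(2)[of a b] ab M(1) by (intro mult_left_mono) auto
    finally have 1: "norm (m 0 b a (Y b) - m 0 b a (m 0 a b (Y a))) \<le> M * (L * (v - u) powr p)" .
    have Ya: "Y a \<in> cball 0 R" using R(1)[of a] ab by simp
    have "norm (m 0 b a (m 0 a b (Y a)) - m 0 a a (Y a)) \<le> K * (\<bar>b - a\<bar> + \<bar>a - b\<bar>) powr p"
      by (rule almost_flowD(4)[OF K ab(4,4,5) Ya])
    also have "\<bar>b - a\<bar> + \<bar>a - b\<bar> = 2 * (v - u)" using ab by simp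
    finally have 2: "norm (m 0 b a (m 0 a b (Y a)) - Y a) \<le> K * (2 powr p * (v - u) powr p)"
      using almost_flow_id[OF K ab(4) Ya] uv by (simp only: powr_mult)
    have "norm (Y a - m 0 b a (Y b)) \<le> M * (L * (v - u) powr p) + K * (2 powr p * (v - u) powr p)"
      using norm_diff_triangle_le[OF 1 2] by (simp add: norm_minus_commute)
    thus "norm (Y (T - v) - m 0 (T - u) (T - v) (Y (T - u))) \<le> (M * L + K * 2 powr p) * (v - u) powr p"
      unfolding a_def b_def by (simp add: algebra_simps)
  qed
qed

end

lemma almost_flow_reverse:
  assumes "almost_flow T \<alpha> p m D K"
  shows "almost_flow T \<alpha> p (\<lambda>a b. m (T - a) (T - b)) D K"
  unfolding almost_flow_def
proof (intro conjI ballI)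
  fix s t u z z' assume *: "s \<in> {0..T}" "t \<in> {0..T}" "u \<in> {0..T}" "z \<in> D" "z' \<in> D"
  have I: "T - s \<in> {0..T}" "T - t \<in> {0..T}" "T - u \<in> {0..T}" using * by auto
  have e: "\<bar>T - t - (T - s)\<bar> = \<bar>t - s\<bar>" "\<bar>T - u - (T - s)\<bar> = \<bar>u - s\<bar>" "\<bar>T - t - (T - u)\<bar> = \<bar>t - u\<bar>" by auto
  show "norm (m (T - s) (T - t) z - m (T - s) (T - t) z' - (z - z')) \<le> K * \<bar>t - s\<bar> powr \<alpha> * norm (z - z')"
    using almost_flowD(3)[OF assms I(1,2) *(4,5)] unfolding e .
  show "norm (m (T - u) (T - t) (m (T - s) (T - u) z) - m (T - s) (T - t) z) \<le> K * (\<bar>u - s\<bar> + \<bar>t - u\<bar>) powr p"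
    using almost_flowD(4)[OF assms I *(4)] unfolding e .
next
  fix s t z assume *: "s \<in> {0..T}" "t \<in> {0..T}" "z \<in> D"
  have I: "T - s \<in> {0..T}" "T - t \<in> {0..T}" using * by auto
  have e: "\<bar>T - t - (T - s)\<bar> = \<bar>t - s\<bar>" by auto
  show "norm (m (T - s) (T - t) z - z) \<le> K * \<bar>t - s\<bar> powr \<alpha>"
    using almost_flowD(2)[OF assms I *(3)] unfolding e .
qed (use almost_flowD(1)[OF assms] in simp)

lemma davie_mono: "davie p m a b Y \<Longrightarrow> a \<le> a' \<Longrightarrow> b' \<le> b \<Longrightarrow> davie p m a' b' Y"
  unfolding davie_def by (meson order_trans)

text \<open>\<open>no_blowup\<close> concerns chains in increasing time, so unlike the almost-flow
  estimates and the lifts it does not carry over to reversed time by itself.\<close>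

locale flow_tower = step_tower l r pr T \<alpha> p k m
  for l r :: "'e::banach \<Rightarrow> 'e" and pr T \<alpha> p k m +
  assumes no_blowup_rev: "no_blowup T (\<lambda>a b. m 0 (T - a) (T - b))"
begin

interpretation rev: step_tower l r pr T \<alpha> p k "\<lambda>j a b. m j (T - a) (T - b)"
proof
  show "local_almost_flow T \<alpha> p (\<lambda>a b. m j (T - a) (T - b))" if "j \<le> k" for j
    using local_almost_flow[OF that] almost_flow_reverse unfolding local_almost_flow_def by blast
  show "lift T (\<lambda>a b. m j (T - a) (T - b)) (\<lambda>a b. m (Suc j) (T - a) (T - b))" if "j < k" for j
    using lift[OF that] unfolding lift_def by auto
qed (use T \<alpha> p k no_blowup_rev in auto)

text \<open>A flow line read backwards is a Davie path for the reversed steps, so it is the flow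
  line of the reversed flow by uniqueness; the other identity is the same argument with the two
  flows exchanged.\<close>

lemma \<Phi>_inverse:
  assumes "0 \<le> s" "s \<le> t" "t \<le> T"
  shows "rev.\<Phi> 0 (T - t) (T - s) (\<Phi> 0 s t z) = z" "\<Phi> 0 s t (rev.\<Phi> 0 (T - t) (T - s) z) = z"
proof -
  have sT: "s \<le> T" "0 \<le> T - t" "T - t \<le> T - s" "T - s \<le> T" "T - t \<le> T" using assms by auto
  have "davie p (m 0) s t (\<lambda>t. \<Phi> 0 s t z)"
    using davie_\<Phi>[OF assms(1) sT(1)] order_refl assms(3) by (rule davie_mono)
  from rev.davie_eq_\<Phi>[OF davie_reverse[OF this assms] sT(2-4)]
  show "rev.\<Phi> 0 (T - t) (T - s) (\<Phi> 0 s t z) = z" using \<Phi>_start[OF assms(1) sT(1) le0] by simp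
  have "davie p (\<lambda>a b. m 0 (T - a) (T - b)) (T - t) (T - s) (\<lambda>a. rev.\<Phi> 0 (T - t) a z)"
    using rev.davie_\<Phi>[OF sT(2,5)] order_refl sT(4) by (rule davie_mono)
  from rev.davie_reverse[OF this sT(2-4)]
  have "davie p (m 0) s t (\<lambda>a. rev.\<Phi> 0 (T - t) (T - a) z)" by simp
  from davie_eq_\<Phi>[OF this assms]
  show "\<Phi> 0 s t (rev.\<Phi> 0 (T - t) (T - s) z) = z" using rev.\<Phi>_start[OF sT(2,5) le0] by simp
qed

text \<open>\<open>i\<close> embeds the state space into \<open>'e\<close>, with left inverse \<open>\<pi>\<close>.\<close>

lemma diffeomorphism:
  fixes i :: "'w::euclidean_space \<Rightarrow> 'e" and \<pi> :: "'e \<Rightarrow> 'w"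
  assumes bl: "bounded_linear i" "bounded_linear \<pi>" and \<pi>_i: "\<And>x. \<pi> (i x) = x"
    and m_i: "\<And>a b x. a \<in> {0..T} \<Longrightarrow> b \<in> {0..T} \<Longrightarrow> i (\<pi> (m 0 a b (i x))) = m 0 a b (i x)"
    and st: "0 \<le> s" "s \<le> t" "t \<le> T"
  shows "C_k_diffeomorphism k (\<lambda>x. \<pi> (\<Phi> 0 s t (i x)))"
proof -
  let ?f = "\<lambda>x. \<pi> (\<Phi> 0 s t (i x))" and ?g = "\<lambda>x. \<pi> (rev.\<Phi> 0 (T - t) (T - s) (i x))"
  have st': "0 \<le> T - t" "T - t \<le> T - s" "T - s \<le> T" using st by auto
  have 1: "i (?f x) = \<Phi> 0 s t (i x)" for x
    by (rule \<Phi>_embed[OF bl m_i \<pi>_i st])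
  have 2: "i (?g x) = rev.\<Phi> 0 (T - t) (T - s) (i x)" for x
    by (rule rev.\<Phi>_embed[OF bl _ \<pi>_i st']) (auto intro: m_i)
  have inv: "?g (?f x) = x" "?f (?g x) = x" for x
    unfolding 1 2 using \<Phi>_inverse[OF st] \<pi>_i by simp_all
  have "?g \<circ> ?f = id" "?f \<circ> ?g = id" using inv by (simp_all add: fun_eq_iff)
  hence "bij ?f" "inv ?f = ?g" by (rule o_bij, rule inv_unique_comp[rotated])
  moreover have "C_k k ?f" "C_k k ?g"
    using C_k_\<Phi>[of k 0 i \<pi> s t 0] rev.C_k_\<Phi>[of k 0 i \<pi> "T - t" "T - s" 0] bl st st' by simp_all
  ultimately show ?thesis unfolding C_k_diffeomorphism_def by simp
qed

end

section \<open>Milstein steps\<close>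

lemma norm_sum_scaleR_le:
  fixes v :: "'i::finite \<Rightarrow> 'e::real_normed_vector" and A B :: real
  assumes "\<And>i. \<bar>a i\<bar> \<le> A" "\<And>i. norm (v i) \<le> B"
  shows "norm (\<Sum>i\<in>UNIV. a i *\<^sub>R v i) \<le> CARD('i) * (A * B)"
proof -
  have A: "0 \<le> A" using assms(1)[of undefined] by linarith
  have "norm (\<Sum>i\<in>UNIV. a i *\<^sub>R v i) \<le> (\<Sum>i\<in>(UNIV :: 'i set). A * B)"
  proof (rule sum_norm_le)
    fix i
    show "norm (a i *\<^sub>R v i) \<le> A * B" using assms[of i] A by (auto intro: mult_mono)
  qed
  thus ?thesis by simp
qed

lemma norm_sum_sum_scaleR_le:
  fixes v :: "'i::finite \<Rightarrow> 'i \<Rightarrow> 'e::real_normed_vector" and A B :: real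
  assumes "\<And>i j. \<bar>a i j\<bar> \<le> A" "\<And>i j. norm (v i j) \<le> B"
  shows "norm (\<Sum>i\<in>UNIV. \<Sum>j\<in>UNIV. a i j *\<^sub>R v i j) \<le> CARD('i) * (CARD('i) * (A * B))"
proof -
  have "norm (\<Sum>i\<in>UNIV. 1 *\<^sub>R (\<Sum>j\<in>UNIV. a i j *\<^sub>R v i j)) \<le> CARD('i) * (1 * (CARD('i) * (A * B)))"
    by (rule norm_sum_scaleR_le) (auto intro: norm_sum_scaleR_le assms)
  thus ?thesis by simp
qed

text \<open>The coordinate of \<open>\<partial>f f + f'\<close> on the tensor product of the basis
  vectors \<open>i\<close> and \<open>j\<close>. The first index belongs to the earlier increment,
  so the inner \<open>f\<close> carries \<open>i\<close> and the differentiated field carries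
  \<open>j\<close>.\<close>

definition gub :: "('i \<Rightarrow> real \<Rightarrow> 'e \<Rightarrow> 'e) \<Rightarrow> ('i \<Rightarrow> real \<Rightarrow> 'e \<Rightarrow> 'e \<Rightarrow> 'e) \<Rightarrow> ('i \<Rightarrow> 'i \<Rightarrow> real \<Rightarrow> 'e \<Rightarrow> 'e)
   \<Rightarrow> 'i \<Rightarrow> 'i \<Rightarrow> real \<Rightarrow> 'e::real_normed_vector \<Rightarrow> 'e" where
  "gub f Df f' i j s z = Df j s z (f i s z) + f' i j s z"

text \<open>The coordinates \<open>x t i\<close> and \<open>xx s t i j\<close> are those of the rough path; Chen's relation is
  required for times in any order, which makes the class of step maps invariant under time reversal.\<close>

locale rough_coords =
  fixes T \<alpha> B :: real and x :: "real \<Rightarrow> 'i::finite \<Rightarrow> real" and xx :: "real \<Rightarrow> real \<Rightarrow> 'i \<Rightarrow> 'i \<Rightarrow> real"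
  assumes T: "0 < T" and \<alpha>: "0 < \<alpha>" and B: "0 \<le> B"
    and x_bound: "s \<in> {0..T} \<Longrightarrow> t \<in> {0..T} \<Longrightarrow> \<bar>x t i - x s i\<bar> \<le> B * \<bar>t - s\<bar> powr \<alpha>"
    and xx_bound: "s \<in> {0..T} \<Longrightarrow> t \<in> {0..T} \<Longrightarrow> \<bar>xx s t i j\<bar> \<le> B * (\<bar>t - s\<bar> powr \<alpha>)\<^sup>2"
    and chen: "s \<in> {0..T} \<Longrightarrow> u \<in> {0..T} \<Longrightarrow> t \<in> {0..T} \<Longrightarrow>
       xx s t i j = xx s u i j + xx u t i j + (x u i - x s i) * (x t j - x u j)"
begin

definition incr :: "('i \<Rightarrow> real \<Rightarrow> 'e \<Rightarrow> 'e) \<Rightarrow> ('i \<Rightarrow> real \<Rightarrow> 'e \<Rightarrow> 'e \<Rightarrow> 'e) \<Rightarrow> ('i \<Rightarrow> 'i \<Rightarrow> real \<Rightarrow> 'e \<Rightarrow> 'e)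
   \<Rightarrow> real \<Rightarrow> real \<Rightarrow> 'e::real_normed_vector \<Rightarrow> 'e" where
  "incr f Df f' s t z = (\<Sum>i\<in>UNIV. (x t i - x s i) *\<^sub>R f i s z) +
     (\<Sum>i\<in>UNIV. \<Sum>j\<in>UNIV. xx s t i j *\<^sub>R gub f Df f' i j s z)"

definition milstein :: "('i \<Rightarrow> real \<Rightarrow> 'e \<Rightarrow> 'e) \<Rightarrow> ('i \<Rightarrow> real \<Rightarrow> 'e \<Rightarrow> 'e \<Rightarrow> 'e) \<Rightarrow> ('i \<Rightarrow> 'i \<Rightarrow> real \<Rightarrow> 'e \<Rightarrow> 'e)
   \<Rightarrow> real \<Rightarrow> real \<Rightarrow> 'e::real_normed_vector \<Rightarrow> 'e" where
  "milstein f Df f' s t z = z + incr f Df f' s t z"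

text \<open>Bounds and condition (ii) for one vector field, for times in any order. Remainders are
  measured in the distance \<open>max (\<bar>t - s\<bar> powr \<alpha>) (norm (z1 - z0))\<close>, in
  which time counts with the regularity of the path. In the sum the first index of \<open>f'\<close>
  is that of the driving increment, as in \<open>gub\<close>.\<close>

definition field_est :: "('i \<Rightarrow> real \<Rightarrow> 'e \<Rightarrow> 'e) \<Rightarrow> ('i \<Rightarrow> real \<Rightarrow> 'e \<Rightarrow> 'e \<Rightarrow> 'e) \<Rightarrow> ('i \<Rightarrow> 'i \<Rightarrow> real \<Rightarrow> 'e \<Rightarrow> 'e)
   \<Rightarrow> 'e::real_normed_vector set \<Rightarrow> real \<Rightarrow> bool" where
  "field_est f Df f' D K \<longleftrightarrow> 0 \<le> K \<and> (\<forall>s\<in>{0..T}. \<forall>t\<in>{0..T}. \<forall>z0\<in>D. \<forall>z1\<in>D. \<forall>i j h.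
     linear (Df i s z0) \<and> norm (f i s z0) \<le> K \<and> norm (Df i s z0 h) \<le> K * norm h \<and> norm (f' i j s z0) \<le> K \<and>
     norm (f i t z1 - f i s z0) \<le> K * max (\<bar>t - s\<bar> powr \<alpha>) (norm (z1 - z0)) \<and>
     norm (f' i j t z1 - f' i j s z0) \<le> K * max (\<bar>t - s\<bar> powr \<alpha>) (norm (z1 - z0)) \<and>
     norm (Df i t z1 h - Df i s z0 h) \<le> K * max (\<bar>t - s\<bar> powr \<alpha>) (norm (z1 - z0)) * norm h \<and>
     norm (f i t z1 - f i s z0 - (\<Sum>i'\<in>UNIV. (x t i' - x s i') *\<^sub>R f' i' i s z0) - Df i s z0 (z1 - z0))
       \<le> K * (max (\<bar>t - s\<bar> powr \<alpha>) (norm (z1 - z0)))\<^sup>2)"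

lemma field_estD:
  assumes "field_est f Df f' D K"
  shows "0 \<le> K" and "s \<in> {0..T} \<Longrightarrow> t \<in> {0..T} \<Longrightarrow> z0 \<in> D \<Longrightarrow> z1 \<in> D \<Longrightarrow>
     linear (Df i s z0) \<and> norm (f i s z0) \<le> K \<and> norm (Df i s z0 h) \<le> K * norm h \<and> norm (f' i j s z0) \<le> K \<and>
     norm (f i t z1 - f i s z0) \<le> K * max (\<bar>t - s\<bar> powr \<alpha>) (norm (z1 - z0)) \<and>
     norm (f' i j t z1 - f' i j s z0) \<le> K * max (\<bar>t - s\<bar> powr \<alpha>) (norm (z1 - z0)) \<and>
     norm (Df i t z1 h - Df i s z0 h) \<le> K * max (\<bar>t - s\<bar> powr \<alpha>) (norm (z1 - z0)) * norm h \<and>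
     norm (f i t z1 - f i s z0 - (\<Sum>i'\<in>UNIV. (x t i' - x s i') *\<^sub>R f' i' i s z0) - Df i s z0 (z1 - z0))
       \<le> K * (max (\<bar>t - s\<bar> powr \<alpha>) (norm (z1 - z0)))\<^sup>2"
  using assms unfolding field_est_def by blast+

lemma gub_bounds:
  assumes F: "field_est f Df f' D K" and I: "s \<in> {0..T}" "t \<in> {0..T}" and z: "z0 \<in> D" "z1 \<in> D"
  shows "norm (gub f Df f' i j s z0) \<le> K * K + K"
    and "norm (gub f Df f' i j t z1 - gub f Df f' i j s z0) \<le> (2 * (K * K) + K) * max (\<bar>t - s\<bar> powr \<alpha>) (norm (z1 - z0))"
proof -
  note K = field_estD(1)[OF F] and D = field_estD(2)[OF F I z] and D1 = field_estD(2)[OF F I(2,1) z(2,1)]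
  have "norm (Df j s z0 (f i s z0)) \<le> K * norm (f i s z0)" using D by blast
  also have "\<dots> \<le> K * K" using D K by (intro mult_left_mono) auto
  finally show "norm (gub f Df f' i j s z0) \<le> K * K + K"
    unfolding gub_def using D[of i _ j] by (meson add_mono norm_triangle_ineq order_trans)
  let ?\<rho> = "max (\<bar>t - s\<bar> powr \<alpha>) (norm (z1 - z0))"
  have \<rho>: "0 \<le> ?\<rho>" by (simp add: le_max_iff_disj)
  have lin: "linear (Df j t z1)" using D1 by blast
  have "norm (Df j t z1 (f i t z1 - f i s z0)) \<le> K * norm (f i t z1 - f i s z0)" using D1 by blast
  also have "\<dots> \<le> K * (K * ?\<rho>)" using D K by (intro mult_left_mono) auto
  finally have 1: "norm (Df j t z1 (f i t z1) - Df j t z1 (f i s z0)) \<le> K * (K * ?\<rho>)"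
    by (simp only: linear_diff[OF lin])
  have "norm (Df j t z1 (f i s z0) - Df j s z0 (f i s z0)) \<le> K * ?\<rho> * norm (f i s z0)" using D by blast
  also have "\<dots> \<le> K * ?\<rho> * K" using D K \<rho> by (intro mult_left_mono) auto
  finally have 2: "norm (Df j t z1 (f i s z0) - Df j s z0 (f i s z0)) \<le> K * ?\<rho> * K" .
  have 3: "norm (f' i j t z1 - f' i j s z0) \<le> K * ?\<rho>" using D by blast
  have "gub f Df f' i j t z1 - gub f Df f' i j s z0 =
      (Df j t z1 (f i t z1) - Df j s z0 (f i s z0)) + (f' i j t z1 - f' i j s z0)" by (simp add: gub_def)
  also have "norm \<dots> \<le> (K * (K * ?\<rho>) + K * ?\<rho> * K) + K * ?\<rho>"
    by (intro norm_triangle_mono norm_diff_triangle_le[OF 1 2] 3)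
  also have "\<dots> = (2 * (K * K) + K) * ?\<rho>" by (simp add: algebra_simps)
  finally show "norm (gub f Df f' i j t z1 - gub f Df f' i j s z0) \<le> (2 * (K * K) + K) * ?\<rho>" .
qed

lemma second_order_bound:
  assumes F: "field_est f Df f' D K" and I: "s \<in> {0..T}" "t \<in> {0..T}" and z: "z \<in> D"
  shows "norm (\<Sum>i\<in>UNIV. \<Sum>j\<in>UNIV. xx s t i j *\<^sub>R gub f Df f' i j s z) \<le>
    CARD('i) * (CARD('i) * (B * (\<bar>t - s\<bar> powr \<alpha>)\<^sup>2 * (K * K + K)))"
  by (intro norm_sum_sum_scaleR_le xx_bound I gub_bounds(1)[OF F I z z])

text \<open>The constant is obtained before the field and its domain are fixed, as it depends on the
  field through \<open>K\<close> alone.\<close>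

lemma incr_bound:
  assumes K: "0 \<le> K"
  obtains C where "0 \<le> C" "\<And>f Df f' (D :: 'e::real_normed_vector set) s t z. field_est f Df f' D K \<Longrightarrow> s \<in> {0..T} \<Longrightarrow>
     t \<in> {0..T} \<Longrightarrow> z \<in> D \<Longrightarrow> norm (incr f Df f' s t z) \<le> C * \<bar>t - s\<bar> powr \<alpha>"
proof -
  define n where "n = real CARD('i)"
  have n: "0 \<le> n" by (simp add: n_def)
  define C where "C = n * (B * K) + n * (n * (B * T powr \<alpha> * (K * K + K)))"
  have "norm (incr f Df f' s t z) \<le> C * \<bar>t - s\<bar> powr \<alpha>"
    if F: "field_est f Df f' D K" and I: "s \<in> {0..T}" "t \<in> {0..T}" and z: "z \<in> D" for f Df f' and D :: "'e set" and s t z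
  proof -
    let ?\<tau> = "\<bar>t - s\<bar> powr \<alpha>"
    have "norm (\<Sum>i\<in>UNIV. (x t i - x s i) *\<^sub>R f i s z) \<le> n * (B * ?\<tau> * K)"
      unfolding n_def using field_estD(2)[OF F I z z] by (intro norm_sum_scaleR_le x_bound I) auto
    moreover have "norm (\<Sum>i\<in>UNIV. \<Sum>j\<in>UNIV. xx s t i j *\<^sub>R gub f Df f' i j s z) \<le> n * (n * (B * T powr \<alpha> * (K * K + K))) * ?\<tau>"
    proof -
      have "B * ?\<tau>\<^sup>2 \<le> B * T powr \<alpha> * ?\<tau>"
        using abs_powr_le[OF I, of \<alpha>] \<alpha> B by (simp add: power2_eq_square mult.assoc mult_left_mono mult_right_mono)
      hence "n * (n * (B * ?\<tau>\<^sup>2 * (K * K + K))) \<le> n * (n * (B * T powr \<alpha> * ?\<tau> * (K * K + K)))"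
        using n K by (intro mult_left_mono mult_right_mono) auto
      thus ?thesis using second_order_bound[OF F I z] by (simp add: n_def mult_ac)
    qed
    ultimately have "norm (incr f Df f' s t z) \<le> n * (B * ?\<tau> * K) + n * (n * (B * T powr \<alpha> * (K * K + K))) * ?\<tau>"
      unfolding incr_def by (rule norm_triangle_mono)
    also have "\<dots> = C * ?\<tau>" by (simp add: C_def algebra_simps)
    finally show ?thesis .
  qed
  moreover have "0 \<le> C" using n B K by (simp add: C_def)
  ultimately show thesis using that by blast
qed

lemma incr_lipschitz:
  assumes K: "0 \<le> K"
  obtains C where "0 \<le> C" "\<And>f Df f' (D :: 'e::real_normed_vector set) s t z z'. field_est f Df f' D K \<Longrightarrow> s \<in> {0..T} \<Longrightarrow>
     t \<in> {0..T} \<Longrightarrow> z \<in> D \<Longrightarrow> z' \<in> D \<Longrightarrow>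
     norm (incr f Df f' s t z - incr f Df f' s t z') \<le> C * \<bar>t - s\<bar> powr \<alpha> * norm (z - z')"
proof -
  define n where "n = real CARD('i)"
  have n: "0 \<le> n" by (simp add: n_def)
  define C where "C = n * (B * K) + n * (n * (B * T powr \<alpha> * (2 * (K * K) + K)))"
  have "norm (incr f Df f' s t z - incr f Df f' s t z') \<le> C * \<bar>t - s\<bar> powr \<alpha> * norm (z - z')"
    if F: "field_est f Df f' D K" and I: "s \<in> {0..T}" "t \<in> {0..T}" and z: "z \<in> D" "z' \<in> D"
    for f Df f' and D :: "'e set" and s t z z'
  proof -
    let ?\<tau> = "\<bar>t - s\<bar> powr \<alpha>" and ?d = "norm (z - z')"
    have "norm (\<Sum>i\<in>UNIV. (x t i - x s i) *\<^sub>R (f i s z - f i s z')) \<le> n * (B * ?\<tau> * (K * ?d))"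
      unfolding n_def using field_estD(2)[OF F I(1,1) z(2,1)] by (intro norm_sum_scaleR_le x_bound I) auto
    moreover have "norm (\<Sum>i\<in>UNIV. \<Sum>j\<in>UNIV. xx s t i j *\<^sub>R (gub f Df f' i j s z - gub f Df f' i j s z'))
       \<le> n * (n * (B * T powr \<alpha> * (2 * (K * K) + K))) * ?\<tau> * ?d"
    proof -
      have "norm (\<Sum>i\<in>UNIV. \<Sum>j\<in>UNIV. xx s t i j *\<^sub>R (gub f Df f' i j s z - gub f Df f' i j s z'))
         \<le> n * (n * (B * ?\<tau>\<^sup>2 * ((2 * (K * K) + K) * ?d)))"
        unfolding n_def using gub_bounds(2)[OF F I(1,1) z(2,1)] by (intro norm_sum_sum_scaleR_le xx_bound I) auto
      also have "\<dots> \<le> n * (n * (B * T powr \<alpha> * ?\<tau> * ((2 * (K * K) + K) * ?d)))"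
      proof -
        have "B * ?\<tau>\<^sup>2 \<le> B * T powr \<alpha> * ?\<tau>"
          using abs_powr_le[OF I, of \<alpha>] \<alpha> B by (simp add: power2_eq_square mult.assoc mult_left_mono mult_right_mono)
        thus ?thesis using n K by (intro mult_left_mono mult_right_mono) auto
      qed
      finally show ?thesis by (simp add: mult_ac)
    qed
    ultimately have "norm ((\<Sum>i\<in>UNIV. (x t i - x s i) *\<^sub>R (f i s z - f i s z')) +
        (\<Sum>i\<in>UNIV. \<Sum>j\<in>UNIV. xx s t i j *\<^sub>R (gub f Df f' i j s z - gub f Df f' i j s z')))
       \<le> n * (B * ?\<tau> * (K * ?d)) + n * (n * (B * T powr \<alpha> * (2 * (K * K) + K))) * ?\<tau> * ?d"
      by (rule norm_triangle_mono)
    also have "\<dots> = C * ?\<tau> * ?d" by (simp add: C_def algebra_simps)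
    also have "(\<Sum>i\<in>UNIV. (x t i - x s i) *\<^sub>R (f i s z - f i s z')) +
        (\<Sum>i\<in>UNIV. \<Sum>j\<in>UNIV. xx s t i j *\<^sub>R (gub f Df f' i j s z - gub f Df f' i j s z')) =
        incr f Df f' s t z - incr f Df f' s t z'"
      by (simp add: incr_def scaleR_diff_right sum_subtractf)
    finally show ?thesis .
  qed
  moreover have "0 \<le> C" using n B K by (simp add: C_def)
  ultimately show thesis using that by blast
qed

text \<open>Chen's relation rewrites the defect of the Milstein step as \<open>X\<^sub>u\<^sub>t\<close> times the remainder of
  the controlled expansion of \<open>f\<close>, which is of order 2, plus \<open>\<XX>\<^sub>u\<^sub>t\<close> times the increment of the
  Gubinelli derivative.\<close>

lemma incr_defect:
  assumes K: "0 \<le> K"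
  obtains C where "0 \<le> C" "\<And>f Df f' (D :: 'e::real_normed_vector set) s u t z. field_est f Df f' D K \<Longrightarrow> s \<in> {0..T} \<Longrightarrow>
     u \<in> {0..T} \<Longrightarrow> t \<in> {0..T} \<Longrightarrow> z \<in> D \<Longrightarrow> milstein f Df f' s u z \<in> D \<Longrightarrow>
     norm (milstein f Df f' u t (milstein f Df f' s u z) - milstein f Df f' s t z)
       \<le> C * (\<bar>u - s\<bar> + \<bar>t - u\<bar>) powr (3 * \<alpha>)"
proof -
  obtain C1 where C1: "0 \<le> C1" "\<And>f Df f' (D :: 'e set) s t z. field_est f Df f' D K \<Longrightarrow> s \<in> {0..T} \<Longrightarrow>
     t \<in> {0..T} \<Longrightarrow> z \<in> D \<Longrightarrow> norm (incr f Df f' s t z) \<le> C1 * \<bar>t - s\<bar> powr \<alpha>"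
    by (rule incr_bound[OF K]) (erule that)
  define n where "n = real CARD('i)"
  have n: "0 \<le> n" by (simp add: n_def)
  \<comment> \<open>The first summand of \<open>b\<close> comes from the controlled expansion at
    distance at most \<open>(1 + C1) * \<sigma>\<close>, the second from \<open>Df\<close> applied
    to the second-order part of the step.\<close>
  define b where "b = K * (1 + C1)\<^sup>2 + K * (n * (n * (B * (K * K + K))))"
  define C where "C = n * (B * b) + n * (n * (B * ((2 * (K * K) + K) * (1 + C1))))"
  have "norm (milstein f Df f' u t (milstein f Df f' s u z) - milstein f Df f' s t z)
       \<le> C * (\<bar>u - s\<bar> + \<bar>t - u\<bar>) powr (3 * \<alpha>)"
    if F: "field_est f Df f' D K" and I: "s \<in> {0..T}" "u \<in> {0..T}" "t \<in> {0..T}"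
      and z: "z \<in> D" "milstein f Df f' s u z \<in> D" for f Df f' and D :: "'e set" and s u t z
  proof -
    define \<sigma> where "\<sigma> = (\<bar>u - s\<bar> + \<bar>t - u\<bar>) powr \<alpha>"
    have \<sigma>: "0 \<le> \<sigma>" "\<bar>u - s\<bar> powr \<alpha> \<le> \<sigma>" "\<bar>t - u\<bar> powr \<alpha> \<le> \<sigma>"
      unfolding \<sigma>_def using \<alpha> by (auto intro!: powr_mono2)
    let ?G = "gub f Df f'"
    define y where "y = milstein f Df f' s u z"
    have yD: "y \<in> D" using z(2) by (simp add: y_def)
    have yz: "y - z = incr f Df f' s u z" by (simp add: y_def milstein_def)
    define \<rho> where "\<rho> = max (\<bar>u - s\<bar> powr \<alpha>) (norm (y - z))"
    have "norm (y - z) \<le> C1 * \<bar>u - s\<bar> powr \<alpha>" unfolding yz by (rule C1(2)[OF F I(1,2) z(1)])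
    also have "\<dots> \<le> C1 * \<sigma>" using C1(1) \<sigma> by (intro mult_left_mono)
    finally have "norm (y - z) \<le> C1 * \<sigma>" .
    moreover have "0 \<le> C1 * \<sigma>" using C1(1) \<sigma> by simp
    ultimately have \<rho>: "0 \<le> \<rho>" "\<rho> \<le> (1 + C1) * \<sigma>"
      using \<sigma> by (auto simp: \<rho>_def le_max_iff_disj algebra_simps)
    note D = field_estD(2)[OF F I(1,2) z(1) yD, folded \<rho>_def]
    have rem: "norm (f j u y - f j s z - (\<Sum>i\<in>UNIV. (x u i - x s i) *\<^sub>R ?G i j s z)) \<le> b * \<sigma>\<^sup>2" for j
    proof -
      have lin: "linear (Df j s z)" using D by blast
      have 1: "norm (f j u y - f j s z - (\<Sum>i\<in>UNIV. (x u i - x s i) *\<^sub>R f' i j s z) - Df j s z (y - z)) \<le> K * (1 + C1)\<^sup>2 * \<sigma>\<^sup>2"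
      proof -
        have "norm (f j u y - f j s z - (\<Sum>i\<in>UNIV. (x u i - x s i) *\<^sub>R f' i j s z) - Df j s z (y - z)) \<le> K * \<rho>\<^sup>2"
          using D by blast
        also have "\<dots> \<le> K * ((1 + C1) * \<sigma>)\<^sup>2" using \<rho> K by (intro mult_left_mono power_mono)
        finally show ?thesis by (simp add: power_mult_distrib mult.assoc)
      qed
      let ?S = "\<Sum>i\<in>UNIV. \<Sum>j\<in>UNIV. xx s u i j *\<^sub>R ?G i j s z"
      have 2: "norm (Df j s z ?S) \<le> K * (n * (n * (B * (K * K + K)))) * \<sigma>\<^sup>2"
      proof -
        have "norm (Df j s z ?S) \<le> K * norm ?S" using D by blast
        also have "\<dots> \<le> K * (n * (n * (B * \<sigma>\<^sup>2 * (K * K + K))))"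
        proof (intro mult_left_mono[OF _ K])
          have "norm ?S \<le> n * (n * (B * (\<bar>u - s\<bar> powr \<alpha>)\<^sup>2 * (K * K + K)))"
            unfolding n_def by (rule second_order_bound[OF F I(1,2) z(1)])
          also have "\<dots> \<le> n * (n * (B * \<sigma>\<^sup>2 * (K * K + K)))"
            using n B K \<sigma> by (intro mult_left_mono mult_right_mono power_mono) auto
          finally show "norm ?S \<le> n * (n * (B * \<sigma>\<^sup>2 * (K * K + K)))" .
        qed
        finally show ?thesis by (simp add: mult_ac)
      qed
      have "Df j s z (y - z) = (\<Sum>i\<in>UNIV. (x u i - x s i) *\<^sub>R Df j s z (f i s z)) + Df j s z ?S"
        unfolding yz incr_def using lin by (simp add: linear_add linear_sum linear_scale)
      hence "f j u y - f j s z - (\<Sum>i\<in>UNIV. (x u i - x s i) *\<^sub>R ?G i j s z) =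
         (f j u y - f j s z - (\<Sum>i\<in>UNIV. (x u i - x s i) *\<^sub>R f' i j s z) - Df j s z (y - z)) + Df j s z ?S"
        by (simp add: gub_def scaleR_add_right sum.distrib)
      also have "norm \<dots> \<le> K * (1 + C1)\<^sup>2 * \<sigma>\<^sup>2 + K * (n * (n * (B * (K * K + K)))) * \<sigma>\<^sup>2"
        by (rule norm_triangle_mono[OF 1 2])
      also have "\<dots> = b * \<sigma>\<^sup>2" by (simp add: b_def algebra_simps)
      finally show ?thesis .
    qed
    have "milstein f Df f' u t y - milstein f Df f' s t z = incr f Df f' s u z + incr f Df f' u t y - incr f Df f' s t z"
      using yz by (simp add: milstein_def)
    also have "\<dots> = (\<Sum>j\<in>UNIV. (x t j - x u j) *\<^sub>R (f j u y - f j s z - (\<Sum>i\<in>UNIV. (x u i - x s i) *\<^sub>R ?G i j s z)))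
       + (\<Sum>i\<in>UNIV. \<Sum>j\<in>UNIV. xx u t i j *\<^sub>R (?G i j u y - ?G i j s z))"
    proof -
      have e1: "(\<Sum>i\<in>UNIV. \<Sum>j\<in>UNIV. xx s t i j *\<^sub>R ?G i j s z) =
          (\<Sum>i\<in>UNIV. \<Sum>j\<in>UNIV. xx s u i j *\<^sub>R ?G i j s z) + (\<Sum>i\<in>UNIV. \<Sum>j\<in>UNIV. xx u t i j *\<^sub>R ?G i j s z)
          + (\<Sum>i\<in>UNIV. \<Sum>j\<in>UNIV. ((x u i - x s i) * (x t j - x u j)) *\<^sub>R ?G i j s z)"
        by (simp add: chen[OF I] scaleR_add_left sum.distrib)
      have e2: "(\<Sum>i\<in>UNIV. \<Sum>j\<in>UNIV. ((x u i - x s i) * (x t j - x u j)) *\<^sub>R ?G i j s z) =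
          (\<Sum>j\<in>UNIV. (x t j - x u j) *\<^sub>R (\<Sum>i\<in>UNIV. (x u i - x s i) *\<^sub>R ?G i j s z))"
        by (subst sum.swap) (simp add: scaleR_sum_right mult.commute)
      have e3: "(\<Sum>j\<in>UNIV. (x t j - x s j) *\<^sub>R f j s z) = (\<Sum>j\<in>UNIV. (x u j - x s j) *\<^sub>R f j s z) + (\<Sum>j\<in>UNIV. (x t j - x u j) *\<^sub>R f j s z)"
        by (simp flip: sum.distrib scaleR_add_left)
      show ?thesis
        unfolding incr_def e1 e2 e3 by (simp add: scaleR_diff_right sum_subtractf)
    qed
    also have "norm \<dots> \<le> n * (B * \<sigma> * (b * \<sigma>\<^sup>2)) + n * (n * (B * \<sigma>\<^sup>2 * ((2 * (K * K) + K) * ((1 + C1) * \<sigma>))))"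
      unfolding n_def
    proof (intro norm_triangle_mono norm_sum_scaleR_le norm_sum_sum_scaleR_le rem)
      show "\<bar>x t i - x u i\<bar> \<le> B * \<sigma>" for i
        using x_bound[OF I(2,3)] mult_left_mono[OF \<sigma>(3) B] by (rule order_trans)
      show "\<bar>xx u t i j\<bar> \<le> B * \<sigma>\<^sup>2" for i j
        by (rule order_trans[OF xx_bound[OF I(2,3)]]) (intro mult_left_mono power_mono \<sigma> B, simp)
      show "norm (?G i j u y - ?G i j s z) \<le> (2 * (K * K) + K) * ((1 + C1) * \<sigma>)" for i j
        by (rule order_trans[OF gub_bounds(2)[OF F I(1,2) z(1) yD, folded \<rho>_def]])
           (use \<rho> K in \<open>intro mult_left_mono, auto\<close>)
    qed
    also have "\<dots> = C * \<sigma> ^ 3" by (simp add: C_def algebra_simps power2_eq_square power3_eq_cube)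
    also have "\<sigma> ^ 3 = (\<bar>u - s\<bar> + \<bar>t - u\<bar>) powr (3 * \<alpha>)"
      by (simp add: \<sigma>_def power3_eq_cube flip: powr_add)
    finally show ?thesis by (simp add: y_def)
  qed
  moreover have "0 \<le> C" using n B K C1 by (simp add: C_def b_def)
  ultimately show thesis using that by blast
qed

text \<open>The defect estimate evaluates the field after a step, so the field estimates are asked
  for on a set \<open>D\<close> that contains the images of \<open>D0\<close>.\<close>

lemma almost_flow_milstein:
  fixes f :: "'i \<Rightarrow> real \<Rightarrow> 'e::real_normed_vector \<Rightarrow> 'e"
  assumes F: "field_est f Df f' D K" and D0: "D0 \<subseteq> D"
    and stay: "\<And>s u z. s \<in> {0..T} \<Longrightarrow> u \<in> {0..T} \<Longrightarrow> z \<in> D0 \<Longrightarrow> milstein f Df f' s u z \<in> D"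
  shows "\<exists>K. almost_flow T \<alpha> (3 * \<alpha>) (milstein f Df f') D0 K"
proof -
  note K = field_estD(1)[OF F]
  obtain C1 where C1: "0 \<le> C1" "\<And>f Df f' (D :: 'e set) s t z. field_est f Df f' D K \<Longrightarrow> s \<in> {0..T} \<Longrightarrow>
     t \<in> {0..T} \<Longrightarrow> z \<in> D \<Longrightarrow> norm (incr f Df f' s t z) \<le> C1 * \<bar>t - s\<bar> powr \<alpha>"
    by (rule incr_bound[OF K]) (erule that)
  obtain C2 where C2: "0 \<le> C2" "\<And>f Df f' (D :: 'e set) s t z z'. field_est f Df f' D K \<Longrightarrow> s \<in> {0..T} \<Longrightarrow>
     t \<in> {0..T} \<Longrightarrow> z \<in> D \<Longrightarrow> z' \<in> D \<Longrightarrow>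
     norm (incr f Df f' s t z - incr f Df f' s t z') \<le> C2 * \<bar>t - s\<bar> powr \<alpha> * norm (z - z')"
    by (rule incr_lipschitz[OF K]) (erule that)
  obtain C3 where C3: "0 \<le> C3" "\<And>f Df f' (D :: 'e set) s u t z. field_est f Df f' D K \<Longrightarrow> s \<in> {0..T} \<Longrightarrow>
     u \<in> {0..T} \<Longrightarrow> t \<in> {0..T} \<Longrightarrow> z \<in> D \<Longrightarrow> milstein f Df f' s u z \<in> D \<Longrightarrow>
     norm (milstein f Df f' u t (milstein f Df f' s u z) - milstein f Df f' s t z)
       \<le> C3 * (\<bar>u - s\<bar> + \<bar>t - u\<bar>) powr (3 * \<alpha>)"
    by (rule incr_defect[OF K]) (erule that)
  define C where "C = C1 + C2 + C3"
  have C: "C1 \<le> C" "C2 \<le> C" "C3 \<le> C" "0 \<le> C" using C1(1) C2(1) C3(1) by (auto simp: C_def)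
  have "almost_flow T \<alpha> (3 * \<alpha>) (milstein f Df f') D0 C"
    unfolding almost_flow_def
  proof (intro conjI ballI C(4))
    fix s t z assume I: "s \<in> {0..T}" "t \<in> {0..T}" and z: "z \<in> D0"
    hence zD: "z \<in> D" using D0 by auto
    show "norm (milstein f Df f' s t z - z) \<le> C * \<bar>t - s\<bar> powr \<alpha>"
      using C1(2)[OF F I zD] mult_right_mono[OF C(1), of "\<bar>t - s\<bar> powr \<alpha>"] by (simp add: milstein_def)
    show "norm (milstein f Df f' s t z - milstein f Df f' s t z' - (z - z')) \<le> C * \<bar>t - s\<bar> powr \<alpha> * norm (z - z')"
      if "z' \<in> D0" for z'
    proof -
      have "norm (incr f Df f' s t z - incr f Df f' s t z') \<le> C2 * \<bar>t - s\<bar> powr \<alpha> * norm (z - z')"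
        using that D0 by (intro C2(2)[OF F I zD]) auto
      also have "\<dots> \<le> C * \<bar>t - s\<bar> powr \<alpha> * norm (z - z')" by (intro mult_right_mono C) auto
      finally show ?thesis by (simp add: milstein_def algebra_simps)
    qed
    show "norm (milstein f Df f' u t (milstein f Df f' s u z) - milstein f Df f' s t z)
        \<le> C * (\<bar>u - s\<bar> + \<bar>t - u\<bar>) powr (3 * \<alpha>)" if "u \<in> {0..T}" for u
      by (rule order_trans[OF C3(2)[OF F I(1) that I(2) zD stay[OF I(1) that z]]]) (intro mult_right_mono C, simp)
  qed
  thus ?thesis by blast
qed

lemma local_almost_flow_milstein:
  fixes f :: "'i \<Rightarrow> real \<Rightarrow> 'e::real_normed_vector \<Rightarrow> 'e"
  assumes F: "\<And>R. \<exists>K. field_est f Df f' (cball 0 R) K"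
  shows "local_almost_flow T \<alpha> (3 * \<alpha>) (milstein f Df f')"
  unfolding local_almost_flow_def
proof
  fix R
  obtain K where K: "field_est f Df f' (cball 0 R) K" using F by blast
  obtain C where C: "0 \<le> C" "\<And>f Df f' (D :: 'e set) s t z. field_est f Df f' D K \<Longrightarrow> s \<in> {0..T} \<Longrightarrow>
     t \<in> {0..T} \<Longrightarrow> z \<in> D \<Longrightarrow> norm (incr f Df f' s t z) \<le> C * \<bar>t - s\<bar> powr \<alpha>"
    by (rule incr_bound[OF field_estD(1)[OF K]]) (erule that)
  obtain K' where K': "field_est f Df f' (cball 0 (R + C * T powr \<alpha>)) K'" using F by blast
  show "\<exists>K. almost_flow T \<alpha> (3 * \<alpha>) (milstein f Df f') (cball 0 R) K"
  proof (rule almost_flow_milstein[OF K'])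
    show "cball 0 R \<subseteq> cball 0 (R + C * T powr \<alpha>)" using C(1) by (intro subset_cball) simp
    fix s u and z :: 'e assume I: "s \<in> {0..T}" "u \<in> {0..T}" and z: "z \<in> cball 0 R"
    have "norm (incr f Df f' s u z) \<le> C * \<bar>u - s\<bar> powr \<alpha>" by (rule C(2)[OF K I z])
    also have "\<dots> \<le> C * T powr \<alpha>" using C(1) \<alpha> I by (intro mult_left_mono abs_powr_le) auto
    finally show "milstein f Df f' s u z \<in> cball 0 (R + C * T powr \<alpha>)"
      using z norm_triangle_ineq[of z "incr f Df f' s u z"] by (simp add: milstein_def)
  qed
qed

end

section \<open>Vector fields built from jets\<close>

abbreviation nrm :: "'w::real_normed_vector list \<Rightarrow> real" where
  "nrm ws \<equiv> prod_list (map norm ws)"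

lemma nrm_nonneg: "0 \<le> nrm ws"
  by (induction ws) auto

lemma nrm_le_power: "(\<And>w. w \<in> set ws \<Longrightarrow> norm w \<le> R) \<Longrightarrow> 0 \<le> R \<Longrightarrow> nrm ws \<le> (1 + R) ^ length ws"
proof (induction ws)
  case (Cons w ws)
  have "norm w \<le> 1 + R" "nrm ws \<le> (1 + R) ^ length ws" using Cons by (auto simp: add_increasing)
  thus ?case using nrm_nonneg[of ws] Cons.prems(2) by (simp add: mult_mono)
qed simp

lemma multilin_linear: "multilin j A \<Longrightarrow> length us + length vs + 1 = j \<Longrightarrow> linear (\<lambda>w. A (us @ w # vs))"
  by (simp add: multilin_def)

lemma multilin_Cons: "multilin (Suc n) A \<Longrightarrow> multilin n (\<lambda>ws. A (w # ws))"
  using multilin_linear[of "Suc n" A "w # _"] by (simp add: multilin_def)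

lemma multilin_snoc: "multilin (Suc n) A \<Longrightarrow> multilin n (\<lambda>ws. A (ws @ [w]))"
  using multilin_linear[of "Suc n" A _ "_ @ [w]"] by (simp add: multilin_def)

lemma multilin_linear_update:
  assumes "multilin n A" "length ws = n" "i < n"
  shows "linear (\<lambda>w. A (ws[i := w]))"
  using multilin_linear[OF assms(1), of "take i ws" "drop (Suc i) ws"] assms(2,3)
  by (simp add: upd_conv_take_nth_drop)

text \<open>The arguments are exchanged one at a time. Powers of \<open>1 + R\<close> instead of
  \<open>R\<close> keep the bounds for different lengths comparable.\<close>

lemma multilin_diff_bound:
  fixes K R d :: real
  assumes "list_all2 (\<lambda>w v. norm (w - v) \<le> d) W V" "multilin (length W) A"
    and "\<And>ws. length ws = length W \<Longrightarrow> norm (A ws) \<le> K * nrm ws"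
    and "\<And>w. w \<in> set W \<union> set V \<Longrightarrow> norm w \<le> R" "0 \<le> K" "0 \<le> R" "0 \<le> d"
  shows "norm (A W - A V) \<le> length W * K * (1 + R) ^ length W * d"
  using assms
proof (induction W V arbitrary: A K rule: list_all2_induct)
  case (Cons w W v V)
  let ?n = "length W" and ?P = "(1 + R) ^ length W"
  have P: "1 \<le> ?P" using Cons by (simp add: one_le_power)
  have lin: "linear (\<lambda>w. A (w # W))" using multilin_linear[OF Cons.prems(1), of "[]" W] by simp
  have "norm (A ((w - v) # W)) \<le> K * (norm (w - v) * nrm W)" using Cons.prems(2)[of "(w - v) # W"] by simp
  also have "\<dots> \<le> K * (d * ?P)"
    using Cons by (intro mult_left_mono mult_mono nrm_le_power nrm_nonneg) auto
  finally have 1: "norm (A (w # W) - A (v # W)) \<le> K * (d * ?P)"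
    using linear_diff[OF lin] by simp
  have "norm (A (v # W) - A (v # V)) \<le> ?n * (K * (1 + R)) * ?P * d"
  proof (rule Cons.IH)
    show "multilin ?n (\<lambda>ws. A (v # ws))" using Cons.prems(1) by (simp add: multilin_Cons)
    show "norm (A (v # ws)) \<le> K * (1 + R) * nrm ws" if "length ws = ?n" for ws
    proof -
      have "norm (A (v # ws)) \<le> K * norm v * nrm ws" using Cons.prems(2)[of "v # ws"] that by (simp add: mult.assoc)
      also have "\<dots> \<le> K * (1 + R) * nrm ws"
        using Cons.prems by (intro mult_right_mono mult_left_mono nrm_nonneg) (auto simp: add_increasing)
      finally show ?thesis .
    qed
  qed (use Cons.prems in auto)
  with 1 have "norm (A (w # W) - A (v # V)) \<le> K * (d * ?P) + ?n * (K * (1 + R)) * ?P * d"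
    by (rule norm_diff_triangle_le)
  also have "K * (d * ?P) \<le> (1 + R) * (K * (d * ?P))"
    using mult_right_mono[of 1 "1 + R" "K * (d * ?P)"] Cons.prems P by simp
  finally show ?case by (simp add: algebra_simps)
qed simp

text \<open>The subtracted sum is the derivative of \<open>A\<close> at \<open>V\<close> in
  direction \<open>W - V\<close>. Changing the first argument while the others move gives an error
  with two small factors; the remaining arguments are treated by induction.\<close>

lemma multilin_second_order:
  fixes K R d :: real
  assumes "list_all2 (\<lambda>w v. norm (w - v) \<le> d) W V" "multilin (length W) A"
    and "\<And>ws. length ws = length W \<Longrightarrow> norm (A ws) \<le> K * nrm ws"
    and "\<And>w. w \<in> set W \<union> set V \<Longrightarrow> norm w \<le> R" "0 \<le> K" "0 \<le> R" "0 \<le> d"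
  shows "norm (A W - A V - (\<Sum>i<length W. A (V[i := W ! i - V ! i]))) \<le> (length W)\<^sup>2 * K * (1 + R) ^ length W * d\<^sup>2"
  using assms
proof (induction W V arbitrary: A K rule: list_all2_induct)
  case (Cons w W v V)
  let ?n = "length W" and ?P = "(1 + R) ^ length W"
  have P: "1 \<le> ?P" using Cons by (simp add: one_le_power)
  have len: "length V = ?n" using Cons by (simp add: list_all2_lengthD)
  have lin: "linear (\<lambda>w. A (w # W))" using multilin_linear[OF Cons.prems(1), of "[]" W] by simp
  have bnd: "norm (A (u # ws)) \<le> K * c * nrm ws" if "length ws = ?n" "norm u \<le> c" for u c ws
  proof -
    have "norm (A (u # ws)) \<le> K * norm u * nrm ws" using Cons.prems(2)[of "u # ws"] that by (simp add: mult.assoc)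
    also have "\<dots> \<le> K * c * nrm ws"
      using Cons.prems that by (intro mult_right_mono mult_left_mono nrm_nonneg) auto
    finally show ?thesis .
  qed
  have 1: "norm (A ((w - v) # W) - A ((w - v) # V)) \<le> ?n * (K * d) * ?P * d"
    by (rule multilin_diff_bound[OF Cons.hyps(2)])
       (use Cons bnd in \<open>auto simp: multilin_Cons\<close>)
  have 2: "norm (A (v # W) - A (v # V) - (\<Sum>i<?n. A (v # V[i := W ! i - V ! i]))) \<le> ?n\<^sup>2 * (K * (1 + R)) * ?P * d\<^sup>2"
  proof (rule Cons.IH)
    show "norm (A (v # ws)) \<le> K * (1 + R) * nrm ws" if "length ws = ?n" for ws
      using that Cons.prems by (intro bnd) (auto simp: add_increasing)
  qed (use Cons.prems in \<open>auto simp: multilin_Cons\<close>)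
  have "(\<Sum>i<length (w # W). A ((v # V)[i := (w # W) ! i - (v # V) ! i])) =
      A ((w - v) # V) + (\<Sum>i<?n. A (v # V[i := W ! i - V ! i]))"
    unfolding length_Cons sum.lessThan_Suc_shift by simp
  hence "A (w # W) - A (v # V) - (\<Sum>i<length (w # W). A ((v # V)[i := (w # W) ! i - (v # V) ! i])) =
      (A ((w - v) # W) - A ((w - v) # V)) + (A (v # W) - A (v # V) - (\<Sum>i<?n. A (v # V[i := W ! i - V ! i])))"
    using linear_diff[OF lin, of w v] by simp
  also have "norm \<dots> \<le> ?n * (K * d) * ?P * d + ?n\<^sup>2 * (K * (1 + R)) * ?P * d\<^sup>2"
    by (rule norm_triangle_mono[OF 1 2])
  also have "?n * (K * d) * ?P * d \<le> (1 + R) * (?n * (K * d) * ?P * d)"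
    using mult_right_mono[of 1 "1 + R" "?n * (K * d) * ?P * d"] Cons.prems P by simp
  also have "(1 + R) * (?n * (K * d) * ?P * d) + ?n\<^sup>2 * (K * (1 + R)) * ?P * d\<^sup>2 =
      (?n + ?n\<^sup>2) * (K * ((1 + R) * ?P) * d\<^sup>2)"
    by (simp add: algebra_simps power2_eq_square)
  also have "\<dots> \<le> (length (w # W))\<^sup>2 * (K * ((1 + R) * ?P) * d\<^sup>2)"
    using Cons.prems P by (intro mult_right_mono) (auto simp: power2_eq_square algebra_simps)
  finally show ?case by (simp add: mult.assoc)
qed simp

lemma has_derivative_quadratic:
  assumes f': "bounded_linear f'" and q: "\<And>y. norm (y - x) < 1 \<Longrightarrow> norm (f y - f x - f' (y - x)) \<le> C * (norm (y - x))\<^sup>2"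
  shows "(f has_derivative f') (at x)"
  unfolding has_derivative_at_alt
proof (intro conjI f' allI impI)
  fix e :: real assume e: "0 < e"
  define d where "d = min 1 (e / (\<bar>C\<bar> + 1))"
  have "norm (f y - f x - f' (y - x)) \<le> e * norm (y - x)" if y: "norm (y - x) < d" for y
  proof -
    have "C * norm (y - x) \<le> (\<bar>C\<bar> + 1) * norm (y - x)" by (intro mult_right_mono) auto
    also have "norm (y - x) \<le> e / (\<bar>C\<bar> + 1)" using y by (simp add: d_def)
    hence "(\<bar>C\<bar> + 1) * norm (y - x) \<le> e" by (simp add: pos_le_divide_eq mult.commute)
    finally have "C * norm (y - x) * norm (y - x) \<le> e * norm (y - x)" by (intro mult_right_mono) auto
    thus ?thesis using q[of y] y by (simp add: d_def power2_eq_square mult.assoc)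
  qed
  thus "\<exists>d>0. \<forall>y. norm (y - x) < d \<longrightarrow> norm (f y - f x - f' (y - x)) \<le> e * norm (y - x)"
    using e by (intro exI[of _ d]) (auto simp: d_def)
qed

text \<open>Norm at most 1 keeps the estimates below independent of the particular linear maps in a
  term.\<close>

definition contr :: "('a::real_normed_vector \<Rightarrow> 'b::real_normed_vector) \<Rightarrow> bool" where
  "contr f \<longleftrightarrow> linear f \<and> (\<forall>x. norm (f x) \<le> norm x)"

lemma contr_o: "contr f \<Longrightarrow> contr g \<Longrightarrow> contr (f \<circ> g)"
  unfolding contr_def by (auto intro: linear_compose order_trans)

text \<open>The term \<open>(e, l\<^sub>0, [l\<^sub>1, \<dots>, l\<^sub>n])\<close> stands for the vector field
  \<open>z \<mapsto> e (\<partial>\<^sup>n g (l\<^sub>0 z) (l\<^sub>1 z, \<dots>, l\<^sub>n z))\<close>; finite sums of such fields are closed under passing to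
  the tangent field.\<close>

type_synonym ('w, 'e) trm = "('w \<Rightarrow> 'e) \<times> ('e \<Rightarrow> 'w) \<times> ('e \<Rightarrow> 'w) list"
type_synonym 'w jet = "nat \<Rightarrow> 'w \<Rightarrow> 'w list \<Rightarrow> 'w"

fun app_term :: "'w jet \<Rightarrow> ('w, 'e) trm \<Rightarrow> 'e \<Rightarrow> 'e" where
  "app_term g (e, l0, ls) z = e (g (length ls) (l0 z) (map (\<lambda>l. l z) ls))"

fun diff_term :: "('w::real_normed_vector) jet \<Rightarrow> ('w, 'e) trm \<Rightarrow> 'e \<Rightarrow> 'e \<Rightarrow> 'e" where
  "diff_term g (e, l0, ls) z h = e (g (Suc (length ls)) (l0 z) (map (\<lambda>l. l z) ls @ [l0 h])
     + (\<Sum>i<length ls. g (length ls) (l0 z) ((map (\<lambda>l. l z) ls)[i := (ls ! i) h])))"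

definition fld :: "('w, 'e) trm list \<Rightarrow> 'w jet \<Rightarrow> 'e::real_normed_vector \<Rightarrow> 'e" where
  "fld ts g z = (\<Sum>\<tau>\<leftarrow>ts. app_term g \<tau> z)"

definition dfld :: "('w, 'e) trm list \<Rightarrow> ('w::real_normed_vector) jet \<Rightarrow> 'e::real_normed_vector \<Rightarrow> 'e \<Rightarrow> 'e" where
  "dfld ts g z h = (\<Sum>\<tau>\<leftarrow>ts. diff_term g \<tau> z h)"

fun term_ok :: "nat \<Rightarrow> ('w::real_normed_vector, 'e::real_normed_vector) trm \<Rightarrow> bool" where
  "term_ok N (e, l0, ls) \<longleftrightarrow> contr e \<and> contr l0 \<and> (\<forall>l\<in>set ls. contr l) \<and> length ls \<le> N"

text \<open>The base point and the tangent arguments are constrained separately, so that for bounded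
  fields the base point may range over the whole space.\<close>

fun term_in :: "'w set \<Rightarrow> real \<Rightarrow> 'e \<Rightarrow> ('w::real_normed_vector, 'e) trm \<Rightarrow> bool" where
  "term_in D R z (e, l0, ls) \<longleftrightarrow> l0 z \<in> D \<and> (\<forall>l\<in>set ls. norm (l z) \<le> R)"

definition jet_bound :: "nat \<Rightarrow> 'w::real_normed_vector set \<Rightarrow> real \<Rightarrow> 'w jet \<Rightarrow> bool" where
  "jet_bound N D K g \<longleftrightarrow> (\<forall>j\<le>N. \<forall>x\<in>D. multilin j (g j x) \<and> (\<forall>ws. length ws = j \<longrightarrow> norm (g j x ws) \<le> K * nrm ws))"

lemma jet_boundD:
  assumes "jet_bound N D K g" "j \<le> N" "x \<in> D"
  shows "multilin j (g j x)" "length ws = j \<Longrightarrow> norm (g j x ws) \<le> K * nrm ws"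
  using assms by (auto simp: jet_bound_def)

lemma norm_sum_list_le:
  fixes C :: real
  assumes "\<And>\<tau>. \<tau> \<in> set ts \<Longrightarrow> norm (f \<tau>) \<le> C"
  shows "norm (\<Sum>\<tau>\<leftarrow>ts. f \<tau>) \<le> length ts * C"
  using assms
proof (induction ts)
  case (Cons \<tau> ts)
  have "norm (f \<tau> + (\<Sum>\<tau>\<leftarrow>ts. f \<tau>)) \<le> C + length ts * C"
    using Cons by (intro norm_triangle_mono) auto
  thus ?case by (simp add: algebra_simps)
qed simp

text \<open>The square is \<open>1 + 2 * n + n\<^sup>2\<close>, which counts the errors in
  \<open>fld_second_order\<close>: one controlled remainder, \<open>n\<close> for moving the
  arguments of \<open>c\<close>, \<open>n\<close> for those of the next derivative, and
  \<open>n\<^sup>2\<close> from \<open>multilin_second_order\<close>.\<close>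

definition term_const :: "nat \<Rightarrow> real \<Rightarrow> real" where
  "term_const N R = (1 + real N)\<^sup>2 * (1 + R) ^ N"

lemma term_const_ge:
  assumes "n \<le> N" "0 \<le> R"
  shows "(1 + R) ^ n \<le> term_const N R" "(1 + real n)\<^sup>2 * (1 + R) ^ n \<le> term_const N R"
proof -
  have 1: "(1 + R) ^ n \<le> (1 + R) ^ N" using assms by (intro power_increasing) auto
  show 2: "(1 + real n)\<^sup>2 * (1 + R) ^ n \<le> term_const N R"
    unfolding term_const_def using assms 1 by (intro mult_mono power_mono) auto
  have "1 * (1 + R) ^ n \<le> (1 + real n)\<^sup>2 * (1 + R) ^ n" using assms by (intro mult_right_mono) auto
  thus "(1 + R) ^ n \<le> term_const N R" using 2 by simp
qed

lemma term_values:
  assumes "term_ok N (e, l0, ls)" "term_in D R z1 (e, l0, ls)" "term_in D R z0 (e, l0, ls)"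
  shows "list_all2 (\<lambda>w v. norm (w - v) \<le> norm (z1 - z0)) (map (\<lambda>l. l z1) ls) (map (\<lambda>l. l z0) ls)"
    and "\<And>w. w \<in> set (map (\<lambda>l. l z1) ls) \<union> set (map (\<lambda>l. l z0) ls) \<Longrightarrow> norm w \<le> R"
proof -
  have "norm (l z1 - l z0) \<le> norm (z1 - z0)" if "l \<in> set ls" for l
    using assms(1) that by (auto simp: contr_def simp flip: linear_diff)
  thus "list_all2 (\<lambda>w v. norm (w - v) \<le> norm (z1 - z0)) (map (\<lambda>l. l z1) ls) (map (\<lambda>l. l z0) ls)"
    by (simp add: list_all2_conv_all_nth)
  show "norm w \<le> R" if "w \<in> set (map (\<lambda>l. l z1) ls) \<union> set (map (\<lambda>l. l z0) ls)" for w
    using assms(2,3) that by auto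
qed

lemma fld_bound:
  fixes K R :: real
  assumes ok: "\<And>\<tau>. \<tau> \<in> set ts \<Longrightarrow> term_ok N \<tau> \<and> term_in D R z \<tau>" and g: "jet_bound N D K g" and KR: "0 \<le> K" "0 \<le> R"
  shows "norm (fld ts g z) \<le> length ts * (K * term_const N R)"
  unfolding fld_def
proof (rule norm_sum_list_le)
  fix \<tau> assume "\<tau> \<in> set ts"
  moreover obtain e l0 ls where \<tau>: "\<tau> = (e, l0, ls)" by (cases \<tau>)
  ultimately have t: "term_ok N (e, l0, ls)" "term_in D R z (e, l0, ls)" using ok by auto
  let ?W = "map (\<lambda>l. l z) ls"
  have "norm (app_term g \<tau> z) \<le> norm (g (length ls) (l0 z) ?W)" using t by (auto simp: \<tau> contr_def)
  also have "\<dots> \<le> K * nrm ?W" using t by (intro jet_boundD(2)[OF g]) auto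
  also have "\<dots> \<le> K * (1 + R) ^ length ?W" using t KR by (intro mult_left_mono nrm_le_power) auto
  also have "\<dots> \<le> K * term_const N R" using t KR term_const_ge(1)[of "length ls" N R] by (intro mult_left_mono) auto
  finally show "norm (app_term g \<tau> z) \<le> K * term_const N R" .
qed

lemma fld_lipschitz:
  fixes K R \<delta> :: real
  assumes ok: "\<And>\<tau>. \<tau> \<in> set ts \<Longrightarrow> term_ok N \<tau> \<and> term_in D R z0 \<tau> \<and> term_in D R z1 \<tau>"
    and g: "jet_bound N D K g0" and KR: "0 \<le> K" "0 \<le> R" "0 \<le> \<delta>"
    and lip: "\<And>j x0 x1 ws. j \<le> N \<Longrightarrow> x0 \<in> D \<Longrightarrow> x1 \<in> D \<Longrightarrow> length ws = j \<Longrightarrow>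
       norm (g1 j x1 ws - g0 j x0 ws) \<le> K * max \<delta> (norm (x1 - x0)) * nrm ws"
  shows "norm (fld ts g1 z1 - fld ts g0 z0) \<le> length ts * (K * max \<delta> (norm (z1 - z0)) * term_const N R)"
  unfolding fld_def sum_list_subtractf[symmetric]
proof (rule norm_sum_list_le)
  fix \<tau> assume "\<tau> \<in> set ts"
  moreover obtain e l0 ls where \<tau>: "\<tau> = (e, l0, ls)" by (cases \<tau>)
  ultimately have t: "term_ok N (e, l0, ls)" "term_in D R z1 (e, l0, ls)" "term_in D R z0 (e, l0, ls)" using ok by auto
  let ?W1 = "map (\<lambda>l. l z1) ls" and ?W0 = "map (\<lambda>l. l z0) ls" and ?n = "length ls" and ?\<rho> = "max \<delta> (norm (z1 - z0))"
  have \<rho>: "0 \<le> ?\<rho>" using KR by simp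
  have "norm (l0 z1 - l0 z0) \<le> norm (z1 - z0)" using t by (auto simp: contr_def simp flip: linear_diff)
  hence le: "max \<delta> (norm (l0 z1 - l0 z0)) \<le> ?\<rho>" by auto
  have "norm (g1 ?n (l0 z1) ?W1 - g0 ?n (l0 z0) ?W1) \<le> K * max \<delta> (norm (l0 z1 - l0 z0)) * nrm ?W1"
    using t by (intro lip) auto
  also have "\<dots> \<le> K * ?\<rho> * (1 + R) ^ length ?W1"
    using t KR le \<rho> by (intro mult_mono mult_left_mono nrm_le_power nrm_nonneg) auto
  finally have 1: "norm (g1 ?n (l0 z1) ?W1 - g0 ?n (l0 z0) ?W1) \<le> K * ?\<rho> * (1 + R) ^ ?n" by simp
  have "norm (g0 ?n (l0 z0) ?W1 - g0 ?n (l0 z0) ?W0) \<le> length ?W1 * K * (1 + R) ^ length ?W1 * norm (z1 - z0)"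
    by (rule multilin_diff_bound[OF term_values(1)[OF t] _ _ term_values(2)[OF t]])
       (use t KR jet_boundD[OF g] in auto)
  also have "\<dots> \<le> length ?W1 * K * (1 + R) ^ length ?W1 * ?\<rho>" using KR by (intro mult_left_mono) auto
  finally have 2: "norm (g0 ?n (l0 z0) ?W1 - g0 ?n (l0 z0) ?W0) \<le> ?n * K * (1 + R) ^ ?n * ?\<rho>" by simp
  have "norm (app_term g1 \<tau> z1 - app_term g0 \<tau> z0) \<le> norm (g1 ?n (l0 z1) ?W1 - g0 ?n (l0 z0) ?W0)"
    using t by (auto simp: \<tau> contr_def simp flip: linear_diff)
  also have "\<dots> \<le> K * ?\<rho> * (1 + R) ^ ?n + ?n * K * (1 + R) ^ ?n * ?\<rho>" by (rule norm_diff_triangle_le[OF 1 2])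
  also have "\<dots> = (1 + ?n) * (K * ?\<rho> * (1 + R) ^ ?n)" by (simp add: algebra_simps)
  also have "\<dots> \<le> (1 + real ?n)\<^sup>2 * (K * ?\<rho> * (1 + R) ^ ?n)"
    using KR \<rho> by (intro mult_right_mono) (auto simp: power2_eq_square)
  also have "\<dots> = K * ?\<rho> * ((1 + real ?n)\<^sup>2 * (1 + R) ^ ?n)" by (simp add: mult_ac)
  also have "\<dots> \<le> K * ?\<rho> * term_const N R" using t KR \<rho> by (intro mult_left_mono term_const_ge(2)) auto
  finally show "norm (app_term g1 \<tau> z1 - app_term g0 \<tau> z0) \<le> K * ?\<rho> * term_const N R" .
qed

text \<open>The jet \<open>c\<close> is the first-order change in time: the field \<open>f'\<close>
  paired with the increment of the path, or 0 at a fixed time. It is of size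
  \<open>K * \<delta>\<close>, so moving its arguments is already an error of second order.\<close>

lemma fld_second_order:
  fixes K R \<delta> :: real
  assumes ok: "\<And>\<tau>. \<tau> \<in> set ts \<Longrightarrow> term_ok N \<tau> \<and> term_in D R z0 \<tau> \<and> term_in D R z1 \<tau>"
    and g: "jet_bound (Suc N) D K g0" and c: "jet_bound N D (K * \<delta>) c" and KR: "0 \<le> K" "0 \<le> R" "0 \<le> \<delta>"
    and sec: "\<And>j x0 x1 ws. j \<le> N \<Longrightarrow> x0 \<in> D \<Longrightarrow> x1 \<in> D \<Longrightarrow> length ws = j \<Longrightarrow>
       norm (g1 j x1 ws - g0 j x0 ws - c j x0 ws - g0 (Suc j) x0 (ws @ [x1 - x0])) \<le> K * (max \<delta> (norm (x1 - x0)))\<^sup>2 * nrm ws"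
  shows "norm (fld ts g1 z1 - fld ts g0 z0 - fld ts c z0 - dfld ts g0 z0 (z1 - z0)) \<le>
     length ts * (K * (max \<delta> (norm (z1 - z0)))\<^sup>2 * term_const N R)"
  unfolding fld_def dfld_def sum_list_subtractf[symmetric]
proof (rule norm_sum_list_le)
  fix \<tau> assume "\<tau> \<in> set ts"
  moreover obtain e l0 ls where \<tau>: "\<tau> = (e, l0, ls)" by (cases \<tau>)
  ultimately have t: "term_ok N (e, l0, ls)" "term_in D R z1 (e, l0, ls)" "term_in D R z0 (e, l0, ls)" using ok by auto
  let ?W1 = "map (\<lambda>l. l z1) ls" and ?W0 = "map (\<lambda>l. l z0) ls" and ?n = "length ls" and ?\<rho> = "max \<delta> (norm (z1 - z0))"
  let ?x1 = "l0 z1" and ?x0 = "l0 z0" and ?P = "(1 + R) ^ length ls" and ?d = "norm (z1 - z0)"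
  have \<rho>: "0 \<le> ?\<rho>" using KR by simp
  have lin: "linear e" "linear l0" "l \<in> set ls \<Longrightarrow> linear l" for l using t by (auto simp: contr_def)
  have x: "?x1 \<in> D" "?x0 \<in> D" "?n \<le> N" "norm (?x1 - ?x0) \<le> ?d" using t by (auto simp: contr_def simp flip: linear_diff)
  hence le: "max \<delta> (norm (?x1 - ?x0)) \<le> ?\<rho>" by auto
  note W = term_values[OF t]
  have "norm (g1 ?n ?x1 ?W1 - g0 ?n ?x0 ?W1 - c ?n ?x0 ?W1 - g0 (Suc ?n) ?x0 (?W1 @ [?x1 - ?x0]))
      \<le> K * (max \<delta> (norm (?x1 - ?x0)))\<^sup>2 * nrm ?W1"
    using x by (intro sec) auto
  also have "\<dots> \<le> K * ?\<rho>\<^sup>2 * (1 + R) ^ length ?W1"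
    using t KR le \<rho> by (intro mult_mono mult_left_mono power_mono nrm_le_power nrm_nonneg) auto
  finally have 1: "norm (g1 ?n ?x1 ?W1 - g0 ?n ?x0 ?W1 - c ?n ?x0 ?W1 - g0 (Suc ?n) ?x0 (?W1 @ [?x1 - ?x0])) \<le> K * ?\<rho>\<^sup>2 * ?P" by simp
  have "norm (c ?n ?x0 ?W1 - c ?n ?x0 ?W0) \<le> length ?W1 * (K * \<delta>) * (1 + R) ^ length ?W1 * ?d"
    by (rule multilin_diff_bound[OF W(1) _ _ W(2)]) (use x KR jet_boundD[OF c] in auto)
  also have "\<dots> = ?n * K * ?P * (\<delta> * ?d)" by (simp add: mult_ac)
  also have "\<dots> \<le> ?n * K * ?P * (?\<rho> * ?\<rho>)" using KR \<rho> by (intro mult_left_mono mult_mono) auto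
  finally have 2: "norm (c ?n ?x0 ?W1 - c ?n ?x0 ?W0) \<le> ?n * K * ?P * (?\<rho> * ?\<rho>)" .
  have "norm (g0 (Suc ?n) ?x0 (?W1 @ [?x1 - ?x0]) - g0 (Suc ?n) ?x0 (?W0 @ [?x1 - ?x0])) \<le>
      length ?W1 * (K * ?d) * (1 + R) ^ length ?W1 * ?d"
  proof (rule multilin_diff_bound[OF W(1) _ _ W(2)])
    show "multilin (length ?W1) (\<lambda>ws. g0 (Suc ?n) ?x0 (ws @ [?x1 - ?x0]))"
      using jet_boundD(1)[OF g, of "Suc ?n" ?x0] x by (auto intro: multilin_snoc)
    show "norm (g0 (Suc ?n) ?x0 (ws @ [?x1 - ?x0])) \<le> K * ?d * nrm ws" if "length ws = length ?W1" for ws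
    proof -
      have "norm (g0 (Suc ?n) ?x0 (ws @ [?x1 - ?x0])) \<le> K * (nrm ws * norm (?x1 - ?x0))"
        using jet_boundD(2)[OF g, of "Suc ?n" ?x0 "ws @ [?x1 - ?x0]"] x that by simp
      also have "\<dots> \<le> K * (nrm ws * ?d)" using x KR nrm_nonneg by (intro mult_left_mono) auto
      finally show ?thesis by (simp add: mult_ac)
    qed
  qed (use KR in auto)
  also have "\<dots> = ?n * K * ?P * (?d * ?d)" by (simp add: mult_ac)
  also have "\<dots> \<le> ?n * K * ?P * (?\<rho> * ?\<rho>)" using KR \<rho> by (intro mult_left_mono mult_mono) auto
  finally have 3: "norm (g0 (Suc ?n) ?x0 (?W1 @ [?x1 - ?x0]) - g0 (Suc ?n) ?x0 (?W0 @ [?x1 - ?x0])) \<le> ?n * K * ?P * (?\<rho> * ?\<rho>)" .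
  have "norm (g0 ?n ?x0 ?W1 - g0 ?n ?x0 ?W0 - (\<Sum>i<length ?W1. g0 ?n ?x0 (?W0[i := ?W1 ! i - ?W0 ! i])))
      \<le> (length ?W1)\<^sup>2 * K * (1 + R) ^ length ?W1 * ?d\<^sup>2"
    by (rule multilin_second_order[OF W(1) _ _ W(2)]) (use x KR jet_boundD[OF g, of ?n] in auto)
  also have "\<dots> \<le> (length ?W1)\<^sup>2 * K * (1 + R) ^ length ?W1 * ?\<rho>\<^sup>2" using KR by (intro mult_left_mono power_mono) auto
  also have "(\<Sum>i<length ?W1. g0 ?n ?x0 (?W0[i := ?W1 ! i - ?W0 ! i])) = (\<Sum>i<?n. g0 ?n ?x0 (?W0[i := (ls ! i) (z1 - z0)]))"
    using lin by (intro sum.cong) (auto simp: linear_diff)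
  finally have 4: "norm (g0 ?n ?x0 ?W1 - g0 ?n ?x0 ?W0 - (\<Sum>i<?n. g0 ?n ?x0 (?W0[i := (ls ! i) (z1 - z0)]))) \<le> ?n\<^sup>2 * K * ?P * ?\<rho>\<^sup>2"
    by simp
  let ?E = "g1 ?n ?x1 ?W1 - g0 ?n ?x0 ?W0 - c ?n ?x0 ?W0 -
     (g0 (Suc ?n) ?x0 (?W0 @ [?x1 - ?x0]) + (\<Sum>i<?n. g0 ?n ?x0 (?W0[i := (ls ! i) (z1 - z0)])))"
  have "norm ?E \<le> K * ?\<rho>\<^sup>2 * ?P + ?n * K * ?P * (?\<rho> * ?\<rho>) + ?n * K * ?P * (?\<rho> * ?\<rho>) + ?n\<^sup>2 * K * ?P * ?\<rho>\<^sup>2"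
    using norm_triangle_mono[OF norm_triangle_mono[OF norm_triangle_mono[OF 1 2] 3] 4] by (simp add: algebra_simps)
  also have "\<dots> = K * ?\<rho>\<^sup>2 * ((1 + real ?n)\<^sup>2 * ?P)" by (simp add: power2_eq_square algebra_simps)
  also have "\<dots> \<le> K * ?\<rho>\<^sup>2 * term_const N R" using x KR by (intro mult_left_mono term_const_ge(2)) auto
  finally have "norm ?E \<le> K * ?\<rho>\<^sup>2 * term_const N R" .
  moreover have "app_term g1 \<tau> z1 - app_term g0 \<tau> z0 - app_term c \<tau> z0 - diff_term g0 \<tau> z0 (z1 - z0) = e ?E"
    by (simp add: \<tau> linear_diff[OF lin(1)] linear_diff[OF lin(2)])
  moreover have "norm (e ?E) \<le> norm ?E" using t by (auto simp: contr_def)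
  ultimately show "norm (app_term g1 \<tau> z1 - app_term g0 \<tau> z0 - app_term c \<tau> z0 - diff_term g0 \<tau> z0 (z1 - z0)) \<le> K * ?\<rho>\<^sup>2 * term_const N R"
    by simp
qed

lemma sum_list_upt_eq_sum: "(\<Sum>i\<leftarrow>[0..<n]. f i) = (\<Sum>i<n. f i)"
  by (simp add: interv_sum_list_conv_sum_set_nat atLeast0LessThan)

lemma sum_list_concat_map: "(\<Sum>x\<leftarrow>concat (map h ts). f x) = (\<Sum>\<tau>\<leftarrow>ts. \<Sum>x\<leftarrow>h \<tau>. f x)"
  by (induction ts) auto

section \<open>Tangent fields and second derivatives of sums of terms\<close>

context doubling
begin

text \<open>The head is the value of the term, placed in the base component. The other terms are the
  summands of the product rule, placed in the tangent component; the direction is read off by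
  \<open>r\<close>.\<close>

fun tan_term :: "('w::real_normed_vector, 'e) trm \<Rightarrow> ('w, 'e) trm list" where
  "tan_term (e, l0, ls) =
     ((\<lambda>w. pr (e w) 0), l0 \<circ> l, map (\<lambda>f. f \<circ> l) ls) #
     ((\<lambda>w. pr 0 (e w)), l0 \<circ> l, map (\<lambda>f. f \<circ> l) ls @ [l0 \<circ> r]) #
     map (\<lambda>i. ((\<lambda>w. pr 0 (e w)), l0 \<circ> l, (map (\<lambda>f. f \<circ> l) ls)[i := ls ! i \<circ> r])) [0..<length ls]"

definition tan :: "('w::real_normed_vector, 'e) trm list \<Rightarrow> ('w, 'e) trm list" where
  "tan ts = concat (map tan_term ts)"

lemma contr_l: "contr l" and contr_r: "contr r"
  using linear_l linear_r norm_l norm_r by (auto simp: contr_def)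

lemma linear_pr: "linear (\<lambda>w. pr w 0)" "linear (\<lambda>w. pr 0 w)"
  using bounded_linear_pr_left bounded_linear_pr_right by (auto intro: bounded_linear.linear)

lemma contr_pr: "contr e \<Longrightarrow> contr (\<lambda>w. pr (e w) 0)" "contr e \<Longrightarrow> contr (\<lambda>w. pr 0 (e w))"
  unfolding contr_def
  using linear_compose[of e, OF _ linear_pr(1)] linear_compose[of e, OF _ linear_pr(2)]
    norm_pr[of _ 0] norm_pr[of 0] by (auto simp: o_def intro: order_trans)

lemma tan_term_ok:
  assumes "term_ok N \<tau>" "\<sigma> \<in> set (tan_term \<tau>)"
  shows "term_ok (Suc N) \<sigma>"
proof -
  obtain e l0 ls where \<tau>: "\<tau> = (e, l0, ls)" by (cases \<tau>)
  have t: "contr e" "contr l0" "\<And>f. f \<in> set ls \<Longrightarrow> contr f" "length ls \<le> N" using assms(1) by (auto simp: \<tau>)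
  have 1: "contr f" if "f \<in> set (map (\<lambda>f. f \<circ> l) ls)" for f using that t(3) by (auto intro: contr_o contr_l)
  have 2: "contr f" if "f \<in> set ((map (\<lambda>f. f \<circ> l) ls)[i := ls ! i \<circ> r])" "i < length ls" for f i
    using set_update_subset_insert[of "map (\<lambda>f. f \<circ> l) ls" i "ls ! i \<circ> r"] that 1 t(3)[of "ls ! i"]
    by (auto intro: contr_o contr_r)
  show ?thesis
    using assms(2) t 1 2 by (auto simp: \<tau> contr_pr contr_o contr_l contr_r)
qed

lemma tan_term_in:
  assumes "term_in D R (l z) \<tau>" "term_ok N \<tau>" "norm (r z) \<le> R" "\<sigma> \<in> set (tan_term \<tau>)"
  shows "term_in D R z \<sigma>"
proof -
  obtain e l0 ls where \<tau>: "\<tau> = (e, l0, ls)" by (cases \<tau>)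
  have t: "l0 (l z) \<in> D" "\<And>f. f \<in> set ls \<Longrightarrow> norm (f (l z)) \<le> R" using assms(1) by (auto simp: \<tau>)
  have "norm (f (r z)) \<le> R" if "contr f" for f
    using that assms(3) by (auto simp: contr_def intro: order_trans[of _ "norm (r z)"])
  hence ok: "norm (l0 (r z)) \<le> R" "\<And>f. f \<in> set ls \<Longrightarrow> norm (f (r z)) \<le> R"
    using assms(2) by (auto simp: \<tau>)
  have 2: "norm (f z) \<le> R" if "f \<in> set ((map (\<lambda>f. f \<circ> l) ls)[i := ls ! i \<circ> r])" "i < length ls" for f i
    using set_update_subset_insert[of "map (\<lambda>f. f \<circ> l) ls" i "ls ! i \<circ> r"] that t ok(2)[of "ls ! i"] by auto
  show ?thesis using assms(4) t ok 2 by (auto simp: \<tau>)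
qed

lemma linear_prs: "linear e \<Longrightarrow> pr (e a) 0 + (pr 0 (e b) + (\<Sum>i<n. pr 0 (e (c i)))) = pr (e a) (e (b + (\<Sum>i<n. c i)))"
  for n :: nat
  by (simp add: linear_add linear_sum linear_sum[OF linear_pr(2), symmetric] pr_add)

lemma fld_tan_term:
  assumes "term_ok N \<tau>"
  shows "fld (tan_term \<tau>) g (pr a b) = pr (app_term g \<tau> a) (diff_term g \<tau> a b)"
proof -
  obtain e l0 ls where \<tau>: "\<tau> = (e, l0, ls)" by (cases \<tau>)
  have e: "linear e" using assms by (simp add: \<tau> contr_def)
  show ?thesis
    by (simp add: fld_def \<tau> comp_def sum_list_upt_eq_sum map_update linear_prs[OF e])
qed

text \<open>The second derivative at \<open>a\<close> in the directions \<open>b\<close> and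
  \<open>h\<close>. Each argument slot is linear and is differentiated at most once, so the double
  sum runs over distinct slots.\<close>

definition hess_term :: "'w jet \<Rightarrow> ('w::real_normed_vector, 'e) trm \<Rightarrow> 'e \<Rightarrow> 'e \<Rightarrow> 'e \<Rightarrow> 'e" where
  "hess_term g = (\<lambda>(e, l0, ls) a b h. let n = length ls; W = map (\<lambda>l. l a) ls; x = l0 a in
     e (g (Suc (Suc n)) x (W @ [l0 b, l0 h])
       + ((\<Sum>i<n. g (Suc n) x (W[i := (ls ! i) h] @ [l0 b])) + (\<Sum>i<n. g (Suc n) x (W[i := (ls ! i) b] @ [l0 h])))
       + (\<Sum>i<n. \<Sum>i'\<in>{..<n} - {i}. g n x (W[i := (ls ! i) b, i' := (ls ! i') h]))))"

text \<open>The two mixed sums trade places and the double sum is invariant because updates of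
  distinct slots commute. The top-order term is where the symmetry of the jet in its last two
  arguments enters.\<close>

lemma hess_term_commute:
  assumes sym: "\<And>ws u v. length ws = length (snd (snd \<tau>)) \<Longrightarrow>
     g (Suc (Suc (length ws))) (fst (snd \<tau>) a) (ws @ [u, v]) = g (Suc (Suc (length ws))) (fst (snd \<tau>) a) (ws @ [v, u])"
  shows "hess_term g \<tau> a b h = hess_term g \<tau> a h b"
proof -
  obtain e l0 ls where \<tau>: "\<tau> = (e, l0, ls)" by (cases \<tau>)
  let ?n = "length ls" and ?W = "map (\<lambda>l. l a) ls" and ?x = "l0 a"
  have 1: "g (Suc (Suc ?n)) ?x (?W @ [l0 b, l0 h]) = g (Suc (Suc ?n)) ?x (?W @ [l0 h, l0 b])"
    using sym[of ?W] by (simp add: \<tau>)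
  \<comment> \<open>Written over a full square, the off-diagonal sum can be transposed by
    \<open>sum.swap\<close>.\<close>
  have offdiag: "(\<Sum>i<?n. \<Sum>i'\<in>{..<?n} - {i}. f i i') = (\<Sum>i<?n. \<Sum>i'<?n. if i = i' then 0 else f i i')"
    for f :: "nat \<Rightarrow> nat \<Rightarrow> 'a"
    by (intro sum.cong sum.mono_neutral_cong_left) auto
  have "(\<Sum>i<?n. \<Sum>i'\<in>{..<?n} - {i}. g ?n ?x (?W[i := (ls ! i) b, i' := (ls ! i') h])) =
        (\<Sum>i<?n. \<Sum>i'\<in>{..<?n} - {i}. g ?n ?x (?W[i := (ls ! i) h, i' := (ls ! i') b]))"
    unfolding offdiag by (subst sum.swap) (auto intro!: sum.cong simp: list_update_swap)
  with 1 show ?thesis by (simp add: hess_term_def \<tau> Let_def add_ac)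
qed

lemma dfld_tan_term:
  assumes "term_ok N \<tau>"
  shows "dfld (tan_term \<tau>) g (pr a b) (pr h k) = pr (diff_term g \<tau> a h) (hess_term g \<tau> a b h + diff_term g \<tau> a k)"
proof -
  obtain e l0 ls where \<tau>: "\<tau> = (e, l0, ls)" by (cases \<tau>)
  have e: "linear e" using assms by (simp add: \<tau> contr_def)
  let ?n = "length ls" and ?W = "map (\<lambda>l. l a) ls" and ?x = "l0 a"
  have s2: "(\<Sum>i<Suc ?n. g (Suc ?n) ?x ((?W @ [l0 b])[i := ((map (\<lambda>f. f \<circ> l) ls @ [l0 \<circ> r]) ! i) (pr h k)])) =
      (\<Sum>i<?n. g (Suc ?n) ?x (?W[i := (ls ! i) h] @ [l0 b])) + g (Suc ?n) ?x (?W @ [l0 k])"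
    by (simp add: list_update_append nth_append)
  \<comment> \<open>At \<open>i' = i\<close> the slot reads the tangent component of the direction
    and returns \<open>k\<close>; every other slot reads the base component and returns
    \<open>h\<close>.\<close>
  have s3: "(\<Sum>i'<?n. g ?n ?x (?W[i := (ls ! i) b, i' := ((map (\<lambda>f. f \<circ> l) ls)[i := ls ! i \<circ> r] ! i') (pr h k)])) =
      g ?n ?x (?W[i := (ls ! i) k]) + (\<Sum>i'\<in>{..<?n} - {i}. g ?n ?x (?W[i := (ls ! i) b, i' := (ls ! i') h]))"
    if "i < ?n" for i
    using that by (subst sum.remove[of _ i]) (auto intro!: sum.cong)
  have t3: "(\<Sum>i<?n. pr 0 (e (g (Suc ?n) ?x (?W[i := (ls ! i) b] @ [l0 h]) +
      (\<Sum>i'<?n. g ?n ?x (?W[i := (ls ! i) b, i' := ((map (\<lambda>f. f \<circ> l) ls)[i := ls ! i \<circ> r] ! i') (pr h k)]))))) =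
     (\<Sum>i<?n. pr 0 (e (g (Suc ?n) ?x (?W[i := (ls ! i) b] @ [l0 h]) +
      (g ?n ?x (?W[i := (ls ! i) k]) + (\<Sum>i'\<in>{..<?n} - {i}. g ?n ?x (?W[i := (ls ! i) b, i' := (ls ! i') h]))))))"
    by (intro sum.cong) (simp_all add: s3)
  have "dfld (tan_term \<tau>) g (pr a b) (pr h k) =
     pr (e (g (Suc ?n) ?x (?W @ [l0 h]) + (\<Sum>i<?n. g ?n ?x (?W[i := (ls ! i) h])))) 0 +
     (pr 0 (e (g (Suc (Suc ?n)) ?x (?W @ [l0 b, l0 h]) +
       (\<Sum>i<Suc ?n. g (Suc ?n) ?x ((?W @ [l0 b])[i := ((map (\<lambda>f. f \<circ> l) ls @ [l0 \<circ> r]) ! i) (pr h k)])))) +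
     (\<Sum>i<?n. pr 0 (e (g (Suc ?n) ?x (?W[i := (ls ! i) b] @ [l0 h]) +
      (\<Sum>i'<?n. g ?n ?x (?W[i := (ls ! i) b, i' := ((map (\<lambda>f. f \<circ> l) ls)[i := ls ! i \<circ> r] ! i') (pr h k)]))))))"
    by (simp add: dfld_def \<tau> comp_def sum_list_upt_eq_sum map_update del: sum.lessThan_Suc)
  also have "\<dots> = pr (diff_term g \<tau> a h) (hess_term g \<tau> a b h + diff_term g \<tau> a k)"
    unfolding s2 t3 linear_prs[OF e]
    by (simp add: \<tau> hess_term_def Let_def linear_add[OF e, symmetric] sum.distrib add_ac)
  finally show ?thesis .
qed

lemma tan_ok: "\<forall>\<tau>\<in>set ts. term_ok N \<tau> \<Longrightarrow> \<forall>\<tau>\<in>set (tan ts). term_ok (Suc N) \<tau>"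
  by (auto simp: tan_def simp del: term_ok.simps intro: tan_term_ok)

lemma fld_tan:
  assumes "\<forall>\<tau>\<in>set ts. term_ok N \<tau>"
  shows "fld (tan ts) g (pr a b) = pr (fld ts g a) (dfld ts g a b)"
proof -
  have "(\<Sum>\<tau>\<leftarrow>ts. fld (tan_term \<tau>) g (pr a b)) = pr (fld ts g a) (dfld ts g a b)"
    using assms
  proof (induction ts)
    case (Cons \<tau> ts)
    thus ?case using fld_tan_term[of N \<tau> g a b] by (simp add: fld_def dfld_def pr_add)
  qed (simp add: fld_def dfld_def pr_0_0)
  thus ?thesis by (simp add: fld_def tan_def sum_list_concat_map)
qed

definition hess :: "('w::real_normed_vector, 'e) trm list \<Rightarrow> 'w jet \<Rightarrow> 'e \<Rightarrow> 'e \<Rightarrow> 'e \<Rightarrow> 'e" where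
  "hess ts g a b h = (\<Sum>\<tau>\<leftarrow>ts. hess_term g \<tau> a b h)"

lemma dfld_tan:
  assumes "\<forall>\<tau>\<in>set ts. term_ok N \<tau>"
  shows "dfld (tan ts) g (pr a b) (pr h k) = pr (dfld ts g a h) (hess ts g a b h + dfld ts g a k)"
proof -
  have "(\<Sum>\<tau>\<leftarrow>ts. dfld (tan_term \<tau>) g (pr a b) (pr h k)) = pr (dfld ts g a h) (hess ts g a b h + dfld ts g a k)"
    using assms
  proof (induction ts)
    case (Cons \<tau> ts)
    thus ?case using dfld_tan_term[of N \<tau> g a b h k] by (simp add: hess_def dfld_def pr_add add_ac)
  qed (simp add: hess_def dfld_def pr_0_0)
  thus ?thesis by (simp add: dfld_def tan_def sum_list_concat_map)
qed

lemma hess_commute: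
  assumes "\<forall>\<tau>\<in>set ts. term_ok N \<tau>"
    and "\<And>y ws u v. length ws \<le> N \<Longrightarrow>
     g (Suc (Suc (length ws))) y (ws @ [u, v]) = g (Suc (Suc (length ws))) y (ws @ [v, u])"
  shows "hess ts g a b h = hess ts g a h b"
proof -
  have "hess_term g \<tau> a b h = hess_term g \<tau> a h b" if "\<tau> \<in> set ts" for \<tau>
  proof (rule hess_term_commute)
    have "length (snd (snd \<tau>)) \<le> N" using assms(1) that by (cases \<tau>) force
    thus "g (Suc (Suc (length ws))) (fst (snd \<tau>) a) (ws @ [u, v]) = g (Suc (Suc (length ws))) (fst (snd \<tau>) a) (ws @ [v, u])"
      if "length ws = length (snd (snd \<tau>))" for ws u v using that by (intro assms(2)) simp
  qed
  thus ?thesis unfolding hess_def by (intro arg_cong[of _ _ sum_list] map_cong refl)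
qed

text \<open>Bounds on derivatives are thereby read off from bounds on tangent fields at unit tangent
  vectors.\<close>

lemma dfld_eq_tan:
  assumes "\<forall>\<tau>\<in>set ts. term_ok N \<tau>"
  shows "dfld ts g z h = r (fld (tan ts) g (pr z h))"
  by (simp add: fld_tan[OF assms])

lemma linear_dfld:
  assumes ok: "\<forall>\<tau>\<in>set ts. term_ok N \<tau> \<and> term_in D R z \<tau>" and g: "jet_bound (Suc N) D K g"
  shows "linear (dfld ts g z)"
proof -
  have "linear (diff_term g \<tau> z)" if "\<tau> \<in> set ts" for \<tau>
  proof -
    obtain e l0 ls where \<tau>: "\<tau> = (e, l0, ls)" by (cases \<tau>)
    have t: "linear e" "linear l0" "\<And>f. f \<in> set ls \<Longrightarrow> linear f" "length ls \<le> N" "l0 z \<in> D"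
      using ok that by (auto simp: \<tau> contr_def)
    have "linear (\<lambda>h. g (Suc (length ls)) (l0 z) (map (\<lambda>l. l z) ls @ [l0 h]))"
      using linear_compose[OF t(2) multilin_linear[OF jet_boundD(1)[OF g, of "Suc (length ls)"], of "l0 z" "map (\<lambda>l. l z) ls" "[]"]] t
      by (simp add: comp_def)
    moreover have "linear (\<lambda>h. g (length ls) (l0 z) ((map (\<lambda>l. l z) ls)[i := (ls ! i) h]))" if "i < length ls" for i
      using linear_compose[OF t(3)[OF nth_mem[OF that]]
          multilin_linear_update[OF jet_boundD(1)[OF g, of "length ls"], of "l0 z" "map (\<lambda>l. l z) ls" i]] t that
      by (simp add: comp_def)
    ultimately have "linear (\<lambda>h. g (Suc (length ls)) (l0 z) (map (\<lambda>l. l z) ls @ [l0 h])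
       + (\<Sum>i<length ls. g (length ls) (l0 z) ((map (\<lambda>l. l z) ls)[i := (ls ! i) h])))"
      by (intro linear_compose_add linear_compose_sum) auto
    from linear_compose[OF this t(1)] show ?thesis by (simp add: \<tau> comp_def flip: diff_term.simps)
  qed
  thus ?thesis unfolding dfld_def
  proof (induction ts)
    case Nil
    show ?case by (simp add: linear_zero)
  next
    case (Cons \<tau> ts)
    have "linear (diff_term g \<tau> z)" "linear (\<lambda>h. \<Sum>\<tau>\<leftarrow>ts. diff_term g \<tau> z h)" using Cons by simp_all
    thus ?case unfolding list.map sum_list.Cons by (rule linear_compose_add)
  qed
qed

end

lemma fld_sum:
  fixes a :: "'i::finite \<Rightarrow> real"
  assumes "\<forall>\<tau>\<in>set ts. term_ok N \<tau>"
  shows "fld ts (\<lambda>j y ws. \<Sum>i\<in>UNIV. a i *\<^sub>R g i j y ws) z = (\<Sum>i\<in>UNIV. a i *\<^sub>R fld ts (g i) z)"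
  using assms
proof (induction ts)
  case (Cons \<tau> ts)
  obtain e l0 ls where \<tau>: "\<tau> = (e, l0, ls)" by (cases \<tau>)
  have "linear e" using Cons.prems by (simp add: \<tau> contr_def)
  hence "app_term (\<lambda>j y ws. \<Sum>i\<in>UNIV. a i *\<^sub>R g i j y ws) \<tau> z = (\<Sum>i\<in>UNIV. a i *\<^sub>R app_term (g i) \<tau> z)"
    by (simp add: \<tau> linear_sum linear_scale)
  thus ?case using Cons by (simp add: fld_def scaleR_add_right sum.distrib)
qed (simp add: fld_def)

lemma multilin_sum_scaleR:
  assumes "\<And>i. multilin n (A i)"
  shows "multilin n (\<lambda>ws. \<Sum>i\<in>I. a i *\<^sub>R A i ws)"
  using assms unfolding multilin_def by (auto intro!: linear_compose_sum linear_compose_scale_right)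

section \<open>Controlled fields in coordinates\<close>

locale controlled_fields = rough_coords T \<alpha> B x xx + doubling l r pr
  for T \<alpha> B and x :: "real \<Rightarrow> 'i::finite \<Rightarrow> real" and xx and l r :: "'e::real_normed_vector \<Rightarrow> 'e" and pr +
  fixes k :: nat and F :: "'i \<Rightarrow> real \<Rightarrow> 'w::real_normed_vector jet" and F' :: "'i \<Rightarrow> 'i \<Rightarrow> real \<Rightarrow> 'w jet"
  assumes F_multilin: "t \<in> {0..T} \<Longrightarrow> j \<le> Suc k \<Longrightarrow> multilin j (F i t j y)"
    and F_sym: "t \<in> {0..T} \<Longrightarrow> length ws < k \<Longrightarrow>
      F i t (Suc (Suc (length ws))) y (ws @ [u, v]) = F i t (Suc (Suc (length ws))) y (ws @ [v, u])"
    and F'_multilin: "t \<in> {0..T} \<Longrightarrow> j \<le> k \<Longrightarrow> multilin j (F' i i' t j y)"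
begin

text \<open>Orders up to \<open>Suc N\<close> of \<open>F\<close> and up to \<open>N\<close> of
  \<open>F'\<close> are what a field built from terms with at most \<open>N\<close> tangent slots
  uses in \<open>field_est\<close>.\<close>

definition jet_est :: "nat \<Rightarrow> 'w set \<Rightarrow> real \<Rightarrow> bool" where
  "jet_est N D K \<longleftrightarrow> 0 \<le> K \<and> (\<forall>s\<in>{0..T}. \<forall>t\<in>{0..T}. \<forall>y0\<in>D. \<forall>y1\<in>D. \<forall>i i' ws.
    (length ws \<le> Suc N \<longrightarrow> norm (F i s (length ws) y0 ws) \<le> K * nrm ws \<and>
       norm (F i t (length ws) y1 ws - F i s (length ws) y0 ws) \<le> K * max (\<bar>t - s\<bar> powr \<alpha>) (norm (y1 - y0)) * nrm ws) \<and>
    (length ws \<le> N \<longrightarrow> norm (F' i i' s (length ws) y0 ws) \<le> K * nrm ws \<and>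
       norm (F' i i' t (length ws) y1 ws - F' i i' s (length ws) y0 ws) \<le> K * max (\<bar>t - s\<bar> powr \<alpha>) (norm (y1 - y0)) * nrm ws \<and>
       norm (F i t (length ws) y1 ws - F i s (length ws) y0 ws
          - (\<Sum>i'\<in>UNIV. (x t i' - x s i') *\<^sub>R F' i' i s (length ws) y0 ws) - F i s (Suc (length ws)) y0 (ws @ [y1 - y0]))
         \<le> K * (max (\<bar>t - s\<bar> powr \<alpha>) (norm (y1 - y0)))\<^sup>2 * nrm ws))"

lemma jet_estD:
  assumes "jet_est N D K"
  shows "0 \<le> K"
    and "s \<in> {0..T} \<Longrightarrow> y0 \<in> D \<Longrightarrow> length ws \<le> Suc N \<Longrightarrow> norm (F i s (length ws) y0 ws) \<le> K * nrm ws"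
    and "s \<in> {0..T} \<Longrightarrow> t \<in> {0..T} \<Longrightarrow> y0 \<in> D \<Longrightarrow> y1 \<in> D \<Longrightarrow> length ws \<le> Suc N \<Longrightarrow>
       norm (F i t (length ws) y1 ws - F i s (length ws) y0 ws) \<le> K * max (\<bar>t - s\<bar> powr \<alpha>) (norm (y1 - y0)) * nrm ws"
    and "s \<in> {0..T} \<Longrightarrow> y0 \<in> D \<Longrightarrow> length ws \<le> N \<Longrightarrow> norm (F' i i' s (length ws) y0 ws) \<le> K * nrm ws"
    and "s \<in> {0..T} \<Longrightarrow> t \<in> {0..T} \<Longrightarrow> y0 \<in> D \<Longrightarrow> y1 \<in> D \<Longrightarrow> length ws \<le> N \<Longrightarrow>
       norm (F' i i' t (length ws) y1 ws - F' i i' s (length ws) y0 ws) \<le> K * max (\<bar>t - s\<bar> powr \<alpha>) (norm (y1 - y0)) * nrm ws"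
    and "s \<in> {0..T} \<Longrightarrow> t \<in> {0..T} \<Longrightarrow> y0 \<in> D \<Longrightarrow> y1 \<in> D \<Longrightarrow> length ws \<le> N \<Longrightarrow>
       norm (F i t (length ws) y1 ws - F i s (length ws) y0 ws
          - (\<Sum>i'\<in>UNIV. (x t i' - x s i') *\<^sub>R F' i' i s (length ws) y0 ws) - F i s (Suc (length ws)) y0 (ws @ [y1 - y0]))
         \<le> K * (max (\<bar>t - s\<bar> powr \<alpha>) (norm (y1 - y0)))\<^sup>2 * nrm ws"
  using assms unfolding jet_est_def by blast+

abbreviation (input) "Ff ts \<equiv> \<lambda>i s. fld ts (F i s)"
abbreviation (input) "DFf ts \<equiv> \<lambda>i s. dfld ts (F i s)"
abbreviation (input) "Ff' ts \<equiv> \<lambda>i i' s. fld ts (F' i i' s)"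

lemma field_est_terms:
  fixes ts :: "('w, 'e) trm list"
  assumes ok: "\<forall>\<tau>\<in>set ts. term_ok N \<tau>" and dom: "\<And>z \<tau>. z \<in> D \<Longrightarrow> \<tau> \<in> set ts \<Longrightarrow> term_in Dw R z \<tau>"
    and J: "jet_est N Dw K" and N: "N \<le> k" and R: "1 \<le> R"
  shows "\<exists>K. field_est (Ff ts) (DFf ts) (Ff' ts) D K"
proof -
  note K = jet_estD(1)[OF J]
  \<comment> \<open>The second summand accounts for the jet \<open>?c\<close>, a sum over the
    coordinates of the path increment.\<close>
  define K1 where "K1 = K * (1 + CARD('i) * B)"
  have K1: "0 \<le> K1" "K \<le> K1" "CARD('i) * (B * K) \<le> K1" using K B by (auto simp: K1_def algebra_simps)
  have K1R: "0 \<le> K1" "0 \<le> R" using K1 R by auto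
  define C where "C = length ts * (K1 * term_const N R) + length (tan ts) * (K1 * term_const (Suc N) R)"
  have tc: "0 \<le> term_const n R" for n using R by (simp add: term_const_def)
  have C1: "length ts * (K1 * c * term_const N R) \<le> C * c" and C2: "length (tan ts) * (K1 * c * term_const (Suc N) R) \<le> C * c"
    if "0 \<le> c" for c
    using that K1 tc[of N] tc[of "Suc N"] by (simp_all add: C_def algebra_simps)
  have ok2: "\<forall>\<tau>\<in>set (tan ts). term_ok (Suc N) \<tau>" using ok by (rule tan_ok)
  have dom2: "term_in Dw R (pr z h) \<tau>" if zh: "z \<in> D" "norm h \<le> 1" "\<tau> \<in> set (tan ts)" for z h \<tau>
  proof -
    obtain \<sigma> where "\<sigma> \<in> set ts" "\<tau> \<in> set (tan_term \<sigma>)" using zh(3) by (auto simp: tan_def)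
    thus ?thesis using tan_term_in[of Dw R "pr z h" \<sigma> N \<tau>] dom[OF zh(1)] ok zh(2) R by simp
  qed
  have gF: "jet_bound (Suc N) Dw K1 (F i s)" if "s \<in> {0..T}" for i s
    unfolding jet_bound_def
  proof (intro allI impI ballI conjI)
    fix j y and ws :: "'w list" assume "j \<le> Suc N" "y \<in> Dw"
    thus "multilin j (F i s j y)" using F_multilin that N by simp
    show "norm (F i s j y ws) \<le> K1 * nrm ws" if "length ws = j"
      using jet_estD(2)[OF J \<open>s \<in> {0..T}\<close> \<open>y \<in> Dw\<close>, of ws i] \<open>j \<le> Suc N\<close> that mult_right_mono[OF K1(2) nrm_nonneg[of ws]] by simp
  qed
  have gF': "jet_bound N Dw K1 (F' i i' s)" if "s \<in> {0..T}" for i i' s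
    unfolding jet_bound_def
  proof (intro allI impI ballI conjI)
    fix j y and ws :: "'w list" assume "j \<le> N" "y \<in> Dw"
    thus "multilin j (F' i i' s j y)" using F'_multilin that N by simp
    show "norm (F' i i' s j y ws) \<le> K1 * nrm ws" if "length ws = j"
      using jet_estD(4)[OF J \<open>s \<in> {0..T}\<close> \<open>y \<in> Dw\<close>, of ws i i'] \<open>j \<le> N\<close> that mult_right_mono[OF K1(2) nrm_nonneg[of ws]] by simp
  qed
  have lipF: "norm (F i t j y1 ws - F i s j y0 ws) \<le> K1 * max (\<bar>t - s\<bar> powr \<alpha>) (norm (y1 - y0)) * nrm ws"
    if "s \<in> {0..T}" "t \<in> {0..T}" "j \<le> Suc N" "y0 \<in> Dw" "y1 \<in> Dw" "length ws = j" for i s t j y0 y1 ws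
    by (rule order_trans[OF jet_estD(3)[OF J that(1,2,4,5), of ws i, unfolded that(6), OF that(3)]])
       (intro mult_right_mono K1 nrm_nonneg, simp add: le_max_iff_disj)
  have lipF': "norm (F' i i' t j y1 ws - F' i i' s j y0 ws) \<le> K1 * max (\<bar>t - s\<bar> powr \<alpha>) (norm (y1 - y0)) * nrm ws"
    if "s \<in> {0..T}" "t \<in> {0..T}" "j \<le> N" "y0 \<in> Dw" "y1 \<in> Dw" "length ws = j" for i i' s t j y0 y1 ws
    by (rule order_trans[OF jet_estD(5)[OF J that(1,2,4,5), of ws i i', unfolded that(6), OF that(3)]])
       (intro mult_right_mono K1 nrm_nonneg, simp add: le_max_iff_disj)
  have lin: "linear (dfld ts (F i s) z)" if "s \<in> {0..T}" "z \<in> D" for i s z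
    using ok dom[OF that(2)] gF[OF that(1)] by (intro linear_dfld[of ts N Dw R]) auto
  have "field_est (Ff ts) (DFf ts) (Ff' ts) D C"
    unfolding field_est_def
  proof (intro conjI ballI allI)
    show "0 \<le> C" using K1 tc by (simp add: C_def)
    fix s t z0 z1 i i' h assume I: "s \<in> {0..T}" "t \<in> {0..T}" and z: "z0 \<in> D" "z1 \<in> D"
    let ?\<delta> = "\<bar>t - s\<bar> powr \<alpha>"
    let ?\<rho> = "max ?\<delta> (norm (z1 - z0))"
    have \<rho>: "0 \<le> ?\<rho>" by (simp add: le_max_iff_disj)
    show "linear (dfld ts (F i s) z0)" using lin I z by blast
    show "norm (fld ts (F i s) z0) \<le> C"
      using fld_bound[of ts N Dw R z0 K1 "F i s"] ok dom z gF[OF I(1)] K1R C1[of 1] by (auto simp: jet_bound_def)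
    show "norm (fld ts (F' i i' s) z0) \<le> C"
      using fld_bound[of ts N Dw R z0 K1 "F' i i' s"] ok dom z gF'[OF I(1)] K1R C1[of 1] by auto
    show "norm (dfld ts (F i s) z0 h) \<le> C * norm h"
    proof (rule linear_unit_bound[OF lin[OF I(1) z(1)]])
      fix h :: 'e assume h: "norm h \<le> 1"
      have "norm (dfld ts (F i s) z0 h) \<le> norm (fld (tan ts) (F i s) (pr z0 h))"
        unfolding dfld_eq_tan[OF ok] by (rule norm_r)
      also have "\<dots> \<le> length (tan ts) * (K1 * term_const (Suc N) R)"
        using ok2 dom2[OF z(1) h] by (intro fld_bound[OF _ gF[OF I(1)]] K1R) auto
      finally show "norm (dfld ts (F i s) z0 h) \<le> C" using C2[of 1] by simp
    qed
    show "norm (fld ts (F i t) z1 - fld ts (F i s) z0) \<le> C * ?\<rho>"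
    proof -
      have "jet_bound N Dw K1 (F i s)" using gF[OF I(1)] by (auto simp: jet_bound_def)
      hence "norm (fld ts (F i t) z1 - fld ts (F i s) z0) \<le> length ts * (K1 * ?\<rho> * term_const N R)"
      proof (rule fld_lipschitz[rotated])
        show "norm (F i t j y1 ws - F i s j y0 ws) \<le> K1 * max ?\<delta> (norm (y1 - y0)) * nrm ws"
          if "j \<le> N" "y0 \<in> Dw" "y1 \<in> Dw" "length ws = j" for j y0 y1 ws
          using that by (intro lipF I) auto
      qed (use ok dom z K1R in auto)
      thus ?thesis using C1[OF \<rho>] by (rule order_trans)
    qed
    show "norm (fld ts (F' i i' t) z1 - fld ts (F' i i' s) z0) \<le> C * ?\<rho>"
    proof -
      have "norm (fld ts (F' i i' t) z1 - fld ts (F' i i' s) z0) \<le> length ts * (K1 * ?\<rho> * term_const N R)"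
      proof (rule fld_lipschitz[OF _ gF'[OF I(1)]])
        show "norm (F' i i' t j y1 ws - F' i i' s j y0 ws) \<le> K1 * max ?\<delta> (norm (y1 - y0)) * nrm ws"
          if "j \<le> N" "y0 \<in> Dw" "y1 \<in> Dw" "length ws = j" for j y0 y1 ws
          using that by (intro lipF' I) auto
      qed (use ok dom z K1R in auto)
      thus ?thesis using C1[OF \<rho>] by (rule order_trans)
    qed
    show "norm (dfld ts (F i t) z1 h - dfld ts (F i s) z0 h) \<le> C * ?\<rho> * norm h"
    proof (rule linear_unit_bound[OF linear_compose_sub[OF lin[OF I(2) z(2)] lin[OF I(1) z(1)]]])
      fix h :: 'e assume h: "norm h \<le> 1"
      have "norm (dfld ts (F i t) z1 h - dfld ts (F i s) z0 h) \<le> norm (fld (tan ts) (F i t) (pr z1 h) - fld (tan ts) (F i s) (pr z0 h))"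
        unfolding dfld_eq_tan[OF ok] using norm_r by (simp flip: r_linear)
      also have "\<dots> \<le> length (tan ts) * (K1 * max ?\<delta> (norm (pr z1 h - pr z0 h)) * term_const (Suc N) R)"
      proof (rule fld_lipschitz[OF _ gF[OF I(1)]])
        show "norm (F i t j y1 ws - F i s j y0 ws) \<le> K1 * max ?\<delta> (norm (y1 - y0)) * nrm ws"
          if "j \<le> Suc N" "y0 \<in> Dw" "y1 \<in> Dw" "length ws = j" for j y0 y1 ws
          using that by (intro lipF I) auto
      qed (use ok2 dom2[OF _ h] z K1R in auto)
      also have "\<dots> \<le> C * max ?\<delta> (norm (pr z1 h - pr z0 h))" by (rule C2) (simp add: le_max_iff_disj)
      also have "\<dots> \<le> C * ?\<rho>"
        using norm_pr[of "z1 - z0" 0] \<open>0 \<le> C\<close> by (intro mult_left_mono) (auto simp: pr_diff)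
      finally show "norm (dfld ts (F i t) z1 h - dfld ts (F i s) z0 h) \<le> C * ?\<rho>" .
    qed
    let ?c = "\<lambda>j y ws. \<Sum>i'\<in>UNIV. (x t i' - x s i') *\<^sub>R F' i' i s j y ws"
    have c: "jet_bound N Dw (K1 * ?\<delta>) ?c"
      unfolding jet_bound_def
    proof (intro allI impI ballI conjI)
      fix j and y :: 'w and ws :: "'w list" assume j: "j \<le> N" "y \<in> Dw"
      show "multilin j (?c j y)" using F'_multilin I j N by (intro multilin_sum_scaleR) auto
      assume "length ws = j"
      hence "norm (?c j y ws) \<le> CARD('i) * (B * ?\<delta> * (K * nrm ws))"
        using jet_estD(4)[OF J I(1) j(2), of ws] j by (intro norm_sum_scaleR_le x_bound I) auto
      also have "\<dots> = CARD('i) * (B * K) * (?\<delta> * nrm ws)" by (simp add: mult_ac)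
      also have "\<dots> \<le> K1 * (?\<delta> * nrm ws)" using nrm_nonneg[of ws] by (intro mult_right_mono K1) auto
      finally show "norm (?c j y ws) \<le> K1 * ?\<delta> * nrm ws" by (simp add: mult_ac)
    qed
    have sec: "norm (F i t j y1 ws - F i s j y0 ws - ?c j y0 ws - F i s (Suc j) y0 (ws @ [y1 - y0]))
        \<le> K1 * (max ?\<delta> (norm (y1 - y0)))\<^sup>2 * nrm ws"
      if "j \<le> N" "y0 \<in> Dw" "y1 \<in> Dw" "length ws = j" for j y0 y1 ws
      by (rule order_trans[OF jet_estD(6)[OF J I that(2,3), of ws i, unfolded that(4), OF that(1)]])
         (intro mult_right_mono K1 nrm_nonneg, simp)
    have "norm (fld ts (F i t) z1 - fld ts (F i s) z0 - fld ts ?c z0 - dfld ts (F i s) z0 (z1 - z0)) \<le>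
       length ts * (K1 * ?\<rho>\<^sup>2 * term_const N R)"
      by (rule fld_second_order[OF _ gF[OF I(1)] c K1R _ sec]) (use ok dom z in auto)
    also have "\<dots> \<le> C * ?\<rho>\<^sup>2" by (rule C1) simp
    finally show "norm (fld ts (F i t) z1 - fld ts (F i s) z0 - (\<Sum>i'\<in>UNIV. (x t i' - x s i') *\<^sub>R fld ts (F' i' i s) z0)
        - dfld ts (F i s) z0 (z1 - z0)) \<le> C * ?\<rho>\<^sup>2"
      by (simp only: fld_sum[OF ok])
  qed
  thus ?thesis by blast
qed

lemma jet_est_mono:
  assumes J: "jet_est N D K" and le: "N' \<le> N"
  shows "jet_est N' D K"
  unfolding jet_est_def by (intro conjI ballI allI impI jet_estD[OF J]) (use le in auto)

end

text \<open>Of \<open>F'\<close> the estimates in \<open>jet_est\<close> bound only values and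
  increments; \<open>F'_second\<close> supplies the spatial expansion by which the tangent lift
  differentiates it.\<close>

locale local_fields = controlled_fields T \<alpha> B x xx l r pr k F F'
  for T \<alpha> B and x :: "real \<Rightarrow> 'i::finite \<Rightarrow> real" and xx and l r :: "'e::real_normed_vector \<Rightarrow> 'e" and pr k
    and F :: "'i \<Rightarrow> real \<Rightarrow> 'w::real_normed_vector jet" and F' +
  assumes loc: "\<exists>K. jet_est k (cball 0 R) K"
    and F'_second: "\<exists>K\<ge>0. \<forall>t\<in>{0..T}. \<forall>y0\<in>cball 0 R. \<forall>y1\<in>cball 0 R. \<forall>i i' ws. length ws < k \<longrightarrow>
      norm (F' i i' t (length ws) y1 ws - F' i i' t (length ws) y0 ws - F' i i' t (Suc (length ws)) y0 (ws @ [y1 - y0]))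
        \<le> K * (norm (y1 - y0))\<^sup>2 * nrm ws"
begin

lemma term_ok_in: "term_ok N \<tau> \<Longrightarrow> norm z \<le> R \<Longrightarrow> term_in (cball 0 R) R z \<tau>"
  by (cases \<tau>) (auto simp: contr_def intro: order_trans[of _ "norm z"])

lemma field_est_local:
  fixes ts :: "('w, 'e) trm list"
  assumes ok: "\<forall>\<tau>\<in>set ts. term_ok N \<tau>" and N: "N \<le> k"
  shows "\<exists>K. field_est (Ff ts) (DFf ts) (Ff' ts) (cball 0 R) K"
proof -
  obtain K where "jet_est k (cball 0 (max R 1)) K" using loc by blast
  hence J: "jet_est N (cball 0 (max R 1)) K" using N by (rule jet_est_mono)
  have "term_in (cball 0 (max R 1)) (max R 1) z \<tau>" if "z \<in> cball 0 R" "\<tau> \<in> set ts" for z \<tau>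
    using that ok by (intro term_ok_in[of N]) auto
  thus ?thesis by (rule field_est_terms[OF ok _ J N]) simp_all
qed

text \<open>At equal times the controlled expansion is a quadratic Taylor estimate in space.\<close>

lemma fld_F_has_derivative:
  fixes ts :: "('w, 'e) trm list"
  assumes ok: "\<forall>\<tau>\<in>set ts. term_ok N \<tau>" and N: "N \<le> k" and t: "t \<in> {0..T}"
  shows "(fld ts (F i t) has_derivative dfld ts (F i t) z) (at z)"
proof -
  obtain K where F: "field_est (Ff ts) (DFf ts) (Ff' ts) (cball 0 (norm z + 1)) K" using field_est_local[OF ok N] by blast
  have z: "z \<in> cball 0 (norm z + 1)" by simp
  show ?thesis
  proof (rule has_derivative_quadratic)
    show "bounded_linear (dfld ts (F i t) z)"
      using field_estD(2)[OF F t t z z, of i] by (intro bounded_linear_intro[where K = K]) (auto simp: linear_add linear_scale mult.commute)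
    fix y assume "norm (y - z) < 1"
    hence "y \<in> cball 0 (norm z + 1)" using norm_triangle_sub[of y z] by simp
    from field_estD(2)[OF F t t z this, of i]
    show "norm (fld ts (F i t) y - fld ts (F i t) z - dfld ts (F i t) z (y - z)) \<le> K * (norm (y - z))\<^sup>2" by simp
  qed
qed

text \<open>The derivative involves one more order of \<open>F'\<close>, whence
  \<open>N < k\<close>. The expansion is \<open>fld_second_order\<close> at a fixed time, with both
  \<delta> and the jet \<open>c\<close> equal to 0.\<close>

lemma fld_F'_has_derivative:
  fixes ts :: "('w, 'e) trm list"
  assumes ok: "\<forall>\<tau>\<in>set ts. term_ok N \<tau>" and N: "N < k" and t: "t \<in> {0..T}"
  shows "(fld ts (F' i i' t) has_derivative dfld ts (F' i i' t) z) (at z)"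
proof -
  let ?R = "norm z + 1" and ?g = "F' i i' t"
  obtain K1 where J: "jet_est k (cball 0 ?R) K1" using loc by blast
  obtain K2 where K2: "0 \<le> K2" "\<And>y0 y1 ws. y0 \<in> cball 0 ?R \<Longrightarrow> y1 \<in> cball 0 ?R \<Longrightarrow> length ws < k \<Longrightarrow>
     norm (?g (length ws) y1 ws - ?g (length ws) y0 ws - ?g (Suc (length ws)) y0 (ws @ [y1 - y0])) \<le> K2 * (norm (y1 - y0))\<^sup>2 * nrm ws"
    using F'_second[of ?R] t by blast
  define K where "K = max K1 K2"
  have K: "0 \<le> K" "K1 \<le> K" "K2 \<le> K" "0 \<le> ?R" using K2(1) by (auto simp: K_def add_nonneg_nonneg)
  have dom: "term_in (cball 0 ?R) ?R y \<tau>" if "norm y \<le> ?R" "\<tau> \<in> set ts" for y \<tau>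
    using that ok by (intro term_ok_in[of N]) auto
  have g: "jet_bound (Suc N) (cball 0 ?R) K ?g"
    unfolding jet_bound_def
  proof (intro allI impI ballI conjI)
    fix j and y :: 'w and ws :: "'w list" assume j: "j \<le> Suc N" "y \<in> cball 0 ?R"
    thus "multilin j (?g j y)" using F'_multilin t N by simp
    assume "length ws = j"
    thus "norm (?g j y ws) \<le> K * nrm ws"
      using jet_estD(4)[OF J t j(2), of ws i i'] j(1) N mult_right_mono[OF K(2) nrm_nonneg[of ws]] by simp
  qed
  have z: "norm z \<le> ?R" by simp
  have q: "norm (fld ts ?g y - fld ts ?g z - dfld ts ?g z (y - z)) \<le> length ts * (K * term_const N ?R) * (norm (y - z))\<^sup>2"
    if "norm (y - z) < 1" for y
  proof -
    have y: "norm y \<le> ?R" using that norm_triangle_sub[of y z] by simp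
    have "norm (fld ts ?g y - fld ts ?g z - fld ts (\<lambda>j y ws. 0) z - dfld ts ?g z (y - z)) \<le>
       length ts * (K * (max 0 (norm (y - z)))\<^sup>2 * term_const N ?R)"
    proof (rule fld_second_order[OF _ g _ K(1,4)])
      show "jet_bound N (cball 0 ?R) (K * 0) (\<lambda>j y ws. 0)"
        by (simp add: jet_bound_def multilin_def linear_zero)
      show "norm (?g j y1 ws - ?g j y0 ws - 0 - ?g (Suc j) y0 (ws @ [y1 - y0])) \<le> K * (max 0 (norm (y1 - y0)))\<^sup>2 * nrm ws"
        if "j \<le> N" "y0 \<in> cball 0 ?R" "y1 \<in> cball 0 ?R" "length ws = j" for j y0 y1 ws
        using K2(2)[OF that(2,3), of ws] that(1,4) N
          mult_right_mono[OF mult_right_mono[OF K(3), of "(norm (y1 - y0))\<^sup>2"] nrm_nonneg[of ws]] by simp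
    qed (use ok dom[OF y] dom[OF z] in auto)
    moreover have "fld ts (\<lambda>j y ws. 0) z = 0"
      using fld_sum[of ts N "\<lambda>i::'i. 0" "\<lambda>i j y ws. 0"] ok by simp
    ultimately show ?thesis by (simp add: mult_ac)
  qed
  have lin: "linear (dfld ts ?g z)"
    using ok dom[OF z] by (intro linear_dfld[OF _ g]) auto
  have "norm (dfld ts ?g z h) \<le> (length (tan ts) * (K * term_const (Suc N) ?R)) * norm h" for h
  proof (rule linear_unit_bound[OF lin])
    fix h :: 'e assume h: "norm h \<le> 1"
    have "norm (dfld ts ?g z h) \<le> norm (fld (tan ts) ?g (pr z h))" unfolding dfld_eq_tan[OF ok] by (rule norm_r)
    also have "\<dots> \<le> length (tan ts) * (K * term_const (Suc N) ?R)"
      using tan_ok[OF ok] norm_pr[of z h] h by (intro fld_bound[OF _ g K(1,4)]) (auto intro: term_ok_in)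
    finally show "norm (dfld ts ?g z h) \<le> length (tan ts) * (K * term_const (Suc N) ?R)" .
  qed
  hence "bounded_linear (dfld ts ?g z)"
    using lin by (intro bounded_linear_intro[where K = "length (tan ts) * (K * term_const (Suc N) ?R)"])
      (auto simp: linear_add linear_scale mult.commute)
  thus ?thesis using q by (rule has_derivative_quadratic)
qed

lemma pr_sum: "(\<Sum>i\<in>A. pr (f i) (g i)) = pr (\<Sum>i\<in>A. f i) (\<Sum>i\<in>A. g i)" for A :: "'i set"
  by (induction A rule: infinite_finite_induct) (simp_all add: pr_0_0 pr_add)

text \<open>Both sides contain a second derivative of the field \<open>j\<close> in the directions
  \<open>v\<close> and \<open>f_i(z)\<close>, but in opposite order: the derivative of
  \<open>Df_j(z)(f_i(z))\<close> meets \<open>f_i(z)\<close> first, the Gubinelli derivative of the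
  tangent field meets \<open>v\<close> first. Symmetry of second derivatives makes them
  agree.\<close>

lemma lift_milstein:
  fixes ts :: "('w, 'e) trm list"
  assumes ok: "\<forall>\<tau>\<in>set ts. term_ok N \<tau>" and N: "N < k"
  shows "lift T (milstein (Ff ts) (DFf ts) (Ff' ts)) (milstein (Ff (tan ts)) (DFf (tan ts)) (Ff' (tan ts)))"
  unfolding lift_def
proof (intro ballI allI conjI)
  fix s t z assume I: "s \<in> {0..T}" "t \<in> {0..T}"
  define D where "D = (\<lambda>a v. v + ((\<Sum>i\<in>UNIV. (x t i - x s i) *\<^sub>R dfld ts (F i s) a v) +
     (\<Sum>i\<in>UNIV. \<Sum>j\<in>UNIV. xx s t i j *\<^sub>R (hess ts (F j s) a v (fld ts (F i s) a) + dfld ts (F j s) a (dfld ts (F i s) a v)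
        + dfld ts (F' i j s) a v))))"
  have step: "milstein (Ff (tan ts)) (DFf (tan ts)) (Ff' (tan ts)) s t (pr a v) =
      pr (milstein (Ff ts) (DFf ts) (Ff' ts) s t a) (D a v)" for a v
    by (simp add: milstein_def incr_def gub_def D_def fld_tan[OF ok] dfld_tan[OF ok] pr_add pr_scale pr_sum)
  show "l (milstein (Ff (tan ts)) (DFf (tan ts)) (Ff' (tan ts)) s t z) = milstein (Ff ts) (DFf ts) (Ff' ts) s t (l z)"
    using step[of "l z" "r z"] by simp
  have dF: "(fld ts (F i s) has_derivative dfld ts (F i s) z) (at z)" for i
    using N by (intro fld_F_has_derivative[OF ok _ I(1)]) simp
  have dF': "(fld ts (F' i j s) has_derivative dfld ts (F' i j s) z) (at z)" for i j
    by (rule fld_F'_has_derivative[OF ok N I(1)])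
  \<comment> \<open>\<open>Df_j(z)(f_i(z))\<close> is the tangent component of the tangent field of
    \<open>f_j\<close> at the point \<open>(z, f_i(z))\<close>, so its derivative follows from the
    chain rule and \<open>fld_F_has_derivative\<close> for \<open>tan ts\<close>.\<close>
  have dG: "((\<lambda>z. dfld ts (F j s) z (fld ts (F i s) z)) has_derivative
      (\<lambda>v. hess ts (F j s) z v (fld ts (F i s) z) + dfld ts (F j s) z (dfld ts (F i s) z v))) (at z)" for i j
  proof -
    have "((\<lambda>z. pr z 0 + pr 0 (fld ts (F i s) z)) has_derivative (\<lambda>v. pr v 0 + pr 0 (dfld ts (F i s) z v))) (at z)"
      by (intro has_derivative_add bounded_linear_imp_has_derivative bounded_linear_pr_left
          bounded_linear.has_derivative[OF bounded_linear_pr_right] dF)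
    hence "((\<lambda>z. pr z (fld ts (F i s) z)) has_derivative (\<lambda>v. pr v (dfld ts (F i s) z v))) (at z)"
      by (simp add: pr_add)
    moreover have "(fld (tan ts) (F j s) has_derivative dfld (tan ts) (F j s) (pr z (fld ts (F i s) z))) (at (pr z (fld ts (F i s) z)))"
      using N by (intro fld_F_has_derivative[OF tan_ok[OF ok] _ I(1)]) simp
    ultimately have "((\<lambda>z. fld (tan ts) (F j s) (pr z (fld ts (F i s) z))) has_derivative
        (\<lambda>v. dfld (tan ts) (F j s) (pr z (fld ts (F i s) z)) (pr v (dfld ts (F i s) z v)))) (at z)"
      by (rule has_derivative_compose)
    from bounded_linear.has_derivative[OF bounded_linear_r this]
    have "((\<lambda>z. dfld ts (F j s) z (fld ts (F i s) z)) has_derivative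
        (\<lambda>v. hess ts (F j s) z (fld ts (F i s) z) v + dfld ts (F j s) z (dfld ts (F i s) z v))) (at z)"
      by (simp add: dfld_tan[OF ok] fld_tan[OF ok])
    moreover have "hess ts (F j s) z (fld ts (F i s) z) v = hess ts (F j s) z v (fld ts (F i s) z)" for v
      using F_sym[OF I(1)] N by (intro hess_commute[OF ok]) simp
    ultimately show ?thesis by simp
  qed
  have "(milstein (Ff ts) (DFf ts) (Ff' ts) s t has_derivative D z) (at z)"
    unfolding milstein_def incr_def gub_def D_def
    by (intro has_derivative_add has_derivative_ident has_derivative_sum has_derivative_scaleR_right dF dF' dG)
  thus "(milstein (Ff ts) (DFf ts) (Ff' ts) s t has_derivative
     (\<lambda>v. r (milstein (Ff (tan ts)) (DFf (tan ts)) (Ff' (tan ts)) s t (pr z v)))) (at z)"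
    by (simp add: step)
qed

end

context controlled_fields
begin

abbreviation (input) "fb \<equiv> \<lambda>i s y. F i s 0 y []"
abbreviation (input) "Dfb \<equiv> \<lambda>i s y h. F i s (Suc 0) y [h]"
abbreviation (input) "fb' \<equiv> \<lambda>i i' s y. F' i i' s 0 y []"

lemma field_est_base:
  assumes J: "jet_est 0 D K"
  shows "field_est fb Dfb fb' D K"
  unfolding field_est_def
proof (intro conjI ballI allI)
  show "0 \<le> K" by (rule jet_estD(1)[OF J])
  fix s t y0 y1 i i' h assume I: "s \<in> {0..T}" "t \<in> {0..T}" and y: "y0 \<in> D" "y1 \<in> D"
  show "linear (\<lambda>h. F i s (Suc 0) y0 [h])"
    using multilin_linear[OF F_multilin[OF I(1), of "Suc 0"], of "[]" "[]" i y0] by simp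
  show "norm (F i s 0 y0 []) \<le> K" using jet_estD(2)[OF J I(1) y(1), of "[]"] by simp
  show "norm (F i s (Suc 0) y0 [h]) \<le> K * norm h" using jet_estD(2)[OF J I(1) y(1), of "[h]"] by simp
  show "norm (F' i i' s 0 y0 []) \<le> K" using jet_estD(4)[OF J I(1) y(1), of "[]"] by simp
  show "norm (F i t 0 y1 [] - F i s 0 y0 []) \<le> K * max (\<bar>t - s\<bar> powr \<alpha>) (norm (y1 - y0))"
    using jet_estD(3)[OF J I y, of "[]"] by simp
  show "norm (F' i i' t 0 y1 [] - F' i i' s 0 y0 []) \<le> K * max (\<bar>t - s\<bar> powr \<alpha>) (norm (y1 - y0))"
    using jet_estD(5)[OF J I y, of "[]"] by simp
  show "norm (F i t (Suc 0) y1 [h] - F i s (Suc 0) y0 [h]) \<le> K * max (\<bar>t - s\<bar> powr \<alpha>) (norm (y1 - y0)) * norm h"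
    using jet_estD(3)[OF J I y, of "[h]"] by simp
  show "norm (F i t 0 y1 [] - F i s 0 y0 [] - (\<Sum>i'\<in>UNIV. (x t i' - x s i') *\<^sub>R F' i' i s 0 y0 []) - F i s (Suc 0) y0 [y1 - y0])
      \<le> K * (max (\<bar>t - s\<bar> powr \<alpha>) (norm (y1 - y0)))\<^sup>2"
    using jet_estD(6)[OF J I y, of "[]"] by simp
qed

end

section \<open>The tower of Milstein steps of the equation\<close>

locale rde_fields = local_fields T \<alpha> B x xx l r pr k F F'
  for T \<alpha> B and x :: "real \<Rightarrow> 'i::finite \<Rightarrow> real" and xx and l r :: "'e::banach \<Rightarrow> 'e" and pr k
    and F :: "'i \<Rightarrow> real \<Rightarrow> 'w::euclidean_space jet" and F' +
  fixes \<iota> :: "'w \<Rightarrow> 'e" and \<pi> :: "'e \<Rightarrow> 'w"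
  assumes k: "1 \<le> k" and \<alpha>3: "1 / 3 < \<alpha>" and \<iota>: "contr \<iota>" and \<pi>: "contr \<pi>" and \<pi>_\<iota> [simp]: "\<pi> (\<iota> y) = y"
    and bounded_or_linear: "(\<exists>K. jet_est 0 UNIV K) \<or>
      (\<forall>t\<in>{0..T}. \<forall>i i'. bounded_linear (\<lambda>y. F i t 0 y []) \<and> bounded_linear (\<lambda>y. F' i i' t 0 y []))"
begin

text \<open>The base term is a field on \<open>'e\<close> that reads only \<open>\<pi> z\<close> and
  moves only within the range of \<open>\<iota>\<close>, so both maps intertwine its steps with
  those of the given field.\<close>

primrec ts :: "nat \<Rightarrow> ('w, 'e) trm list" where
  "ts 0 = [(\<iota>, \<pi>, [])]"
| "ts (Suc j) = tan (ts j)"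

lemma ts_ok: "\<forall>\<tau>\<in>set (ts j). term_ok j \<tau>"
proof (induction j)
  case 0
  show ?case using \<iota> \<pi> by simp
next
  case (Suc j)
  thus ?case unfolding ts.simps(2) by (rule tan_ok)
qed

definition m :: "nat \<Rightarrow> real \<Rightarrow> real \<Rightarrow> 'e \<Rightarrow> 'e" where
  "m j = milstein (Ff (ts j)) (DFf (ts j)) (Ff' (ts j))"

definition mu :: "real \<Rightarrow> real \<Rightarrow> 'w \<Rightarrow> 'w" where
  "mu = milstein fb Dfb fb'"

lemma \<iota>_linear: "linear \<iota>" and \<pi>_linear: "linear \<pi>" and norm_\<iota>: "norm (\<iota> y) \<le> norm y" and norm_\<pi>: "norm (\<pi> z) \<le> norm z"
  using \<iota> \<pi> by (auto simp: contr_def)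

lemma bounded_linear_\<iota>: "bounded_linear \<iota>"
  using \<iota>_linear norm_\<iota> by (intro bounded_linear_intro[where K = 1]) (auto simp: linear_add linear_scale)

lemma bounded_linear_\<pi>: "bounded_linear \<pi>"
  using \<pi>_linear norm_\<pi> by (intro bounded_linear_intro[where K = 1]) (auto simp: linear_add linear_scale)

lemma m_0: "m 0 s t z = z + \<iota> (incr fb Dfb fb' s t (\<pi> z))"
  using \<iota>_linear by (simp add: m_def milstein_def incr_def gub_def fld_def dfld_def linear_add linear_sum linear_scale)

lemma m_\<iota>: "m 0 s t (\<iota> y) = \<iota> (mu s t y)"
  using \<iota>_linear by (simp add: m_0 mu_def milstein_def linear_add)

lemma \<pi>_m: "\<pi> (m 0 s t z) = mu s t (\<pi> z)"
  using \<pi>_linear by (simp add: m_0 mu_def milstein_def linear_add)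

lemma fld_0: "fld (ts 0) g z = \<iota> (g 0 (\<pi> z) [])"
  by (simp add: fld_def)

text \<open>The first jet of a linear field is the field itself, by uniqueness of derivatives, so
  its Gubinelli derivative is linear in the state as well.\<close>

lemma m_0_homogeneous:
  assumes lin: "\<forall>t\<in>{0..T}. \<forall>i i'. bounded_linear (\<lambda>y. F i t 0 y []) \<and> bounded_linear (\<lambda>y. F' i i' t 0 y [])"
    and I: "s \<in> {0..T}"
  shows "m 0 s t (c *\<^sub>R z) = c *\<^sub>R m 0 s t z"
proof -
  have 0: "bounded_linear (fld (ts 0) g)" if "bounded_linear (\<lambda>y. g 0 y [])" for g
    unfolding fld_0[abs_def]
    using bounded_linear_compose[OF bounded_linear_\<iota> bounded_linear_compose[OF that bounded_linear_\<pi>]] .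
  have bl: "bounded_linear (fld (ts 0) (F i s))" "bounded_linear (fld (ts 0) (F' i i' s))" for i i'
    using 0[of "F i s"] 0[of "F' i i' s"] lin I by blast+
  have d: "dfld (ts 0) (F i s) z = fld (ts 0) (F i s)" for i z
    using has_derivative_unique[OF fld_F_has_derivative[OF ts_ok _ I] bounded_linear_imp_has_derivative[OF bl(1)]] k by simp
  note sc = linear_scale[OF bounded_linear.linear[OF bl(1)]] linear_scale[OF bounded_linear.linear[OF bl(2)]]
  show ?thesis
    unfolding m_def milstein_def incr_def gub_def d sc
    by (simp add: scaleR_add_right scaleR_sum_right mult.commute sum.distrib)
qed

lemma local_almost_flow_m: "j \<le> k \<Longrightarrow> local_almost_flow T \<alpha> (3 * \<alpha>) (m j)"
  unfolding m_def by (intro local_almost_flow_milstein field_est_local[OF ts_ok])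

lemma no_blowup_m: "no_blowup T (m 0) \<and> no_blowup T (\<lambda>a b. m 0 (T - a) (T - b))"
  using bounded_or_linear
proof
  assume "\<exists>K. jet_est 0 UNIV K"
  then obtain K where J: "jet_est 0 UNIV K" by blast
  have "\<exists>K. field_est (Ff (ts 0)) (DFf (ts 0)) (Ff' (ts 0)) UNIV K"
    by (rule field_est_terms[OF ts_ok _ J, where R = 1]) auto
  then obtain K where F: "field_est (Ff (ts 0)) (DFf (ts 0)) (Ff' (ts 0)) UNIV K" by blast
  obtain K where "almost_flow T \<alpha> (3 * \<alpha>) (m 0) UNIV K"
    using almost_flow_milstein[OF F subset_UNIV] by (auto simp: m_def)
  thus ?thesis using \<alpha> \<alpha>3 by (auto intro: no_blowup_uniform[of \<alpha> "3 * \<alpha>"] almost_flow_reverse)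
next
  assume lin: "\<forall>t\<in>{0..T}. \<forall>i i'. bounded_linear (\<lambda>y. F i t 0 y []) \<and> bounded_linear (\<lambda>y. F' i i' t 0 y [])"
  \<comment> \<open>A linear step is homogeneous in the whole state: the bounded component is 0 and
    the homogeneous one is everything.\<close>
  have no_blowup: "no_blowup T f" if "local_almost_flow T \<alpha> (3 * \<alpha>) f" and "\<And>s t c z. s \<in> {0..T} \<Longrightarrow> t \<in> {0..T} \<Longrightarrow> f s t (c *\<^sub>R z) = c *\<^sub>R f s t z"
    for f :: "real \<Rightarrow> real \<Rightarrow> 'e \<Rightarrow> 'e"
    by (rule no_blowup_homogeneous[where l = "\<lambda>_. 0" and r = id and sc = "\<lambda>c z. c *\<^sub>R z", OF \<alpha> _ that(1)])
       (use \<alpha>3 that(2) in auto)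
  have I: "T - s \<in> {0..T}" if "s \<in> {0..T}" for s using that by auto
  have "local_almost_flow T \<alpha> (3 * \<alpha>) (\<lambda>a b. m 0 (T - a) (T - b))"
    using local_almost_flow_m[OF le0] almost_flow_reverse unfolding local_almost_flow_def by blast
  thus ?thesis using local_almost_flow_m[OF le0] I by (intro conjI no_blowup m_0_homogeneous[OF lin])
qed

interpretation flow: flow_tower l r pr T \<alpha> "3 * \<alpha>" k m
proof
  show "lift T (m j) (m (Suc j))" if "j < k" for j
    unfolding m_def ts.simps(2) by (rule lift_milstein[OF ts_ok that])
qed (use T \<alpha> \<alpha>3 k local_almost_flow_m no_blowup_m in auto)

definition flow_map :: "real \<Rightarrow> real \<Rightarrow> 'w \<Rightarrow> 'w" where
  "flow_map s t y = \<pi> (flow.\<Phi> 0 s t (\<iota> y))"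

lemma flow_map_diffeomorphism:
  assumes "0 \<le> s" "s \<le> t" "t \<le> T"
  shows "C_k_diffeomorphism k (flow_map s t)"
  unfolding flow_map_def[abs_def]
  by (rule flow.diffeomorphism[OF bounded_linear_\<iota> bounded_linear_\<pi> \<pi>_\<iota> _ assms]) (simp add: m_\<iota>)

lemma davie_flow_map:
  assumes "0 \<le> s" "s \<le> T"
  shows "davie (3 * \<alpha>) mu s T (\<lambda>t. flow_map s t y)" "flow_map s s y = y"
proof -
  obtain L where L: "0 \<le> L" "\<And>u v. s \<le> u \<Longrightarrow> u \<le> v \<Longrightarrow> v \<le> T \<Longrightarrow>
     norm (flow.\<Phi> 0 s v (\<iota> y) - m 0 u v (flow.\<Phi> 0 s u (\<iota> y))) \<le> L * (v - u) powr (3 * \<alpha>)"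
    by (rule davieD[OF flow.davie_\<Phi>[OF assms, of "\<iota> y"]]) (erule that)
  show "davie (3 * \<alpha>) mu s T (\<lambda>t. flow_map s t y)"
    unfolding davie_def
  proof (intro exI allI impI)
    fix u v assume uv: "s \<le> u" "u \<le> v" "v \<le> T"
    show "norm (flow_map s v y - mu u v (flow_map s u y)) \<le> L * (v - u) powr (3 * \<alpha>)"
      using order_trans[OF norm_\<pi> L(2)[OF uv]] by (simp add: flow_map_def linear_diff[OF \<pi>_linear] \<pi>_m)
  qed
  show "flow_map s s y = y" using flow.\<Phi>_start[OF assms le0] by (simp add: flow_map_def)
qed

lemma davie_\<iota>:
  assumes Y: "davie (3 * \<alpha>) mu s t Y"
  shows "davie (3 * \<alpha>) (m 0) s t (\<lambda>u. \<iota> (Y u))"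
proof -
  obtain L where L: "0 \<le> L" "\<And>u v. s \<le> u \<Longrightarrow> u \<le> v \<Longrightarrow> v \<le> t \<Longrightarrow> norm (Y v - mu u v (Y u)) \<le> L * (v - u) powr (3 * \<alpha>)"
    by (rule davieD[OF Y]) (erule that)
  show ?thesis
    unfolding davie_def
  proof (intro exI allI impI)
    fix u v assume uv: "s \<le> u" "u \<le> v" "v \<le> t"
    show "norm (\<iota> (Y v) - m 0 u v (\<iota> (Y u))) \<le> L * (v - u) powr (3 * \<alpha>)"
      using order_trans[OF norm_\<iota> L(2)[OF uv]] by (simp add: linear_diff[OF \<iota>_linear] m_\<iota>)
  qed
qed

lemma davie_eq_flow_map:
  assumes Y: "davie (3 * \<alpha>) mu s t Y" and st: "0 \<le> s" "s \<le> t" "t \<le> T"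
  shows "Y t = flow_map s t (Y s)"
proof -
  have "\<pi> (\<iota> (Y t)) = flow_map s t (Y s)"
    using flow.davie_eq_\<Phi>[OF davie_\<iota>[OF Y] st] by (simp add: flow_map_def)
  thus ?thesis by simp
qed

text \<open>Davie's bound makes \<open>Y\<close> move by order \<alpha>. Dropping the second-order
  part of the step leaves a remainder of order \<open>2 * \<alpha>\<close>, so \<open>Y\<close> is
  controlled with derivative \<open>f(Y)\<close>; inserting this into the expansion of the field
  shows that \<open>f(Y)\<close> is controlled with derivative \<open>gub\<close>.\<close>

lemma davie_controlled:
  assumes Y: "davie (3 * \<alpha>) mu s T Y" and s: "0 \<le> s" "s \<le> T"
  obtains C where "\<And>u v i j. s \<le> u \<Longrightarrow> u \<le> v \<Longrightarrow> v \<le> T \<Longrightarrow>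
    norm (Y v - Y u - (\<Sum>i\<in>UNIV. (x v i - x u i) *\<^sub>R fb i u (Y u))) \<le> C * (v - u) powr (2 * \<alpha>) \<and>
    norm (fb i v (Y v) - fb i u (Y u)) \<le> C * (v - u) powr \<alpha> \<and>
    norm (gub fb Dfb fb' i j v (Y v) - gub fb Dfb fb' i j u (Y u)) \<le> C * (v - u) powr \<alpha> \<and>
    norm (fb j v (Y v) - fb j u (Y u) - (\<Sum>i\<in>UNIV. (x v i - x u i) *\<^sub>R gub fb Dfb fb' i j u (Y u))) \<le> C * (v - u) powr (2 * \<alpha>)"
proof -
  obtain L where L: "0 \<le> L" "\<And>u v. s \<le> u \<Longrightarrow> u \<le> v \<Longrightarrow> v \<le> T \<Longrightarrow> norm (Y v - mu u v (Y u)) \<le> L * (v - u) powr (3 * \<alpha>)"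
    by (rule davieD[OF Y]) (erule that)
  obtain R where R: "\<And>u. s \<le> u \<Longrightarrow> u \<le> T \<Longrightarrow> norm (\<iota> (Y u)) \<le> R"
    by (rule flow.davie_bounds[OF davie_\<iota>[OF Y] s(1) order_refl]) (erule that)
  have Y_R: "Y u \<in> cball 0 R" if "s \<le> u" "u \<le> T" for u
    using order_trans[OF norm_\<pi> R[OF that]] by simp
  obtain K where "jet_est k (cball 0 R) K" using loc by blast
  hence Fe: "field_est fb Dfb fb' (cball 0 R) K" by (intro field_est_base) (rule jet_est_mono, auto)
  note K = field_estD(1)[OF Fe]
  obtain C1 where C1: "0 \<le> C1" "\<And>f Df f' (D :: 'w set) s t z. field_est f Df f' D K \<Longrightarrow> s \<in> {0..T} \<Longrightarrow>
     t \<in> {0..T} \<Longrightarrow> z \<in> D \<Longrightarrow> norm (incr f Df f' s t z) \<le> C1 * \<bar>t - s\<bar> powr \<alpha>"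
    by (rule incr_bound[OF K]) (erule that)
  define n where "n = real CARD('i)"
  \<comment> \<open>\<open>b0\<close> is a Hoelder constant for \<open>Y\<close>, and
    \<open>b1\<close> bounds its controlled remainder; powers of \<open>T\<close> trade the surplus
    order of the Davie error.\<close>
  define b0 b1 where "b0 = L * (T powr \<alpha>)\<^sup>2 + C1" and "b1 = L * T powr \<alpha> + n * (n * (B * (K * K + K)))"
  have b: "0 \<le> b0" "0 \<le> b1" using L(1) C1(1) B K by (auto simp: b0_def b1_def n_def)
  define C where "C = b1 + K * (1 + b0) + (2 * (K * K) + K) * (1 + b0) + (K * (1 + b0)\<^sup>2 + K * b1)"
  have C: "b1 \<le> C" "K * (1 + b0) \<le> C" "(2 * (K * K) + K) * (1 + b0) \<le> C" "K * (1 + b0)\<^sup>2 + K * b1 \<le> C"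
    using b K by (auto simp: C_def)
  show thesis
  proof (rule that[of C])
    fix u v i j assume uv: "s \<le> u" "u \<le> v" "v \<le> T"
    have I: "u \<in> {0..T}" "v \<in> {0..T}" using uv s by auto
    have y: "Y u \<in> cball 0 R" "Y v \<in> cball 0 R" using Y_R uv by auto
    define a where "a = (v - u) powr \<alpha>"
    have a: "0 \<le> a" "a \<le> T powr \<alpha>" "\<bar>v - u\<bar> powr \<alpha> = a" "(v - u) powr (2 * \<alpha>) = a\<^sup>2" "(v - u) powr (3 * \<alpha>) = a * a\<^sup>2"
      using abs_powr_le[OF I, of \<alpha>] \<alpha> uv by (auto simp: a_def power2_eq_square simp flip: powr_add)
    have La: "L * (a * a\<^sup>2) \<le> L * (T powr \<alpha>) * a\<^sup>2" "L * (a * a\<^sup>2) \<le> L * (T powr \<alpha>)\<^sup>2 * a"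
    proof -
      show "L * (a * a\<^sup>2) \<le> L * (T powr \<alpha>) * a\<^sup>2"
        using L(1) a(1,2) by (simp add: mult.assoc mult_left_mono mult_right_mono)
      have "a * a\<^sup>2 \<le> (T powr \<alpha>)\<^sup>2 * a" using a(1,2) power_mono[OF a(2,1), of 2] by (simp add: mult.commute mult_left_mono)
      thus "L * (a * a\<^sup>2) \<le> L * (T powr \<alpha>)\<^sup>2 * a" using L(1) by (simp add: mult.assoc mult_left_mono)
    qed
    let ?G = "gub fb Dfb fb'" and ?S = "\<Sum>i\<in>UNIV. (x v i - x u i) *\<^sub>R fb i u (Y u)"
    have dav: "norm (Y v - (Y u + incr fb Dfb fb' u v (Y u))) \<le> L * (a * a\<^sup>2)"
      using L(2)[OF uv] by (simp add: mu_def milstein_def a(5))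
    have "norm (Y v - Y u) \<le> L * (a * a\<^sup>2) + C1 * a"
      using norm_triangle_mono[OF dav C1(2)[OF Fe I y(1), unfolded a(3)]] by simp
    also have "\<dots> \<le> b0 * a" using La(2) by (simp add: b0_def algebra_simps)
    finally have inc: "norm (Y v - Y u) \<le> b0 * a" .
    have 1: "norm (Y v - Y u - ?S) \<le> b1 * a\<^sup>2"
    proof -
      have "norm (\<Sum>i\<in>UNIV. \<Sum>j\<in>UNIV. xx u v i j *\<^sub>R ?G i j u (Y u)) \<le> n * (n * (B * a\<^sup>2 * (K * K + K)))"
        using second_order_bound[OF Fe I y(1)] by (simp add: n_def a(3))
      from norm_triangle_mono[OF dav this]
      have "norm (Y v - Y u - ?S) \<le> L * (a * a\<^sup>2) + n * (n * (B * a\<^sup>2 * (K * K + K)))"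
        by (simp add: incr_def algebra_simps)
      also have "\<dots> \<le> b1 * a\<^sup>2" using La(1) by (simp add: b1_def algebra_simps)
      finally show ?thesis .
    qed
    define \<rho> where "\<rho> = max (\<bar>v - u\<bar> powr \<alpha>) (norm (Y v - Y u))"
    have \<rho>: "0 \<le> \<rho>" "\<rho> \<le> (1 + b0) * a" using inc a b by (auto simp: \<rho>_def le_max_iff_disj algebra_simps)
    note D = field_estD(2)[OF Fe I y, folded \<rho>_def]
    have K\<rho>: "c * \<rho> \<le> c * (1 + b0) * a" if "0 \<le> c" for c using mult_left_mono[OF \<rho>(2) that] by (simp add: mult.assoc)
    have 2: "norm (fb i v (Y v) - fb i u (Y u)) \<le> K * (1 + b0) * a"
      using D[of i] K\<rho>[OF K] by (meson order_trans)
    have 3: "norm (?G i j v (Y v) - ?G i j u (Y u)) \<le> (2 * (K * K) + K) * (1 + b0) * a"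
      using order_trans[OF gub_bounds(2)[OF Fe I y, of i j, folded \<rho>_def] K\<rho>] K by simp
    have 4: "norm (fb j v (Y v) - fb j u (Y u) - (\<Sum>i\<in>UNIV. (x v i - x u i) *\<^sub>R ?G i j u (Y u))) \<le> (K * (1 + b0)\<^sup>2 + K * b1) * a\<^sup>2"
    proof -
      have lin: "linear (Dfb j u (Y u))" using D by blast
      let ?R = "fb j v (Y v) - fb j u (Y u) - (\<Sum>i\<in>UNIV. (x v i - x u i) *\<^sub>R fb' i j u (Y u)) - Dfb j u (Y u) (Y v - Y u)"
      have "norm ?R \<le> K * \<rho>\<^sup>2" using D by blast
      also have "\<dots> \<le> K * ((1 + b0) * a)\<^sup>2" using \<rho> K by (intro mult_left_mono power_mono)
      finally have r1: "norm ?R \<le> K * (1 + b0)\<^sup>2 * a\<^sup>2" by (simp add: power_mult_distrib mult.assoc)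
      have "norm (Dfb j u (Y u) (Y v - Y u - ?S)) \<le> K * norm (Y v - Y u - ?S)" using D by blast
      also have "\<dots> \<le> K * (b1 * a\<^sup>2)" using 1 K by (rule mult_left_mono)
      finally have r2: "norm (Dfb j u (Y u) (Y v - Y u - ?S)) \<le> K * b1 * a\<^sup>2" by (simp add: mult.assoc)
      have "Dfb j u (Y u) (Y v - Y u - ?S) = Dfb j u (Y u) (Y v - Y u) - (\<Sum>i\<in>UNIV. (x v i - x u i) *\<^sub>R Dfb j u (Y u) (fb i u (Y u)))"
        using linear_diff[OF lin, of "Y v - Y u" ?S] by (simp add: linear_sum[OF lin] linear_scale[OF lin])
      hence eq: "fb j v (Y v) - fb j u (Y u) - (\<Sum>i\<in>UNIV. (x v i - x u i) *\<^sub>R ?G i j u (Y u)) = ?R + Dfb j u (Y u) (Y v - Y u - ?S)"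
        by (simp add: gub_def scaleR_add_right sum.distrib)
      show ?thesis unfolding eq using norm_triangle_mono[OF r1 r2] by (simp only: distrib_right)
    qed
    have "b1 * a\<^sup>2 \<le> C * a\<^sup>2" "(K * (1 + b0)\<^sup>2 + K * b1) * a\<^sup>2 \<le> C * a\<^sup>2"
      "K * (1 + b0) * a \<le> C * a" "(2 * (K * K) + K) * (1 + b0) * a \<le> C * a"
      using C a(1) by (auto intro: mult_right_mono)
    with 1 2 3 4 show "norm (Y v - Y u - ?S) \<le> C * (v - u) powr (2 * \<alpha>) \<and>
      norm (fb i v (Y v) - fb i u (Y u)) \<le> C * (v - u) powr \<alpha> \<and>
      norm (?G i j v (Y v) - ?G i j u (Y u)) \<le> C * (v - u) powr \<alpha> \<and>
      norm (fb j v (Y v) - fb j u (Y u) - (\<Sum>i\<in>UNIV. (x v i - x u i) *\<^sub>R ?G i j u (Y u))) \<le> C * (v - u) powr (2 * \<alpha>)"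
      unfolding a(4) a_def[symmetric] by (meson order_trans)
  qed
qed

end

section \<open>A self-doubling Banach space\<close>

text \<open>The bounded functions on a countable discrete space are isomorphic to pairs of such functions;
  this makes the tangent lift an operation on a single Banach space.\<close>

type_synonym 'w seq = "nat discrete \<Rightarrow>\<^sub>C 'w"

instance bcontfun :: (metric_space, banach) banach ..

lemma bcontfun_discreteI: "(\<And>n. norm (f n) \<le> b) \<Longrightarrow> f \<in> bcontfun"
  for f :: "nat discrete \<Rightarrow> 'w::euclidean_space"
  by (rule bcontfun_normI) (auto simp: continuous_on_open_vimage open_discrete)

definition even_part :: "'w::euclidean_space seq \<Rightarrow> 'w seq" where
  "even_part z = Bcontfun (\<lambda>n. apply_bcontfun z (discrete (2 * of_discrete n)))"

definition odd_part :: "'w::euclidean_space seq \<Rightarrow> 'w seq" where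
  "odd_part z = Bcontfun (\<lambda>n. apply_bcontfun z (discrete (2 * of_discrete n + 1)))"

definition interleave :: "'w::euclidean_space seq \<Rightarrow> 'w seq \<Rightarrow> 'w seq" where
  "interleave a b = Bcontfun (\<lambda>n. apply_bcontfun (if even (of_discrete n) then a else b) (discrete (of_discrete n div 2)))"

lemma even_part_apply: "apply_bcontfun (even_part z) n = apply_bcontfun z (discrete (2 * of_discrete n))"
  unfolding even_part_def by (subst Bcontfun_inverse) (auto intro: bcontfun_discreteI norm_bounded)

lemma odd_part_apply: "apply_bcontfun (odd_part z) n = apply_bcontfun z (discrete (2 * of_discrete n + 1))"
  unfolding odd_part_def by (subst Bcontfun_inverse) (auto intro: bcontfun_discreteI norm_bounded)

lemma interleave_apply:
  "apply_bcontfun (interleave a b) n = apply_bcontfun (if even (of_discrete n) then a else b) (discrete (of_discrete n div 2))"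
proof -
  have "norm (apply_bcontfun (if even (of_discrete n) then a else b) (discrete (of_discrete n div 2))) \<le> norm a + norm b" for n
    by (simp add: norm_bounded add_increasing add_increasing2)
  thus ?thesis unfolding interleave_def by (subst Bcontfun_inverse) (auto intro: bcontfun_discreteI)
qed

lemma doubling_seq: "doubling (even_part :: 'w::euclidean_space seq \<Rightarrow> _) odd_part interleave"
proof (rule doubling.intro)
  fix a b z :: "'w seq"
  note [simp] = even_part_apply odd_part_apply interleave_apply discrete_inverse of_discrete_inverse
  show "linear (even_part :: 'w seq \<Rightarrow> _)" "linear (odd_part :: 'w seq \<Rightarrow> _)"
    by (auto intro!: linearI bcontfun_eqI)
  show "even_part (interleave a b) = a" "odd_part (interleave a b) = b" "interleave (even_part z) (odd_part z) = z"
    by (auto intro!: bcontfun_eqI)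
  show "norm (even_part z) \<le> norm z" "norm (odd_part z) \<le> norm z"
    by (auto intro!: norm_bound simp: norm_bounded)
  show "norm z \<le> norm (even_part z) + norm (odd_part z)"
  proof (rule norm_bound)
    fix n
    have "norm (apply_bcontfun z n) \<le> (if even (of_discrete n) then norm (even_part z) else norm (odd_part z))"
      using norm_bounded[of "even_part z" "discrete (of_discrete n div 2)"]
        norm_bounded[of "odd_part z" "discrete (of_discrete n div 2)"]
      by auto
    also have "\<dots> \<le> norm (even_part z) + norm (odd_part z)" by simp
    finally show "norm (apply_bcontfun z n) \<le> norm (even_part z) + norm (odd_part z)" .
  qed
qed

text \<open>The state space is embedded as the constant sequences; evaluation at an index is a left
  inverse.\<close>

lemma contr_const_bcontfun: "contr (const_bcontfun :: 'w::euclidean_space \<Rightarrow> 'w seq)"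
  unfolding contr_def
  by (auto intro!: linearI bcontfun_eqI norm_bound simp: const_bcontfun.rep_eq)

lemma contr_apply_bcontfun: "contr (\<lambda>z :: 'w::euclidean_space seq. apply_bcontfun z n)"
  unfolding contr_def by (auto intro!: linearI norm_bounded)

section \<open>Norms of multilinear maps\<close>

lemma multilin_bounded:
  fixes A :: "'w::euclidean_space list \<Rightarrow> 'u::real_normed_vector"
  assumes "multilin n A"
  shows "\<exists>K. \<forall>ws. length ws = n \<longrightarrow> norm (A ws) \<le> K * nrm ws"
  using assms
proof (induction n arbitrary: A)
  case 0
  show ?case by (intro exI[of _ "norm (A [])"]) auto
next
  case (Suc n)
  obtain K where K: "\<And>b ws. b \<in> Basis \<Longrightarrow> length ws = n \<Longrightarrow> norm (A (b # ws)) \<le> K b * nrm ws"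
    using Suc.IH[OF multilin_Cons[OF Suc.prems]] by metis
  have "norm (A ws) \<le> (\<Sum>b\<in>Basis. \<bar>K b\<bar>) * nrm ws" if len: "length ws = Suc n" for ws
  proof -
    obtain w vs where ws: "ws = w # vs" "length vs = n" using len by (cases ws) auto
    have lin: "linear (\<lambda>w. A (w # vs))" using multilin_linear[OF Suc.prems, of "[]" vs] ws by simp
    have "A ws = A ((\<Sum>b\<in>Basis. (w \<bullet> b) *\<^sub>R b) # vs)" by (simp add: ws euclidean_representation)
    also have "\<dots> = (\<Sum>b\<in>Basis. (w \<bullet> b) *\<^sub>R A (b # vs))" by (simp add: linear_sum[OF lin] linear_scale[OF lin])
    also have "norm \<dots> \<le> (\<Sum>b\<in>Basis. norm w * (\<bar>K b\<bar> * nrm vs))"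
    proof (rule sum_norm_le)
      fix b :: 'w assume b: "b \<in> Basis"
      have "norm (A (b # vs)) \<le> \<bar>K b\<bar> * nrm vs"
        using K[OF b ws(2)] mult_right_mono[OF abs_ge_self[of "K b"] nrm_nonneg[of vs]] by linarith
      thus "norm ((w \<bullet> b) *\<^sub>R A (b # vs)) \<le> norm w * (\<bar>K b\<bar> * nrm vs)"
        using Basis_le_norm[OF b, of w] by (auto intro: mult_mono)
    qed
    also have "\<dots> = (\<Sum>b\<in>Basis. \<bar>K b\<bar>) * nrm ws" by (simp add: ws sum_distrib_left sum_distrib_right mult_ac)
    finally show ?thesis .
  qed
  thus ?case by blast
qed

text \<open>The arguments are normalised one at a time and collected in the prefix \<open>us\<close>
  of vectors in the unit ball. That the supremum is over a bounded set comes from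
  \<open>multilin_bounded\<close>.\<close>

lemma mnorm_upper:
  fixes A :: "'w::euclidean_space list \<Rightarrow> 'u::real_normed_vector"
  assumes A: "multilin n A" and len: "length ws = n"
  shows "norm (A ws) \<le> mnorm n A * nrm ws"
proof -
  obtain K where K: "\<And>ws. length ws = n \<Longrightarrow> norm (A ws) \<le> K * nrm ws" using multilin_bounded[OF A] by blast
  have unit: "norm (A vs) \<le> mnorm n A" if "length vs = n" "\<forall>v\<in>set vs. norm v \<le> 1" for vs
    unfolding mnorm_def
  proof (rule cSUP_upper)
    show "bdd_above ((\<lambda>ws. norm (A ws)) ` {ws. length ws = n \<and> (\<forall>w\<in>set ws. norm w \<le> 1)})"
    proof (rule bdd_aboveI2)
      fix us :: "'w list" assume us: "us \<in> {ws. length ws = n \<and> (\<forall>w\<in>set ws. norm w \<le> 1)}"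
      have "nrm us \<le> 1" using us nrm_nonneg by (induction us arbitrary: n) (auto intro: mult_le_one)
      hence "\<bar>K\<bar> * nrm us \<le> \<bar>K\<bar>" by (simp add: mult_left_le)
      thus "norm (A us) \<le> \<bar>K\<bar>"
        using K[of us] us mult_right_mono[OF abs_ge_self[of K] nrm_nonneg[of us]] by auto
    qed
  qed (use that in auto)
  have "norm (A (us @ ws)) \<le> mnorm n A * nrm ws" if "length us + length ws = n" "\<forall>u\<in>set us. norm u \<le> 1" for us ws
    using that
  proof (induction ws arbitrary: us)
    case Nil
    thus ?case using unit[of us] by simp
  next
    case (Cons w ws)
    have lin: "linear (\<lambda>w. A (us @ w # ws))" using Cons.prems by (intro multilin_linear[OF A]) simp
    show ?case
    proof (cases "w = 0")
      case True
      thus ?thesis using linear_0[OF lin] by simp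
    next
      case False
      have "norm (A ((us @ [w /\<^sub>R norm w]) @ ws)) \<le> mnorm n A * nrm ws"
        by (rule Cons.IH) (use Cons.prems False in auto)
      moreover have "A (us @ w # ws) = norm w *\<^sub>R A (us @ (w /\<^sub>R norm w) # ws)"
        using linear_scale[OF lin, of "norm w" "w /\<^sub>R norm w"] False by simp
      ultimately show ?thesis by (simp add: mult_left_mono mult.left_commute)
    qed
  qed
  from this[of "[]" ws] len show ?thesis by simp
qed

lemma mnorm_nonneg:
  fixes A :: "'w::euclidean_space list \<Rightarrow> 'u::real_normed_vector"
  assumes "multilin n A"
  shows "0 \<le> mnorm n A"
proof -
  obtain b :: 'w where "b \<in> Basis" using nonempty_Basis by blast
  hence "nrm (replicate n b) = 1" by (induction n) auto
  thus ?thesis using order_trans[OF norm_ge_zero mnorm_upper[OF assms, of "replicate n b"]] by simp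
qed

lemma mnorm_le_imp:
  fixes A :: "'w::euclidean_space list \<Rightarrow> 'u::real_normed_vector"
  assumes "mnorm n A \<le> C" "multilin n A" "length ws = n"
  shows "norm (A ws) \<le> C * nrm ws"
  using mnorm_upper[OF assms(2,3)] mult_right_mono[OF assms(1) nrm_nonneg[of ws]] by linarith

lemma multilin_diff: "multilin n A \<Longrightarrow> multilin n A' \<Longrightarrow> multilin n (\<lambda>ws. A ws - A' ws)"
  unfolding multilin_def by (auto intro: linear_compose_sub)

lemma multilin_scaleR: "multilin n A \<Longrightarrow> multilin n (\<lambda>ws. c *\<^sub>R A ws)"
  unfolding multilin_def by (auto intro: linear_compose_scale_right)

lemma multilin_sum: "(\<And>i. i \<in> S \<Longrightarrow> multilin n (A i)) \<Longrightarrow> multilin n (\<lambda>ws. \<Sum>i\<in>S. A i ws)"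
  unfolding multilin_def by (auto intro!: linear_compose_sum)

lemma multilin_compose:
  assumes "multilin n A" "linear f"
  shows "multilin n (\<lambda>ws. f (A ws))"
  unfolding multilin_def using linear_compose[OF multilin_linear[OF assms(1)] assms(2)] by (simp add: comp_def)

lemma multilin_append: "multilin (n + length vs) A \<Longrightarrow> multilin n (\<lambda>ws. A (ws @ vs))"
  using multilin_linear[of "n + length vs" A _ "_ @ vs"] by (simp add: multilin_def)

lemma linear_blinfun_apply: "linear (\<lambda>A :: 'a::real_normed_vector \<Rightarrow>\<^sub>L 'b::real_normed_vector. blinfun_apply A v)"
  by (intro bounded_linear.linear bounded_linear_intros)

section \<open>The coordinates of a controlled Lipschitz field\<close>

locale rde_data =
  fixes \<alpha> T :: real and k :: nat
    and X :: "real \<Rightarrow> real ^ 'dX"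
    and XX :: "real \<Rightarrow> real \<Rightarrow> real ^ 'dX ^ 'dX"
    and F :: "real \<Rightarrow> nat \<Rightarrow> real ^ 'dY \<Rightarrow> (real ^ 'dY) list \<Rightarrow> (real ^ 'dX) \<Rightarrow>\<^sub>L (real ^ 'dY)"
    and F' :: "real \<Rightarrow> nat \<Rightarrow> real ^ 'dY \<Rightarrow> (real ^ 'dY) list \<Rightarrow>
                 (real ^ 'dX) \<Rightarrow>\<^sub>L (real ^ 'dX) \<Rightarrow>\<^sub>L (real ^ 'dY)"
  assumes \<alpha>: "1 / 3 < \<alpha>" and k: "k \<ge> 1" and T: "T > 0"
    and rough: "rough_path \<alpha> T X XX"
    and controlled: "controlled_Lip \<alpha> T X (k + 2) F F'"
    and cases: "(\<forall>t\<in>{0..T}. (\<lambda>x. F t 0 x []) \<in> bcontfun \<and> (\<lambda>x. F' t 0 x []) \<in> bcontfun) \<or>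
         (\<forall>t\<in>{0..T}. bounded_linear (\<lambda>x. F t 0 x []) \<and> bounded_linear (\<lambda>x. F' t 0 x []))"
begin

definition xc :: "real \<Rightarrow> 'dX \<Rightarrow> real" where "xc t i = X t $ i"

text \<open>This extends \<open>\<XX>\<^sub>s\<^sub>t\<close> to \<open>s > t\<close> by Chen's relation.\<close>

definition xxc :: "real \<Rightarrow> real \<Rightarrow> 'dX \<Rightarrow> 'dX \<Rightarrow> real" where
  "xxc s t i j = XX 0 t $ i $ j - XX 0 s $ i $ j - (X s $ i - X 0 $ i) * (X t $ j - X s $ j)"

definition Fc :: "'dX \<Rightarrow> real \<Rightarrow> (real ^ 'dY) jet" where
  "Fc i t j y ws = F t j y ws (axis i 1)"

definition Fc' :: "'dX \<Rightarrow> 'dX \<Rightarrow> real \<Rightarrow> (real ^ 'dY) jet" where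
  "Fc' i i' t j y ws = F' t j y ws (axis i 1) (axis i' 1)"

lemma xxc_eq:
  assumes "0 \<le> s" "s \<le> t" "t \<le> T"
  shows "xxc s t i j = XX s t $ i $ j"
proof -
  have "XX 0 t - XX 0 s - XX s t = tensor (X s - X 0) (X t - X s)"
    using rough assms unfolding rough_path_def by auto
  hence "(XX 0 t - XX 0 s - XX s t) $ i $ j = tensor (X s - X 0) (X t - X s) $ i $ j" by simp
  thus ?thesis by (simp add: xxc_def tensor_def)
qed

lemma X_holder:
  obtains C where "0 \<le> C" "\<And>s t. s \<in> {0..T} \<Longrightarrow> t \<in> {0..T} \<Longrightarrow> norm (X t - X s) \<le> C * \<bar>t - s\<bar> powr \<alpha>"
proof -
  obtain C where "\<forall>u\<in>{0..T}. \<forall>v\<in>{0..T}. norm (X v - X u) \<le> C * \<bar>v - u\<bar> powr \<alpha>"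
    using rough unfolding rough_path_def holder_on_def by blast
  hence "norm (X t - X s) \<le> max 0 C * \<bar>t - s\<bar> powr \<alpha>" if "s \<in> {0..T}" "t \<in> {0..T}" for s t
    using that by (intro order_trans[OF _ mult_right_mono[of C "max 0 C"]]) auto
  thus thesis using that[of "max 0 C"] by simp
qed

lemma XX_holder:
  obtains C where "0 \<le> C" "\<And>s t. 0 \<le> s \<Longrightarrow> s \<le> t \<Longrightarrow> t \<le> T \<Longrightarrow> norm (XX s t) \<le> C * (\<bar>t - s\<bar> powr \<alpha>)\<^sup>2"
proof -
  obtain C where C: "\<forall>s t. 0 \<le> s \<and> s \<le> t \<and> t \<le> T \<longrightarrow> norm (XX s t) \<le> C * \<bar>t - s\<bar> powr (2 * \<alpha>)"
    using rough unfolding rough_path_def by blast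
  have p: "\<bar>t - s\<bar> powr (2 * \<alpha>) = (\<bar>t - s\<bar> powr \<alpha>)\<^sup>2" for s t :: real
    by (simp add: power2_eq_square flip: powr_add)
  have "norm (XX s t) \<le> max 0 C * (\<bar>t - s\<bar> powr \<alpha>)\<^sup>2" if "0 \<le> s" "s \<le> t" "t \<le> T" for s t
  proof -
    have "norm (XX s t) \<le> C * (\<bar>t - s\<bar> powr \<alpha>)\<^sup>2" using C that unfolding p by blast
    also have "\<dots> \<le> max 0 C * (\<bar>t - s\<bar> powr \<alpha>)\<^sup>2" by (intro mult_right_mono) auto
    finally show ?thesis .
  qed
  thus thesis using that[of "max 0 C"] by simp
qed

lemma rough_coords: "\<exists>B. rough_coords T \<alpha> B xc xxc"
proof -
  obtain C where C: "0 \<le> C" "\<And>s t. s \<in> {0..T} \<Longrightarrow> t \<in> {0..T} \<Longrightarrow> norm (X t - X s) \<le> C * \<bar>t - s\<bar> powr \<alpha>"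
    by (rule X_holder) (erule that)
  obtain C' where C': "0 \<le> C'" "\<And>s t. 0 \<le> s \<Longrightarrow> s \<le> t \<Longrightarrow> t \<le> T \<Longrightarrow> norm (XX s t) \<le> C' * (\<bar>t - s\<bar> powr \<alpha>)\<^sup>2"
    by (rule XX_holder) (erule that)
  define B where "B = C + C' + C * C"
  have B: "0 \<le> B" "C \<le> B" "C' \<le> B" "C' + C * C \<le> B" using C(1) C'(1) by (auto simp: B_def)
  have x: "\<bar>xc t i - xc s i\<bar> \<le> C * \<bar>t - s\<bar> powr \<alpha>" if "s \<in> {0..T}" "t \<in> {0..T}" for s t i
    using order_trans[OF component_le_norm_cart[of "X t - X s" i] C(2)[OF that]] by (simp add: xc_def)
  have xx: "\<bar>xxc s t i j\<bar> \<le> C' * (\<bar>t - s\<bar> powr \<alpha>)\<^sup>2" if "0 \<le> s" "s \<le> t" "t \<le> T" for s t i j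
  proof -
    have "\<bar>XX s t $ i $ j\<bar> \<le> norm (XX s t $ i)" by (rule component_le_norm_cart)
    also have "\<dots> \<le> norm (XX s t)" by (rule Finite_Cartesian_Product.norm_nth_le)
    finally show ?thesis using C'(2)[OF that] by (simp add: xxc_eq[OF that])
  qed
  have "rough_coords T \<alpha> B xc xxc"
  proof
    fix s t i j assume I: "s \<in> {0..T}" "t \<in> {0..T}"
    show "\<bar>xc t i - xc s i\<bar> \<le> B * \<bar>t - s\<bar> powr \<alpha>"
      using x[OF I] mult_right_mono[OF B(2), of "\<bar>t - s\<bar> powr \<alpha>"] by (meson order_trans powr_ge_zero)
    let ?p = "(\<bar>t - s\<bar> powr \<alpha>)\<^sup>2"
    show "\<bar>xxc s t i j\<bar> \<le> B * ?p"
    proof (cases "s \<le> t")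
      case True
      thus ?thesis using xx[of s t i j] I mult_right_mono[OF B(3), of ?p] by (auto intro: order_trans)
    next
      case False
      \<comment> \<open>Chen's relation for the times \<open>s, t, s\<close> expresses the backward
        increment through the forward one.\<close>
      have "xxc s t i j = (xc t i - xc s i) * (xc t j - xc s j) - xxc t s i j"
        by (simp add: xxc_def xc_def algebra_simps)
      moreover have "\<bar>(xc t i - xc s i) * (xc t j - xc s j)\<bar> \<le> (C * \<bar>t - s\<bar> powr \<alpha>) * (C * \<bar>t - s\<bar> powr \<alpha>)"
        unfolding abs_mult using C(1) by (intro mult_mono x I) auto
      moreover have "\<bar>xxc t s i j\<bar> \<le> C' * ?p" using xx[of t s i j] False I by (simp add: abs_minus_commute)
      ultimately have "\<bar>xxc s t i j\<bar> \<le> (C * \<bar>t - s\<bar> powr \<alpha>) * (C * \<bar>t - s\<bar> powr \<alpha>) + C' * ?p" by linarith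
      also have "\<dots> = (C' + C * C) * ?p" by (simp add: algebra_simps power2_eq_square)
      also have "\<dots> \<le> B * ?p" by (intro mult_right_mono B) simp
      finally show ?thesis .
    qed
  next
    show "xxc s t i j = xxc s u i j + xxc u t i j + (xc u i - xc s i) * (xc t j - xc u j)" for s t u i j
      by (simp add: xxc_def xc_def algebra_simps)
  qed (use T \<alpha> B in auto)
  thus ?thesis by blast
qed

lemma multilin_F: "t \<in> {0..T} \<Longrightarrow> j \<le> Suc k \<Longrightarrow> multilin j (F t j y)"
  and symmetric_F: "t \<in> {0..T} \<Longrightarrow> j \<le> Suc k \<Longrightarrow> symmetric_mlin j (F t j y)"
  and multilin_F': "t \<in> {0..T} \<Longrightarrow> j \<le> k \<Longrightarrow> multilin j (F' t j y)"
  using controlled unfolding controlled_Lip_def by auto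

lemma controlled_fields:
  assumes "rough_coords T \<alpha> B xc xxc"
  shows "controlled_fields T \<alpha> B xc xxc (even_part :: (real ^ 'dY) seq \<Rightarrow> _) odd_part interleave k Fc Fc'"
proof (intro controlled_fields.intro assms doubling_seq controlled_fields_axioms.intro)
  show "multilin j (Fc i t j y)" if "t \<in> {0..T}" "j \<le> Suc k" for i t j y
    unfolding Fc_def by (rule multilin_compose[OF multilin_F[OF that] linear_blinfun_apply])
  show "multilin j (Fc' i i' t j y)" if "t \<in> {0..T}" "j \<le> k" for i i' t j y
    unfolding Fc'_def
    by (rule multilin_compose[OF multilin_compose[OF multilin_F'[OF that] linear_blinfun_apply] linear_blinfun_apply])
  show "Fc i t (Suc (Suc (length ws))) y (ws @ [u, v]) = Fc i t (Suc (Suc (length ws))) y (ws @ [v, u])"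
    if "t \<in> {0..T}" "length ws < k" for i t ws y u v
    unfolding Fc_def
    by (subst symmetric_F[OF that(1), unfolded symmetric_mlin_def, rule_format, of "Suc (Suc (length ws))" "ws @ [u, v]" "ws @ [v, u]"])
       (use that(2) in simp_all)
qed

text \<open>Condition (ii) for \<open>\<partial>\<^sup>j f\<close> is only asked for \<open>t\<^sub>0 \<le> t\<^sub>1\<close>; the Hoelder bounds on
  \<open>\<partial>\<^sup>j f'\<close> and \<open>\<partial>\<^sup>j\<^sup>+\<^sup>1 f\<close> give it for times in any order.\<close>

lemma controlled_bounds:
  obtains C where "0 \<le> C"
    "\<And>t0 t1 y0 y1 ws. t0 \<in> {0..T} \<Longrightarrow> t1 \<in> {0..T} \<Longrightarrow> length ws \<le> k \<Longrightarrow>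
      norm (F' t1 (length ws) y1 ws - F' t0 (length ws) y0 ws) \<le> C * max (\<bar>t1 - t0\<bar> powr \<alpha>) (norm (y1 - y0)) * nrm ws"
    "\<And>t0 t1 y0 y1 ws. t0 \<in> {0..T} \<Longrightarrow> t1 \<in> {0..T} \<Longrightarrow> 1 \<le> length ws \<Longrightarrow> length ws \<le> Suc k \<Longrightarrow>
      norm (F t1 (length ws) y1 ws - F t0 (length ws) y0 ws) \<le> C * max (\<bar>t1 - t0\<bar> powr \<alpha>) (norm (y1 - y0)) * nrm ws"
    "\<And>t0 t1 y0 y1 ws. t0 \<in> {0..T} \<Longrightarrow> t1 \<in> {0..T} \<Longrightarrow> length ws \<le> k \<Longrightarrow>
      norm (F t1 (length ws) y1 ws - F t0 (length ws) y0 ws - F' t0 (length ws) y0 ws (X t1 - X t0)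
        - F t0 (Suc (length ws)) y0 (ws @ [y1 - y0])) \<le> C * (max (\<bar>t1 - t0\<bar> powr \<alpha>) (norm (y1 - y0)))\<^sup>2 * nrm ws"
proof -
  obtain CX where CX: "0 \<le> CX" "\<And>s t. s \<in> {0..T} \<Longrightarrow> t \<in> {0..T} \<Longrightarrow> norm (X t - X s) \<le> CX * \<bar>t - s\<bar> powr \<alpha>"
    by (rule X_holder) (erule that)
  let ?\<rho> = "\<lambda>t0 t1 y0 y1 :: real ^ 'dY. max (\<bar>t1 - t0\<bar> powr \<alpha>) (norm (y1 - y0))"
  let ?E = "\<lambda>j t0 t1 y0 y1 ws. F t1 j y1 ws - F t0 j y0 ws - F' t0 j y0 ws (X t1 - X t0) - F t0 (Suc j) y0 (ws @ [y1 - y0])"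
  define P where "P = (\<lambda>j C. \<forall>t0 t1 y0 y1. 0 \<le> t0 \<and> t0 \<le> t1 \<and> t1 \<le> T \<longrightarrow>
     mnorm j (?E j t0 t1 y0 y1) \<le> C * (?\<rho> t0 t1 y0 y1)\<^sup>2 \<and>
     mnorm j (\<lambda>ws. F' t1 j y1 ws - F' t0 j y0 ws) + mnorm (Suc j) (\<lambda>ws. F t1 (Suc j) y1 ws - F t0 (Suc j) y0 ws) \<le> C * ?\<rho> t0 t1 y0 y1)"
  have "\<exists>C. P j C" if "j \<le> k" for j
    using controlled that unfolding controlled_Lip_def Let_def P_def by simp
  then obtain Cj where PCj: "\<And>j. j \<le> k \<Longrightarrow> P j (Cj j)" by metis
  have Cj: "mnorm j (?E j t0 t1 y0 y1) \<le> Cj j * (?\<rho> t0 t1 y0 y1)\<^sup>2 \<and>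
     mnorm j (\<lambda>ws. F' t1 j y1 ws - F' t0 j y0 ws) + mnorm (Suc j) (\<lambda>ws. F t1 (Suc j) y1 ws - F t0 (Suc j) y0 ws) \<le> Cj j * ?\<rho> t0 t1 y0 y1"
    if "j \<le> k" "0 \<le> t0" "t0 \<le> t1" "t1 \<le> T" for j t0 t1 y0 y1
    using PCj[OF that(1)] that(2-4) unfolding P_def by blast
  define C0 where "C0 = (\<Sum>j\<le>k. \<bar>Cj j\<bar>)"
  have C0: "0 \<le> C0" "Cj j \<le> C0" if "j \<le> k" for j
  proof -
    show "0 \<le> C0" by (simp add: C0_def sum_nonneg)
    have "\<bar>Cj j\<bar> \<le> C0" unfolding C0_def by (rule member_le_sum) (use that in auto)
    thus "Cj j \<le> C0" by simp
  qed
  have \<rho>: "0 \<le> ?\<rho> t0 t1 y0 y1" for t0 t1 y0 y1 by (simp add: le_max_iff_disj)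
  have mE: "multilin j (?E j t0 t1 y0 y1)" if "j \<le> k" "t0 \<in> {0..T}" "t1 \<in> {0..T}" for j t0 t1 y0 y1
    using that by (intro multilin_diff multilin_snoc multilin_compose[OF multilin_F' linear_blinfun_apply]) (auto intro: multilin_F)
  have mF: "multilin (Suc j) (\<lambda>ws. F t1 (Suc j) y1 ws - F t0 (Suc j) y0 ws)"
      "multilin j (\<lambda>ws. F' t1 j y1 ws - F' t0 j y0 ws)" if "j \<le> k" "t0 \<in> {0..T}" "t1 \<in> {0..T}" for j t0 t1 y0 y1
    using that by (auto intro!: multilin_diff multilin_F multilin_F')
  have fwd: "norm (?E j t0 t1 y0 y1 ws) \<le> C0 * (?\<rho> t0 t1 y0 y1)\<^sup>2 * nrm ws"
      "norm (F' t1 j y1 ws - F' t0 j y0 ws) \<le> C0 * ?\<rho> t0 t1 y0 y1 * nrm ws"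
      "length vs = Suc j \<Longrightarrow> norm (F t1 (Suc j) y1 vs - F t0 (Suc j) y0 vs) \<le> C0 * ?\<rho> t0 t1 y0 y1 * nrm vs"
    if j: "j \<le> k" "length ws = j" and t: "0 \<le> t0" "t0 \<le> t1" "t1 \<le> T" for j t0 t1 y0 y1 ws vs
  proof -
    have I: "t0 \<in> {0..T}" "t1 \<in> {0..T}" using t by auto
    note c = Cj[OF j(1) t, of y1 y0]
    have le: "Cj j * ?\<rho> t0 t1 y0 y1 \<le> C0 * ?\<rho> t0 t1 y0 y1" by (intro mult_right_mono C0 j \<rho>)
    have "mnorm j (?E j t0 t1 y0 y1) \<le> C0 * (?\<rho> t0 t1 y0 y1)\<^sup>2"
      using c mult_right_mono[OF C0(2)[OF j(1)], of "(?\<rho> t0 t1 y0 y1)\<^sup>2"] by (meson order_trans zero_le_power2)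
    thus "norm (?E j t0 t1 y0 y1 ws) \<le> C0 * (?\<rho> t0 t1 y0 y1)\<^sup>2 * nrm ws"
      using mE[OF j(1) I] j(2) by (rule mnorm_le_imp)
    \<comment> \<open>Condition (ii) bounds the sum of two norms; dropping the other one uses that
      it is nonnegative.\<close>
    have "mnorm j (\<lambda>ws. F' t1 j y1 ws - F' t0 j y0 ws) \<le> C0 * ?\<rho> t0 t1 y0 y1"
      using c le mnorm_nonneg[OF mF(1)[OF j(1) I, of y1 y0]] by linarith
    thus "norm (F' t1 j y1 ws - F' t0 j y0 ws) \<le> C0 * ?\<rho> t0 t1 y0 y1 * nrm ws"
      using mF(2)[OF j(1) I] j(2) by (rule mnorm_le_imp)
    have "mnorm (Suc j) (\<lambda>ws. F t1 (Suc j) y1 ws - F t0 (Suc j) y0 ws) \<le> C0 * ?\<rho> t0 t1 y0 y1"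
      using c le mnorm_nonneg[OF mF(2)[OF j(1) I, of y1 y0]] by linarith
    thus "norm (F t1 (Suc j) y1 vs - F t0 (Suc j) y0 vs) \<le> C0 * ?\<rho> t0 t1 y0 y1 * nrm vs" if "length vs = Suc j"
      using mF(1)[OF j(1) I] that by (rule mnorm_le_imp)
  qed
  have sym: "?\<rho> t1 t0 y1 y0 = ?\<rho> t0 t1 y0 y1" for t0 t1 y0 y1 by (simp add: abs_minus_commute norm_minus_commute)
  have lip': "norm (F' t1 j y1 ws - F' t0 j y0 ws) \<le> C0 * ?\<rho> t0 t1 y0 y1 * nrm ws"
    if "j \<le> k" "length ws = j" "t0 \<in> {0..T}" "t1 \<in> {0..T}" for j t0 t1 y0 y1 ws
  proof (cases "t0 \<le> t1")
    case True
    thus ?thesis using fwd(2)[OF that(1,2), of t0 t1] that by auto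
  next
    case False
    thus ?thesis using fwd(2)[OF that(1,2), of t1 t0 y0 y1] that unfolding sym[of t1 t0] by (simp add: norm_minus_commute)
  qed
  have lip: "norm (F t1 (Suc j) y1 vs - F t0 (Suc j) y0 vs) \<le> C0 * ?\<rho> t0 t1 y0 y1 * nrm vs"
    if "j \<le> k" "length vs = Suc j" "t0 \<in> {0..T}" "t1 \<in> {0..T}" for j t0 t1 y0 y1 vs
  proof (cases "t0 \<le> t1")
    case True
    thus ?thesis using fwd(3)[OF that(1), of "tl vs" t0 t1] that by auto
  next
    case False
    thus ?thesis using fwd(3)[OF that(1), of "tl vs" t1 t0 vs y0 y1] that unfolding sym[of t1 t0] by (simp add: norm_minus_commute)
  qed
  define C where "C = C0 * (2 + CX)"
  have C: "C0 \<le> C" "0 \<le> C" using C0(1)[of 0] CX(1) by (auto simp: C_def algebra_simps)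
  have sec: "norm (?E j t0 t1 y0 y1 ws) \<le> C * (?\<rho> t0 t1 y0 y1)\<^sup>2 * nrm ws"
    if j: "j \<le> k" "length ws = j" and I: "t0 \<in> {0..T}" "t1 \<in> {0..T}" for j t0 t1 y0 y1 ws
  proof (cases "t0 \<le> t1")
    case True
    show ?thesis using I True
      by (intro order_trans[OF fwd(1)[OF j]] mult_right_mono C nrm_nonneg) auto
  next
    case False
    let ?r = "?\<rho> t0 t1 y0 y1"
    have lin: "linear (\<lambda>v. F t1 (Suc j) y1 (ws @ [v]))"
      using multilin_linear[OF multilin_F[OF I(2), of "Suc j" y1], of ws "[]"] j by simp
    have "F t1 (Suc j) y1 (ws @ [y0 - y1]) = - F t1 (Suc j) y1 (ws @ [y1 - y0])"
      using linear_neg[OF lin, of "y1 - y0"] by simp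
    \<comment> \<open>Exchanging the endpoints changes the sign of the remainder and moves the base
      point of the two first-order terms. Each such move is a Hoelder increment times a factor of
      first order, hence of second order.\<close>
    hence "?E j t0 t1 y0 y1 ws = - ?E j t1 t0 y1 y0 ws + (F' t1 j y1 ws - F' t0 j y0 ws) (X t1 - X t0)
        + (F t1 (Suc j) y1 (ws @ [y1 - y0]) - F t0 (Suc j) y0 (ws @ [y1 - y0]))"
      by (simp add: blinfun.bilinear_simps)
    also have "norm \<dots> \<le> C0 * ?r\<^sup>2 * nrm ws + C0 * ?r * nrm ws * (CX * ?r) + C0 * ?r * (nrm ws * ?r)"
    proof (intro norm_triangle_mono)
      show "norm (- ?E j t1 t0 y1 y0 ws) \<le> C0 * ?r\<^sup>2 * nrm ws"
        using fwd(1)[OF j, of t1 t0 y0 y1] False I unfolding sym[of t1 t0] norm_minus_cancel by simp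
      have "norm ((F' t1 j y1 ws - F' t0 j y0 ws) (X t1 - X t0)) \<le> norm (F' t1 j y1 ws - F' t0 j y0 ws) * norm (X t1 - X t0)"
        by (rule norm_blinfun)
      also have "\<dots> \<le> C0 * ?r * nrm ws * (CX * ?r)"
      proof (intro mult_mono lip' j I)
        show "norm (X t1 - X t0) \<le> CX * ?r"
          by (rule order_trans[OF CX(2)[OF I]]) (intro mult_left_mono CX(1), simp)
      qed (intro norm_ge_zero mult_nonneg_nonneg C0(1)[of 0] \<rho> nrm_nonneg le0)+
      finally show "norm ((F' t1 j y1 ws - F' t0 j y0 ws) (X t1 - X t0)) \<le> C0 * ?r * nrm ws * (CX * ?r)" .
      have "norm (F t1 (Suc j) y1 (ws @ [y1 - y0]) - F t0 (Suc j) y0 (ws @ [y1 - y0])) \<le> C0 * ?r * nrm (ws @ [y1 - y0])"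
        by (rule lip) (use j I in auto)
      also have "\<dots> \<le> C0 * ?r * (nrm ws * ?r)"
        using C0(1)[of 0] \<rho>[of t1 t0 y1 y0] nrm_nonneg[of ws] by (auto intro!: mult_left_mono mult_nonneg_nonneg simp: le_max_iff_disj)
      finally show "norm (F t1 (Suc j) y1 (ws @ [y1 - y0]) - F t0 (Suc j) y0 (ws @ [y1 - y0])) \<le> C0 * ?r * (nrm ws * ?r)" .
    qed
    also have "\<dots> = C * ?r\<^sup>2 * nrm ws" by (simp add: C_def algebra_simps power2_eq_square)
    finally show ?thesis .
  qed
  show thesis
  proof (rule that[OF C(2)])
    fix t0 t1 :: real and y0 y1 :: "real ^ 'dY" and ws :: "(real ^ 'dY) list" assume I: "t0 \<in> {0..T}" "t1 \<in> {0..T}"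
    have up: "C0 * ?\<rho> t0 t1 y0 y1 * nrm ws \<le> C * ?\<rho> t0 t1 y0 y1 * nrm ws"
      by (intro mult_right_mono C \<rho> nrm_nonneg)
    show "norm (F' t1 (length ws) y1 ws - F' t0 (length ws) y0 ws) \<le> C * ?\<rho> t0 t1 y0 y1 * nrm ws" if "length ws \<le> k"
      using order_trans[OF lip'[OF that refl I] up] .
    show "norm (F t1 (length ws) y1 ws - F t0 (length ws) y0 ws) \<le> C * ?\<rho> t0 t1 y0 y1 * nrm ws"
      if "1 \<le> length ws" "length ws \<le> Suc k"
      using order_trans[OF lip[OF _ _ I, of "length ws - 1" ws] up] that by simp
    show "norm (?E (length ws) t0 t1 y0 y1 ws) \<le> C * (?\<rho> t0 t1 y0 y1)\<^sup>2 * nrm ws" if "length ws \<le> k"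
      by (rule sec[OF that refl I])
  qed
qed

end

lemma norm_blinfun_axis: "norm (blinfun_apply A (axis i 1)) \<le> norm A" for A :: "(real ^ 'n) \<Rightarrow>\<^sub>L 'u::real_normed_vector"
  using norm_blinfun[of A "axis i 1"] by (simp add: norm_axis_1)

lemma vec_expansion: "v = (\<Sum>i\<in>UNIV. v $ i *\<^sub>R axis i 1)" for v :: "real ^ 'n"
  using basis_expansion[of v] by (simp add: scalar_mult_eq_scaleR)

locale rde_coords = rde_data \<alpha> T k X XX F F'
  for \<alpha> T k and X :: "real \<Rightarrow> real ^ 'dX" and XX
    and F :: "real \<Rightarrow> nat \<Rightarrow> real ^ 'dY \<Rightarrow> (real ^ 'dY) list \<Rightarrow> (real ^ 'dX) \<Rightarrow>\<^sub>L (real ^ 'dY)" and F' +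
  fixes B :: real
  assumes rc: "rough_coords T \<alpha> B xc xxc"
begin

sublocale cf: controlled_fields T \<alpha> B xc xxc "even_part :: (real ^ 'dY) seq \<Rightarrow> _" odd_part interleave k Fc Fc'
  by (rule controlled_fields[OF rc])

definition value_bound :: "(real ^ 'dY) set \<Rightarrow> real \<Rightarrow> bool" where
  "value_bound D M \<longleftrightarrow> (\<forall>t\<in>{0..T}. \<forall>y\<in>D. norm (F t 0 y []) \<le> M \<and> norm (F' t 0 y []) \<le> M)"

text \<open>The Lip seminorms start at the first derivative and leave the values of the fields open.
  These are bounded on a ball by expanding from time 0 and the origin.\<close>

lemma local_value_bound: "\<exists>M. value_bound (cball 0 R) M"
proof -
  obtain C where C: "0 \<le> C"
    "\<And>t0 t1 y0 y1 ws. t0 \<in> {0..T} \<Longrightarrow> t1 \<in> {0..T} \<Longrightarrow> length ws \<le> k \<Longrightarrow>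
      norm (F' t1 (length ws) y1 ws - F' t0 (length ws) y0 ws) \<le> C * max (\<bar>t1 - t0\<bar> powr \<alpha>) (norm (y1 - y0)) * nrm ws"
    "\<And>t0 t1 y0 y1 ws. t0 \<in> {0..T} \<Longrightarrow> t1 \<in> {0..T} \<Longrightarrow> 1 \<le> length ws \<Longrightarrow> length ws \<le> Suc k \<Longrightarrow>
      norm (F t1 (length ws) y1 ws - F t0 (length ws) y0 ws) \<le> C * max (\<bar>t1 - t0\<bar> powr \<alpha>) (norm (y1 - y0)) * nrm ws"
    "\<And>t0 t1 y0 y1 ws. t0 \<in> {0..T} \<Longrightarrow> t1 \<in> {0..T} \<Longrightarrow> length ws \<le> k \<Longrightarrow>
      norm (F t1 (length ws) y1 ws - F t0 (length ws) y0 ws - F' t0 (length ws) y0 ws (X t1 - X t0)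
        - F t0 (Suc (length ws)) y0 (ws @ [y1 - y0])) \<le> C * (max (\<bar>t1 - t0\<bar> powr \<alpha>) (norm (y1 - y0)))\<^sup>2 * nrm ws"
    by (rule controlled_bounds) (erule that)
  obtain CX where CX: "0 \<le> CX" "\<And>s t. s \<in> {0..T} \<Longrightarrow> t \<in> {0..T} \<Longrightarrow> norm (X t - X s) \<le> CX * \<bar>t - s\<bar> powr \<alpha>"
    by (rule X_holder) (erule that)
  have z: "0 \<in> {0..T}" using T by simp
  obtain K where K: "\<And>ws. length ws = Suc 0 \<Longrightarrow> norm (F 0 (Suc 0) 0 ws) \<le> K * nrm ws"
    using multilin_bounded[OF multilin_F[OF z, of "Suc 0"]] by auto
  let ?r = "max (T powr \<alpha>) \<bar>R\<bar>"
  define M1 where "M1 = norm (F' 0 0 0 []) + C * ?r"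
  define M2 where "M2 = norm (F 0 0 0 []) + norm (F' 0 0 0 []) * (CX * ?r) + \<bar>K\<bar> * ?r + C * ?r\<^sup>2"
  have "norm (F t 0 y []) \<le> max M1 M2 \<and> norm (F' t 0 y []) \<le> max M1 M2" if t: "t \<in> {0..T}" and y: "y \<in> cball 0 R" for t y
  proof -
    let ?p = "max (\<bar>t - 0\<bar> powr \<alpha>) (norm (y - 0))"
    have p: "0 \<le> ?p" "?p \<le> ?r" using abs_powr_le[OF z t, of \<alpha>] \<alpha> y by (auto simp: le_max_iff_disj)
    have "norm (F' t 0 y [] - F' 0 0 0 []) \<le> C * ?p" using C(2)[OF z t, of "[]" y 0] by simp
    also have "\<dots> \<le> C * ?r" using p C(1) by (intro mult_left_mono)
    finally have 1: "norm (F' t 0 y []) \<le> M1" using norm_triangle_sub[of "F' t 0 y []" "F' 0 0 0 []"] by (simp add: M1_def)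
    let ?E = "F t 0 y [] - F 0 0 0 [] - F' 0 0 0 [] (X t - X 0) - F 0 (Suc 0) 0 [y - 0]"
    have "norm ?E \<le> C * ?p\<^sup>2" using C(4)[OF z t, of "[]" y 0] by simp
    also have "\<dots> \<le> C * ?r\<^sup>2" using p C(1) by (intro mult_left_mono power_mono)
    finally have e1: "norm ?E \<le> C * ?r\<^sup>2" .
    have "norm (X t - X 0) \<le> CX * \<bar>t - 0\<bar> powr \<alpha>" by (rule CX(2)[OF z t])
    also have "\<dots> \<le> CX * ?r" by (rule mult_left_mono[OF order_trans[OF max.cobounded1 p(2)] CX(1)])
    finally have "norm (F' 0 0 0 [] (X t - X 0)) \<le> norm (F' 0 0 0 []) * (CX * ?r)"
      by (intro order_trans[OF norm_blinfun] mult_left_mono) auto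
    moreover have "norm (F 0 (Suc 0) 0 [y - 0]) \<le> \<bar>K\<bar> * ?r"
    proof -
      have "norm (F 0 (Suc 0) 0 [y - 0]) \<le> K * norm y" using K[of "[y - 0]"] by simp
      also have "\<dots> \<le> \<bar>K\<bar> * ?r" using y by (intro mult_mono) (auto simp: le_max_iff_disj)
      finally show ?thesis .
    qed
    ultimately have "norm (F 0 0 0 [] + F' 0 0 0 [] (X t - X 0) + F 0 (Suc 0) 0 [y - 0] + ?E) \<le> M2"
      unfolding M2_def by (intro norm_triangle_mono e1 order_refl)
    hence "norm (F t 0 y []) \<le> M2" by simp
    with 1 show ?thesis by (simp add: le_max_iff_disj)
  qed
  thus ?thesis unfolding value_bound_def by blast
qed

text \<open>Boundedness is given for each time separately. Expanding in time from time 0 at a fixed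
  point of space makes it uniform in time.\<close>

lemma global_value_bound:
  assumes "\<forall>t\<in>{0..T}. (\<lambda>x. F t 0 x []) \<in> bcontfun \<and> (\<lambda>x. F' t 0 x []) \<in> bcontfun"
  shows "\<exists>M. value_bound UNIV M"
proof -
  obtain C where C: "0 \<le> C"
    "\<And>t0 t1 y0 y1 ws. t0 \<in> {0..T} \<Longrightarrow> t1 \<in> {0..T} \<Longrightarrow> length ws \<le> k \<Longrightarrow>
      norm (F' t1 (length ws) y1 ws - F' t0 (length ws) y0 ws) \<le> C * max (\<bar>t1 - t0\<bar> powr \<alpha>) (norm (y1 - y0)) * nrm ws"
    "\<And>t0 t1 y0 y1 ws. t0 \<in> {0..T} \<Longrightarrow> t1 \<in> {0..T} \<Longrightarrow> 1 \<le> length ws \<Longrightarrow> length ws \<le> Suc k \<Longrightarrow>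
      norm (F t1 (length ws) y1 ws - F t0 (length ws) y0 ws) \<le> C * max (\<bar>t1 - t0\<bar> powr \<alpha>) (norm (y1 - y0)) * nrm ws"
    "\<And>t0 t1 y0 y1 ws. t0 \<in> {0..T} \<Longrightarrow> t1 \<in> {0..T} \<Longrightarrow> length ws \<le> k \<Longrightarrow>
      norm (F t1 (length ws) y1 ws - F t0 (length ws) y0 ws - F' t0 (length ws) y0 ws (X t1 - X t0)
        - F t0 (Suc (length ws)) y0 (ws @ [y1 - y0])) \<le> C * (max (\<bar>t1 - t0\<bar> powr \<alpha>) (norm (y1 - y0)))\<^sup>2 * nrm ws"
    by (rule controlled_bounds) (erule that)
  obtain CX where CX: "0 \<le> CX" "\<And>s t. s \<in> {0..T} \<Longrightarrow> t \<in> {0..T} \<Longrightarrow> norm (X t - X s) \<le> CX * \<bar>t - s\<bar> powr \<alpha>"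
    by (rule X_holder) (erule that)
  have z: "0 \<in> {0..T}" using T by simp
  have "bounded (range (\<lambda>x. F 0 0 x []))" "bounded (range (\<lambda>x. F' 0 0 x []))"
    using assms z by (auto simp: bcontfun_def)
  then obtain b1 b2 where b: "\<And>y. norm (F 0 0 y []) \<le> b1" "\<And>y. norm (F' 0 0 y []) \<le> b2"
    unfolding bounded_iff by blast
  let ?r = "T powr \<alpha>"
  define M1 where "M1 = b2 + C * ?r"
  define M2 where "M2 = b1 + b2 * (CX * ?r) + C * ?r\<^sup>2"
  have "norm (F t 0 y []) \<le> max M1 M2 \<and> norm (F' t 0 y []) \<le> max M1 M2" if t: "t \<in> {0..T}" for t y
  proof -
    let ?p = "\<bar>t - 0\<bar> powr \<alpha>"
    have p: "?p \<le> ?r" using abs_powr_le[OF z t, of \<alpha>] \<alpha> by simp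
    have "norm (F' t 0 y [] - F' 0 0 y []) \<le> C * ?p" using C(2)[OF z t, of "[]" y y] by simp
    also have "\<dots> \<le> C * ?r" using p C(1) by (intro mult_left_mono)
    finally have 1: "norm (F' t 0 y []) \<le> M1"
      using norm_triangle_sub[of "F' t 0 y []" "F' 0 0 y []"] b(2)[of y] by (simp add: M1_def)
    have "linear (\<lambda>v. F 0 (Suc 0) y [v])" using multilin_linear[OF multilin_F[OF z, of "Suc 0"], of "[]" "[]"] by simp
    hence F0: "F 0 (Suc 0) y [0] = 0" by (rule linear_0)
    let ?E = "F t 0 y [] - F 0 0 y [] - F' 0 0 y [] (X t - X 0)"
    have "norm ?E \<le> C * ?p\<^sup>2" using C(4)[OF z t, of "[]" y y] by (simp add: F0)
    also have "\<dots> \<le> C * ?r\<^sup>2" using p C(1) by (intro mult_left_mono power_mono) auto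
    finally have e1: "norm ?E \<le> C * ?r\<^sup>2" .
    have "norm (X t - X 0) \<le> CX * \<bar>t - 0\<bar> powr \<alpha>" by (rule CX(2)[OF z t])
    also have "\<dots> \<le> CX * ?r" by (rule mult_left_mono[OF p CX(1)])
    finally have "norm (F' 0 0 y [] (X t - X 0)) \<le> b2 * (CX * ?r)"
      using b(2)[of y] CX(1) order_trans[OF norm_ge_zero b(2)[of y]] by (intro order_trans[OF norm_blinfun] mult_mono) auto
    hence "norm (F 0 0 y [] + F' 0 0 y [] (X t - X 0) + ?E) \<le> M2"
      unfolding M2_def by (intro norm_triangle_mono e1 b(1))
    hence "norm (F t 0 y []) \<le> M2" by simp
    with 1 show ?thesis by (simp add: le_max_iff_disj)
  qed
  thus ?thesis unfolding value_bound_def by blast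
qed

lemma sum_Fc': "(\<Sum>i'\<in>UNIV. (xc t i' - xc s i') *\<^sub>R Fc' i' i s j y ws) = F' s j y ws (X t - X s) (axis i 1)"
proof -
  have "F' s j y ws (X t - X s) = F' s j y ws (\<Sum>i'\<in>UNIV. (X t - X s) $ i' *\<^sub>R axis i' 1)"
    by (rule arg_cong[OF vec_expansion])
  thus ?thesis
    by (simp add: blinfun.sum_right blinfun.scaleR_right blinfun.sum_left blinfun.scaleR_left xc_def Fc'_def)
qed

lemma Lip_bound_F: "\<exists>C. \<forall>t\<in>{0..T}. Lip_bound (k + 2) (F t) C"
  and Lip_bound_F': "\<exists>C. \<forall>t\<in>{0..T}. Lip_bound (k + 1) (F' t) C"
  using controlled unfolding controlled_Lip_def by simp_all

text \<open>Orders 1 and higher are bounded on the whole space by the Lip seminorms, and increments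
  and expansions by condition (ii); \<open>D\<close> enters through the values of the fields,
  including the Lipschitz estimate at order 0.\<close>

lemma jet_est_of_value_bound:
  assumes M: "value_bound D M"
  shows "\<exists>K. cf.jet_est k D K"
proof -
  obtain C where C: "0 \<le> C"
    "\<And>t0 t1 y0 y1 ws. t0 \<in> {0..T} \<Longrightarrow> t1 \<in> {0..T} \<Longrightarrow> length ws \<le> k \<Longrightarrow>
      norm (F' t1 (length ws) y1 ws - F' t0 (length ws) y0 ws) \<le> C * max (\<bar>t1 - t0\<bar> powr \<alpha>) (norm (y1 - y0)) * nrm ws"
    "\<And>t0 t1 y0 y1 ws. t0 \<in> {0..T} \<Longrightarrow> t1 \<in> {0..T} \<Longrightarrow> 1 \<le> length ws \<Longrightarrow> length ws \<le> Suc k \<Longrightarrow>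
      norm (F t1 (length ws) y1 ws - F t0 (length ws) y0 ws) \<le> C * max (\<bar>t1 - t0\<bar> powr \<alpha>) (norm (y1 - y0)) * nrm ws"
    "\<And>t0 t1 y0 y1 ws. t0 \<in> {0..T} \<Longrightarrow> t1 \<in> {0..T} \<Longrightarrow> length ws \<le> k \<Longrightarrow>
      norm (F t1 (length ws) y1 ws - F t0 (length ws) y0 ws - F' t0 (length ws) y0 ws (X t1 - X t0)
        - F t0 (Suc (length ws)) y0 (ws @ [y1 - y0])) \<le> C * (max (\<bar>t1 - t0\<bar> powr \<alpha>) (norm (y1 - y0)))\<^sup>2 * nrm ws"
    by (rule controlled_bounds) (erule that)
  obtain CX where CX: "0 \<le> CX" "\<And>s t. s \<in> {0..T} \<Longrightarrow> t \<in> {0..T} \<Longrightarrow> norm (X t - X s) \<le> CX * \<bar>t - s\<bar> powr \<alpha>"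
    by (rule X_holder) (erule that)
  obtain C1 where C1: "\<And>t. t \<in> {0..T} \<Longrightarrow> Lip_bound (k + 2) (F t) C1"
    using Lip_bound_F by blast
  obtain C2 where C2: "\<And>t. t \<in> {0..T} \<Longrightarrow> Lip_bound (k + 1) (F' t) C2"
    using Lip_bound_F' by blast
  define K where "K = C + \<bar>C1\<bar> + \<bar>C2\<bar> + 2 * \<bar>M\<bar> + \<bar>M\<bar> * CX"
  have K: "0 \<le> K" "C \<le> K" "C1 \<le> K" "C2 \<le> K" "M \<le> K" "2 * \<bar>M\<bar> \<le> K" "\<bar>M\<bar> * CX + C1 + C \<le> K"
  proof -
    have "0 \<le> \<bar>M\<bar> * CX" using CX(1) by simp
    thus "0 \<le> K" "C \<le> K" "C1 \<le> K" "C2 \<le> K" "M \<le> K" "2 * \<bar>M\<bar> \<le> K" "\<bar>M\<bar> * CX + C1 + C \<le> K"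
      unfolding K_def using C(1) abs_ge_self[of C1] abs_ge_self[of C2] abs_ge_self[of M]
        abs_ge_zero[of C1] abs_ge_zero[of C2] abs_ge_zero[of M] by linarith+
  qed
  have bF: "norm (F t (length ws) y ws) \<le> K * nrm ws" if "t \<in> {0..T}" "y \<in> D" "length ws \<le> Suc k" for t y ws
  proof (cases "ws = []")
    case True
    have "norm (F t 0 y []) \<le> M" using M that unfolding value_bound_def by auto
    hence "norm (F t 0 y []) \<le> K" using K(5) by linarith
    thus ?thesis by (simp add: True)
  next
    case False
    hence "1 \<le> length ws" by (cases ws) auto
    hence "mnorm (length ws) (F t (length ws) y) \<le> C1"
      using C1[OF that(1)] that(3) unfolding Lip_bound_def by auto
    hence "mnorm (length ws) (F t (length ws) y) \<le> K" using K(3) by linarith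
    thus ?thesis using multilin_F[OF that(1,3)] by (intro mnorm_le_imp) auto
  qed
  have bF': "norm (F' t (length ws) y ws) \<le> K * nrm ws" if "t \<in> {0..T}" "y \<in> D" "length ws \<le> k" for t y ws
  proof (cases "ws = []")
    case True
    have "norm (F' t 0 y []) \<le> M" using M that unfolding value_bound_def by auto
    hence "norm (F' t 0 y []) \<le> K" using K(5) by linarith
    thus ?thesis by (simp add: True)
  next
    case False
    hence "1 \<le> length ws" by (cases ws) auto
    hence "mnorm (length ws) (F' t (length ws) y) \<le> C2"
      using C2[OF that(1)] that(3) unfolding Lip_bound_def by auto
    hence "mnorm (length ws) (F' t (length ws) y) \<le> K" using K(4) by linarith
    thus ?thesis using multilin_F'[OF that(1,3)] by (intro mnorm_le_imp) auto
  qed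
  have lF: "norm (F t (length ws) y1 ws - F s (length ws) y0 ws) \<le> K * max (\<bar>t - s\<bar> powr \<alpha>) (norm (y1 - y0)) * nrm ws"
    if I: "s \<in> {0..T}" "t \<in> {0..T}" and y: "y0 \<in> D" "y1 \<in> D" and "length ws \<le> Suc k" for s t y0 y1 ws
  proof -
    let ?p = "max (\<bar>t - s\<bar> powr \<alpha>) (norm (y1 - y0))"
    have p: "0 \<le> ?p" "\<bar>t - s\<bar> powr \<alpha> \<le> ?p" "norm (y1 - y0) \<le> ?p" by (auto simp: le_max_iff_disj)
    show ?thesis
    proof (cases "ws = []")
      case ws: True
      have b: "norm (F t 0 y1 []) \<le> M" "norm (F s 0 y0 []) \<le> M" "norm (F' s 0 y0 []) \<le> M"
        using M I y unfolding value_bound_def by auto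
      show ?thesis
      \<comment> \<open>For large distances the value bound suffices; for distances below 1 the
        quadratic remainder of the expansion is dominated by a linear one.\<close>
      proof (cases "1 \<le> ?p")
        case True
        have "norm (F t 0 y1 [] - F s 0 y0 []) \<le> K * 1"
          using norm_triangle_ineq4[of "F t 0 y1 []" "F s 0 y0 []"] b K(6) by linarith
        also have "\<dots> \<le> K * ?p" using True K(1) by (rule mult_left_mono)
        finally show ?thesis by (simp add: ws)
      next
        case False
        hence "?p \<le> 1" by linarith
        from mult_right_mono[OF this p(1)] have p2: "?p\<^sup>2 \<le> ?p" unfolding power2_eq_square by (simp only: mult_1)
        let ?E = "F t 0 y1 [] - F s 0 y0 [] - F' s 0 y0 [] (X t - X s) - F s (Suc 0) y0 [y1 - y0]"
        have 1: "norm ?E \<le> C * ?p"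
          using C(4)[OF I, of "[]" y1 y0] mult_left_mono[OF p2 C(1)] by simp
        have 2: "norm (F' s 0 y0 [] (X t - X s)) \<le> \<bar>M\<bar> * (CX * ?p)"
          using b(3) order_trans[OF CX(2)[OF I] mult_left_mono[OF p(2) CX(1)]]
          by (intro order_trans[OF norm_blinfun] mult_mono) auto
        have "mnorm (Suc 0) (F s (Suc 0) y0) \<le> C1" using C1[OF I(1)] unfolding Lip_bound_def by auto
        hence "norm (F s (Suc 0) y0 [y1 - y0]) \<le> C1 * nrm [y1 - y0]"
          using multilin_F[OF I(1), of "Suc 0"] by (intro mnorm_le_imp) auto
        also have "\<dots> \<le> C1 * ?p"
        proof -
          have "0 \<le> C1" using order_trans[OF mnorm_nonneg[OF multilin_F[OF I(1), of "Suc 0" y0]] \<open>mnorm (Suc 0) (F s (Suc 0) y0) \<le> C1\<close>] by simp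
          thus ?thesis using p by (intro mult_left_mono) auto
        qed
        finally have 3: "norm (F s (Suc 0) y0 [y1 - y0]) \<le> C1 * ?p" .
        have "F t 0 y1 [] - F s 0 y0 [] = F' s 0 y0 [] (X t - X s) + F s (Suc 0) y0 [y1 - y0] + ?E" by simp
        also have "norm \<dots> \<le> \<bar>M\<bar> * (CX * ?p) + C1 * ?p + C * ?p" by (intro norm_triangle_mono 1 2 3)
        also have "\<dots> = (\<bar>M\<bar> * CX + C1 + C) * ?p" by (simp add: algebra_simps)
        also have "\<dots> \<le> K * ?p" by (intro mult_right_mono K p)
        finally show ?thesis by (simp add: ws)
      qed
    next
      case False
      hence "1 \<le> length ws" by (cases ws) auto
      thus ?thesis using that by (intro order_trans[OF C(3)[OF I]] mult_right_mono K p nrm_nonneg)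
    qed
  qed
  have "cf.jet_est k D K"
    unfolding cf.jet_est_def
  proof (intro conjI ballI allI impI K(1))
    fix s t y0 y1 i i' and ws :: "(real ^ 'dY) list" assume I: "s \<in> {0..T}" "t \<in> {0..T}" and y: "y0 \<in> D" "y1 \<in> D"
    let ?p = "max (\<bar>t - s\<bar> powr \<alpha>) (norm (y1 - y0))"
    have p: "0 \<le> ?p" by (simp add: le_max_iff_disj)
    show "norm (Fc i s (length ws) y0 ws) \<le> K * nrm ws" if "length ws \<le> Suc k"
      unfolding Fc_def by (rule order_trans[OF norm_blinfun_axis bF[OF I(1) y(1) that]])
    show "norm (Fc i t (length ws) y1 ws - Fc i s (length ws) y0 ws) \<le> K * ?p * nrm ws" if "length ws \<le> Suc k"
      unfolding Fc_def blinfun.diff_left[symmetric] by (rule order_trans[OF norm_blinfun_axis lF[OF I y that]])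
    show "norm (Fc' i i' s (length ws) y0 ws) \<le> K * nrm ws" if "length ws \<le> k"
      unfolding Fc'_def by (rule order_trans[OF norm_blinfun_axis order_trans[OF norm_blinfun_axis bF'[OF I(1) y(1) that]]])
    show "norm (Fc' i i' t (length ws) y1 ws - Fc' i i' s (length ws) y0 ws) \<le> K * ?p * nrm ws" if "length ws \<le> k"
      unfolding Fc'_def blinfun.diff_left[symmetric]
      by (rule order_trans[OF norm_blinfun_axis order_trans[OF norm_blinfun_axis order_trans[OF C(2)[OF I that]]]])
         (intro mult_right_mono K p nrm_nonneg)
    show "norm (Fc i t (length ws) y1 ws - Fc i s (length ws) y0 ws
        - (\<Sum>i'\<in>UNIV. (xc t i' - xc s i') *\<^sub>R Fc' i' i s (length ws) y0 ws) - Fc i s (Suc (length ws)) y0 (ws @ [y1 - y0]))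
        \<le> K * ?p\<^sup>2 * nrm ws" if "length ws \<le> k"
      unfolding sum_Fc' unfolding Fc_def blinfun.diff_left[symmetric]
      by (rule order_trans[OF norm_blinfun_axis order_trans[OF C(4)[OF I that]]])
         (intro mult_right_mono K nrm_nonneg, simp)
  qed
  thus ?thesis by blast
qed

text \<open>In the Taylor estimate of the Lip seminorm the terms after the linear one and the
  remainder all carry at least two factors \<open>y1 - y0\<close>. On the ball the surplus factors
  are bounded by \<open>P\<close>, and there are at most \<open>1 + k\<close> such
  contributions.\<close>

lemma F'_second:
  "\<exists>K\<ge>0. \<forall>t\<in>{0..T}. \<forall>y0\<in>cball 0 R. \<forall>y1\<in>cball 0 R. \<forall>i i' ws. length ws < k \<longrightarrow>
      norm (Fc' i i' t (length ws) y1 ws - Fc' i i' t (length ws) y0 ws - Fc' i i' t (Suc (length ws)) y0 (ws @ [y1 - y0]))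
        \<le> K * (norm (y1 - y0))\<^sup>2 * nrm ws"
proof -
  obtain C2 where C2: "\<And>t. t \<in> {0..T} \<Longrightarrow> Lip_bound (k + 1) (F' t) C2"
    using Lip_bound_F' by blast
  let ?c = "\<bar>C2\<bar>"
  define P where "P = (1 + 2 * \<bar>R\<bar>) ^ k"
  have P: "1 \<le> P" by (simp add: P_def one_le_power)
  define K where "K = (1 + k) * (?c * P)"
  have "0 \<le> K" using P by (simp add: K_def)
  have "norm (F' t j y1 ws - F' t j y0 ws - F' t (Suc j) y0 (ws @ [y1 - y0])) \<le> K * (norm (y1 - y0))\<^sup>2 * nrm ws"
    if t: "t \<in> {0..T}" and y: "y0 \<in> cball 0 R" "y1 \<in> cball 0 R" and j: "length ws = j" "j < k" for t y0 y1 j ws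
  proof -
    let ?h = "y1 - y0" and ?G = "F' t"
    have pow: "norm ?h ^ (l + 2) \<le> (norm ?h)\<^sup>2 * P" if "l \<le> k" for l
    proof -
      have "norm ?h \<le> 1 + 2 * \<bar>R\<bar>" using norm_triangle_ineq4[of y1 y0] y by simp
      hence "norm ?h ^ l \<le> (1 + 2 * \<bar>R\<bar>) ^ l" by (intro power_mono) auto
      also have "\<dots> \<le> P" unfolding P_def using that by (intro power_increasing) auto
      finally have "(norm ?h)\<^sup>2 * norm ?h ^ l \<le> (norm ?h)\<^sup>2 * P" by (rule mult_left_mono) simp
      moreover have "norm ?h ^ (l + 2) = (norm ?h)\<^sup>2 * norm ?h ^ l" by (simp only: power_add mult.commute)
      ultimately show ?thesis by (simp only:)
    qed
    define q where "q = k - 1 - j"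
    have q: "k + 1 - j = Suc (Suc q)" "q \<le> k" using j by (auto simp: q_def)
    let ?f = "\<lambda>ws l. (1 / fact l) *\<^sub>R ?G (j + l) y0 (ws @ replicate l ?h)"
    let ?A = "\<lambda>ws. ?G j y1 ws - (\<Sum>l<k + 1 - j. ?f ws l)"
    have mA: "multilin j ?A"
    proof (intro multilin_diff multilin_sum multilin_scaleR)
      show "multilin j (?G j y1)" using multilin_F'[OF t] j by simp
      fix l assume "l \<in> {..<k + 1 - j}"
      hence "multilin (j + length (replicate l ?h)) (?G (j + l) y0)" using multilin_F'[OF t, of "j + l"] by simp
      thus "multilin j (\<lambda>ws. ?G (j + l) y0 (ws @ replicate l ?h))" by (rule multilin_append)
    qed
    have nn: "0 \<le> nrm ws" by (rule nrm_nonneg)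
    have "mnorm j ?A \<le> C2 * norm ?h ^ (k + 1 - j)"
      using C2[OF t] j unfolding Lip_bound_def by auto
    also have "\<dots> \<le> ?c * norm ?h ^ (q + 2)" using q by (intro mult_mono) auto
    also have "\<dots> \<le> ?c * ((norm ?h)\<^sup>2 * P)" by (intro mult_left_mono pow q) auto
    finally have 1: "norm (?A ws) \<le> ?c * ((norm ?h)\<^sup>2 * P) * nrm ws" using mA j(1) by (rule mnorm_le_imp)
    have 2: "norm (\<Sum>l<q. ?f ws (l + 2)) \<le> (\<Sum>l<q. ?c * ((norm ?h)\<^sup>2 * P) * nrm ws)"
    proof (rule sum_norm_le)
      fix l assume "l \<in> {..<q}"
      hence l: "j + (l + 2) \<le> k" "l \<le> k" using j by (auto simp: q_def)
      have "mnorm (j + (l + 2)) (?G (j + (l + 2)) y0) \<le> C2"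
        using C2[OF t] l unfolding Lip_bound_def by auto
      hence "mnorm (j + (l + 2)) (?G (j + (l + 2)) y0) \<le> ?c" by linarith
      hence "norm (?G (j + (l + 2)) y0 (ws @ replicate (l + 2) ?h)) \<le> ?c * nrm (ws @ replicate (l + 2) ?h)"
        using multilin_F'[OF t l(1)] j by (intro mnorm_le_imp) auto
      also have "nrm (ws @ replicate (l + 2) ?h) = nrm ws * norm ?h ^ (l + 2)" by (simp add: prod_list_replicate)
      also have "?c * (nrm ws * norm ?h ^ (l + 2)) \<le> ?c * (nrm ws * ((norm ?h)\<^sup>2 * P))"
        by (intro mult_left_mono pow l nn) auto
      finally have "norm (?G (j + (l + 2)) y0 (ws @ replicate (l + 2) ?h)) \<le> ?c * ((norm ?h)\<^sup>2 * P) * nrm ws"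
        by (simp add: mult_ac)
      moreover have "norm (?f ws (l + 2)) \<le> norm (?G (j + (l + 2)) y0 (ws @ replicate (l + 2) ?h))"
      proof -
        have "1 / fact (l + 2) \<le> (1 :: real)" using fact_ge_1[of "l + 2", where 'a = real] by (simp add: divide_le_eq)
        from mult_right_mono[OF this, of "norm (?G (j + (l + 2)) y0 (ws @ replicate (l + 2) ?h))"]
        show ?thesis by simp
      qed
      ultimately show "norm (?f ws (l + 2)) \<le> ?c * ((norm ?h)\<^sup>2 * P) * nrm ws" by linarith
    qed
    have "(\<Sum>l<k + 1 - j. ?f ws l) = ?G j y0 ws + (?G (Suc j) y0 (ws @ [?h]) + (\<Sum>l<q. ?f ws (l + 2)))"
      unfolding q(1) sum.lessThan_Suc_shift by (simp del: replicate_Suc fact_Suc add: replicate_Suc[of 0])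
    hence "?G j y1 ws - ?G j y0 ws - ?G (Suc j) y0 (ws @ [?h]) = ?A ws + (\<Sum>l<q. ?f ws (l + 2))" by simp
    also have "norm \<dots> \<le> ?c * ((norm ?h)\<^sup>2 * P) * nrm ws + (\<Sum>l<q. ?c * ((norm ?h)\<^sup>2 * P) * nrm ws)"
      by (rule norm_triangle_mono[OF 1 2])
    also have "\<dots> = (1 + real q) * (?c * ((norm ?h)\<^sup>2 * P) * nrm ws)" by (simp add: algebra_simps)
    also have "\<dots> \<le> (1 + real k) * (?c * ((norm ?h)\<^sup>2 * P) * nrm ws)" using q(2) P nn by (intro mult_right_mono) auto
    also have "\<dots> = K * (norm ?h)\<^sup>2 * nrm ws" by (simp add: K_def mult_ac)
    finally show ?thesis .
  qed
  moreover have "norm (Fc' i i' t (length ws) y1 ws - Fc' i i' t (length ws) y0 ws - Fc' i i' t (Suc (length ws)) y0 (ws @ [y1 - y0]))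
     \<le> norm (F' t (length ws) y1 ws - F' t (length ws) y0 ws - F' t (Suc (length ws)) y0 (ws @ [y1 - y0]))" for i i' t y0 y1 ws
    unfolding Fc'_def blinfun.diff_left[symmetric] by (rule order_trans[OF norm_blinfun_axis norm_blinfun_axis])
  ultimately show ?thesis using \<open>0 \<le> K\<close> by (meson order_trans)
qed

sublocale fl: rde_fields T \<alpha> B xc xxc "even_part :: (real ^ 'dY) seq \<Rightarrow> _" odd_part interleave k Fc Fc'
  const_bcontfun "\<lambda>z. apply_bcontfun z (discrete 0)"
proof
  show "\<exists>K. cf.jet_est k (cball 0 R) K" for R
    using local_value_bound[of R] jet_est_of_value_bound by blast
  show "\<exists>K\<ge>0. \<forall>t\<in>{0..T}. \<forall>y0\<in>cball 0 R. \<forall>y1\<in>cball 0 R. \<forall>i i' ws. length ws < k \<longrightarrow>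
      norm (Fc' i i' t (length ws) y1 ws - Fc' i i' t (length ws) y0 ws - Fc' i i' t (Suc (length ws)) y0 (ws @ [y1 - y0]))
        \<le> K * (norm (y1 - y0))\<^sup>2 * nrm ws" for R
    by (rule F'_second)
  show "(\<exists>K. cf.jet_est 0 UNIV K) \<or>
      (\<forall>t\<in>{0..T}. \<forall>i i'. bounded_linear (\<lambda>y. Fc i t 0 y []) \<and> bounded_linear (\<lambda>y. Fc' i i' t 0 y []))"
    using cases
  proof
    assume "\<forall>t\<in>{0..T}. (\<lambda>x. F t 0 x []) \<in> bcontfun \<and> (\<lambda>x. F' t 0 x []) \<in> bcontfun"
    then obtain K where "cf.jet_est k UNIV K" using global_value_bound jet_est_of_value_bound by blast
    thus ?thesis using cf.jet_est_mono by blast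
  next
    assume bl: "\<forall>t\<in>{0..T}. bounded_linear (\<lambda>x. F t 0 x []) \<and> bounded_linear (\<lambda>x. F' t 0 x [])"
    show ?thesis
      unfolding Fc_def Fc'_def using bl
      by (intro disjI2 ballI allI conjI bounded_linear_compose[OF blinfun.bounded_linear_left]) auto
  qed
qed (use k \<alpha> contr_const_bcontfun contr_apply_bcontfun in \<open>auto simp: const_bcontfun.rep_eq\<close>)

end

section \<open>Rough integrals and Davie solutions\<close>

lemma apply_tensor_add: "apply_tensor A (M + N) = apply_tensor A M + apply_tensor A N"
  by (simp add: apply_tensor_def scaleR_add_left sum.distrib)

lemma apply_tensor_diff_left: "apply_tensor (A - A') M = apply_tensor A M - apply_tensor A' M"
  by (simp add: apply_tensor_def blinfun.diff_left scaleR_diff_right sum_subtractf)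

lemma apply_tensor_tensor: "apply_tensor A (tensor a b) = A a b"
proof -
  have "A a b = A (\<Sum>i\<in>UNIV. a $ i *\<^sub>R axis i 1) (\<Sum>j\<in>UNIV. b $ j *\<^sub>R axis j 1)"
    using vec_expansion[of a] vec_expansion[of b] by (rule arg_cong2)
  also have "\<dots> = (\<Sum>i\<in>UNIV. \<Sum>j\<in>UNIV. (a $ i * b $ j) *\<^sub>R A (axis i 1) (axis j 1))"
    by (simp add: blinfun.sum_right blinfun.sum_left blinfun.scaleR_right blinfun.scaleR_left scaleR_sum_right)
      (subst sum.swap, simp add: mult.commute)
  finally show ?thesis by (simp add: apply_tensor_def tensor_def)
qed

lemma norm_apply_tensor_le:
  fixes A :: "(real ^ 'n) \<Rightarrow>\<^sub>L (real ^ 'n) \<Rightarrow>\<^sub>L 'u::real_normed_vector"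
  shows "norm (apply_tensor A M) \<le> real CARD('n) * (real CARD('n) * (norm M * norm A))"
  unfolding apply_tensor_def
proof (rule norm_sum_sum_scaleR_le)
  fix i j :: 'n
  have "\<bar>M $ i $ j\<bar> \<le> norm (M $ i)" by (rule component_le_norm_cart)
  also have "\<dots> \<le> norm M" by (rule Finite_Cartesian_Product.norm_nth_le)
  finally show "\<bar>M $ i $ j\<bar> \<le> norm M" .
  show "norm (A (axis i 1) (axis j 1)) \<le> norm A"
    by (rule order_trans[OF norm_blinfun_axis norm_blinfun_axis])
qed

lemma norm_blinfun_le_sum_axis:
  fixes A :: "(real ^ 'n) \<Rightarrow>\<^sub>L 'u::real_normed_vector"
  assumes "\<And>i. norm (blinfun_apply A (axis i 1)) \<le> c"
  shows "norm A \<le> real CARD('n) * c"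
proof (rule norm_blinfun_bound)
  have "0 \<le> c" using order_trans[OF norm_ge_zero assms] .
  thus "0 \<le> real CARD('n) * c" by simp
  fix v :: "real ^ 'n"
  have "A v = A (\<Sum>i\<in>UNIV. v $ i *\<^sub>R axis i 1)" by (rule arg_cong[OF vec_expansion])
  also have "\<dots> = (\<Sum>i\<in>UNIV. v $ i *\<^sub>R A (axis i 1))" by (simp add: blinfun.sum_right blinfun.scaleR_right)
  also have "norm \<dots> \<le> real CARD('n) * (norm v * c)"
    by (rule norm_sum_scaleR_le) (auto intro: component_le_norm_cart assms)
  finally show "norm (A v) \<le> real CARD('n) * c * norm v" by (simp add: mult_ac)
qed

lemma fine_partition:
  assumes "a \<le> b" "0 < (\<delta>::real)"
  obtains N :: nat and \<pi> :: "nat \<Rightarrow> real"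
    where "\<pi> 0 = a" "\<pi> N = b" "\<And>i. i < N \<Longrightarrow> \<pi> i < \<pi> (Suc i)" "\<And>i. i < N \<Longrightarrow> \<pi> (Suc i) - \<pi> i < \<delta>"
proof (cases "a = b")
  case True
  thus thesis using that[of "\<lambda>_. a" 0] by simp
next
  case False
  define N where "N = Suc (nat \<lceil>(b - a) / \<delta>\<rceil>)"
  have "(b - a) / \<delta> < N" unfolding N_def using real_nat_ceiling_ge[of "(b - a) / \<delta>"] by linarith
  hence small: "(b - a) / N < \<delta>" using assms(2) by (simp add: N_def field_simps)
  let ?\<pi> = "\<lambda>i::nat. a + (b - a) * i / N"
  have d: "?\<pi> (Suc i) - ?\<pi> i = (b - a) / N" for i by (simp add: distrib_left add_divide_distrib)
  have "0 < real N" by (simp add: N_def)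
  hence "0 < (b - a) / N" using False assms by simp
  hence "?\<pi> i < ?\<pi> (Suc i)" "?\<pi> (Suc i) - ?\<pi> i < \<delta>" for i using d[of i] small by linarith+
  thus thesis using that[of ?\<pi> N] by (simp add: N_def)
qed

lemma partition_mono:
  fixes \<pi> :: "nat \<Rightarrow> real"
  assumes "\<And>i. i < N \<Longrightarrow> \<pi> i < \<pi> (Suc i)" "i \<le> j" "j \<le> N"
  shows "\<pi> i \<le> \<pi> j"
  using assms(2,3)
proof (induction j rule: dec_induct)
  case (step j)
  thus ?case using assms(1)[of j] by simp
qed simp

lemma sum_lessThan_add: "(\<Sum>i<m + n. f i) = (\<Sum>i<m. f i) + (\<Sum>i<n. f (m + i))" for m n :: nat
  by (induction n) (auto simp: add.assoc)

text \<open>The discrete sewing lemma: an additive increment \<open>\<Xi>\<close> is the step map \<open>z \<mapsto> z + \<Xi>\<^sub>s\<^sub>t\<close>, whose chains are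
  the Riemann sums.\<close>

lemma riemann_sum_defect:
  fixes \<Xi> :: "real \<Rightarrow> real \<Rightarrow> 'w::real_normed_vector"
  assumes p: "1 < p" and K: "0 \<le> K" and \<Xi>0: "\<And>u. u \<in> {s..T} \<Longrightarrow> \<Xi> u u = 0"
    and def: "\<And>u r t. s \<le> u \<Longrightarrow> u \<le> r \<Longrightarrow> r \<le> t \<Longrightarrow> t \<le> T \<Longrightarrow> norm (\<Xi> u r + \<Xi> r t - \<Xi> u t) \<le> K * (t - u) powr p"
  obtains L where "\<And>N \<pi>. (\<And>i. i < N \<Longrightarrow> \<pi> i < \<pi> (Suc i)) \<Longrightarrow> s \<le> \<pi> 0 \<Longrightarrow> \<pi> N \<le> T \<Longrightarrow>
    norm ((\<Sum>i<N. \<Xi> (\<pi> i) (\<pi> (Suc i))) - \<Xi> (\<pi> 0) (\<pi> N)) \<le> L * (\<pi> N - \<pi> 0) powr p"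
proof -
  obtain e L where cst: "0 < e" "0 \<le> L" "(1 + (1 + e)\<^sup>2) * L * (1/2) powr p + (2 + e) * K \<le> L"
    using davie_constants[OF p K] by metis
  define m where "m = (\<lambda>u v (z::'w). z + \<Xi> u v)"
  show thesis
  proof (rule that[of L])
    fix N and \<pi> :: "nat \<Rightarrow> real"
    assume inc: "\<And>i. i < N \<Longrightarrow> \<pi> i < \<pi> (Suc i)" and st: "s \<le> \<pi> 0" "\<pi> N \<le> T"
    note mono = partition_mono[of N \<pi>, OF inc]
    let ?A = "\<pi> ` {..N}" and ?y = "path m (\<pi> ` {..N}) (\<pi> 0) 0"
    have A: "finite ?A" "?A \<subseteq> {s..T}" "\<pi> 0 \<in> ?A" "\<pi> N \<in> ?A"
      using order_trans[OF st(1) mono[of 0]] order_trans[OF mono[of _ N] st(2)] by auto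
    have sub: "?A \<inter> {\<pi> 0..} = ?A" using mono[of 0] by auto
    have y: "?y (\<pi> i) = (\<Sum>j<i. \<Xi> (\<pi> j) (\<pi> (Suc j)))" if "i \<le> N" for i
      using that
    proof (induction i)
      case 0
      show ?case by (simp add: path_start[OF A(1,3)])
    next
      case (Suc i)
      have "consec ?A (\<pi> i) (\<pi> (Suc i))"
        unfolding consec_def
      proof (intro conjI ballI)
        fix x assume "x \<in> ?A"
        then obtain i' where i': "i' \<le> N" "x = \<pi> i'" by auto
        show "x \<le> \<pi> i \<or> \<pi> (Suc i) \<le> x"
          using mono[of i' i] mono[of "Suc i" i'] i' Suc.prems by (cases "i' \<le> i") auto
      qed (use Suc.prems inc in auto)
      from path_step[OF A(1,3) this mono[of 0 i], of m 0] show ?case using Suc by (simp add: m_def)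
    qed
    show "norm ((\<Sum>i<N. \<Xi> (\<pi> i) (\<pi> (Suc i))) - \<Xi> (\<pi> 0) (\<pi> N)) \<le> L * (\<pi> N - \<pi> 0) powr p"
    proof (cases "N = 0")
      case True
      thus ?thesis using \<Xi>0[of "\<pi> 0"] st by simp
    next
      case False
      \<comment> \<open>The step is a translation, hence an isometry, so Davie's bound holds over
        the whole interval with all of the space as domain.\<close>
      have "norm (?y (\<pi> N) - m (\<pi> 0) (\<pi> N) (?y (\<pi> 0))) \<le> L * (\<pi> N - \<pi> 0) powr p"
      proof (rule davie_chain_bound[where A = ?A and I = "{s..T}" and B = UNIV and D = UNIV and K = K
            and e = e and d = "T - s" and w = "\<pi> N"])
        show "chain m ?A ?y" using path_chain[OF A(1,3), of m 0] unfolding sub .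
        show "norm (m u t z - m u t z') \<le> (1 + e) * norm (z - z')" for u t z z'
          using cst(1) by (simp add: m_def algebra_simps)
        show "norm (m r t (m u r z) - m u t z) \<le> K * (t - u) powr p"
          if "u \<in> {s..T}" "t \<in> {s..T}" "u \<le> r" "r \<le> t" for u r t z
          using def[of u r t] that by (simp add: m_def algebra_simps)
        show "\<pi> 0 < \<pi> N" using False inc[of 0] mono[of "Suc 0" N] by (cases N) auto
        show "\<pi> N - \<pi> 0 \<le> T - s" using st by simp
      qed (use A cst K p in \<open>auto simp: m_def \<Xi>0\<close>)
      thus ?thesis using y[of 0] y[of N] by (simp add: m_def algebra_simps)
    qed
  qed
qed

context rde_data
begin

text \<open>The integrals up to \<open>u\<close> and \<open>v\<close> are approximated along
  partitions that agree on \<open>[s, u]\<close>, so their difference is a limit of Riemann sums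
  over \<open>[u, v]\<close>, to which the discrete sewing bound applies.\<close>

lemma rough_integral_local:
  fixes Y :: "real \<Rightarrow> (real ^ 'dX) \<Rightarrow>\<^sub>L (real ^ 'dY)"
  assumes s: "0 \<le> s" and cp: "controlled_path \<alpha> s T X Y Y'"
    and I: "\<And>t. t \<in> {s..T} \<Longrightarrow> has_rough_integral \<alpha> X XX Y Y' s t (I t)"
  obtains L where "\<And>u v. s \<le> u \<Longrightarrow> u \<le> v \<Longrightarrow> v \<le> T \<Longrightarrow>
    norm (I v - I u - (Y u (X v - X u) + apply_tensor (Y' u) (XX u v))) \<le> L * (v - u) powr (3 * \<alpha>)"
proof -
  define \<Xi> where "\<Xi> = (\<lambda>u v. Y u (X v - X u) + apply_tensor (Y' u) (XX u v))"
  obtain CX where CX: "0 \<le> CX" "\<And>s t. s \<in> {0..T} \<Longrightarrow> t \<in> {0..T} \<Longrightarrow> norm (X t - X s) \<le> CX * \<bar>t - s\<bar> powr \<alpha>"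
    by (rule X_holder) (erule that)
  obtain CC where CC: "0 \<le> CC" "\<And>s t. 0 \<le> s \<Longrightarrow> s \<le> t \<Longrightarrow> t \<le> T \<Longrightarrow> norm (XX s t) \<le> CC * (\<bar>t - s\<bar> powr \<alpha>)\<^sup>2"
    by (rule XX_holder) (erule that)
  obtain C1 where C1: "\<And>u v. u \<in> {s..T} \<Longrightarrow> v \<in> {s..T} \<Longrightarrow> norm (Y' v - Y' u) \<le> C1 * \<bar>v - u\<bar> powr \<alpha>"
    using cp unfolding controlled_path_def holder_on_def by blast
  obtain C2 where C2: "\<And>u v. s \<le> u \<Longrightarrow> u \<le> v \<Longrightarrow> v \<le> T \<Longrightarrow> norm (Y v - Y u - Y' u (X v - X u)) \<le> C2 * \<bar>v - u\<bar> powr (2 * \<alpha>)"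
    using cp unfolding controlled_path_def by blast
  define n where "n = real CARD('dX)"
  define K where "K = \<bar>C2\<bar> * CX + n * (n * (CC * \<bar>C1\<bar>))"
  have K: "0 \<le> K" using CX(1) CC(1) by (simp add: K_def n_def)
  have \<Xi>0: "\<Xi> u u = 0" if "u \<in> {s..T}" for u
  proof -
    have "norm (XX u u) \<le> 0" using CC(2)[of u u] that s by simp
    thus ?thesis by (simp add: \<Xi>_def apply_tensor_def blinfun.zero_right)
  qed
  have def: "norm (\<Xi> u r + \<Xi> r t - \<Xi> u t) \<le> K * (t - u) powr (3 * \<alpha>)"
    if o: "s \<le> u" "u \<le> r" "r \<le> t" "t \<le> T" for u r t
  proof -
    define a where "a = (t - u) powr \<alpha>"
    have a: "0 \<le> a" "(r - u) powr \<alpha> \<le> a" "(t - r) powr \<alpha> \<le> a" "(t - u) powr (3 * \<alpha>) = a\<^sup>2 * a" "(r - u) powr (2 * \<alpha>) \<le> a\<^sup>2"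
    proof -
      show "(r - u) powr \<alpha> \<le> a" "(t - r) powr \<alpha> \<le> a" unfolding a_def using o \<alpha> by (auto intro!: powr_mono2)
      have "(r - u) powr (2 * \<alpha>) \<le> (t - u) powr (2 * \<alpha>)" using o \<alpha> by (intro powr_mono2) auto
      thus "(r - u) powr (2 * \<alpha>) \<le> a\<^sup>2" by (simp add: a_def power2_eq_square flip: powr_add)
    qed (auto simp: a_def power2_eq_square simp flip: powr_add)
    have "XX u t - XX u r - XX r t = tensor (X r - X u) (X t - X r)"
      using rough o s unfolding rough_path_def by auto
    hence XXeq: "XX u t = XX u r + XX r t + tensor (X r - X u) (X t - X r)" by (simp add: algebra_simps)
    \<comment> \<open>By Chen's relation the defect is the controlled remainder of \<open>Y\<close>
      against the increment of \<open>X\<close> plus the increment of \<open>Y'\<close> against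
      \<open>XX\<close>; both products are of order \<open>3 * \<alpha>\<close>.\<close>
    have "\<Xi> u r + \<Xi> r t - \<Xi> u t = (Y r - Y u - Y' u (X r - X u)) (X t - X r) + apply_tensor (Y' r - Y' u) (XX r t)"
      by (simp add: \<Xi>_def XXeq apply_tensor_add apply_tensor_tensor apply_tensor_diff_left blinfun.bilinear_simps)
    also have "norm \<dots> \<le> \<bar>C2\<bar> * a\<^sup>2 * (CX * a) + n * (n * (CC * a\<^sup>2 * (\<bar>C1\<bar> * a)))"
    proof (rule norm_triangle_mono)
      have x: "norm (X t - X r) \<le> CX * a"
        by (rule order_trans[OF CX(2)]) (use o s a CX(1) in \<open>auto intro: mult_left_mono\<close>)
      have y: "norm (Y r - Y u - Y' u (X r - X u)) \<le> \<bar>C2\<bar> * a\<^sup>2"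
        by (rule order_trans[OF C2 mult_mono]) (use o a in auto)
      show "norm ((Y r - Y u - Y' u (X r - X u)) (X t - X r)) \<le> \<bar>C2\<bar> * a\<^sup>2 * (CX * a)"
        by (rule order_trans[OF norm_blinfun mult_mono[OF y x]]) auto
      have xx: "norm (XX r t) \<le> CC * a\<^sup>2"
        by (rule order_trans[OF CC(2)]) (use o s a CC(1) in \<open>auto intro!: mult_left_mono power_mono\<close>)
      have y': "norm (Y' r - Y' u) \<le> \<bar>C1\<bar> * a"
        by (rule order_trans[OF C1 mult_mono]) (use o a in auto)
      show "norm (apply_tensor (Y' r - Y' u) (XX r t)) \<le> n * (n * (CC * a\<^sup>2 * (\<bar>C1\<bar> * a)))"
        unfolding n_def
        by (rule order_trans[OF norm_apply_tensor_le]) (intro mult_left_mono mult_mono xx y' mult_nonneg_nonneg CC(1), auto)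
    qed
    also have "\<dots> = K * (t - u) powr (3 * \<alpha>)" unfolding a(4) K_def by (simp add: algebra_simps)
    finally show ?thesis .
  qed
  have p: "1 < 3 * \<alpha>" using \<alpha> by simp
  obtain L where L: "\<And>N \<pi>. (\<And>i. i < N \<Longrightarrow> \<pi> i < \<pi> (Suc i)) \<Longrightarrow> s \<le> \<pi> 0 \<Longrightarrow> \<pi> N \<le> T \<Longrightarrow>
    norm ((\<Sum>i<N. \<Xi> (\<pi> i) (\<pi> (Suc i))) - \<Xi> (\<pi> 0) (\<pi> N)) \<le> L * (\<pi> N - \<pi> 0) powr (3 * \<alpha>)"
    by (rule riemann_sum_defect[OF p K, of s T \<Xi>]) ((assumption | erule \<Xi>0 | erule (3) def | erule that)+)
  have lim: "\<exists>\<delta>>0. \<forall>N \<pi>. \<pi> 0 = s \<and> \<pi> N = t \<and> (\<forall>i<N. \<pi> i < \<pi> (Suc i) \<and> \<pi> (Suc i) - \<pi> i < \<delta>) \<longrightarrow>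
      norm ((\<Sum>i<N. \<Xi> (\<pi> i) (\<pi> (Suc i))) - I t) < e" if "t \<in> {s..T}" "0 < e" for t e
    using I[OF that(1)] that(2) unfolding has_rough_integral_def \<Xi>_def by blast
  have "norm (I v - I u - \<Xi> u v) \<le> L * (v - u) powr (3 * \<alpha>)" if uv: "s \<le> u" "u \<le> v" "v \<le> T" for u v
  proof (rule field_le_epsilon)
    fix e :: real assume e: "0 < e"
    obtain \<delta>1 where \<delta>1: "0 < \<delta>1" "\<And>N \<pi>. \<pi> 0 = s \<and> \<pi> N = u \<and> (\<forall>i<N. \<pi> i < \<pi> (Suc i) \<and> \<pi> (Suc i) - \<pi> i < \<delta>1) \<Longrightarrow>
        norm ((\<Sum>i<N. \<Xi> (\<pi> i) (\<pi> (Suc i))) - I u) < e / 2"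
      using lim[of u "e / 2"] uv e by auto
    obtain \<delta>2 where \<delta>2: "0 < \<delta>2" "\<And>N \<pi>. \<pi> 0 = s \<and> \<pi> N = v \<and> (\<forall>i<N. \<pi> i < \<pi> (Suc i) \<and> \<pi> (Suc i) - \<pi> i < \<delta>2) \<Longrightarrow>
        norm ((\<Sum>i<N. \<Xi> (\<pi> i) (\<pi> (Suc i))) - I v) < e / 2"
      using lim[of v "e / 2"] uv e by auto
    define \<delta> where "\<delta> = min \<delta>1 \<delta>2"
    have \<delta>: "0 < \<delta>" "\<delta> \<le> \<delta>1" "\<delta> \<le> \<delta>2" using \<delta>1(1) \<delta>2(1) by (auto simp: \<delta>_def)
    obtain N1 \<pi>1 where \<pi>1: "\<pi>1 0 = s" "\<pi>1 N1 = u" "\<And>i. i < N1 \<Longrightarrow> \<pi>1 i < \<pi>1 (Suc i)" "\<And>i. i < N1 \<Longrightarrow> \<pi>1 (Suc i) - \<pi>1 i < \<delta>"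
      using fine_partition[OF uv(1) \<delta>(1)] by metis
    obtain N2 \<pi>2 where \<pi>2: "\<pi>2 0 = u" "\<pi>2 N2 = v" "\<And>i. i < N2 \<Longrightarrow> \<pi>2 i < \<pi>2 (Suc i)" "\<And>i. i < N2 \<Longrightarrow> \<pi>2 (Suc i) - \<pi>2 i < \<delta>"
      using fine_partition[OF uv(2) \<delta>(1)] by metis
    define \<pi> where "\<pi> = (\<lambda>i. if i \<le> N1 then \<pi>1 i else \<pi>2 (i - N1))"
    have \<pi>_lo: "\<pi> i = \<pi>1 i" if "i \<le> N1" for i using that by (simp add: \<pi>_def)
    have \<pi>_hi: "\<pi> (N1 + i) = \<pi>2 i" for i using \<pi>1(2) \<pi>2(1) by (auto simp: \<pi>_def)
    have steps: "\<pi> i < \<pi> (Suc i) \<and> \<pi> (Suc i) - \<pi> i < \<delta>" if "i < N1 + N2" for i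
    proof (cases "i < N1")
      case True
      thus ?thesis using \<pi>1(3,4)[of i] by (simp add: \<pi>_lo)
    next
      case False
      define i' where "i' = i - N1"
      have i': "i = N1 + i'" "i' < N2" using False that by (auto simp: i'_def)
      show ?thesis using \<pi>2(3,4)[OF i'(2)] \<pi>_hi[of i'] \<pi>_hi[of "Suc i'"] by (simp add: i'(1))
    qed
    let ?S1 = "\<Sum>i<N1. \<Xi> (\<pi>1 i) (\<pi>1 (Suc i))" and ?S2 = "\<Sum>i<N2. \<Xi> (\<pi>2 i) (\<pi>2 (Suc i))"
    have 1: "norm (?S1 - I u) < e / 2" using \<pi>1 \<delta>(2) by (intro \<delta>1(2)) fastforce
    have sum: "(\<Sum>i<N1 + N2. \<Xi> (\<pi> i) (\<pi> (Suc i))) = ?S1 + ?S2"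
      unfolding sum_lessThan_add using \<pi>_hi[of "Suc _"] by (simp add: \<pi>_lo \<pi>_hi)
    have "norm ((\<Sum>i<N1 + N2. \<Xi> (\<pi> i) (\<pi> (Suc i))) - I v) < e / 2"
      using steps \<delta>(3) \<pi>1(1) \<pi>2(2) \<pi>_lo[of 0] \<pi>_hi[of N2] by (intro \<delta>2(2)) fastforce
    hence 2: "norm (?S1 + ?S2 - I v) < e / 2" unfolding sum .
    have 3: "norm (?S2 - \<Xi> u v) \<le> L * (v - u) powr (3 * \<alpha>)" using L[of N2 \<pi>2] \<pi>2 uv by simp
    have "I v - I u - \<Xi> u v = (?S1 - I u) - (?S1 + ?S2 - I v) + (?S2 - \<Xi> u v)" by simp
    hence "norm (I v - I u - \<Xi> u v) = norm ((?S1 - I u) - (?S1 + ?S2 - I v) + (?S2 - \<Xi> u v))" by (rule arg_cong)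
    also have "\<dots> \<le> norm (?S1 - I u) + norm (?S1 + ?S2 - I v) + norm (?S2 - \<Xi> u v)"
      by (rule order_trans[OF norm_triangle_ineq add_right_mono[OF norm_triangle_ineq4]])
    finally show "norm (I v - I u - \<Xi> u v) \<le> L * (v - u) powr (3 * \<alpha>) + e" using 1 2 3 by linarith
  qed
  thus thesis using that[of L] by (simp add: \<Xi>_def)
qed

end

lemma holder_on_ordered:
  assumes "\<And>u v. s \<le> u \<Longrightarrow> u \<le> v \<Longrightarrow> v \<le> t \<Longrightarrow> norm (g v - g u) \<le> C * (v - u) powr a"
  shows "holder_on a {s..t} g"
  unfolding holder_on_def
proof (intro exI ballI)
  fix u v assume uv: "u \<in> {s..t}" "v \<in> {s..t}"
  show "norm (g v - g u) \<le> C * \<bar>v - u\<bar> powr a"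
  proof (cases "u \<le> v")
    case True
    thus ?thesis using assms[of u v] uv by simp
  next
    case False
    thus ?thesis using assms[of v u] uv by (simp add: norm_minus_commute abs_minus_commute)
  qed
qed

lemma controlled_path_subset:
  assumes "controlled_path a s t X Y Y'" "t' \<le> t"
  shows "controlled_path a s t' X Y Y'"
proof -
  have "holder_on a {s..t'} Y'"
    using assms unfolding controlled_path_def holder_on_def by (meson atLeastAtMost_iff order_trans)
  moreover have "\<exists>C. \<forall>u v. s \<le> u \<and> u \<le> v \<and> v \<le> t' \<longrightarrow> norm (Y v - Y u - Y' u (X v - X u)) \<le> C * \<bar>v - u\<bar> powr (2 * a)"
    using assms unfolding controlled_path_def by (meson order_trans)
  ultimately show ?thesis unfolding controlled_path_def by blast
qed

lemma davie_cong:
  assumes "davie p m a b Y" "\<And>t. a \<le> t \<Longrightarrow> t \<le> b \<Longrightarrow> Y' t = Y t"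
  shows "davie p m a b Y'"
  using assms unfolding davie_def by (metis order_trans)

section \<open>Solutions of the equation as Davie paths\<close>

context rde_coords
begin

lemma rde_gubinelli_apply:
  assumes "s \<in> {0..T}"
  shows "blinfun_apply (rde_gubinelli F F' s y) v = Blinfun (\<lambda>w. F s (Suc 0) y [w]) (F s 0 y [] v) + F' s 0 y [] v"
    and "blinfun_apply (Blinfun (\<lambda>w. F s (Suc 0) y [w])) w = F s (Suc 0) y [w]"
proof -
  have "linear (\<lambda>w. F s (Suc 0) y [w])" using multilin_linear[OF multilin_F[OF assms, of "Suc 0"], of "[]" "[]"] by simp
  hence "bounded_linear (\<lambda>w. F s (Suc 0) y [w])" by (rule linear_conv_bounded_linear[THEN iffD1])
  thus "blinfun_apply (Blinfun (\<lambda>w. F s (Suc 0) y [w])) w = F s (Suc 0) y [w]"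
    by (simp add: bounded_linear_Blinfun_apply)
  show "blinfun_apply (rde_gubinelli F F' s y) v = Blinfun (\<lambda>w. F s (Suc 0) y [w]) (F s 0 y [] v) + F' s 0 y [] v"
    by (simp add: rde_gubinelli_def blinfun.add_left)
qed

lemma gub_eq:
  assumes "s \<in> {0..T}"
  shows "gub (\<lambda>i s y. Fc i s 0 y []) (\<lambda>i s y h. Fc i s (Suc 0) y [h]) (\<lambda>i i' s y. Fc' i i' s 0 y []) i j s y
    = rde_gubinelli F F' s y (axis i 1) (axis j 1)"
  using assms by (simp add: gub_def Fc_def Fc'_def rde_gubinelli_apply blinfun.add_left)

lemma sum_Fc: "(\<Sum>i\<in>UNIV. (xc t i - xc s i) *\<^sub>R Fc i s 0 y []) = F s 0 y [] (X t - X s)"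
proof -
  have "F s 0 y [] (X t - X s) = F s 0 y [] (\<Sum>i\<in>UNIV. (X t - X s) $ i *\<^sub>R axis i 1)"
    by (rule arg_cong[OF vec_expansion])
  thus ?thesis by (simp add: blinfun.sum_right blinfun.scaleR_right xc_def Fc_def)
qed

lemma sum_rde_gubinelli:
  "(\<Sum>i\<in>UNIV. (xc t i - xc s i) *\<^sub>R rde_gubinelli F F' s y (axis i 1) v) = rde_gubinelli F F' s y (X t - X s) v"
proof -
  have "rde_gubinelli F F' s y (X t - X s) v = rde_gubinelli F F' s y (\<Sum>i\<in>UNIV. (X t - X s) $ i *\<^sub>R axis i 1) v"
    by (rule arg_cong[OF vec_expansion])
  thus ?thesis
    by (simp add: blinfun.sum_right blinfun.scaleR_right blinfun.sum_left blinfun.scaleR_left xc_def)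
qed

lemma mu_eq:
  assumes "0 \<le> s" "s \<le> t" "t \<le> T"
  shows "fl.mu s t y = y + (F s 0 y [] (X t - X s) + apply_tensor (rde_gubinelli F F' s y) (XX s t))"
  unfolding fl.mu_def cf.milstein_def cf.incr_def sum_Fc using assms
  by (simp add: gub_eq apply_tensor_def xxc_eq)

text \<open>The local expansion of the rough integral is exactly the Milstein step in the
  coordinates of \<open>mu_eq\<close>.\<close>

lemma davie_of_solution:
  assumes s: "s \<in> {0..T}" and sol: "rde_solution \<alpha> T X XX F F' s \<xi> (Y, Y')"
  shows "davie (3 * \<alpha>) fl.mu s T Y" and "Y s = \<xi>"
proof -
  let ?f = "\<lambda>r. F r 0 (Y r) []" and ?G = "\<lambda>r. rde_gubinelli F F' r (Y r)"
  have I: "has_rough_integral \<alpha> X XX ?f ?G s t (Y t - \<xi>)" if t: "t \<in> {s..T}" for t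
  proof -
    obtain I where "has_rough_integral \<alpha> X XX ?f ?G s t I" "Y t = \<xi> + I"
      using sol t unfolding rde_solution_def prod.case by blast
    thus ?thesis by simp
  qed
  have cp: "controlled_path \<alpha> s T X ?f ?G" using I[of T] s unfolding has_rough_integral_def by auto
  obtain L where L: "\<And>u v. s \<le> u \<Longrightarrow> u \<le> v \<Longrightarrow> v \<le> T \<Longrightarrow>
    norm ((Y v - \<xi>) - (Y u - \<xi>) - (?f u (X v - X u) + apply_tensor (?G u) (XX u v))) \<le> L * (v - u) powr (3 * \<alpha>)"
    by (rule rough_integral_local[OF _ cp I]) (use s in \<open>auto intro: that\<close>)
  show "davie (3 * \<alpha>) fl.mu s T Y"
    unfolding davie_def
  proof (intro exI allI impI)
    fix u v assume uv: "s \<le> u" "u \<le> v" "v \<le> T"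
    show "norm (Y v - fl.mu u v (Y u)) \<le> L * (v - u) powr (3 * \<alpha>)"
      using L[OF uv] uv s by (simp add: mu_eq algebra_simps)
  qed
  have "norm (Y s - \<xi>) \<le> 0"
  proof (rule field_le_epsilon)
    fix e :: real assume e: "0 < e"
    \<comment> \<open>The empty partition, \<open>N = 0\<close>, is admissible for the integral from
      \<open>s\<close> to \<open>s\<close> and forces it to vanish.\<close>
    have "norm ((\<Sum>i<0::nat. ?f s (X s - X s) + apply_tensor (?G s) (XX s s)) - (Y s - \<xi>)) < e"
      using I[of s] s e unfolding has_rough_integral_def by (auto dest!: spec[of _ e] spec[of _ "0::nat"] spec[of _ "\<lambda>_. s"])
    thus "norm (Y s - \<xi>) \<le> 0 + e" by (simp add: norm_minus_commute)
  qed
  thus "Y s = \<xi>" by simp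
qed

lemma controlled_of_davie:
  assumes s: "s \<in> {0..T}" and Y: "davie (3 * \<alpha>) fl.mu s T Y"
  shows "controlled_path \<alpha> s T X Y (\<lambda>t. F t 0 (Y t) [])"
    and "controlled_path \<alpha> s T X (\<lambda>t. F t 0 (Y t) []) (\<lambda>t. rde_gubinelli F F' t (Y t))"
proof -
  let ?f = "\<lambda>r. F r 0 (Y r) []" and ?G = "\<lambda>r. rde_gubinelli F F' r (Y r)"
  let ?g = "gub (\<lambda>i s y. Fc i s 0 y []) (\<lambda>i s y h. Fc i s (Suc 0) y [h]) (\<lambda>i i' s y. Fc' i i' s 0 y [])"
  have s': "0 \<le> s" "s \<le> T" using s by auto
  obtain C where C: "\<And>u v i j. s \<le> u \<Longrightarrow> u \<le> v \<Longrightarrow> v \<le> T \<Longrightarrow>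
    norm (Y v - Y u - (\<Sum>i\<in>UNIV. (xc v i - xc u i) *\<^sub>R Fc i u 0 (Y u) [])) \<le> C * (v - u) powr (2 * \<alpha>) \<and>
    norm (Fc i v 0 (Y v) [] - Fc i u 0 (Y u) []) \<le> C * (v - u) powr \<alpha> \<and>
    norm (?g i j v (Y v) - ?g i j u (Y u)) \<le> C * (v - u) powr \<alpha> \<and>
    norm (Fc j v 0 (Y v) [] - Fc j u 0 (Y u) [] - (\<Sum>i\<in>UNIV. (xc v i - xc u i) *\<^sub>R ?g i j u (Y u))) \<le> C * (v - u) powr (2 * \<alpha>)"
    by (rule fl.davie_controlled[OF Y s']) (erule that)
  have 1: "norm (Y v - Y u - ?f u (X v - X u)) \<le> C * (v - u) powr (2 * \<alpha>)"
    and 2: "norm (?f v - ?f u) \<le> (real CARD('dX) * C) * (v - u) powr \<alpha>"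
    and 3: "norm (?G v - ?G u) \<le> (real CARD('dX) * (real CARD('dX) * C)) * (v - u) powr \<alpha>"
    and 4: "norm (?f v - ?f u - ?G u (X v - X u)) \<le> (real CARD('dX) * C) * (v - u) powr (2 * \<alpha>)"
    if uv: "s \<le> u" "u \<le> v" "v \<le> T" for u v
  proof -
    have I: "u \<in> {0..T}" "v \<in> {0..T}" using s uv by auto
    note C = C[OF uv, unfolded gub_eq[OF I(1)] gub_eq[OF I(2)] sum_Fc sum_rde_gubinelli, unfolded Fc_def]
    show "norm (Y v - Y u - ?f u (X v - X u)) \<le> C * (v - u) powr (2 * \<alpha>)" using C by blast
    show "norm (?f v - ?f u) \<le> (real CARD('dX) * C) * (v - u) powr \<alpha>"
      unfolding mult.assoc by (intro norm_blinfun_le_sum_axis) (use C in \<open>simp add: blinfun.diff_left\<close>)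
    show "norm (?G v - ?G u) \<le> (real CARD('dX) * (real CARD('dX) * C)) * (v - u) powr \<alpha>"
      unfolding mult.assoc by (intro norm_blinfun_le_sum_axis) (use C in \<open>simp add: blinfun.diff_left\<close>)
    show "norm (?f v - ?f u - ?G u (X v - X u)) \<le> (real CARD('dX) * C) * (v - u) powr (2 * \<alpha>)"
      unfolding mult.assoc by (intro norm_blinfun_le_sum_axis) (use C in \<open>simp add: blinfun.diff_left\<close>)
  qed
  show "controlled_path \<alpha> s T X Y ?f"
    unfolding controlled_path_def
  proof (intro conjI exI allI impI)
    show "holder_on \<alpha> {s..T} ?f" using 2 by (rule holder_on_ordered)
    show "norm (Y v - Y u - ?f u (X v - X u)) \<le> C * \<bar>v - u\<bar> powr (2 * \<alpha>)" if "s \<le> u \<and> u \<le> v \<and> v \<le> T" for u v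
      using 1[of u v] that by simp
  qed
  show "controlled_path \<alpha> s T X ?f ?G"
    unfolding controlled_path_def
  proof (intro conjI exI allI impI)
    show "holder_on \<alpha> {s..T} ?G" using 3 by (rule holder_on_ordered)
    show "norm (?f v - ?f u - ?G u (X v - X u)) \<le> real CARD('dX) * C * \<bar>v - u\<bar> powr (2 * \<alpha>)"
      if "s \<le> u \<and> u \<le> v \<and> v \<le> T" for u v
      using 4[of u v] that by simp
  qed
qed

text \<open>Each summand of a Riemann sum differs from the increment of \<open>Y\<close> by a Davie
  error. As \<open>3 * \<alpha> > 1\<close>, these errors add up to at most a multiple of
  \<open>t - s\<close> that vanishes with the mesh.\<close>

lemma rough_integral_of_davie:
  assumes s: "s \<in> {0..T}" and Y: "davie (3 * \<alpha>) fl.mu s T Y" and t: "t \<in> {s..T}"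
  shows "has_rough_integral \<alpha> X XX (\<lambda>r. F r 0 (Y r) []) (\<lambda>r. rde_gubinelli F F' r (Y r)) s t (Y t - Y s)"
  unfolding has_rough_integral_def
proof (intro conjI allI impI)
  let ?f = "\<lambda>r. F r 0 (Y r) []" and ?G = "\<lambda>r. rde_gubinelli F F' r (Y r)"
  show "controlled_path \<alpha> s t X ?f ?G"
    using controlled_of_davie(2)[OF s Y] t by (auto intro: controlled_path_subset)
  fix e :: real assume e: "0 < e"
  let ?\<Xi> = "\<lambda>u v. ?f u (X v - X u) + apply_tensor (?G u) (XX u v)"
  obtain L where L: "0 \<le> L" "\<And>u v. s \<le> u \<Longrightarrow> u \<le> v \<Longrightarrow> v \<le> T \<Longrightarrow> norm (Y v - fl.mu u v (Y u)) \<le> L * (v - u) powr (3 * \<alpha>)"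
    by (rule davieD[OF Y]) (erule that)
  have L': "norm (?\<Xi> u v - (Y v - Y u)) \<le> L * (v - u) powr (3 * \<alpha>)" if uv: "s \<le> u" "u \<le> v" "v \<le> T" for u v
  proof -
    have "?\<Xi> u v - (Y v - Y u) = - (Y v - fl.mu u v (Y u))" using uv s by (simp add: mu_eq)
    thus ?thesis using L(2)[OF uv] by (simp only: norm_minus_cancel)
  qed
  define r where "r = e / (T + 1)"
  have r: "0 < r" "r * T < e" using e T by (auto simp: r_def field_simps)
  obtain d where d: "0 < d" "\<And>x. 0 \<le> x \<Longrightarrow> x \<le> d \<Longrightarrow> L * x powr (3 * \<alpha> - 1) \<le> r"
    using small_powr[of "3 * \<alpha> - 1" r L] \<alpha> r(1) by auto
  show "\<exists>\<delta>>0. \<forall>N \<pi>. \<pi> 0 = s \<and> \<pi> N = t \<and> (\<forall>i<N. \<pi> i < \<pi> (Suc i) \<and> \<pi> (Suc i) - \<pi> i < \<delta>) \<longrightarrow>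
      norm ((\<Sum>i<N. ?\<Xi> (\<pi> i) (\<pi> (Suc i))) - (Y t - Y s)) < e"
  proof (intro exI[of _ d] conjI d(1) allI impI)
    fix N and \<pi> :: "nat \<Rightarrow> real"
    assume asm: "\<pi> 0 = s \<and> \<pi> N = t \<and> (\<forall>i<N. \<pi> i < \<pi> (Suc i) \<and> \<pi> (Suc i) - \<pi> i < d)"
    hence st: "\<pi> 0 = s" "\<pi> N = t" and step: "\<And>i. i < N \<Longrightarrow> \<pi> i < \<pi> (Suc i)" "\<And>i. i < N \<Longrightarrow> \<pi> (Suc i) - \<pi> i < d" by auto
    note mono = partition_mono[of N \<pi>, OF step(1)]
    have tel: "(\<Sum>i<N. Y (\<pi> (Suc i)) - Y (\<pi> i)) = Y t - Y s"
      using sum_lessThan_telescope[of "\<lambda>i. Y (\<pi> i)" N] by (simp only: st)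
    have "(\<Sum>i<N. ?\<Xi> (\<pi> i) (\<pi> (Suc i))) - (Y t - Y s) = (\<Sum>i<N. ?\<Xi> (\<pi> i) (\<pi> (Suc i)) - (Y (\<pi> (Suc i)) - Y (\<pi> i)))"
      by (simp only: sum_subtractf[of "\<lambda>i. ?\<Xi> (\<pi> i) (\<pi> (Suc i))" "\<lambda>i. Y (\<pi> (Suc i)) - Y (\<pi> i)"] tel)
    also have "norm \<dots> \<le> (\<Sum>i<N. r * (\<pi> (Suc i) - \<pi> i))"
    proof (rule sum_norm_le)
      fix i assume "i \<in> {..<N}"
      hence i: "i < N" by simp
      let ?x = "\<pi> (Suc i) - \<pi> i"
      have "s \<le> \<pi> i" "\<pi> (Suc i) \<le> T" using mono[of 0 i] mono[of "Suc i" N] i st t by auto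
      hence "norm (?\<Xi> (\<pi> i) (\<pi> (Suc i)) - (Y (\<pi> (Suc i)) - Y (\<pi> i))) \<le> L * ?x powr (3 * \<alpha>)"
        using step(1)[OF i] by (intro L') auto
      also have "?x powr (3 * \<alpha>) = ?x powr (3 * \<alpha> - 1) * ?x"
        using step(1)[OF i] powr_add[of ?x "3 * \<alpha> - 1" 1] by simp
      also have "L * (?x powr (3 * \<alpha> - 1) * ?x) = (L * ?x powr (3 * \<alpha> - 1)) * ?x" by simp
      also have "\<dots> \<le> r * ?x" using step[OF i] by (intro mult_right_mono d(2)) auto
      finally show "norm (?\<Xi> (\<pi> i) (\<pi> (Suc i)) - (Y (\<pi> (Suc i)) - Y (\<pi> i))) \<le> r * ?x" .
    qed
    also have "\<dots> = r * (t - s)" unfolding sum_distrib_left[symmetric] sum_lessThan_telescope st ..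
    also have "\<dots> \<le> r * T" using r(1) s t by (intro mult_left_mono) auto
    finally show "norm ((\<Sum>i<N. ?\<Xi> (\<pi> i) (\<pi> (Suc i))) - (Y t - Y s)) < e" using r(2) by linarith
  qed
qed

text \<open>The second component of a solution is a function of the first, so uniqueness reduces to
  that of Davie paths, used on \<open>[s, t]\<close> for each \<open>t\<close>.\<close>

lemma ex1_rde_solution:
  assumes s: "s \<in> {0..T}"
  shows "\<exists>!p. rde_solution \<alpha> T X XX F F' s \<xi> p"
    and "t \<in> {s..T} \<Longrightarrow> rde_flow \<alpha> T X XX F F' s t \<xi> = fl.flow_map s t \<xi>"
proof -
  define Y where "Y = restrict (\<lambda>t. fl.flow_map s t \<xi>) {s..T}"
  define Y' where "Y' = restrict (\<lambda>t. F t 0 (Y t) []) {s..T}"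
  have Y: "davie (3 * \<alpha>) fl.mu s T Y" "Y s = \<xi>"
    using davie_cong[OF fl.davie_flow_map(1)[of s \<xi>], of Y] fl.davie_flow_map(2)[of s \<xi>] s by (auto simp: Y_def)
  have Y': "controlled_path \<alpha> s T X Y Y'"
    using controlled_of_davie(1)[OF s Y(1)] unfolding controlled_path_def holder_on_def Y'_def
    by (simp cong: conj_cong imp_cong)
  have sol: "rde_solution \<alpha> T X XX F F' s \<xi> (Y, Y')"
    unfolding rde_solution_def prod.case
  proof (intro conjI ballI exI)
    fix t assume t: "t \<in> {s..T}"
    show "has_rough_integral \<alpha> X XX (\<lambda>r. F r 0 (Y r) []) (\<lambda>r. rde_gubinelli F F' r (Y r)) s t (Y t - Y s)"
      by (rule rough_integral_of_davie[OF s Y(1) t])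
    show "Y t = \<xi> + (Y t - Y s)" by (simp add: Y(2))
    show "Y' t = F t 0 (Y t) []" using t by (simp add: Y'_def)
  qed (use Y' in \<open>simp_all add: Y_def Y'_def\<close>)
  have uniq: "p = (Y, Y')" if p: "rde_solution \<alpha> T X XX F F' s \<xi> p" for p
  proof -
    obtain Z Z' where p_eq: "p = (Z, Z')" by (cases p)
    note Z = davie_of_solution[OF s p[unfolded p_eq]]
    have "Z t = Y t" if t: "t \<in> {s..T}" for t
    proof -
      have "davie (3 * \<alpha>) fl.mu s t Z" using Z(1) t unfolding davie_def by (meson atLeastAtMost_iff order_trans)
      from fl.davie_eq_flow_map[OF this] show ?thesis using s t by (simp add: Z(2) Y_def)
    qed
    moreover have "Z \<in> extensional {s..T}" "Z' \<in> extensional {s..T}" "\<forall>t\<in>{s..T}. Z' t = F t 0 (Z t) []"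
      using p by (auto simp: p_eq rde_solution_def)
    ultimately have "Z = Y" "Z' = Y'"
      by (auto simp: Y_def Y'_def intro!: extensionalityI[of _ "{s..T}"])
    thus ?thesis by (simp add: p_eq)
  qed
  show ex1: "\<exists>!p. rde_solution \<alpha> T X XX F F' s \<xi> p" using sol uniq by blast
  have "(THE p. rde_solution \<alpha> T X XX F F' s \<xi> p) = (Y, Y')" using sol uniq by (rule the_equality)
  thus "rde_flow \<alpha> T X XX F F' s t \<xi> = fl.flow_map s t \<xi>" if "t \<in> {s..T}"
    using that by (simp add: rde_flow_def Y_def)
qed

lemma rde_flow_diffeomorphism:
  assumes "s \<in> {0..T}" "t \<in> {s..T}"
  shows "C_k_diffeomorphism k (rde_flow \<alpha> T X XX F F' s t)"
proof -
  have "rde_flow \<alpha> T X XX F F' s t = fl.flow_map s t" using ex1_rde_solution(2)[OF assms] by blast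
  thus ?thesis using fl.flow_map_diffeomorphism[of s t] assms by simp
qed

end

theorem theoremB6:
  fixes \<alpha> T :: real and k :: nat
    and X :: "real \<Rightarrow> real ^ 'dX"
    and XX :: "real \<Rightarrow> real \<Rightarrow> real ^ 'dX ^ 'dX"
    and F :: "real \<Rightarrow> nat \<Rightarrow> real ^ 'dY \<Rightarrow> (real ^ 'dY) list \<Rightarrow> (real ^ 'dX) \<Rightarrow>\<^sub>L (real ^ 'dY)"
    and F' :: "real \<Rightarrow> nat \<Rightarrow> real ^ 'dY \<Rightarrow> (real ^ 'dY) list \<Rightarrow>
                 (real ^ 'dX) \<Rightarrow>\<^sub>L (real ^ 'dX) \<Rightarrow>\<^sub>L (real ^ 'dY)"
  assumes "1 / 3 < \<alpha>" and "\<alpha> < 1 / 2" and "k \<ge> 1" and "T > 0"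
    and "rough_path \<alpha> T X XX"
    and "controlled_Lip \<alpha> T X (k + 2) F F'"
    and "(\<forall>t\<in>{0..T}. (\<lambda>x. F t 0 x []) \<in> bcontfun \<and> (\<lambda>x. F' t 0 x []) \<in> bcontfun) \<or>
         (\<forall>t\<in>{0..T}. bounded_linear (\<lambda>x. F t 0 x []) \<and> bounded_linear (\<lambda>x. F' t 0 x []))"
  shows "\<forall>s\<in>{0..T}.
           (\<forall>\<xi>. \<exists>!p. rde_solution \<alpha> T X XX F F' s \<xi> p) \<and>
           (\<forall>t\<in>{s..T}. C_k_diffeomorphism k (rde_flow \<alpha> T X XX F F' s t))"
proof -
  interpret rde_data \<alpha> T k X XX F F' by standard (use assms in auto)
  obtain B where B: "rough_coords T \<alpha> B xc xxc" using rough_coords by blast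
  interpret rde_coords \<alpha> T k X XX F F' B
    by (rule rde_coords.intro[OF rde_data_axioms rde_coords_axioms.intro[OF B]])
  show ?thesis using ex1_rde_solution(1) rde_flow_diffeomorphism by blast
qed

end
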